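(* Let $X_k=\sum_{i=0}^\infty a_i\varepsilon_{k-i}$ be the long-range dependent linear process described in the context. Assume $\inf_{p_0\le p\le p_1}f(\xi_p)>0$ for some $0<p_0<p_1<1$, $\mathbb{E}(\varepsilon_i^4)<\infty$ and $$\sum_{i=0}^2\sup_x|f_\varepsilon^{(i)}(x)|+\int_{\mathbb{R}}|f_\varepsilon'(u)|^2\,du<\infty.$$ Let $b_n=\sigma_{n,1}(\log n)^{1/2}(\log\log n)/n$. Then $$\sup_{p_0\le p\le p_1}\left|\xi_{n,p}-\xi_p-\frac{p-F_n(\xi_p)}{f(\xi_p)}-\frac{\bar X_n^2}{2}\frac{f'(\xi_p)}{f(\xi_p)}\right|=O_{\mathrm{a.s.}}\left[b_n^3+\frac{\sqrt{b_n\log n}}{\sqrt n}+\frac{b_n\sqrt{A_n(\beta)}}{n}\right].$$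
   Context: $(\varepsilon_k)_{k\in\mathbb{Z}}$ are i.i.d. real random variables with mean zero, finite variance and density $f_\varepsilon$. The coefficients are $a_0=1$, $a_n=n^{-\beta}L(n)$ for $n\ge1$, where $1/2<\beta<1$ and $L$ is slowly varying at infinity; $X_k=\sum_{i=0}^\infty a_i\varepsilon_{k-i}$. $F$ and $f$ are the distribution function and density of $X_k$; $\xi_p=\inf\{x:F(x)\ge p\}$; $F_n(x)=\frac1n\sum_{i=1}^n\mathbf 1_{X_i\le x}$; $\xi_{n,p}=\inf\{x:F_n(x)\ge p\}$; $\bar X_n=\frac1n\sum_{i=1}^nX_i$. With $\|Z\|=[\mathbb{E}(Z^2)]^{1/2}$, put $\sigma_{n,1}=\|n\bar X_n\|$. Put $\Psi_n=\sqrt n\sum_{k=1}^nk^{1/2-2\beta}L^2(k)$, and $A_n(\beta)=\Psi_n^2(\log n)(\log\log n)^2$ if $\beta<3/4$, $A_n(\beta)=\Psi_n^2(\log n)^3(\log\log n)^2$ if $\beta\ge3/4$. A sequence of random variables $Z_n$ is $O_{\mathrm{a.s.}}(r_n)$ if $Z_n/r_n$ is almost surely bounded. *)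

theory Defs
  imports "HOL-Probability.Probability"
begin

text \<open>Slow variation in the sense of Karamata: measurable and positive on some half-line
  \<open>[A, \<infinity>)\<close>; nothing is required of \<open>L\<close> below \<open>A\<close>.\<close>

definition slowly_varying :: "(real \<Rightarrow> real) \<Rightarrow> bool" where
  "slowly_varying L \<longleftrightarrow>
     (\<exists>A. L \<in> borel_measurable (restrict_space borel {A..}) \<and> (\<forall>x\<ge>A. L x > 0)) \<and>
     (\<forall>c>0. ((\<lambda>x. L (c * x) / L x) \<longlongrightarrow> 1) at_top)"

definition lrd_coeff :: "real \<Rightarrow> (real \<Rightarrow> real) \<Rightarrow> nat \<Rightarrow> real" where
  "lrd_coeff \<beta> L n = (if n = 0 then 1 else real n powr (- \<beta>) * L (real n))"

text \<open>The series is taken pointwise. For square-summable \<open>a\<close> and i.i.d. centred innovations with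
  finite variance it converges almost surely, so the value of \<^term>\<open>suminf\<close> on divergent series
  only matters on a null set.\<close>

definition linear_process :: "(nat \<Rightarrow> real) \<Rightarrow> (int \<Rightarrow> 'a \<Rightarrow> real) \<Rightarrow> int \<Rightarrow> 'a \<Rightarrow> real" where
  "linear_process a \<epsilon> k \<omega> = (\<Sum>i. a i * \<epsilon> (k - int i) \<omega>)"

definition quantile :: "(real \<Rightarrow> real) \<Rightarrow> real \<Rightarrow> real" where
  "quantile G p = Inf {x. p \<le> G x}"

definition empirical_cdf :: "(int \<Rightarrow> 'a \<Rightarrow> real) \<Rightarrow> nat \<Rightarrow> 'a \<Rightarrow> real \<Rightarrow> real" where
  "empirical_cdf X n \<omega> x = (1 / real n) * (\<Sum>i=1..n. indicator {..x} (X (int i) \<omega>))"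

definition sample_mean :: "(int \<Rightarrow> 'a \<Rightarrow> real) \<Rightarrow> nat \<Rightarrow> 'a \<Rightarrow> real" where
  "sample_mean X n \<omega> = (1 / real n) * (\<Sum>i=1..n. X (int i) \<omega>)"

definition rv_norm :: "'a measure \<Rightarrow> ('a \<Rightarrow> real) \<Rightarrow> real" where
  "rv_norm M Z = sqrt (\<integral>\<omega>. (Z \<omega>)\<^sup>2 \<partial>M)"

definition sigma1 :: "'a measure \<Rightarrow> (int \<Rightarrow> 'a \<Rightarrow> real) \<Rightarrow> nat \<Rightarrow> real" where
  "sigma1 M X n = rv_norm M (\<lambda>\<omega>. real n * sample_mean X n \<omega>)"

definition Psi :: "real \<Rightarrow> (real \<Rightarrow> real) \<Rightarrow> nat \<Rightarrow> real" where
  "Psi \<beta> L n = sqrt (real n) * (\<Sum>k=1..n. real k powr (1/2 - 2 * \<beta>) * (L (real k))\<^sup>2)"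

definition A_seq :: "real \<Rightarrow> (real \<Rightarrow> real) \<Rightarrow> nat \<Rightarrow> real" where
  "A_seq \<beta> L n =
     (if \<beta> < 3/4 then (Psi \<beta> L n)\<^sup>2 * ln (real n) * (ln (ln (real n)))\<^sup>2
      else (Psi \<beta> L n)\<^sup>2 * (ln (real n)) ^ 3 * (ln (ln (real n)))\<^sup>2)"

definition b_seq :: "'a measure \<Rightarrow> (int \<Rightarrow> 'a \<Rightarrow> real) \<Rightarrow> nat \<Rightarrow> real" where
  "b_seq M X n = sigma1 M X n * sqrt (ln (real n)) * ln (ln (real n)) / real n"

text \<open>\<open>Z\<^sub>n = O\<^sub>a\<^sub>.\<^sub>s\<^sub>.(r\<^sub>n)\<close>: the bound is pathwise, so \<open>C\<close> may depend on \<open>\<omega>\<close>.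
  It is imposed for large \<open>n\<close> only, because rates containing \<open>ln (ln n)\<close> are meaningless for
  the first few \<open>n\<close>. \<open>Z\<close> is extended-real-valued so that an infinite supremum counts as infinite.\<close>

definition bigo_as :: "'a measure \<Rightarrow> (nat \<Rightarrow> 'a \<Rightarrow> ereal) \<Rightarrow> (nat \<Rightarrow> real) \<Rightarrow> bool" where
  "bigo_as M Z r \<longleftrightarrow>
     (AE \<omega> in M. \<exists>C::real. \<forall>\<^sub>F n in sequentially. \<bar>Z n \<omega>\<bar> \<le> ereal (C * \<bar>r n\<bar>))"

end

(* Write X_i = eps_i + R_i, let G be the distribution function of eps_i, and put
   D_n(x) = F_n(x) - F(x) + f(x) Xbar_n.  Then n D_n = M_n + N_n, where M_n(x) sums the bounded
   martingale differences 1{X_i <= x} - G(x - R_i) and N_n(x) sums G(x - R_i) - F(x) + f(x) X_i.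
   M_n is controlled uniformly in x by an exponential inequality on a grid.  The summands of N_n
   are sums of orthogonal projections on single innovations; conditional expectations of G are
   smooth, so the projection at lag j has L2 norm of order sqrt j * a_j^2, and a block of length n
   has L2 norm at most of order Psi_n.  A dyadic (Rademacher-Menshov) maximal inequality and a
   Sobolev bound in x turn this into the almost sure rate sqrt A_n for N_n and its derivative; the
   same maximal inequality gives Xbar_n = O(b_n).  What remains is deterministic: xi_{n,p} lies
   within O(b_n) of xi_p, there D_n varies only by an admissible amount, and a second order Taylor
   expansion at xi_p of F(q) - f(q) Xbar_n + D_n(xi_p), which is almost p at q = xi_{n,p}, gives
   the expansion. *)

theory Submission
  imports Defs "HOL-Real_Asymp.Real_Asymp"
begin

text \<open>The second derivative of the innovation density is only bounded, while the size sqrt j *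
  a_j^2 of a lag-j projection needs a Lipschitz derivative. Averaging over one innovation with
  nonzero coefficient removes this obstacle: it makes every bounded function Lipschitz, because
  translations of the density are Lipschitz in L1. That property needs an integrable first
  derivative, which follows from (f')^2 <= C f, valid for a nonnegative function with bounded second
  derivative, and from the second moment. The finitely many lags before this smoothing takes effect
  are bounded crudely. The function L is controlled only near infinity, so rates are phrased through
  a positive sequence \<theta> that satisfies Potter's bounds and equals n^(-\<beta>) L(n) from some
  n on. The case split in A_n belongs to the sequence sqrt n * \<theta>_n^2 of index 2 \<beta> -
  1/2: below index 1 its dyadic partial sums grow geometrically, otherwise their sum over about log
  n levels costs another factor (log n)^2 after squaring.\<close>

section \<open>Slow variation and Potter bounds\<close>

text \<open>With \<open>t = ln x\<close> it is enough that increments of \<open>ln L\<close> over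
  steps of length at most 1 are eventually bounded by 2. Hence \<open>K = exp 2\<close>, and the
  range up to \<open>2 * x\<close> fits because 2 <= e. Measurability of \<open>L\<close> is what
  turns the pointwise limit into a locally uniform bound.\<close>

lemma slowly_varying_locally_bounded:
  assumes "slowly_varying L"
  shows "\<exists>x0\<ge>1. \<exists>K\<ge>1. \<forall>x\<ge>x0. 0 < L x \<and>
           (\<forall>y. x \<le> y \<and> y \<le> 2 * x \<longrightarrow> L y \<le> K * L x \<and> L x \<le> K * L y)"
proof -
  obtain A where meas: "L \<in> borel_measurable (restrict_space borel {A..})"
    and pos: "\<And>x. x \<ge> A \<Longrightarrow> L x > 0"
    and lim: "\<And>c. c > 0 \<Longrightarrow> ((\<lambda>x. L (c * x) / L x) \<longlongrightarrow> 1) at_top"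
    using assms unfolding slowly_varying_def by blast
  define B where "B = max A 1"
  \<comment> \<open>The value 0 below \<open>A\<close> makes \<open>l\<close> Borel on the whole
    line, although \<open>L\<close> is measurable only on \<open>{A..}\<close>.\<close>
  define l where "l = (\<lambda>y. if A \<le> y then ln (L y) else 0)"
  have [measurable]: "l \<in> borel_measurable borel"
  proof -
    have "(\<lambda>y. ln (L y)) \<in> borel_measurable (restrict_space borel {A..})"
      using meas by measurable
    then have "(\<lambda>y. if y \<in> {A..} then ln (L y) else 0) \<in> borel_measurable borel"
      by (subst (asm) measurable_restrict_space_iff) auto
    then show ?thesis unfolding l_def by simp
  qed
  (* V t and the translate of V (t + u) are both almost of full measure in an interval of length 2
     and lie in {0..3}, so they meet; this makes the convergence locally uniform. *)
  define V where "V = (\<lambda>t. {u\<in>{0..2}. \<bar>l (exp (t+u)) - l (exp t)\<bar> \<le> 1})"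
  have Vm[measurable]: "V t \<in> sets borel" for t
    unfolding V_def by measurable
  have lim_l: "((\<lambda>t. l (exp (t+u)) - l (exp t)) \<longlongrightarrow> 0) at_top" if "u \<ge> 0" for u
  proof -
    have "((\<lambda>t. ln (L (exp u * exp t) / L (exp t))) \<longlongrightarrow> ln 1) at_top"
      by (intro tendsto_ln filterlim_compose[OF lim exp_at_top]) auto
    moreover have "\<forall>\<^sub>F t in at_top. ln (L (exp u * exp t) / L (exp t)) = l (exp (t+u)) - l (exp t)"
      using eventually_ge_at_top[of "ln B"]
    proof eventually_elim
      case (elim t)
      have "exp t \<ge> B" using elim exp_le_cancel_iff[of "ln B" t] by (simp add: B_def)
      then have "exp t \<ge> A" by (simp add: B_def)
      moreover have "exp (t+u) \<ge> exp t" using that by simp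
      ultimately have "A \<le> exp (t+u)" "L (exp t) > 0" "L (exp (t+u)) > 0" using pos[of "exp t"] pos[of "exp (t+u)"] by linarith+
      then show ?case using \<open>exp t \<ge> A\<close> by (simp add: l_def ln_div exp_add mult.commute)
    qed
    ultimately show ?thesis using tendsto_cong by fastforce
  qed
  have "((\<lambda>t. \<integral>u. indicat_real (V t) u \<partial>lborel) \<longlongrightarrow> (\<integral>u. indicat_real {0..2::real} u \<partial>lborel)) at_top"
  proof (rule integral_dominated_convergence_at_top[where M=lborel and s="\<lambda>t. indicat_real (V t)"
        and f="indicat_real {0..2}" and w="indicat_real {0..2}"])
    show "\<forall>\<^sub>F t in at_top. AE x in lborel. norm (indicat_real (V t) x) \<le> indicat_real {0..2} x"
      by (intro always_eventually allI AE_I2) (auto simp: V_def indicator_def)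
    show "AE x in lborel. ((\<lambda>t. indicat_real (V t) x) \<longlongrightarrow> indicat_real {0..2} x) at_top"
    proof (rule AE_I2)
      fix u :: real
      show "((\<lambda>t. indicat_real (V t) u) \<longlongrightarrow> indicat_real {0..2} u) at_top"
      proof (cases "u \<in> {0..2}")
        case True
        then have "\<forall>\<^sub>F t in at_top. dist (l (exp (t+u)) - l (exp t)) 0 < 1"
          using tendstoD[OF lim_l[of u], of 1] by auto
        then have "\<forall>\<^sub>F t in at_top. indicat_real (V t) u = indicat_real {0..2} u"
          by eventually_elim (use True in \<open>auto simp: V_def dist_real_def\<close>)
        then show ?thesis by (simp add: tendsto_eventually)
      next
        case False then show ?thesis by (auto simp: V_def)
      qed
    qed
  qed (auto intro!: integrable_real_indicator)
  then have "((\<lambda>t. measure lborel (V t)) \<longlongrightarrow> 2) at_top" by simp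
  \<comment> \<open>Two sets of measure above 3/2 inside an interval of length 3 must meet; 7/4 is
    such a number below the limit 2.\<close>
  then have "\<forall>\<^sub>F t in at_top. 7/4 < measure lborel (V t)"
    by (rule order_tendstoD) simp
  then obtain t0 where t0: "\<And>t. t \<ge> t0 \<Longrightarrow> 7/4 < measure lborel (V t)"
    by (auto simp: eventually_at_top_linorder)
  have finV: "emeasure lborel (V t) < \<infinity>" for t
    by (rule le_less_trans[OF emeasure_mono[of _ "{0..2}"]]) (auto simp: V_def)
  have key: "\<bar>l (exp (t+u)) - l (exp t)\<bar> \<le> 2" if "t \<ge> t0" "0 \<le> u" "u \<le> 1" for t u
  proof -
    define W where "W = (+) (- u) -` V (t+u)"
    have f: "(+) (- u) \<in> borel_measurable borel" by simp
    have [measurable]: "W \<in> sets borel"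
      using measurable_sets[OF f Vm] by (simp add: W_def)
    have "measure (distr lborel borel ((+) (- u))) (V (t+u)) = measure lborel ((+) (- u) -` V (t+u) \<inter> space lborel)"
      using f Vm by (intro measure_distr) auto
    then have mW: "measure lborel W = measure lborel (V (t+u))"
      by (simp add: lborel_distr_plus W_def)
    have finW: "emeasure lborel W < \<infinity>"
      by (rule le_less_trans[OF emeasure_mono[of _ "{0..3}"]]) (use that in \<open>auto simp: V_def W_def\<close>)
    have "V t \<inter> W \<noteq> {}"
    proof
      assume e: "V t \<inter> W = {}"
      have "measure lborel (V t \<union> W) = measure lborel (V t) + measure lborel W"
        using e finV[of t] finW by (intro measure_Union) auto
      moreover have "measure lborel (V t \<union> W) \<le> measure lborel {0..3::real}"
      proof (rule measure_mono_fmeasurable)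
        show "V t \<union> W \<subseteq> {0..3}" using that by (auto simp: V_def W_def)
      qed (auto simp: fmeasurable_def)
      ultimately show False using t0[of t] t0[of "t+u"] that mW by auto
    qed
    then obtain y where "y \<in> V t" "y - u \<in> V (t+u)" by (auto simp: W_def)
    then show ?thesis by (auto simp: V_def)
  qed
  define x0 where "x0 = max B (exp t0)"
  have bd: "\<forall>x\<ge>x0. 0 < L x \<and> (\<forall>y. x \<le> y \<and> y \<le> 2 * x \<longrightarrow> L y \<le> exp 2 * L x \<and> L x \<le> exp 2 * L y)"
  proof (intro conjI allI impI)
    fix x assume x: "x0 \<le> x"
    have xA: "A \<le> x" "1 \<le> x" using x by (auto simp: x0_def B_def)
    then show "0 < L x" using pos by auto
  next
    fix x y assume x: "x0 \<le> x" and y: "x \<le> y \<and> y \<le> 2 * x"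
    have xA: "A \<le> x" "1 \<le> x" using x by (auto simp: x0_def B_def)
    have tx: "ln x \<ge> t0" using x xA by (simp add: x0_def ln_ge_iff)
    have "y / x \<le> 2" using y xA by (simp add: divide_simps)
    also have "2 \<le> exp (1::real)" using exp_ge_add_one_self[of 1] by simp
    finally have "ln (y/x) \<le> ln (exp 1)"
      using xA y by (subst ln_le_cancel_iff) auto
    then have "ln (y/x) \<le> 1" by simp
    moreover have "0 \<le> ln (y/x)" using y xA by simp
    ultimately have "\<bar>l (exp (ln x + ln (y/x))) - l (exp (ln x))\<bar> \<le> 2" using key tx by blast
    moreover have "exp (ln x + ln (y/x)) = y" using y xA by (simp add: exp_add)
    moreover have "exp (ln x) = x" using xA by simp
    ultimately have "\<bar>l y - l x\<bar> \<le> 2" by metis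
    moreover have "l y = ln (L y)" "l x = ln (L x)" using xA y by (auto simp: l_def)
    ultimately have l: "\<bar>ln (L y) - ln (L x)\<bar> \<le> 2" by metis
    have p: "L x > 0" "L y > 0" using pos xA y by auto
    have "exp (ln (L y)) \<le> exp (2 + ln (L x))" "exp (ln (L x)) \<le> exp (2 + ln (L y))"
      unfolding exp_le_cancel_iff using l by linarith+
    then show "L y \<le> exp 2 * L x" "L x \<le> exp 2 * L y"
      unfolding exp_add exp_ln[OF p(1)] exp_ln[OF p(2)] .
  qed
  have K1: "(1::real) \<le> exp 2" by simp
  have x1: "1 \<le> x0" by (auto simp: x0_def B_def)
  show ?thesis
    by (rule exI[of _ x0], rule conjI[OF x1], rule exI[of _ "exp 2"], rule conjI[OF K1 bd])
qed

text \<open>Potter's two-sided bounds for regular variation of index \<open>-\<gamma>\<close>.\<close>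

definition potter :: "real \<Rightarrow> (nat \<Rightarrow> real) \<Rightarrow> bool" where
  "potter \<gamma> \<theta> \<longleftrightarrow> (\<forall>n\<ge>1. 0 < \<theta> n) \<and>
     (\<forall>\<eta>>0. \<exists>C>0. \<forall>m n. 1 \<le> m \<longrightarrow> m \<le> n \<longrightarrow>
        \<theta> n \<le> C * (real n / real m) powr (\<eta> - \<gamma>) * \<theta> m \<and>
        \<theta> m \<le> C * (real n / real m) powr (\<eta> + \<gamma>) * \<theta> n)"

lemma potter_pos: "potter \<gamma> \<theta> \<Longrightarrow> n \<ge> 1 \<Longrightarrow> 0 < \<theta> n"
  by (simp add: potter_def)

lemma potterE:
  assumes "potter \<gamma> \<theta>" "\<eta> > 0"
  obtains C where "C > 0"
    "\<And>m n. 1 \<le> m \<Longrightarrow> m \<le> n \<Longrightarrow> \<theta> n \<le> C * (real n / real m) powr (\<eta> - \<gamma>) * \<theta> m"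
    "\<And>m n. 1 \<le> m \<Longrightarrow> m \<le> n \<Longrightarrow> \<theta> m \<le> C * (real n / real m) powr (\<eta> + \<gamma>) * \<theta> n"
proof -
  have "\<exists>C>0. \<forall>m n. 1 \<le> m \<longrightarrow> m \<le> n \<longrightarrow>
        \<theta> n \<le> C * (real n / real m) powr (\<eta> - \<gamma>) * \<theta> m \<and>
        \<theta> m \<le> C * (real n / real m) powr (\<eta> + \<gamma>) * \<theta> n"
    using assms unfolding potter_def by simp
  then obtain C where "C > 0" and C: "\<forall>m n. 1 \<le> m \<longrightarrow> m \<le> n \<longrightarrow>
        \<theta> n \<le> C * (real n / real m) powr (\<eta> - \<gamma>) * \<theta> m \<and>
        \<theta> m \<le> C * (real n / real m) powr (\<eta> + \<gamma>) * \<theta> n"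
    by (elim exE conjE)
  show ?thesis
    by (rule that[OF \<open>C > 0\<close>]) (simp_all add: C)
qed

text \<open>The ratio tends to 1, so doubling the argument eventually changes \<open>L\<close> by a
  factor of at most \<open>2 powr \<eta>\<close> in either direction. Iterating over the doublings
  between \<open>x\<close> and \<open>y\<close> gives the power; the last, incomplete doubling is
  paid by the local bound \<open>K\<close>.\<close>

lemma slowly_varying_potter_real:
  assumes "slowly_varying L" "\<eta> > 0"
  shows "\<exists>x1\<ge>1. \<exists>K\<ge>1. \<forall>x\<ge>x1. \<forall>y\<ge>x. 0 < L x \<and> L y \<le> K * (y/x) powr \<eta> * L x \<and> L x \<le> K * (y/x) powr \<eta> * L y"
proof -
  obtain x0 K where x0: "x0 \<ge> 1" "K \<ge> 1" and pos: "\<And>x. x \<ge> x0 \<Longrightarrow> 0 < L x"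
    and bd1: "\<And>x y. x \<ge> x0 \<Longrightarrow> x \<le> y \<Longrightarrow> y \<le> 2 * x \<Longrightarrow> L y \<le> K * L x"
    and bd2: "\<And>x y. x \<ge> x0 \<Longrightarrow> x \<le> y \<Longrightarrow> y \<le> 2 * x \<Longrightarrow> L x \<le> K * L y"
    using slowly_varying_locally_bounded[OF assms(1)] by blast
  have lim: "((\<lambda>x. L (2 * x) / L x) \<longlongrightarrow> 1) at_top"
    using assms(1) unfolding slowly_varying_def by auto
  have "(2::real) powr \<eta> > 1" "(2::real) powr (-\<eta>) < 1" using assms(2) by (auto simp: powr_less_one)
  then have "\<forall>\<^sub>F x in at_top. L (2*x) / L x < 2 powr \<eta> \<and> L (2*x) / L x > 2 powr (-\<eta>)"
    using order_tendstoD[OF lim] by (auto intro: eventually_conj)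
  then obtain x2 where x2: "\<And>x. x \<ge> x2 \<Longrightarrow> L (2*x) / L x < 2 powr \<eta> \<and> L (2*x) / L x > 2 powr (-\<eta>)"
    by (auto simp: eventually_at_top_linorder)
  define x1 where "x1 = max x0 x2"
  have up: "L (2*x) \<le> 2 powr \<eta> * L x" and lo: "L x \<le> 2 powr \<eta> * L (2*x)" if "x \<ge> x1" for x
  proof -
    have p: "L x > 0" using pos that by (simp add: x1_def)
    show "L (2*x) \<le> 2 powr \<eta> * L x" using x2[of x] that p by (simp add: x1_def divide_simps)
    have "2 powr (-\<eta>) * L x \<le> L (2*x)" using x2[of x] that p by (simp add: x1_def field_simps)
    then have "2 powr \<eta> * (2 powr (-\<eta>) * L x) \<le> 2 powr \<eta> * L (2*x)" by (intro mult_left_mono) auto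
    moreover have "2 powr \<eta> * (2 powr (-\<eta>) * L x) = L x" by (simp add: powr_minus)
    ultimately show "L x \<le> 2 powr \<eta> * L (2*x)" by linarith
  qed
  have main: "L y \<le> K * (y/x) powr \<eta> * L x \<and> L x \<le> K * (y/x) powr \<eta> * L y"
    if "x \<ge> x1" "x \<le> y" "y \<le> 2 ^ Suc k * x" for k x y
    using that
  proof (induction k arbitrary: x)
    case 0
    have x: "x \<ge> x0" "x > 0" using 0 x0 by (auto simp: x1_def)
    have "(y/x) powr \<eta> \<ge> 1" using 0 x assms(2) by (intro ge_one_powr_ge_zero) (auto simp: divide_simps)
    then have "K * L x \<le> K * (y/x) powr \<eta> * L x" "K * L y \<le> K * (y/x) powr \<eta> * L y"
      using pos[of x] pos[of y] 0 x x0 by (auto intro!: mult_right_mono simp: mult_le_cancel_left1 mult_ac)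
    then show ?case using bd1[of x y] bd2[of x y] 0 x by auto
  next
    case (Suc k)
    have x: "x \<ge> x0" "x > 0" using Suc x0 by (auto simp: x1_def)
    show ?case
    proof (cases "y \<le> 2 * x")
      case True
      have "(y/x) powr \<eta> \<ge> 1" using Suc x assms(2) by (intro ge_one_powr_ge_zero) (auto simp: divide_simps)
      then have "K * L x \<le> K * (y/x) powr \<eta> * L x" "K * L y \<le> K * (y/x) powr \<eta> * L y"
        using pos[of x] pos[of y] Suc x x0 by (auto intro!: mult_right_mono simp: mult_le_cancel_left1 mult_ac)
      then show ?thesis using bd1[of x y] bd2[of x y] Suc x True by auto
    next
      case False
      have IH: "L y \<le> K * (y/(2*x)) powr \<eta> * L (2*x) \<and> L (2*x) \<le> K * (y/(2*x)) powr \<eta> * L y"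
        using Suc.IH[of "2*x"] Suc.prems False x by auto
      have e: "(y/(2*x)) powr \<eta> * 2 powr \<eta> = (y/x) powr \<eta>"
        using x Suc.prems by (simp flip: powr_mult)
      have "L y \<le> K * (y/(2*x)) powr \<eta> * (2 powr \<eta> * L x)"
        using IH up[of x] Suc.prems x0 by (smt (verit) mult_left_mono mult_nonneg_nonneg powr_ge_zero)
      also have "\<dots> = K * (y/x) powr \<eta> * L x" by (simp add: e[symmetric])
      finally have 1: "L y \<le> K * (y/x) powr \<eta> * L x" .
      have "L x \<le> 2 powr \<eta> * (K * (y/(2*x)) powr \<eta> * L y)"
        using IH lo[of x] Suc.prems x0 by (smt (verit) mult_left_mono mult_nonneg_nonneg powr_ge_zero)
      also have "\<dots> = K * (y/x) powr \<eta> * L y" by (simp add: e[symmetric])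
      finally show ?thesis using 1 by blast
    qed
  qed
  have "0 < L x \<and> L y \<le> K * (y/x) powr \<eta> * L x \<and> L x \<le> K * (y/x) powr \<eta> * L y" if "x \<ge> x1" "y \<ge> x" for x y
  proof -
    have "x > 0" using that x0 by (auto simp: x1_def)
    obtain k where "y / x < 2 ^ k" using real_arch_pow[of 2 "y/x"] by auto
    then have "y \<le> 2 ^ k * x" using \<open>x > 0\<close> by (simp add: divide_simps)
    also have "\<dots> \<le> 2 ^ Suc k * x" using \<open>x > 0\<close> by simp
    finally show ?thesis using main[of x y k] that pos[of x] by (auto simp: x1_def)
  qed
  moreover have "x1 \<ge> 1" using x0 by (simp add: x1_def)
  ultimately show ?thesis using x0 by blast
qed

text \<open>Indices below \<open>n1\<close> are handled by passing through \<open>n1\<close>: the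
  finitely many ratios \<open>l i / l j\<close> with \<open>i, j <= n1\<close> are all bounded by
  \<open>C1\<close>.\<close>

lemma potter_ratio_extend:
  fixes l :: "nat \<Rightarrow> real"
  assumes pos: "\<And>n. l n > 0" and K: "K \<ge> 1" and "\<eta> > 0" and "n1 \<ge> 1"
    and bd: "\<And>m n. n1 \<le> m \<Longrightarrow> m \<le> n \<Longrightarrow> l n \<le> K * (n/m) powr \<eta> * l m \<and> l m \<le> K * (n/m) powr \<eta> * l n"
  shows "\<exists>C>0. \<forall>m n. 1 \<le> m \<longrightarrow> m \<le> n \<longrightarrow> l n \<le> C * (real n/ real m) powr \<eta> * l m \<and> l m \<le> C * (real n/ real m) powr \<eta> * l n"
proof -
  define C1 where "C1 = 1 + (\<Sum>i\<le>n1. \<Sum>j\<le>n1. l i / l j)"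
  have nn: "0 \<le> l i / l j" for i j using pos[of i] pos[of j] by simp
  have C1: "C1 \<ge> 1" unfolding C1_def using nn by (simp add: sum_nonneg)
  have fin: "l i \<le> C1 * l j" if "i \<le> n1" "j \<le> n1" for i j
  proof -
    have "l i / l j \<le> (\<Sum>j\<le>n1. l i / l j)" using that nn by (intro member_le_sum) auto
    also have "\<dots> \<le> (\<Sum>i\<le>n1. \<Sum>j\<le>n1. l i / l j)"
      using that nn by (intro member_le_sum[where f="\<lambda>i. \<Sum>j\<le>n1. l i / l j"]) (auto intro!: sum_nonneg)
    finally have "l i / l j \<le> C1" by (simp add: C1_def)
    then show ?thesis using pos[of j] by (simp add: divide_simps)
  qed
  have "l n \<le> (C1 * K) * (n/m) powr \<eta> * l m \<and> l m \<le> (C1 * K) * (n/m) powr \<eta> * l n" if mn: "1 \<le> m" "m \<le> n" for m n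
  proof -
    have r1: "(n/m) powr \<eta> \<ge> 1" using mn assms(3) by (intro ge_one_powr_ge_zero) auto
    have KC: "C1 * K \<ge> 1" "C1 * K \<ge> C1" "C1 * K \<ge> K"
      using C1 K mult_mono[of 1 C1 1 K] by (auto simp: mult_le_cancel_right1 mult_le_cancel_left1)
    consider "n \<le> n1" | "n1 < n" "m \<le> n1" | "n1 < m" using mn by linarith
    then show ?thesis
    proof cases
      case 1
      have "C1 * 1 \<le> (C1 * K) * (n/m) powr \<eta>" using KC r1 C1 by (intro mult_mono) auto
      then have "C1 * l m \<le> (C1 * K) * (n/m) powr \<eta> * l m" "C1 * l n \<le> (C1 * K) * (n/m) powr \<eta> * l n"
        using pos[of n] pos[of m] by (auto intro!: mult_right_mono)
      then show ?thesis using fin[of n m] fin[of m n] 1 mn by linarith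
    next
      case 2
      have r: "(n/n1) powr \<eta> \<le> (n/m) powr \<eta>" using 2 mn assms(3,4) by (intro powr_mono2) (auto simp: divide_simps)
      have "l n \<le> K * (n/n1) powr \<eta> * l n1" using bd[of n1 n] 2 by auto
      also have "\<dots> \<le> K * (n/m) powr \<eta> * (C1 * l m)"
        using r fin[of n1 m] 2 pos[of n1] K by (intro mult_mono) auto
      finally have a: "l n \<le> (C1 * K) * (n/m) powr \<eta> * l m" by (simp add: mult_ac)
      have "l m \<le> C1 * l n1" using fin[of m n1] 2 by auto
      also have "\<dots> \<le> C1 * (K * (n/n1) powr \<eta> * l n)" using bd[of n1 n] 2 C1 by (intro mult_left_mono) auto
      also have "\<dots> \<le> C1 * (K * (n/m) powr \<eta> * l n)"
        using r C1 K pos[of n] by (intro mult_left_mono mult_right_mono) auto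
      finally show ?thesis using a by (simp add: mult_ac)
    next
      case 3
      have "K * (n/m) powr \<eta> \<le> (C1 * K) * (n/m) powr \<eta>" using KC by (intro mult_right_mono) auto
      then have "K * (n/m) powr \<eta> * l m \<le> (C1 * K) * (n/m) powr \<eta> * l m" "K * (n/m) powr \<eta> * l n \<le> (C1 * K) * (n/m) powr \<eta> * l n"
        using pos[of n] pos[of m] by (auto intro!: mult_right_mono)
      then show ?thesis using bd[of m n] 3 mn by auto
    qed
  qed
  moreover have "C1 * K > 0" using C1 K by auto
  ultimately show ?thesis by blast
qed

text \<open>\<open>L\<close> may vanish or be negative at small arguments, so
  \<open>\<theta>\<close> freezes it there at its value at \<open>n0\<close>. Later rates are stated
  through \<open>\<theta>\<close>, and the agreement from \<open>n0\<close> on transfers them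
  back.\<close>

lemma potter_of_slowly_varying:
  assumes "slowly_varying L"
  obtains \<theta> n0 where "n0 \<ge> 1" "potter \<beta> \<theta>" "\<And>n. n \<ge> n0 \<Longrightarrow> \<theta> n = real n powr (-\<beta>) * L (real n)"
proof -
  obtain x0 where x0: "x0 \<ge> 1" and pos: "\<And>x. x \<ge> x0 \<Longrightarrow> 0 < L x"
    using slowly_varying_locally_bounded[OF assms] by blast
  define n0 where "n0 = nat \<lceil>x0\<rceil>"
  have n0: "n0 \<ge> 1" "real n0 \<ge> x0" using x0 unfolding n0_def by linarith+
  define l where "l = (\<lambda>n. L (real (max n n0)))"
  define \<theta> where "\<theta> = (\<lambda>n. real n powr (-\<beta>) * l n)"
  have lpos: "l n > 0" for n unfolding l_def using n0 by (intro pos) auto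
  have ext: "\<exists>C>0. \<forall>m n. 1 \<le> m \<longrightarrow> m \<le> n \<longrightarrow> l n \<le> C * (real n/ real m) powr \<eta> * l m \<and> l m \<le> C * (real n/ real m) powr \<eta> * l n"
    if \<eta>: "\<eta> > 0" for \<eta>
  proof -
    obtain x1 K where x1: "x1 \<ge> 1" "K \<ge> 1" and
      bd: "\<And>x y. x \<ge> x1 \<Longrightarrow> y \<ge> x \<Longrightarrow> L y \<le> K * (y/x) powr \<eta> * L x \<and> L x \<le> K * (y/x) powr \<eta> * L y"
      using slowly_varying_potter_real[OF assms \<eta>] by blast
    define n1 where "n1 = max n0 (nat \<lceil>x1\<rceil>)"
    have n1: "n1 \<ge> 1" "real n1 \<ge> x1" "n1 \<ge> n0" using n0 x1 unfolding n1_def by linarith+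
    show ?thesis
    proof (rule potter_ratio_extend[of l K \<eta> n1])
      fix m n :: nat assume mn: "n1 \<le> m" "m \<le> n"
      then have "max m n0 = m" "max n n0 = n" using n1 by auto
      then show "l n \<le> K * (n/m) powr \<eta> * l m \<and> l m \<le> K * (n/m) powr \<eta> * l n"
        using bd[of "real m" "real n"] n1 mn by (simp add: l_def)
    qed (use lpos x1 n1 \<eta> in auto)
  qed
  have "potter \<beta> \<theta>"
    unfolding potter_def
  proof (intro conjI allI impI)
    fix n :: nat assume "1 \<le> n" then show "0 < \<theta> n" using lpos by (simp add: \<theta>_def)
  next
    fix \<eta> :: real assume "\<eta> > 0"
    from ext[OF this] obtain C where C: "C > 0" and
      bd: "\<And>m n. 1 \<le> m \<Longrightarrow> m \<le> n \<Longrightarrow> l n \<le> C * (real n/ real m) powr \<eta> * l m \<and> l m \<le> C * (real n/ real m) powr \<eta> * l n"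
      by blast
    have "\<theta> n \<le> C * (real n / real m) powr (\<eta> - \<beta>) * \<theta> m \<and> \<theta> m \<le> C * (real n / real m) powr (\<eta> + \<beta>) * \<theta> n"
      if mn: "1 \<le> m" "m \<le> n" for m n
    proof
      have "\<theta> n \<le> real n powr (-\<beta>) * (C * (real n/ real m) powr \<eta> * l m)"
        unfolding \<theta>_def using bd[OF mn] by (intro mult_left_mono) auto
      also have "\<dots> = C * (real n / real m) powr (\<eta> - \<beta>) * \<theta> m"
        using mn by (simp add: \<theta>_def powr_divide powr_diff powr_minus field_simps)
      finally show "\<theta> n \<le> C * (real n / real m) powr (\<eta> - \<beta>) * \<theta> m" .
      have "\<theta> m \<le> real m powr (-\<beta>) * (C * (real n/ real m) powr \<eta> * l n)"
        unfolding \<theta>_def using bd[OF mn] by (intro mult_left_mono) auto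
      also have "\<dots> = C * (real n / real m) powr (\<eta> + \<beta>) * \<theta> n"
        using mn by (simp add: \<theta>_def powr_divide powr_add powr_minus field_simps)
      finally show "\<theta> m \<le> C * (real n / real m) powr (\<eta> + \<beta>) * \<theta> n" .
    qed
    then show "\<exists>C>0. \<forall>m n. 1 \<le> m \<longrightarrow> m \<le> n \<longrightarrow> \<theta> n \<le> C * (real n / real m) powr (\<eta> - \<beta>) * \<theta> m \<and>
        \<theta> m \<le> C * (real n / real m) powr (\<eta> + \<beta>) * \<theta> n" using C by blast
  qed
  moreover have "\<theta> n = real n powr (-\<beta>) * L (real n)" if "n \<ge> n0" for n
    using that by (simp add: \<theta>_def l_def max_def)
  ultimately show ?thesis using that n0 by blast
qed

text \<open>The sequence in question is the size of the lag-\<open>n\<close> projections of the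
  smooth part. Squaring doubles the loss in the exponent, so Potter's bound for
  \<open>\<theta>\<close> is used with \<open>\<eta> / 2\<close>.\<close>

lemma potter_sqrt_square:
  assumes "potter \<gamma> \<theta>"
  shows "potter (2 * \<gamma> - 1/2) (\<lambda>n. sqrt (real n) * (\<theta> n)\<^sup>2)"
  unfolding potter_def
proof (intro conjI allI impI)
  fix n :: nat assume "1 \<le> n" then show "0 < sqrt (real n) * (\<theta> n)\<^sup>2" using potter_pos[OF assms, of n] by simp
next
  fix \<eta> :: real assume "\<eta> > 0"
  then have "\<eta>/2 > 0" by simp
  from potterE[OF assms this] obtain C where C: "C > 0"
    and b1: "\<And>m n. 1 \<le> m \<Longrightarrow> m \<le> n \<Longrightarrow> \<theta> n \<le> C * (real n / real m) powr (\<eta>/2 - \<gamma>) * \<theta> m"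
    and b2: "\<And>m n. 1 \<le> m \<Longrightarrow> m \<le> n \<Longrightarrow> \<theta> m \<le> C * (real n / real m) powr (\<eta>/2 + \<gamma>) * \<theta> n" by blast
  have "sqrt (real n) * (\<theta> n)\<^sup>2 \<le> C\<^sup>2 * (real n / real m) powr (\<eta> - (2*\<gamma> - 1/2)) * (sqrt (real m) * (\<theta> m)\<^sup>2)
     \<and> sqrt (real m) * (\<theta> m)\<^sup>2 \<le> C\<^sup>2 * (real n / real m) powr (\<eta> + (2*\<gamma> - 1/2)) * (sqrt (real n) * (\<theta> n)\<^sup>2)"
    if mn: "1 \<le> m" "m \<le> n" for m n
  proof
    have pm: "\<theta> m > 0" "\<theta> n > 0" using potter_pos[OF assms] mn by auto
    have q: "real n / real m > 0" using mn by auto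
    have s: "sqrt (real n) = (real n / real m) powr (1/2) * sqrt (real m)"
      using mn by (simp add: powr_half_sqrt real_sqrt_divide)
    have sq: "((real n / real m) powr a)\<^sup>2 = (real n / real m) powr (2 * a)" for a
      using q by (simp add: power2_eq_square flip: powr_add)
    have "(\<theta> n)\<^sup>2 \<le> (C * (real n / real m) powr (\<eta>/2 - \<gamma>) * \<theta> m)\<^sup>2"
      using b1[OF mn] pm by (intro power_mono) auto
    then have "sqrt (real n) * (\<theta> n)\<^sup>2 \<le> (real n / real m) powr (1/2) * sqrt (real m) * (C * (real n / real m) powr (\<eta>/2 - \<gamma>) * \<theta> m)\<^sup>2"
      unfolding s by (intro mult_left_mono) auto
    also have "\<dots> = C\<^sup>2 * ((real n / real m) powr (1/2) * (real n / real m) powr (2 * (\<eta>/2 - \<gamma>))) * (sqrt (real m) * (\<theta> m)\<^sup>2)"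
      by (simp add: power_mult_distrib sq mult_ac)
    also have "(real n / real m) powr (1/2) * (real n / real m) powr (2 * (\<eta>/2 - \<gamma>)) = (real n / real m) powr (\<eta> - (2*\<gamma> - 1/2))"
      using q by (subst powr_add[symmetric]) (simp add: algebra_simps)
    finally show "sqrt (real n) * (\<theta> n)\<^sup>2 \<le> C\<^sup>2 * (real n / real m) powr (\<eta> - (2*\<gamma> - 1/2)) * (sqrt (real m) * (\<theta> m)\<^sup>2)" .
    have "(\<theta> m)\<^sup>2 \<le> (C * (real n / real m) powr (\<eta>/2 + \<gamma>) * \<theta> n)\<^sup>2"
      using b2[OF mn] pm by (intro power_mono) auto
    then have "sqrt (real m) * (\<theta> m)\<^sup>2 \<le> sqrt (real m) * (C * (real n / real m) powr (\<eta>/2 + \<gamma>) * \<theta> n)\<^sup>2"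
      by (intro mult_left_mono) auto
    also have "\<dots> = (real n / real m) powr (-1/2) * sqrt (real n) * (C * (real n / real m) powr (\<eta>/2 + \<gamma>) * \<theta> n)\<^sup>2"
      using mn powr_minus[of "real n / real m" "1/2"] by (simp add: powr_half_sqrt real_sqrt_divide)
    also have "\<dots> = C\<^sup>2 * ((real n / real m) powr (-1/2) * (real n / real m) powr (2 * (\<eta>/2 + \<gamma>))) * (sqrt (real n) * (\<theta> n)\<^sup>2)"
      by (simp add: power_mult_distrib sq mult_ac)
    also have "(real n / real m) powr (-1/2) * (real n / real m) powr (2 * (\<eta>/2 + \<gamma>)) = (real n / real m) powr (\<eta> + (2*\<gamma> - 1/2))"
      using q by (subst powr_add[symmetric]) (simp add: algebra_simps)
    finally show "sqrt (real m) * (\<theta> m)\<^sup>2 \<le> C\<^sup>2 * (real n / real m) powr (\<eta> + (2*\<gamma> - 1/2)) * (sqrt (real n) * (\<theta> n)\<^sup>2)" .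
  qed
  then show "\<exists>C>0. \<forall>m n. 1 \<le> m \<longrightarrow> m \<le> n \<longrightarrow>
      sqrt (real n) * (\<theta> n)\<^sup>2 \<le> C * (real n / real m) powr (\<eta> - (2*\<gamma> - 1/2)) * (sqrt (real m) * (\<theta> m)\<^sup>2)
     \<and> sqrt (real m) * (\<theta> m)\<^sup>2 \<le> C * (real n / real m) powr (\<eta> + (2*\<gamma> - 1/2)) * (sqrt (real n) * (\<theta> n)\<^sup>2)"
    using C by (intro exI[of _ "C\<^sup>2"]) auto
qed

section \<open>Partial sums of regularly varying sequences\<close>

lemma sum_powr_le:
  assumes "0 \<le> s" "s < 1"
  shows "(\<Sum>j=1..n. real j powr (-s)) \<le> real n powr (1-s) / (1-s)"
proof (induction n)
  case (Suc n)
  have "(1-s) * real (Suc n) powr (-s) \<le> real (Suc n) powr (1-s) - real n powr (1-s)"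
  proof (cases "n = 0")
    case False
    have "\<exists>z. real n < z \<and> z < real (Suc n) \<and> real (Suc n) powr (1-s) - real n powr (1-s) = (real (Suc n) - real n) * ((1-s) * z powr (-s))"
    proof (rule MVT2)
      fix x assume "real n \<le> x" "x \<le> real (Suc n)"
      then have "x > 0" using False by linarith
      then show "DERIV (\<lambda>x. x powr (1-s)) x :> (1-s) * x powr (-s)"
        by (auto intro!: derivative_eq_intros)
    qed simp
    then obtain z where z: "real n < z" "z < real (Suc n)" "real (Suc n) powr (1-s) - real n powr (1-s) = (1-s) * z powr (-s)"
      by auto
    have "real (Suc n) powr (-s) \<le> z powr (-s)" using z assms by (intro powr_mono2') auto
    then show ?thesis using z(3) assms by (simp add: mult_left_mono)
  qed (use assms in simp)
  then have "real (Suc n) powr (-s) \<le> (real (Suc n) powr (1-s) - real n powr (1-s)) / (1-s)"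
    using assms by (simp add: pos_le_divide_eq mult.commute)
  then show ?case using Suc by (simp add: diff_divide_distrib)
qed simp

lemma sum_powr_tail_le:
  assumes "p > 1" "n \<ge> 1"
  shows "(\<Sum>j=n..N. real j powr (-p)) \<le> (1 + 1/(p-1)) * real n powr (1-p)"
proof -
  have step: "real (Suc j) powr (-p) \<le> (real j powr (1-p) - real (Suc j) powr (1-p)) / (p-1)" if "j \<ge> 1" for j
  proof -
    have "\<exists>z. real j < z \<and> z < real (Suc j) \<and> real (Suc j) powr (1-p) - real j powr (1-p) = (real (Suc j) - real j) * ((1-p) * z powr (-p))"
    proof (rule MVT2)
      fix x assume "real j \<le> x" "x \<le> real (Suc j)"
      then have "x > 0" using that by linarith
      then show "DERIV (\<lambda>x. x powr (1-p)) x :> (1-p) * x powr (-p)"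
        by (auto intro!: derivative_eq_intros)
    qed simp
    then obtain z where z: "real j < z" "z < real (Suc j)" "real (Suc j) powr (1-p) - real j powr (1-p) = (1-p) * z powr (-p)"
      by auto
    have "real (Suc j) powr (-p) \<le> z powr (-p)" using z assms that by (intro powr_mono2') auto
    moreover have "real j powr (1-p) - real (Suc j) powr (1-p) = (p-1) * z powr (-p)" using z(3) by (simp add: algebra_simps)
    ultimately show ?thesis using assms by simp
  qed
  have "(\<Sum>j=n..n+k. real j powr (-p)) \<le> real n powr (-p) + (real n powr (1-p) - real (n+k) powr (1-p)) / (p-1)" for k
  proof (induction k)
    case (Suc k)
    have "(\<Sum>j=n..n + Suc k. real j powr (-p)) = (\<Sum>j=n..n + k. real j powr (-p)) + real (Suc (n+k)) powr (-p)"
      by simp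
    also have "\<dots> \<le> real n powr (-p) + (real n powr (1-p) - real (n+k) powr (1-p)) / (p-1)
        + (real (n+k) powr (1-p) - real (Suc (n+k)) powr (1-p)) / (p-1)"
      using Suc step[of "n+k"] assms by linarith
    finally show ?case by (simp add: diff_divide_distrib)
  qed simp
  note a = this
  show ?thesis
  proof (cases "N \<ge> n")
    case True
    then obtain k where "N = n + k" using le_Suc_ex by blast
    have "real n powr (-p) \<le> real n powr (1-p)" using assms by (intro powr_mono) auto
    moreover have "(real n powr (1-p) - real (n+k) powr (1-p)) / (p-1) \<le> real n powr (1-p) / (p-1)"
      using assms by (intro divide_right_mono) auto
    ultimately show ?thesis using a[of k] \<open>N = n+k\<close> by (simp add: algebra_simps)
  qed (use assms in \<open>auto intro!: add_nonneg_nonneg\<close>)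
qed

text \<open>If lag-\<open>j\<close> projections have L2 norm at most \<open>\<theta> j\<close>, then
  a block of \<open>n\<close> terms has L2 norm at most of order
  \<open>sqrt n * psum \<theta> n\<close>; for the smooth part this is \<open>Psi\<close> up to
  constants.\<close>

definition psum :: "(nat \<Rightarrow> real) \<Rightarrow> nat \<Rightarrow> real" where
  "psum \<theta> n = (\<Sum>j=1..n. \<theta> j)"

context
  fixes \<gamma> :: real and \<theta> :: "nat \<Rightarrow> real"
  assumes P: "potter \<gamma> \<theta>" and \<gamma>: "\<gamma> > 0"
begin

lemma psum_mono_potter: "m \<le> n \<Longrightarrow> psum \<theta> m \<le> psum \<theta> n"
  unfolding psum_def using potter_pos[OF P] by (intro sum_mono2) (auto intro: less_imp_le)

lemma psum_pos_potter: "n \<ge> 1 \<Longrightarrow> psum \<theta> n > 0"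
  unfolding psum_def using potter_pos[OF P] by (intro sum_pos) auto

lemma psum_nonneg_potter: "psum \<theta> n \<ge> 0"
  unfolding psum_def using potter_pos[OF P] by (intro sum_nonneg) (auto intro: less_imp_le)

text \<open>Potter's bound with \<open>\<eta> = \<gamma>\<close>, for which the exponent
  vanishes.\<close>

lemma potter_decreasing: "\<exists>C>0. \<forall>m n. 1 \<le> m \<longrightarrow> m \<le> n \<longrightarrow> \<theta> n \<le> C * \<theta> m"
proof -
  obtain C where C: "C > 0"
    "\<And>m n. 1 \<le> m \<Longrightarrow> m \<le> n \<Longrightarrow> \<theta> n \<le> C * (real n / real m) powr (\<gamma> - \<gamma>) * \<theta> m"
    by (rule potterE[OF P \<gamma>]) blast
  then show ?thesis by (intro exI[of _ C]) fastforce
qed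

text \<open>Absorbs the shift between \<open>a j\<close> and \<open>\<theta> (Suc j)\<close>, which
  is there because the coefficients start at index 0 and Potter's bounds at 1.\<close>

lemma potter_Suc: "\<exists>C>0. \<forall>n\<ge>1. \<theta> n \<le> C * \<theta> (Suc n)"
proof -
  obtain C where C: "C > 0"
    "\<And>m n. 1 \<le> m \<Longrightarrow> m \<le> n \<Longrightarrow> \<theta> m \<le> C * (real n / real m) powr (1 + \<gamma>) * \<theta> n"
    by (rule potterE[OF P zero_less_one]) blast
  have "\<theta> n \<le> C * 2 powr (1+\<gamma>) * \<theta> (Suc n)" if "n \<ge> 1" for n
  proof -
    have "\<theta> n \<le> C * (real (Suc n) / real n) powr (1 + \<gamma>) * \<theta> (Suc n)" using C(2)[of n "Suc n"] that by simp
    also have "\<dots> \<le> C * 2 powr (1+\<gamma>) * \<theta> (Suc n)"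
      using that C \<gamma> potter_pos[OF P, of "Suc n"]
      by (intro mult_right_mono mult_left_mono powr_mono2) (auto simp: divide_simps)
    finally show ?thesis .
  qed
  then show ?thesis using C by (intro exI[of _ "C * 2 powr (1+\<gamma>)"]) auto
qed

lemma potter_term_le_psum: "\<exists>C>0. \<forall>n\<ge>1. real n * \<theta> n \<le> C * psum \<theta> n"
proof -
  obtain C where C: "C > 0" "\<forall>m n. 1 \<le> m \<longrightarrow> m \<le> n \<longrightarrow> \<theta> n \<le> C * \<theta> m"
    using potter_decreasing by blast
  have "real n * \<theta> n \<le> C * psum \<theta> n" if "n \<ge> 1" for n
  proof -
    have "(\<Sum>j=1..n. \<theta> n) \<le> (\<Sum>j=1..n. C * \<theta> j)" using C(2) by (intro sum_mono) auto
    then show ?thesis by (simp add: psum_def sum_distrib_left)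
  qed
  then show ?thesis using C(1) by blast
qed

lemma psum_double: "\<exists>C>0. \<forall>n\<ge>1. psum \<theta> (2*n) \<le> C * psum \<theta> n"
proof -
  obtain C where C: "C > 0" "\<forall>m n. 1 \<le> m \<longrightarrow> m \<le> n \<longrightarrow> \<theta> n \<le> C * \<theta> m"
    using potter_decreasing by blast
  obtain C2 where C2: "C2 > 0" "\<forall>n\<ge>1. real n * \<theta> n \<le> C2 * psum \<theta> n"
    using potter_term_le_psum by blast
  have "psum \<theta> (2*n) \<le> (1 + C*C2) * psum \<theta> n" if "n \<ge> 1" for n
  proof -
    have "psum \<theta> (2*n) = psum \<theta> n + (\<Sum>j=n+1..n+n. \<theta> j)"
      unfolding psum_def mult_2 by (rule sum.ub_add_nat) simp
    also have "(\<Sum>j=n+1..n+n. \<theta> j) \<le> (\<Sum>j=n+1..n+n. C * \<theta> n)"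
      using C(2) that by (intro sum_mono) auto
    also have "\<dots> = C * (real n * \<theta> n)" by simp
    also have "\<dots> \<le> C * (C2 * psum \<theta> n)" using C2 C(1) that by (intro mult_left_mono) auto
    finally show ?thesis by (simp add: algebra_simps)
  qed
  then show ?thesis using C(1) C2(1) by (intro exI[of _ "1 + C*C2"]) (auto intro: add_pos_pos)
qed

lemma potter_sum_squares:
  assumes g2: "\<gamma> > 1/2"
  shows "\<exists>C>0. \<forall>n\<ge>1. \<forall>N. (\<Sum>l=n..N. (\<theta> l)\<^sup>2) \<le> C * real n * (\<theta> n)\<^sup>2"
proof -
  \<comment> \<open>Half of the gap above 1/2, so that \<open>p = \<gamma> + 1/2\<close> is still
    above 1 and the squares can be summed.\<close>
  define \<eta> where "\<eta> = (\<gamma> - 1/2)/2"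
  have \<eta>: "\<eta> > 0" using g2 by (simp add: \<eta>_def)
  define p where "p = 2 * (\<gamma> - \<eta>)"
  have p: "p > 1" using g2 by (simp add: \<eta>_def p_def field_simps)
  obtain C where C: "C > 0"
    "\<And>m n. 1 \<le> m \<Longrightarrow> m \<le> n \<Longrightarrow> \<theta> n \<le> C * (real n / real m) powr (\<eta> - \<gamma>) * \<theta> m"
    by (rule potterE[OF P \<eta>]) blast
  have "(\<Sum>l=n..N. (\<theta> l)\<^sup>2) \<le> C\<^sup>2 * (1 + 1/(p-1)) * real n * (\<theta> n)\<^sup>2" if n: "n \<ge> 1" for n N
  proof -
    have "(\<theta> l)\<^sup>2 \<le> C\<^sup>2 * (\<theta> n)\<^sup>2 * real n powr p * real l powr (-p)" if l: "l \<ge> n" for l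
    proof -
      have "(\<theta> l)\<^sup>2 \<le> (C * (real l / real n) powr (\<eta> - \<gamma>) * \<theta> n)\<^sup>2"
        using C(2)[of n l] l n potter_pos[OF P, of l] by (intro power_mono) auto
      also have "\<dots> = C\<^sup>2 * (\<theta> n)\<^sup>2 * ((real l / real n) powr (\<eta> - \<gamma>))\<^sup>2"
        by (simp add: power_mult_distrib mult_ac)
      also have "((real l / real n) powr (\<eta> - \<gamma>))\<^sup>2 = (real l / real n) powr (-p)"
        using n l by (simp add: power2_eq_square p_def algebra_simps flip: powr_add)
      also have "\<dots> = real n powr p * real l powr (-p)"
        using n l by (simp add: powr_divide powr_minus field_simps)
      finally show ?thesis by (simp add: mult_ac)
    qed
    then have "(\<Sum>l=n..N. (\<theta> l)\<^sup>2) \<le> (\<Sum>l=n..N. C\<^sup>2 * (\<theta> n)\<^sup>2 * real n powr p * real l powr (-p))"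
      by (intro sum_mono) auto
    also have "\<dots> = C\<^sup>2 * (\<theta> n)\<^sup>2 * real n powr p * (\<Sum>l=n..N. real l powr (-p))"
      by (simp add: sum_distrib_left)
    also have "\<dots> \<le> C\<^sup>2 * (\<theta> n)\<^sup>2 * real n powr p * ((1 + 1/(p-1)) * real n powr (1-p))"
      using sum_powr_tail_le[OF p n] by (intro mult_left_mono) auto
    also have "\<dots> = C\<^sup>2 * (1 + 1/(p-1)) * (real n powr p * real n powr (1-p)) * (\<theta> n)\<^sup>2"
      by (simp add: mult_ac)
    also have "real n powr p * real n powr (1-p) = real n" using n by (simp flip: powr_add)
    finally show ?thesis .
  qed
  moreover have "C\<^sup>2 * (1 + 1/(p-1)) > 0" using C p by (simp add: add_pos_pos)
  ultimately show ?thesis by blast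
qed

lemma potter_lower: "s > \<gamma> \<Longrightarrow> \<exists>C>0. \<forall>n\<ge>1. real n powr (-s) \<le> C * \<theta> n"
proof -
  assume s: "s > \<gamma>"
  then have "s - \<gamma> > 0" by simp
  then obtain C where C: "C > 0"
    "\<And>m n. 1 \<le> m \<Longrightarrow> m \<le> n \<Longrightarrow> \<theta> m \<le> C * (real n / real m) powr (s - \<gamma> + \<gamma>) * \<theta> n"
    by (rule potterE[OF P]) blast
  have t1: "\<theta> 1 > 0" using potter_pos[OF P] by simp
  have "real n powr (-s) \<le> C / \<theta> 1 * \<theta> n" if "n \<ge> 1" for n
    using C(2)[of 1 n] that t1 by (simp add: powr_minus field_simps)
  then show ?thesis using C(1) t1 by (intro exI[of _ "C / \<theta> 1"]) auto
qed

lemma potter_upper: "s < \<gamma> \<Longrightarrow> \<exists>C>0. \<forall>n\<ge>1. \<theta> n \<le> C * real n powr (-s)"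
proof -
  assume s: "s < \<gamma>"
  then have "\<gamma> - s > 0" by simp
  then obtain C where C: "C > 0"
    "\<And>m n. 1 \<le> m \<Longrightarrow> m \<le> n \<Longrightarrow> \<theta> n \<le> C * (real n / real m) powr (\<gamma> - s - \<gamma>) * \<theta> m"
    by (rule potterE[OF P]) blast
  have t1: "\<theta> 1 > 0" using potter_pos[OF P] by simp
  have "\<theta> n \<le> C * \<theta> 1 * real n powr (-s)" if "n \<ge> 1" for n
    using C(2)[of 1 n] that by (simp add: mult_ac)
  then show ?thesis using C(1) t1 by (intro exI[of _ "C * \<theta> 1"]) auto
qed

lemma psum_lower: "s > \<gamma> \<Longrightarrow> \<exists>C>0. \<forall>n\<ge>1. real n powr (1-s) \<le> C * psum \<theta> n"
proof -
  assume s: "s > \<gamma>"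
  obtain C1 where C1: "C1 > 0" "\<forall>n\<ge>1. real n powr (-s) \<le> C1 * \<theta> n" using potter_lower[OF s] by blast
  obtain C2 where C2: "C2 > 0" "\<forall>n\<ge>1. real n * \<theta> n \<le> C2 * psum \<theta> n" using potter_term_le_psum by blast
  have "real n powr (1-s) \<le> C1 * C2 * psum \<theta> n" if n: "n \<ge> 1" for n
  proof -
    have "real n powr (1-s) = real n * real n powr (-s)" using n by (simp add: powr_diff powr_minus divide_simps)
    also have "\<dots> \<le> real n * (C1 * \<theta> n)" using C1 n by (intro mult_left_mono) auto
    also have "\<dots> = C1 * (real n * \<theta> n)" by simp
    also have "\<dots> \<le> C1 * (C2 * psum \<theta> n)" using C1 C2 n by (intro mult_left_mono) auto
    finally show ?thesis by simp
  qed
  then show ?thesis using C1 C2 by (intro exI[of _ "C1 * C2"]) auto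
qed

lemma psum_upper: "s < \<gamma> \<Longrightarrow> 0 \<le> s \<Longrightarrow> s < 1 \<Longrightarrow> \<exists>C>0. \<forall>n\<ge>1. psum \<theta> n \<le> C * real n powr (1-s)"
proof -
  assume s: "s < \<gamma>" "0 \<le> s" "s < 1"
  obtain C1 where C1: "C1 > 0" "\<forall>n\<ge>1. \<theta> n \<le> C1 * real n powr (-s)" using potter_upper[OF s(1)] by blast
  have "psum \<theta> n \<le> C1 / (1-s) * real n powr (1-s)" for n
  proof -
    have "psum \<theta> n \<le> (\<Sum>j=1..n. C1 * real j powr (-s))" unfolding psum_def using C1 by (intro sum_mono) auto
    also have "\<dots> = C1 * (\<Sum>j=1..n. real j powr (-s))" by (simp add: sum_distrib_left)
    also have "\<dots> \<le> C1 * (real n powr (1-s) / (1-s))" using C1 sum_powr_le[OF s(2,3)] by (intro mult_left_mono) auto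
    finally show ?thesis by simp
  qed
  then show ?thesis using C1 s by (intro exI[of _ "C1 / (1-s)"]) auto
qed

text \<open>Below index 1, Potter's bound gives
  \<open>psum \<theta> m <= C * (m/n) powr \<kappa> * psum \<theta> n\<close> with
  \<open>\<kappa> > 0\<close>. Along powers of two the partial sums therefore grow at least
  geometrically and the last one dominates, which saves a logarithm over the general maximal
  inequality.\<close>

lemma psum_dyadic_sum:
  assumes g1: "\<gamma> < 1"
  shows "\<exists>C>0. \<forall>d. (\<Sum>r\<le>d. psum \<theta> (2^r)) \<le> C * psum \<theta> (2^d)"
proof -
  define \<eta> where "\<eta> = (1-\<gamma>)/2"
  have \<eta>: "\<eta> > 0" "\<eta> + \<gamma> < 1" using g1 by (auto simp: \<eta>_def field_simps)
  define s where "s = \<eta> + \<gamma>"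
  define \<kappa> where "\<kappa> = 1 - s"
  have s: "0 \<le> s" "s < 1" using \<eta> \<gamma> by (auto simp: s_def)
  have \<kappa>: "\<kappa> > 0" using s by (simp add: \<kappa>_def)
  obtain C where C: "C > 0"
    "\<And>m n. 1 \<le> m \<Longrightarrow> m \<le> n \<Longrightarrow> \<theta> m \<le> C * (real n / real m) powr (\<eta> + \<gamma>) * \<theta> n"
    by (rule potterE[OF P \<eta>(1)]) blast
  obtain C2 where C2: "C2 > 0" "\<forall>n\<ge>1. real n * \<theta> n \<le> C2 * psum \<theta> n" using potter_term_le_psum by blast
  have bd: "psum \<theta> m \<le> C / (1-s) * C2 * (real m / real n) powr \<kappa> * psum \<theta> n" if mn: "1 \<le> m" "m \<le> n" for m n
  proof -
    have "psum \<theta> m \<le> (\<Sum>j=1..m. C * \<theta> n * real n powr s * real j powr (-s))"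
      unfolding psum_def
    proof (intro sum_mono)
      fix j assume j: "j \<in> {1..m}"
      have "\<theta> j \<le> C * (real n / real j) powr s * \<theta> n" using C(2)[of j n] j mn by (auto simp: s_def)
      also have "\<dots> = C * \<theta> n * real n powr s * real j powr (-s)"
        using j mn by (simp add: powr_divide powr_minus field_simps)
      finally show "\<theta> j \<le> C * \<theta> n * real n powr s * real j powr (-s)" .
    qed
    also have "\<dots> = C * \<theta> n * real n powr s * (\<Sum>j=1..m. real j powr (-s))" by (simp add: sum_distrib_left)
    also have "\<dots> \<le> C * \<theta> n * real n powr s * (real m powr \<kappa> / \<kappa>)"
      using C(1) mn potter_pos[OF P, of n] sum_powr_le[OF s, of m] by (intro mult_left_mono) (auto simp: \<kappa>_def)
    also have "\<dots> = C / \<kappa> * (real n * \<theta> n) * (real m powr \<kappa> * (real n powr s / real n))"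
      using mn by (simp add: field_simps)
    also have "real n powr s / real n = real n powr (-\<kappa>)" using mn powr_diff[of "real n" s 1] by (simp add: \<kappa>_def)
    also have "C / \<kappa> * (real n * \<theta> n) * (real m powr \<kappa> * real n powr - \<kappa>) \<le> C / \<kappa> * (C2 * psum \<theta> n) * (real m powr \<kappa> * real n powr - \<kappa>)"
      using C2 C(1) \<kappa> mn by (intro mult_right_mono mult_left_mono) auto
    also have "\<dots> = C / (1-s) * C2 * (real m / real n) powr \<kappa> * psum \<theta> n"
      using mn powr_divide[of "real m" "real n" \<kappa>] powr_minus[of "real n" \<kappa>] by (simp add: \<kappa>_def divide_inverse)
    finally show ?thesis .
  qed
  define q where "q = 2 powr (-\<kappa>)"
  have q: "0 < q" "q < 1" using \<kappa> by (auto simp: q_def powr_less_one)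
  define A where "A = C / (1-s) * C2"
  have A: "A > 0" using C(1) C2 s by (simp add: A_def)
  have "(\<Sum>r\<le>d. psum \<theta> (2^r)) \<le> A / (1-q) * psum \<theta> (2^d)" for d
  proof -
    have "(\<Sum>r\<le>d. psum \<theta> (2^r)) \<le> (\<Sum>r\<le>d. A * psum \<theta> (2^d) * q ^ (d - r))"
    proof (intro sum_mono)
      fix r assume r: "r \<in> {..d}"
      have "psum \<theta> (2^r) \<le> A * (real (2^r) / real (2^d)) powr \<kappa> * psum \<theta> (2^d)"
        using bd[of "2^r" "2^d"] r by (auto simp: A_def)
      also have "real (2^r) / real (2^d) = 2 powr (- real (d - r))"
        using r by (simp add: of_nat_diff powr_diff powr_realpow)
      also have "(2 powr (- real (d - r))) powr \<kappa> = q ^ (d - r)"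
        by (simp add: q_def powr_powr mult.commute flip: powr_realpow)
      finally show "psum \<theta> (2^r) \<le> A * psum \<theta> (2^d) * q ^ (d - r)" by (simp add: mult_ac)
    qed
    also have "\<dots> = A * psum \<theta> (2^d) * (\<Sum>r\<le>d. q ^ (d-r))" by (simp add: sum_distrib_left)
    also have "(\<Sum>r\<le>d. q ^ (d-r)) = (\<Sum>r\<le>d. q ^ r)"
      by (rule sum.reindex_bij_witness[of _ "\<lambda>r. d - r" "\<lambda>r. d - r"]) auto
    also have "\<dots> \<le> 1 / (1-q)"
      using q by (subst sum_gp0) (auto intro!: divide_right_mono)
    finally show ?thesis using A psum_nonneg_potter[of "2^d"] by (simp add: mult_left_mono mult_right_mono mult_ac)
  qed
  then show ?thesis using A q by (intro exI[of _ "A / (1-q)"]) auto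
qed

end

section \<open>Dyadic maximal inequality\<close>

text \<open>Binary expansion: an initial segment of an aligned block of length \<open>2^d\<close> is
  the disjoint union of at most one aligned block per lower level.\<close>

lemma dyadic_partial_sum:
  fixes x b :: "nat \<Rightarrow> real"
  assumes b: "\<And>r m. r \<le> D \<Longrightarrow> m < 2^(D-r) \<Longrightarrow> \<bar>\<Sum>i=m*2^r..<(m+1)*2^r. x i\<bar> \<le> b r"
  shows "d \<le> D \<Longrightarrow> k < 2^(D-d) \<Longrightarrow> n < 2^d \<Longrightarrow> \<bar>\<Sum>i=k*2^d..<k*2^d+n. x i\<bar> \<le> (\<Sum>r<d. b r)"
proof (induction d arbitrary: k n)
  case (Suc d)
  have e: "2^(D-d) = 2 * 2^(D - Suc d)" using Suc.prems(1) by (simp flip: power_Suc add: Suc_diff_Suc)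
  have k: "2*k < 2^(D-d)" "2*k+1 < 2^(D-d)" using Suc.prems(2) unfolding e by linarith+
  have nn: "0 \<le> b d" using b[of d 0] Suc.prems by (smt (verit) abs_ge_zero zero_less_power zero_less_numeral Suc_leD)
  show ?case
  proof (cases "n < 2^d")
    case True
    then show ?thesis using Suc.IH[of "2*k" n] k Suc.prems nn by (simp add: mult_ac)
  next
    case False
    \<comment> \<open>The top bit of \<open>n\<close> is set: the left half \<open>2*k\<close> is
      used whole, and the rest is an initial segment of the right half \<open>2*k+1\<close>.\<close>
    define n' where "n' = n - 2^d"
    have n: "n = 2^d + n'" "n' < 2^d" using False Suc.prems by (auto simp: n'_def)
    have "(\<Sum>i=k*2^Suc d..<k*2^Suc d+n. x i) = (\<Sum>i=(2*k)*2^d..<(2*k+1)*2^d. x i) + (\<Sum>i=(2*k+1)*2^d..<(2*k+1)*2^d+n'. x i)"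
      using n by (subst sum.atLeastLessThan_concat) (auto simp: algebra_simps)
    also have "\<bar>\<dots>\<bar> \<le> b d + (\<Sum>r<d. b r)"
      using b[of d "2*k"] Suc.IH[of "2*k+1" n'] k Suc.prems n by linarith
    finally show ?thesis by simp
  qed
qed simp

lemma weighted_Cauchy_Schwarz:
  fixes b w :: "'i \<Rightarrow> real"
  assumes "\<And>r. r \<in> I \<Longrightarrow> w r > 0"
  shows "(\<Sum>r\<in>I. b r)\<^sup>2 \<le> (\<Sum>r\<in>I. w r) * (\<Sum>r\<in>I. (b r)\<^sup>2 / w r)"
proof -
  have "(\<Sum>r\<in>I. sqrt (w r) * (b r / sqrt (w r)))\<^sup>2 \<le> (\<Sum>r\<in>I. (sqrt (w r))\<^sup>2) * (\<Sum>r\<in>I. (b r / sqrt (w r))\<^sup>2)"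
    by (rule Cauchy_Schwarz_ineq_sum)
  moreover have "(\<Sum>r\<in>I. sqrt (w r) * (b r / sqrt (w r))) = (\<Sum>r\<in>I. b r)"
    using assms by (intro sum.cong refl) (simp add: less_imp_neq[symmetric])
  moreover have "(\<Sum>r\<in>I. (sqrt (w r))\<^sup>2) = (\<Sum>r\<in>I. w r)"
    using assms by (intro sum.cong refl real_sqrt_pow2 order_less_imp_le)
  moreover have "(\<Sum>r\<in>I. (b r / sqrt (w r))\<^sup>2) = (\<Sum>r\<in>I. (b r)\<^sup>2 / w r)"
    using assms by (intro sum.cong refl) (simp add: power_divide order_less_imp_le)
  ultimately show ?thesis by simp
qed

text \<open>A majorant of the squared partial sums for all \<open>n <= 2^d\<close> at once, obtained
  by Cauchy-Schwarz over the levels of the binary expansion. Not depending on \<open>n\<close>, it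
  can be integrated. The weights are free; the later choice \<open>w r = psum \<theta> (2^r)\<close>
  balances the levels.\<close>

definition dyadic_form :: "(nat \<Rightarrow> real) \<Rightarrow> (nat \<Rightarrow> real) \<Rightarrow> nat \<Rightarrow> real" where
  "dyadic_form w x d = (\<Sum>r\<le>d. w r) * (\<Sum>r\<le>d. (\<Sum>m<2^(d-r). (\<Sum>i=m*2^r..<(m+1)*2^r. x i)\<^sup>2) / w r)"

lemma dyadic_form_nonneg:
  assumes "\<And>r. w r > 0"
  shows "0 \<le> dyadic_form w x d"
proof -
  have wn: "0 \<le> w r" for r using assms[of r] by simp
  show ?thesis unfolding dyadic_form_def by (simp add: wn sum_nonneg)
qed

lemma dyadic_maximal:
  assumes w: "\<And>r. w r > 0" and n: "n \<le> 2^d"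
  shows "(\<Sum>i<n. x i)\<^sup>2 \<le> dyadic_form w x d"
proof -
  define b where "b = (\<lambda>r. sqrt (\<Sum>m<2^(d-r). (\<Sum>i=m*2^r..<(m+1)*2^r. x i)\<^sup>2))"
  have b0: "b r \<ge> 0" for r unfolding b_def by (simp add: sum_nonneg)
  have b: "\<bar>\<Sum>i=m*2^r..<(m+1)*2^r. x i\<bar> \<le> b r" if "r \<le> d" "m < 2^(d-r)" for r m
  proof -
    have "(\<Sum>i=m*2^r..<(m+1)*2^r. x i)\<^sup>2 \<le> (\<Sum>m<2^(d-r). (\<Sum>i=m*2^r..<(m+1)*2^r. x i)\<^sup>2)"
      using that by (intro member_le_sum[of m _ "\<lambda>m. (\<Sum>i=m*2^r..<(m+1)*2^r. x i)\<^sup>2"]) auto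
    then show ?thesis unfolding b_def by (simp add: real_le_rsqrt)
  qed
  have "\<bar>\<Sum>i<n. x i\<bar> \<le> (\<Sum>r\<le>d. b r)"
  \<comment> \<open>The binary splitting covers only \<open>n < 2^d\<close>; the full length is the
    single block of level \<open>d\<close>.\<close>
  proof (cases "n = 2^d")
    case True
    have "\<bar>\<Sum>i<n. x i\<bar> \<le> b d" using b[of d 0] True by (simp add: atLeast0LessThan)
    also have "\<dots> \<le> (\<Sum>r\<le>d. b r)" using b0 by (intro member_le_sum) auto
    finally show ?thesis .
  next
    case False
    have "\<bar>\<Sum>i<n. x i\<bar> \<le> (\<Sum>r<d. b r)"
      using dyadic_partial_sum[of d x b d 0 n] b False n by (simp add: atLeast0LessThan)
    also have "\<dots> \<le> (\<Sum>r\<le>d. b r)" using b0 by (intro sum_mono2) auto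
    finally show ?thesis .
  qed
  then have "(\<Sum>i<n. x i)\<^sup>2 \<le> (\<Sum>r\<le>d. b r)\<^sup>2" by (metis abs_ge_zero power2_abs power_mono)
  also have "\<dots> \<le> (\<Sum>r\<le>d. w r) * (\<Sum>r\<le>d. (b r)\<^sup>2 / w r)"
    using w by (intro weighted_Cauchy_Schwarz) auto
  also have "\<dots> = dyadic_form w x d"
    unfolding dyadic_form_def b_def by (simp add: sum_nonneg)
  finally show ?thesis .
qed

text \<open>Level \<open>r\<close> has \<open>2^(d-r)\<close> blocks of second moment at most
  \<open>c * 2^r * (w r)^2\<close>; divided by \<open>w r\<close> they add up to
  \<open>c * 2^d * w r\<close>. The levels then sum to a multiple of the total weight, and the
  prefactor squares it.\<close>

lemma nn_integral_dyadic_form: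
  fixes Z :: "nat \<Rightarrow> 'a \<Rightarrow> real"
  assumes [measurable]: "\<And>i. Z i \<in> borel_measurable M" and w: "\<And>r. w r > 0" and c: "c \<ge> 0"
    and bd: "\<And>u n. n \<ge> 1 \<Longrightarrow> (\<integral>\<^sup>+\<omega>. ennreal ((\<Sum>i=u..<u+n. Z i \<omega>)\<^sup>2) \<partial>M) \<le> ennreal (c * real n * V n)"
    and wV: "\<And>r. V (2^r) = (w r)\<^sup>2"
  shows "(\<integral>\<^sup>+\<omega>. ennreal (dyadic_form w (\<lambda>i. Z i \<omega>) d) \<partial>M) \<le> ennreal (c * 2^d * (\<Sum>r\<le>d. w r)\<^sup>2)"
proof -
  have wn: "\<And>r. w r \<ge> 0" using w less_imp_le by blast
  have "(\<integral>\<^sup>+\<omega>. ennreal (dyadic_form w (\<lambda>i. Z i \<omega>) d) \<partial>M)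
     = (\<integral>\<^sup>+\<omega>. ennreal (\<Sum>r\<le>d. w r) * (\<Sum>r\<le>d. (\<Sum>m<2^(d-r). ennreal ((\<Sum>i=m*2^r..<m*2^r+2^r. Z i \<omega>)\<^sup>2)) * ennreal (1 / w r)) \<partial>M)"
  proof (intro nn_integral_cong)
    fix \<omega>
    let ?X = "\<lambda>r m. (\<Sum>i=m*2^r..<m*2^r+2^r. Z i \<omega>)\<^sup>2"
    have nn: "0 \<le> (\<Sum>m<(2::nat)^(d-r). ?X r m)" for r by (intro sum_nonneg) simp
    have nn2: "0 \<le> (\<Sum>m<(2::nat)^(d-r). ?X r m) * (1 / w r)" for r
      by (rule mult_nonneg_nonneg[OF nn]) (simp add: wn)
    have X: "ennreal (\<Sum>m<(2::nat)^(d-r). ?X r m) = (\<Sum>m<(2::nat)^(d-r). ennreal (?X r m))" for r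
      by (subst sum_ennreal) auto
    have XX: "ennreal ((\<Sum>m<(2::nat)^(d-r). ?X r m) * (1 / w r)) = (\<Sum>m<(2::nat)^(d-r). ennreal (?X r m)) * ennreal (1 / w r)" for r
      unfolding X[symmetric] by (rule ennreal_mult[OF nn]) (simp add: wn)
    have "dyadic_form w (\<lambda>i. Z i \<omega>) d = (\<Sum>r\<le>d. w r) * (\<Sum>r\<le>d. (\<Sum>m<(2::nat)^(d-r). ?X r m) * (1 / w r))"
      by (simp add: dyadic_form_def add.commute)
    then have "ennreal (dyadic_form w (\<lambda>i. Z i \<omega>) d) = ennreal (\<Sum>r\<le>d. w r) * ennreal (\<Sum>r\<le>d. (\<Sum>m<(2::nat)^(d-r). ?X r m) * (1 / w r))"
      by (simp only:) (rule ennreal_mult; intro sum_nonneg nn2 wn)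
    moreover have "ennreal (\<Sum>r\<le>d. (\<Sum>m<(2::nat)^(d-r). ?X r m) * (1 / w r)) = (\<Sum>r\<le>d. (\<Sum>m<(2::nat)^(d-r). ennreal (?X r m)) * ennreal (1 / w r))"
      unfolding XX[symmetric] by (rule sum_ennreal[symmetric]) (rule nn2)
    ultimately show "ennreal (dyadic_form w (\<lambda>i. Z i \<omega>) d) = ennreal (\<Sum>r\<le>d. w r) * (\<Sum>r\<le>d. (\<Sum>m<2^(d-r). ennreal (?X r m)) * ennreal (1 / w r))"
      by (simp only:)
  qed
  also have "\<dots> = ennreal (\<Sum>r\<le>d. w r) * (\<Sum>r\<le>d. (\<Sum>m<2^(d-r). (\<integral>\<^sup>+\<omega>. ennreal ((\<Sum>i=m*2^r..<m*2^r+2^r. Z i \<omega>)\<^sup>2) \<partial>M)) * ennreal (1 / w r))"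
    by (simp del: sum_ennreal add: nn_integral_cmult nn_integral_sum nn_integral_multc)
  also have "\<dots> \<le> ennreal (\<Sum>r\<le>d. w r) * (\<Sum>r\<le>d. (\<Sum>m<(2::nat)^(d-r). ennreal (c * real (2^r) * V (2^r))) * ennreal (1 / w r))"
    by (intro mult_left_mono sum_mono mult_right_mono bd) auto
  also have "\<dots> = ennreal (\<Sum>r\<le>d. w r) * (\<Sum>r\<le>d. ennreal (c * 2^d * w r))"
  proof -
    have "(\<Sum>m<(2::nat)^(d-r). ennreal (c * real (2^r) * V (2^r))) * ennreal (1 / w r) = ennreal (c * 2^d * w r)" if "r \<le> d" for r
    proof -
      have "(\<Sum>m<(2::nat)^(d-r). ennreal (c * real (2^r) * V (2^r))) = ennreal (\<Sum>m<(2::nat)^(d-r). c * real (2^r) * V (2^r))"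
        using c by (subst sum_ennreal) (auto simp: wV)
      also have "(\<Sum>m<(2::nat)^(d-r). c * real (2^r) * V (2^r)) = c * (2^(d-r) * 2^r) * (w r)\<^sup>2" by (simp add: wV)
      also have "(2::real)^(d-r) * 2^r = 2^d" using that by (simp flip: power_add)
      finally show ?thesis using w[of r] c by (simp add: power2_eq_square flip: ennreal_mult)
    qed
    then show ?thesis by simp
  qed
  also have "\<dots> = ennreal (c * 2^d * (\<Sum>r\<le>d. w r)\<^sup>2)"
  proof -
    have "(\<Sum>r\<le>d. ennreal (c * 2^d * w r)) = ennreal (\<Sum>r\<le>d. c * 2^d * w r)"
      using wn c by (intro sum_ennreal) auto
    also have "(\<Sum>r\<le>d. c * 2^d * w r) = c * 2^d * (\<Sum>r\<le>d. w r)" by (simp add: sum_distrib_left)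
    finally show ?thesis
      using wn c by (simp add: sum_nonneg power2_eq_square mult_ac flip: ennreal_mult)
  qed
  finally show ?thesis .
qed

text \<open>The terms are dominated by the increments of \<open>- 1 / ln x\<close>, so the partial
  sums telescope; the shift by 3 keeps all logarithms positive.\<close>

lemma summable_inverse_ln_square: "summable (\<lambda>d. 1 / (real (d+3) * (ln (real (d+3)))\<^sup>2))"
proof (rule summableI_nonneg_bounded)
  fix n show "0 \<le> 1 / (real (n+3) * (ln (real (n+3)))\<^sup>2)" by simp
next
  have step: "1 / (real (d+3) * (ln (real (d+3)))\<^sup>2) \<le> 1 / ln (real (d+2)) - 1 / ln (real (d+3))" for d
  proof -
    have "\<exists>z. real (d+2) < z \<and> z < real (d+3) \<and> (- 1 / ln (real (d+3))) - (- 1 / ln (real (d+2))) = (real (d+3) - real (d+2)) * (1 / (z * (ln z)\<^sup>2))"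
    proof (rule MVT2)
      fix x assume "real (d+2) \<le> x" "x \<le> real (d+3)"
      then have "x > 1" by linarith
      then show "DERIV (\<lambda>x. - 1 / ln x) x :> 1 / (x * (ln x)\<^sup>2)"
        by (auto intro!: derivative_eq_intros simp: power2_eq_square divide_simps)
    qed simp
    then obtain z where z: "real (d+2) < z" "z < real (d+3)"
      "1 / ln (real (d+2)) - 1 / ln (real (d+3)) = 1 / (z * (ln z)\<^sup>2)" by auto
    have z1: "z > 1" using z(1) by simp
    have "z * (ln z)\<^sup>2 \<le> real (d+3) * (ln (real (d+3)))\<^sup>2"
      using z z1 by (intro mult_mono power_mono) auto
    then have "1 / (real (d+3) * (ln (real (d+3)))\<^sup>2) \<le> 1 / (z * (ln z)\<^sup>2)"
      using z1 by (intro divide_left_mono) (auto intro!: mult_pos_pos)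
    then show ?thesis using z(3) by simp
  qed
  have "(\<Sum>d<n. 1 / (real (d+3) * (ln (real (d+3)))\<^sup>2)) \<le> 1 / ln 2 - 1 / ln (real (n+2))" for n
  proof (induction n)
    case (Suc n)
    have e: "real (Suc n + 2) = real (n+3)" by simp
    show ?case unfolding e sum.lessThan_Suc using Suc step[of n] by linarith
  qed simp
  moreover have "1 / ln (real (n+2)) \<ge> 0" for n by simp
  ultimately show "(\<Sum>d<n. 1 / (real (d+3) * (ln (real (d+3)))\<^sup>2)) \<le> 1 / ln 2" for n
    by (smt (verit))
qed

text \<open>The sum of all \<open>Q d\<close> has finite integral, so it is finite almost
  everywhere, and it bounds each of its terms.\<close>

lemma AE_bounded_of_summable_nn_integral:
  assumes [measurable]: "\<And>d. Q d \<in> borel_measurable M"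
    and le: "\<And>d. (\<integral>\<^sup>+\<omega>. Q d \<omega> \<partial>M) \<le> ennreal (c d)" and c: "\<And>d. 0 \<le> c d" "summable c"
  shows "AE \<omega> in M. \<exists>C\<ge>0. \<forall>d. Q d \<omega> \<le> ennreal C"
proof -
  have "(\<integral>\<^sup>+\<omega>. (\<Sum>d. Q d \<omega>) \<partial>M) = (\<Sum>d. \<integral>\<^sup>+\<omega>. Q d \<omega> \<partial>M)" by (intro nn_integral_suminf) auto
  also have "\<dots> \<le> (\<Sum>d. ennreal (c d))" by (intro suminf_le le) auto
  also have "\<dots> = ennreal (\<Sum>d. c d)" using c by (intro suminf_ennreal2) auto
  also have "\<dots> < \<infinity>" by simp
  finally have "(\<integral>\<^sup>+\<omega>. (\<Sum>d. Q d \<omega>) \<partial>M) \<noteq> \<infinity>" by simp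
  then have "AE \<omega> in M. (\<Sum>d. Q d \<omega>) \<noteq> \<infinity>" by (intro nn_integral_noteq_infinite) auto
  then show ?thesis
  proof eventually_elim
    case (elim \<omega>)
    then have "(\<Sum>d. Q d \<omega>) < \<infinity>" by (simp add: less_top)
    then obtain C where C: "C \<ge> 0" "(\<Sum>d. Q d \<omega>) = ennreal C" by (cases "\<Sum>d. Q d \<omega>") auto
    have "Q d \<omega> \<le> (\<Sum>d. Q d \<omega>)" for d
      using sum_le_suminf[of "\<lambda>d. Q d \<omega>" "{d}"] by simp
    then show ?case using C by auto
  qed
qed

text \<open>Division by the expected order times \<open>d * (ln d)^2\<close> makes the integrals
  summable. With \<open>d\<close> of order log n this factor becomes log n (log log n)^2, the origin
  of these logarithms in both b_n and A_n.\<close>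

lemma AE_dyadic_rate:
  assumes Q[measurable]: "\<And>d. Q d \<in> borel_measurable M"
    and G: "\<And>d. G d > 0" and K: "K \<ge> 0"
    and le: "\<And>d. (\<integral>\<^sup>+\<omega>. Q d \<omega> \<partial>M) \<le> ennreal (K * (G d)\<^sup>2)"
  shows "AE \<omega> in M. \<exists>C\<ge>0. \<forall>d\<ge>3. Q d \<omega> \<le> ennreal (C * (G d)\<^sup>2 * (real d * (ln (real d))\<^sup>2))"
proof -
  define s where "s = (\<lambda>d. real (d+3) * (ln (real (d+3)))\<^sup>2)"
  have s: "s d > 0" for d by (simp add: s_def)
  define q where "q = (\<lambda>d. 1 / ((G (d+3))\<^sup>2 * s d))"
  have Gs: "0 < (G (d+3))\<^sup>2 * s d" for d using G[of "d+3"] s[of d] by simp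
  have q: "q d > 0" for d using Gs[of d] by (simp add: q_def)
  have "AE \<omega> in M. \<exists>C\<ge>0. \<forall>d. Q (d+3) \<omega> * ennreal (q d) \<le> ennreal C"
  proof (rule AE_bounded_of_summable_nn_integral)
    show "(\<integral>\<^sup>+\<omega>. Q (d+3) \<omega> * ennreal (q d) \<partial>M) \<le> ennreal (K * (1 / s d))" for d
    proof -
      have "(\<integral>\<^sup>+\<omega>. Q (d+3) \<omega> * ennreal (q d) \<partial>M) = (\<integral>\<^sup>+\<omega>. Q (d+3) \<omega> \<partial>M) * ennreal (q d)"
        by (simp add: nn_integral_multc)
      also have "\<dots> \<le> ennreal (K * (G (d+3))\<^sup>2) * ennreal (q d)" by (intro mult_right_mono le) auto
      also have "\<dots> = ennreal (K * (G (d+3))\<^sup>2 * q d)" using K q[of d] by (subst ennreal_mult) auto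
      also have "K * (G (d+3))\<^sup>2 * q d = K * (1 / s d)" using G[of "d+3"] s[of d] by (simp add: q_def field_simps)
      finally show ?thesis .
    qed
    show "summable (\<lambda>d. K * (1 / s d))" unfolding s_def by (intro summable_mult summable_inverse_ln_square)
  qed (use K s in \<open>auto simp: less_imp_le\<close>)
  then show ?thesis
  proof eventually_elim
    case (elim \<omega>)
    then obtain C where C: "C \<ge> 0" "\<And>d. Q (d+3) \<omega> * ennreal (q d) \<le> ennreal C" by blast
    have "Q d \<omega> \<le> ennreal (C * (G d)\<^sup>2 * (real d * (ln (real d))\<^sup>2))" if d: "d \<ge> 3" for d
    proof -
      define e where "e = d - 3"
      have de: "d = e + 3" using d by (simp add: e_def)
      have "Q d \<omega> = Q (e+3) \<omega> * ennreal (q e) * ennreal ((G (e+3))\<^sup>2 * s e)"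
        using Gs[of e] G[of "e+3"] s[of e] by (simp add: de q_def mult.assoc flip: ennreal_mult)
      also have "\<dots> \<le> ennreal C * ennreal ((G (e+3))\<^sup>2 * s e)" by (intro mult_right_mono C) auto
      also have "\<dots> = ennreal (C * (G d)\<^sup>2 * (real d * (ln (real d))\<^sup>2))"
        using C(1) Gs[of e] by (simp add: de s_def mult.assoc flip: ennreal_mult)
      finally show ?thesis .
    qed
    then show ?case using C(1) by blast
  qed
qed

text \<open>Within dyadic block \<open>d\<close> the partial sums oscillate by at most
  \<open>C * q^d\<close>, so beyond \<open>2^D\<close> they stay within a geometric tail of their
  value at \<open>2^D\<close>.\<close>

lemma summable_of_dyadic_blocks:
  fixes y :: "nat \<Rightarrow> real"
  assumes q: "0 \<le> q" "q < 1" and C: "C \<ge> 0"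
    and bd: "\<And>d n. n \<le> 2^d \<Longrightarrow> \<bar>\<Sum>l<n. y (2^d + l)\<bar> \<le> C * q ^ d"
  shows "summable y"
proof -
  define S where "S = (\<lambda>n. \<Sum>i<n. y i)"
  have blk: "\<bar>S (2^d + n) - S (2^d)\<bar> \<le> C * q ^ d" if "n \<le> 2^d" for d n
  proof -
    have "S (2^d + n) - S (2^d) = (\<Sum>l<n. y (2^d + l))"
      unfolding S_def by (induction n) auto
    then show ?thesis using bd[OF that] by simp
  qed
  have near: "\<bar>S m - S (2^D)\<bar> \<le> C * (\<Sum>r\<in>{D..d}. q ^ r)" if "D \<le> d" "2^d \<le> m" "m \<le> 2^Suc d" for D d m
    using that
  proof (induction "d - D" arbitrary: d m)
    case 0
    then have "d = D" by simp
    then show ?case using blk[of "m - 2^D" D] 0 by simp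
  next
    case (Suc x)
    obtain e where e: "d = Suc e" using Suc by (cases d) auto
    have "\<bar>S (2^d) - S (2^D)\<bar> \<le> C * (\<Sum>r\<in>{D..e}. q ^ r)"
      using Suc.hyps(1)[of e "2^d"] Suc e by auto
    moreover have "\<bar>S m - S (2^d)\<bar> \<le> C * q ^ d" using blk[of "m - 2^d" d] Suc.prems by simp
    moreover have "(\<Sum>r\<in>{D..d}. q ^ r) = (\<Sum>r\<in>{D..e}. q ^ r) + q ^ d"
      using Suc.hyps(2) e by (simp add: sum.cl_ivl_Suc)
    ultimately show ?case by (simp add: algebra_simps)
  qed
  have "Cauchy S"
    unfolding Cauchy_altdef2
  proof (intro allI impI)
    fix e :: real assume "e > 0"
    have "(\<lambda>D. C * (q ^ D / (1-q))) \<longlonglongrightarrow> C * (0 / (1-q))"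
      using q by (intro tendsto_intros LIMSEQ_power_zero) auto
    then have "\<forall>\<^sub>F D in sequentially. C * (q ^ D / (1-q)) < e"
      using \<open>e > 0\<close> by (auto dest: order_tendstoD)
    then obtain D where D: "C * (q ^ D / (1-q)) < e" by (auto simp: eventually_sequentially)
    have "dist (S m) (S (2^D)) < e" if m: "m \<ge> 2^D" for m
    proof -
      have "m > 0" using m by (metis gr0I le_zero_eq power_not_zero zero_neq_numeral)
      then obtain d where d: "2^d \<le> m" "m < 2^Suc d"
        using ex_power_ivl1[of 2 m] by auto
      have "D \<le> d"
      proof (rule ccontr)
        assume "\<not> D \<le> d"
        then have "(2::nat)^Suc d \<le> 2^D" by (intro power_increasing) auto
        then show False using d m by linarith
      qed
      then have "\<bar>S m - S (2^D)\<bar> \<le> C * (\<Sum>r\<in>{D..d}. q ^ r)" using near d by auto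
      also have "(\<Sum>r\<in>{D..d}. q ^ r) \<le> q ^ D / (1-q)"
      proof -
        have "(\<Sum>r\<in>{D..d}. q ^ r) = (q ^ D - q ^ Suc d) / (1-q)"
          using q \<open>D \<le> d\<close> by (simp add: sum_gp)
        also have "\<dots> \<le> q ^ D / (1-q)" using q by (intro divide_right_mono) auto
        finally show ?thesis .
      qed
      finally show ?thesis using D C by (smt (verit) dist_real_def mult_left_mono)
    qed
    then show "\<exists>N. \<forall>n\<ge>N. dist (S n) (S N) < e" by blast
  qed
  then show ?thesis unfolding summable_iff_convergent S_def by (simp add: Cauchy_convergent_iff)
qed

section \<open>Independent innovations\<close>

locale innovations = prob_space M for M :: "'a measure" +
  fixes \<epsilon> :: "int \<Rightarrow> 'a \<Rightarrow> real" and g :: "real \<Rightarrow> real"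
  assumes indep: "indep_vars (\<lambda>_. borel) \<epsilon> UNIV"
    and g_nonneg: "\<And>x. 0 \<le> g x"
    and dist_eps: "\<And>k. distributed M lborel (\<epsilon> k) (\<lambda>x. ennreal (g x))"
    and sq_integrable: "\<And>k. integrable M (\<lambda>\<omega>. (\<epsilon> k \<omega>)\<^sup>2)"
    and mean_zero: "\<And>k. expectation (\<epsilon> k) = 0"
    and fourth_integrable: "\<And>k. integrable M (\<lambda>\<omega>. (\<epsilon> k \<omega>) ^ 4)"
begin

definition \<mu> :: "real measure" where "\<mu> = density lborel (\<lambda>x. ennreal (g x))"

lemma sets_\<mu>[simp, measurable_cong]: "sets \<mu> = sets borel" and space_\<mu>[simp]: "space \<mu> = UNIV"
  by (auto simp: \<mu>_def)

lemma eps_measurable[measurable]: "\<epsilon> k \<in> borel_measurable M"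
  using distributed_measurable[OF dist_eps[of k]] by simp

lemma distr_eps: "distr M borel (\<epsilon> k) = \<mu>"
proof -
  have "distr M borel (\<epsilon> k) = distr M lborel (\<epsilon> k)" by (rule distr_cong) auto
  then show ?thesis using distributed_distr_eq_density[OF dist_eps[of k]] by (simp add: \<mu>_def)
qed

lemma prob_space_\<mu>: "prob_space \<mu>"
  using prob_space_distr[of "\<epsilon> 0" borel] by (simp add: distr_eps)

sublocale \<mu>: prob_space \<mu> by (rule prob_space_\<mu>)

lemma integral_eps: "h \<in> borel_measurable borel \<Longrightarrow> expectation (\<lambda>\<omega>. h (\<epsilon> k \<omega>)) = (\<integral>e. h e \<partial>\<mu>)" for h :: "real \<Rightarrow> real"
  by (subst distr_eps[of k, symmetric]) (simp add: integral_distr)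

lemma integrable_eps: "h \<in> borel_measurable borel \<Longrightarrow> integrable M (\<lambda>\<omega>. h (\<epsilon> k \<omega>)) \<longleftrightarrow> integrable \<mu> h" for h :: "real \<Rightarrow> real"
  by (subst distr_eps[of k, symmetric]) (simp add: integrable_distr_eq)

definition s2 :: real where "s2 = (\<integral>e. e\<^sup>2 \<partial>\<mu>)"

lemma integrable_\<mu>_sq: "integrable \<mu> (\<lambda>e. e\<^sup>2)"
  using sq_integrable[of 0] by (subst (asm) integrable_eps) auto
lemma integrable_\<mu>_4: "integrable \<mu> (\<lambda>e. e^4)"
  using fourth_integrable[of 0] by (subst (asm) integrable_eps) auto
lemma integrable_\<mu>_id: "integrable \<mu> (\<lambda>e. e)"
  by (rule \<mu>.square_integrable_imp_integrable[OF _ integrable_\<mu>_sq]) auto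
lemma integral_\<mu>_id: "(\<integral>e. e \<partial>\<mu>) = 0"
  using mean_zero[of 0] integral_eps[of "\<lambda>x. x" 0] by simp
lemma s2_nonneg: "s2 \<ge> 0" unfolding s2_def by simp
lemma expectation_eps_sq: "expectation (\<lambda>\<omega>. (\<epsilon> k \<omega>)\<^sup>2) = s2"
  using integral_eps[of "\<lambda>x. x\<^sup>2" k] by (simp add: s2_def)

text \<open>A law with a density has no atom at 0. Positivity makes the lower bound for the variance
  of the sums effective.\<close>

lemma s2_pos: "s2 > 0"
proof (rule ccontr)
  assume "\<not> s2 > 0"
  then have "s2 = 0" using s2_nonneg by linarith
  then have "(\<integral>e. e\<^sup>2 \<partial>\<mu>) = 0" by (simp add: s2_def)
  then have "AE e in \<mu>. e\<^sup>2 = 0" using integral_nonneg_eq_0_iff_AE[OF integrable_\<mu>_sq] by simp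
  then have "AE e in \<mu>. e \<in> {0}" by simp
  moreover have "AE e in \<mu>. e \<notin> {0}"
  proof -
    have "AE e in lborel. e \<notin> {0::real}"
      by (rule AE_not_in) (auto simp: null_sets_def)
    then show ?thesis unfolding \<mu>_def
      using dist_eps[of 0] by (subst AE_density) (auto simp: distributed_def)
  qed
  ultimately have "AE e in \<mu>. False" by eventually_elim auto
  then show False by simp
qed

section \<open>The past of an innovation and integration of one innovation\<close>

definition past :: "int \<Rightarrow> 'a measure" where
  "past k = vimage_algebra (space M) (\<lambda>\<omega>. restrict (\<lambda>m. \<epsilon> m \<omega>) {..<k}) (PiM {..<k} (\<lambda>_. borel))"

lemma space_past[simp]: "space (past k) = space M" by (simp add: past_def)

lemma sets_past: "sets (past k) = {(\<lambda>\<omega>. restrict (\<lambda>m. \<epsilon> m \<omega>) {..<k}) -` A \<inter> space M | A. A \<in> sets (PiM {..<k} (\<lambda>_. borel))}"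
  unfolding past_def by (rule sets_vimage_algebra2) (auto simp: space_PiM)

lemma eps_past: "m < k \<Longrightarrow> \<epsilon> m \<in> borel_measurable (past k)"
proof -
  assume m: "m < k"
  have "(\<lambda>\<omega>. restrict (\<lambda>m. \<epsilon> m \<omega>) {..<k}) \<in> measurable (past k) (PiM {..<k} (\<lambda>_. borel))"
    unfolding past_def by (rule measurable_vimage_algebra1) (auto simp: space_PiM)
  from measurable_compose[OF this measurable_component_singleton[of m "{..<k}" "\<lambda>_. borel"]] m
  show ?thesis by simp
qed

lemma sets_past_subset:
  assumes "space N = space M" "\<And>m. m < k \<Longrightarrow> \<epsilon> m \<in> borel_measurable N"
  shows "sets (past k) \<subseteq> sets N"
proof
  fix A assume "A \<in> sets (past k)"
  then obtain B where B: "B \<in> sets (PiM {..<k} (\<lambda>_. borel))" "A = (\<lambda>\<omega>. restrict (\<lambda>m. \<epsilon> m \<omega>) {..<k}) -` B \<inter> space M"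
    unfolding sets_past by auto
  have "(\<lambda>\<omega>. restrict (\<lambda>m. \<epsilon> m \<omega>) {..<k}) \<in> measurable N (PiM {..<k} (\<lambda>_. borel))"
    by (rule measurable_restrict) (use assms in auto)
  from measurable_sets[OF this B(1)] show "A \<in> sets N" by (simp add: B(2) assms(1))
qed

lemma measurable_past_M: "W \<in> measurable (past k) N \<Longrightarrow> W \<in> measurable M N"
  using sets_past_subset[of M k] by (auto simp: measurable_def)

text \<open>Grouped independence of the index sets \<open>{k}\<close> and \<open>{..<k}\<close>:
  \<open>past k\<close> is a pull-back along the restriction map to \<open>{..<k}\<close>, so it is
  the very sigma-algebra that grouping provides.\<close>

lemma indep_past:
  assumes "W \<in> measurable (past k) N"
  shows "indep_set (sigma_sets (space M) {\<epsilon> k -` A \<inter> space M | A. A \<in> sets borel}) (sigma_sets (space M) {W -` A \<inter> space M | A. A \<in> sets N})"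
proof -
  let ?K = "\<lambda>b. if b then {k} else {..<k}"
  have "indep_vars (\<lambda>b. PiM (?K b) (\<lambda>_. borel)) (\<lambda>b \<omega>. restrict (\<lambda>i. \<epsilon> i \<omega>) (?K b)) (UNIV :: bool set)"
    by (rule indep_vars_restrict[OF indep]) (auto simp: disjoint_family_on_def)
  then have "indep_var (PiM {k} (\<lambda>_. borel)) (\<lambda>\<omega>. restrict (\<lambda>i. \<epsilon> i \<omega>) {k}) (PiM {..<k} (\<lambda>_. borel)) (\<lambda>\<omega>. restrict (\<lambda>i. \<epsilon> i \<omega>) {..<k})"
    unfolding indep_var_def by (rule indep_vars_cong[THEN iffD1, rotated -1]) (auto split: bool.split)
  then have i: "indep_set (sigma_sets (space M) {(\<lambda>\<omega>. restrict (\<lambda>i. \<epsilon> i \<omega>) {k}) -` A \<inter> space M | A. A \<in> sets (PiM {k} (\<lambda>_. borel))})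
      (sigma_sets (space M) {(\<lambda>\<omega>. restrict (\<lambda>i. \<epsilon> i \<omega>) {..<k}) -` A \<inter> space M | A. A \<in> sets (PiM {..<k} (\<lambda>_. borel))})"
    unfolding indep_var_eq by blast
  have s1: "{\<epsilon> k -` A \<inter> space M | A. A \<in> sets borel} \<subseteq> {(\<lambda>\<omega>. restrict (\<lambda>i. \<epsilon> i \<omega>) {k}) -` A \<inter> space M | A. A \<in> sets (PiM {k} (\<lambda>_. borel))}"
  proof
    fix B assume "B \<in> {\<epsilon> k -` A \<inter> space M | A. A \<in> sets borel}"
    then obtain A where A: "A \<in> sets borel" "B = \<epsilon> k -` A \<inter> space M" by auto
    have "(\<lambda>f. f k) -` A \<inter> space (PiM {k} (\<lambda>_. borel)) \<in> sets (PiM {k} (\<lambda>_. borel :: real measure))"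
      using A(1) by (intro measurable_sets[OF measurable_component_singleton]) auto
    moreover have "B = (\<lambda>\<omega>. restrict (\<lambda>i. \<epsilon> i \<omega>) {k}) -` ((\<lambda>f. f k) -` A \<inter> space (PiM {k} (\<lambda>_. borel :: real measure))) \<inter> space M"
      using A(2) by (auto simp: space_PiM)
    ultimately show "B \<in> {(\<lambda>\<omega>. restrict (\<lambda>i. \<epsilon> i \<omega>) {k}) -` A \<inter> space M | A. A \<in> sets (PiM {k} (\<lambda>_. borel))}" by blast
  qed
  have s2: "{W -` A \<inter> space M | A. A \<in> sets N} \<subseteq> {(\<lambda>\<omega>. restrict (\<lambda>i. \<epsilon> i \<omega>) {..<k}) -` A \<inter> space M | A. A \<in> sets (PiM {..<k} (\<lambda>_. borel))}"
    unfolding sets_past[symmetric] using measurable_sets[OF assms] by auto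
  show ?thesis
    using i unfolding indep_set_def
    by (rule indep_sets_mono_sets) (auto split: bool.split intro: sigma_sets_mono'[OF s1, THEN subsetD] sigma_sets_mono'[OF s2, THEN subsetD])
qed

lemma distr_eps_past:
  assumes "W \<in> measurable (past k) N"
  shows "distr M (borel \<Otimes>\<^sub>M N) (\<lambda>\<omega>. (\<epsilon> k \<omega>, W \<omega>)) = \<mu> \<Otimes>\<^sub>M distr M N W"
proof -
  have [measurable]: "W \<in> measurable M N" by (rule measurable_past_M[OF assms])
  interpret D: prob_space "distr M N W" by (rule prob_space_distr) simp
  have "\<mu> \<Otimes>\<^sub>M distr M N W = distr M (borel \<Otimes>\<^sub>M N) (\<lambda>\<omega>. (\<epsilon> k \<omega>, W \<omega>))"
  proof (rule pair_measure_eqI)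
    show "sigma_finite_measure \<mu>" "sigma_finite_measure (distr M N W)" by unfold_locales
    show "sets (\<mu> \<Otimes>\<^sub>M distr M N W) = sets (distr M (borel \<Otimes>\<^sub>M N) (\<lambda>\<omega>. (\<epsilon> k \<omega>, W \<omega>)))"
      by (simp cong: sets_pair_measure_cong)
  next
    fix A B assume "A \<in> sets \<mu>" "B \<in> sets (distr M N W)"
    then have [measurable]: "A \<in> sets borel" "B \<in> sets N" by auto
    have "prob ((\<epsilon> k -` A \<inter> space M) \<inter> (W -` B \<inter> space M)) = prob (\<epsilon> k -` A \<inter> space M) * prob (W -` B \<inter> space M)"
      by (rule indep_setD[OF indep_past[OF assms, of ]]) (auto intro!: sigma_sets.Basic)
    moreover have "(\<lambda>\<omega>. (\<epsilon> k \<omega>, W \<omega>)) -` (A \<times> B) \<inter> space M = (\<epsilon> k -` A \<inter> space M) \<inter> (W -` B \<inter> space M)"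
      by auto
    ultimately show "emeasure \<mu> A * emeasure (distr M N W) B = emeasure (distr M (borel \<Otimes>\<^sub>M N) (\<lambda>\<omega>. (\<epsilon> k \<omega>, W \<omega>))) (A \<times> B)"
      by (subst distr_eps[of k, symmetric]) (simp add: emeasure_distr emeasure_eq_measure ennreal_mult)
  qed
  then show ?thesis by simp
qed

text \<open>This takes the place of conditional expectation: given the past,
  \<open>\<epsilon> k\<close> is integrated out while the past-measurable \<open>W\<close> is kept
  fixed.\<close>

lemma freeze_nn:
  assumes W: "W \<in> measurable (past k) N" and [measurable]: "\<phi> \<in> borel_measurable (borel \<Otimes>\<^sub>M N)"
  shows "(\<integral>\<^sup>+\<omega>. \<phi> (\<epsilon> k \<omega>, W \<omega>) \<partial>M) = (\<integral>\<^sup>+\<omega>. (\<integral>\<^sup>+e. \<phi> (e, W \<omega>) \<partial>\<mu>) \<partial>M)"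
proof -
  have [measurable]: "W \<in> measurable M N" by (rule measurable_past_M[OF W])
  interpret D: prob_space "distr M N W" by (rule prob_space_distr) simp
  interpret pair_sigma_finite \<mu> "distr M N W" by unfold_locales
  have "(\<integral>\<^sup>+\<omega>. \<phi> (\<epsilon> k \<omega>, W \<omega>) \<partial>M) = (\<integral>\<^sup>+z. \<phi> z \<partial>distr M (borel \<Otimes>\<^sub>M N) (\<lambda>\<omega>. (\<epsilon> k \<omega>, W \<omega>)))"
    by (subst nn_integral_distr) auto
  also have "\<dots> = (\<integral>\<^sup>+y. (\<integral>\<^sup>+e. \<phi> (e, y) \<partial>\<mu>) \<partial>distr M N W)"
    unfolding distr_eps_past[OF W] by (subst nn_integral_snd) auto
  also have "\<dots> = (\<integral>\<^sup>+\<omega>. (\<integral>\<^sup>+e. \<phi> (e, W \<omega>) \<partial>\<mu>) \<partial>M)"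
    by (subst nn_integral_distr) auto
  finally show ?thesis .
qed

lemma freeze_int:
  fixes \<phi> :: "real \<times> 'b \<Rightarrow> real"
  assumes W: "W \<in> measurable (past k) N" and [measurable]: "\<phi> \<in> borel_measurable (borel \<Otimes>\<^sub>M N)"
    and int: "integrable M (\<lambda>\<omega>. \<phi> (\<epsilon> k \<omega>, W \<omega>))"
  shows "expectation (\<lambda>\<omega>. \<phi> (\<epsilon> k \<omega>, W \<omega>)) = expectation (\<lambda>\<omega>. \<integral>e. \<phi> (e, W \<omega>) \<partial>\<mu>)"
proof -
  have [measurable]: "W \<in> measurable M N" by (rule measurable_past_M[OF W])
  interpret D: prob_space "distr M N W" by (rule prob_space_distr) simp
  interpret pair_sigma_finite \<mu> "distr M N W" by unfold_locales
  have "integrable (\<mu> \<Otimes>\<^sub>M distr M N W) \<phi>"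
    unfolding distr_eps_past[OF W, symmetric] by (subst integrable_distr_eq) (use int in auto)
  then have i: "integrable (\<mu> \<Otimes>\<^sub>M distr M N W) (case_prod (\<lambda>e y. \<phi> (e, y)))" by simp
  have "expectation (\<lambda>\<omega>. \<phi> (\<epsilon> k \<omega>, W \<omega>)) = (\<integral>z. \<phi> z \<partial>distr M (borel \<Otimes>\<^sub>M N) (\<lambda>\<omega>. (\<epsilon> k \<omega>, W \<omega>)))"
    by (subst integral_distr) auto
  also have "\<dots> = (\<integral>y. (\<integral>e. \<phi> (e, y) \<partial>\<mu>) \<partial>distr M N W)"
    unfolding distr_eps_past[OF W] using integral_snd[OF i] by simp
  also have "\<dots> = expectation (\<lambda>\<omega>. \<integral>e. \<phi> (e, W \<omega>) \<partial>\<mu>)"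
    by (subst integral_distr) auto
  finally show ?thesis .
qed

text \<open>Conditional mean zero given the past kills the product with any past-measurable
  \<open>W\<close>. All orthogonality of lag projections rests on this.\<close>

lemma orthogonal_past:
  fixes d :: "real \<Rightarrow> real \<Rightarrow> real"
  assumes [measurable]: "case_prod d \<in> borel_measurable (borel \<Otimes>\<^sub>M borel)"
    and R: "R \<in> borel_measurable (past k)" and W: "W \<in> borel_measurable (past k)"
    and d0: "\<And>r. (\<integral>e. d e r \<partial>\<mu>) = 0"
    and int: "integrable M (\<lambda>\<omega>. d (\<epsilon> k \<omega>) (R \<omega>) * W \<omega>)"
  shows "expectation (\<lambda>\<omega>. d (\<epsilon> k \<omega>) (R \<omega>) * W \<omega>) = 0"
proof -
  \<comment> \<open>\<open>R\<close> and \<open>W\<close> are frozen together as one past-measurable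
    pair.\<close>
  have RW: "(\<lambda>\<omega>. (R \<omega>, W \<omega>)) \<in> measurable (past k) (borel \<Otimes>\<^sub>M borel)" using R W by measurable
  have m: "(\<lambda>(e,r,w). d e r * w) \<in> borel_measurable (borel \<Otimes>\<^sub>M borel \<Otimes>\<^sub>M borel)" by measurable
  show ?thesis using freeze_int[OF RW m] int by (simp add: d0)
qed

lemma expectation_eps_mult:
  assumes "k \<noteq> l"
  shows "integrable M (\<lambda>\<omega>. \<epsilon> k \<omega> * \<epsilon> l \<omega>)" "expectation (\<lambda>\<omega>. \<epsilon> k \<omega> * \<epsilon> l \<omega>) = 0"
proof -
  have int: "integrable M (\<lambda>\<omega>. \<epsilon> k \<omega> * \<epsilon> l \<omega>)" for k l
  proof (rule Bochner_Integration.integrable_bound)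
    show "integrable M (\<lambda>\<omega>. (\<epsilon> k \<omega>)\<^sup>2 + (\<epsilon> l \<omega>)\<^sup>2)" by (intro Bochner_Integration.integrable_add sq_integrable)
    show "AE \<omega> in M. norm (\<epsilon> k \<omega> * \<epsilon> l \<omega>) \<le> norm ((\<epsilon> k \<omega>)\<^sup>2 + (\<epsilon> l \<omega>)\<^sup>2)"
    proof (rule AE_I2)
      fix \<omega>
      have "2 * (\<bar>\<epsilon> k \<omega>\<bar> * \<bar>\<epsilon> l \<omega>\<bar>) \<le> \<bar>\<epsilon> k \<omega>\<bar>\<^sup>2 + \<bar>\<epsilon> l \<omega>\<bar>\<^sup>2" using sum_squares_bound[of "\<bar>\<epsilon> k \<omega>\<bar>" "\<bar>\<epsilon> l \<omega>\<bar>"] by simp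
      moreover have "0 \<le> \<bar>\<epsilon> k \<omega>\<bar> * \<bar>\<epsilon> l \<omega>\<bar>" by simp
      ultimately have "\<bar>\<epsilon> k \<omega>\<bar> * \<bar>\<epsilon> l \<omega>\<bar> \<le> (\<epsilon> k \<omega>)\<^sup>2 + (\<epsilon> l \<omega>)\<^sup>2" unfolding power2_abs by linarith
      then show "norm (\<epsilon> k \<omega> * \<epsilon> l \<omega>) \<le> norm ((\<epsilon> k \<omega>)\<^sup>2 + (\<epsilon> l \<omega>)\<^sup>2)" by (simp add: abs_mult)
    qed
  qed simp
  show "integrable M (\<lambda>\<omega>. \<epsilon> k \<omega> * \<epsilon> l \<omega>)" by (rule int)
  have *: "expectation (\<lambda>\<omega>. \<epsilon> k \<omega> * \<epsilon> l \<omega>) = 0" if "l < k" for k l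
    using orthogonal_past[of "\<lambda>e r. e" "\<lambda>_. 0" k "\<epsilon> l"] eps_past[OF that] int[of k l] by (simp add: integral_\<mu>_id)
  show "expectation (\<lambda>\<omega>. \<epsilon> k \<omega> * \<epsilon> l \<omega>) = 0"
    using *[of k l] *[of l k] assms by (cases "k < l") (simp_all add: mult.commute)
qed

lemma expectation_eps_sum_sq:
  assumes "finite A" "inj_on \<kappa> A"
  shows "integrable M (\<lambda>\<omega>. (\<Sum>m\<in>A. c m * \<epsilon> (\<kappa> m) \<omega>)\<^sup>2)"
    "expectation (\<lambda>\<omega>. (\<Sum>m\<in>A. c m * \<epsilon> (\<kappa> m) \<omega>)\<^sup>2) = s2 * (\<Sum>m\<in>A. (c m)\<^sup>2)"
proof -
  have e: "(\<Sum>m\<in>A. c m * \<epsilon> (\<kappa> m) \<omega>)\<^sup>2 = (\<Sum>m\<in>A. \<Sum>l\<in>A. (c m * c l) * (\<epsilon> (\<kappa> m) \<omega> * \<epsilon> (\<kappa> l) \<omega>))" for \<omega>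
    by (simp add: power2_eq_square sum_product mult_ac)
  have i: "integrable M (\<lambda>\<omega>. (c m * c l) * (\<epsilon> (\<kappa> m) \<omega> * \<epsilon> (\<kappa> l) \<omega>))" if "m \<in> A" "l \<in> A" for m l
    using expectation_eps_mult(1)[of "\<kappa> m" "\<kappa> l"] sq_integrable[of "\<kappa> m"]
    by (cases "\<kappa> m = \<kappa> l") (auto simp: power2_eq_square)
  show "integrable M (\<lambda>\<omega>. (\<Sum>m\<in>A. c m * \<epsilon> (\<kappa> m) \<omega>)\<^sup>2)"
    unfolding e using i by (intro Bochner_Integration.integrable_sum) auto
  have "expectation (\<lambda>\<omega>. (\<Sum>m\<in>A. c m * \<epsilon> (\<kappa> m) \<omega>)\<^sup>2) = (\<Sum>m\<in>A. \<Sum>l\<in>A. (c m * c l) * expectation (\<lambda>\<omega>. \<epsilon> (\<kappa> m) \<omega> * \<epsilon> (\<kappa> l) \<omega>))"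
    unfolding e using i by (simp add: Bochner_Integration.integral_sum Bochner_Integration.integrable_sum del: integral_mult_right_zero integral_mult_right) simp
  also have "\<dots> = (\<Sum>m\<in>A. \<Sum>l\<in>A. if l = m then (c m * c l) * s2 else 0)"
  proof (intro sum.cong refl)
    fix m l assume "m \<in> A" "l \<in> A"
    then show "(c m * c l) * expectation (\<lambda>\<omega>. \<epsilon> (\<kappa> m) \<omega> * \<epsilon> (\<kappa> l) \<omega>) = (if l = m then (c m * c l) * s2 else 0)"
      using expectation_eps_mult(2)[of "\<kappa> m" "\<kappa> l"] expectation_eps_sq[of "\<kappa> m"] inj_onD[OF assms(2), of m l]
      by (auto simp: power2_eq_square)
  qed
  also have "\<dots> = s2 * (\<Sum>m\<in>A. (c m)\<^sup>2)"
    using assms(1) by (simp add: sum_distrib_left power2_eq_square mult_ac)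
  finally show "expectation (\<lambda>\<omega>. (\<Sum>m\<in>A. c m * \<epsilon> (\<kappa> m) \<omega>)\<^sup>2) = s2 * (\<Sum>m\<in>A. (c m)\<^sup>2)" .
qed

lemma nn_integral_eps_sum_sq:
  assumes "finite A" "inj_on \<kappa> A"
  shows "(\<integral>\<^sup>+\<omega>. ennreal ((\<Sum>m\<in>A. c m * \<epsilon> (\<kappa> m) \<omega>)\<^sup>2) \<partial>M) = ennreal (s2 * (\<Sum>m\<in>A. (c m)\<^sup>2))"
  using nn_integral_eq_integral[OF expectation_eps_sum_sq(1)[OF assms, of c]] expectation_eps_sum_sq(2)[OF assms, of c] by simp

end

section \<open>Linear processes\<close>

text \<open>\<open>t\<close> is the distance from the last index of a block of length
  \<open>n\<close> back to an innovation, and the inner sum collects the weights with which that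
  innovation enters the block. Recent innovations (\<open>t < 2 * n\<close>) get at most a partial
  sum of weights; remote ones get \<open>n\<close> comparable weights, whose squares are summable
  over \<open>t\<close> because \<open>\<gamma> > 1/2\<close>.\<close>

lemma lag_sums:
  assumes P: "potter \<gamma> \<theta>" and \<gamma>: "\<gamma> > 1/2"
  shows "\<exists>K>0. \<forall>n\<ge>1. \<forall>N. (\<Sum>t<N. (\<Sum>s | s < n \<and> s \<le> t. \<theta> (Suc (t-s)))\<^sup>2) \<le> K * real n * (psum \<theta> n)\<^sup>2"
proof -
  have \<gamma>0: "\<gamma> > 0" using \<gamma> by simp
  obtain C1 where C1: "C1 > 0" "\<forall>m n. 1 \<le> m \<longrightarrow> m \<le> n \<longrightarrow> \<theta> n \<le> C1 * \<theta> m"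
    using potter_decreasing[OF P \<gamma>0] by blast
  obtain C2 where C2: "C2 > 0" "\<forall>n\<ge>1. real n * \<theta> n \<le> C2 * psum \<theta> n"
    using potter_term_le_psum[OF P \<gamma>0] by blast
  obtain C3 where C3: "C3 > 0" "\<forall>n\<ge>1. psum \<theta> (2*n) \<le> C3 * psum \<theta> n"
    using psum_double[OF P \<gamma>0] by blast
  obtain C4 where C4: "C4 > 0" "\<forall>n\<ge>1. \<forall>N. (\<Sum>l=n..N. (\<theta> l)\<^sup>2) \<le> C4 * real n * (\<theta> n)\<^sup>2"
    using potter_sum_squares[OF P \<gamma>0 \<gamma>] by blast
  have pos: "0 \<le> \<theta> (Suc j)" for j using potter_pos[OF P, of "Suc j"] by simp
  define W where "W = (\<lambda>n t. (\<Sum>s | s < n \<and> s \<le> t. \<theta> (Suc (t-s))))"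
  have W0: "0 \<le> W n t" for n t unfolding W_def by (intro sum_nonneg pos)
  have "(\<Sum>t<N. (W n t)\<^sup>2) \<le> (2 * C3\<^sup>2 + C1\<^sup>2 * C4 * C2\<^sup>2) * real n * (psum \<theta> n)\<^sup>2" if n: "n \<ge> 1" for n N
  proof -
    have small: "W n t \<le> C3 * psum \<theta> n" if t: "t < 2*n" for t
    proof -
      have "W n t = (\<Sum>j\<in>(\<lambda>s. Suc (t-s)) ` {s. s < n \<and> s \<le> t}. \<theta> j)"
        unfolding W_def by (subst sum.reindex) (auto simp: inj_on_def)
      also have "\<dots> \<le> psum \<theta> (2*n)"
        unfolding psum_def
      proof (rule sum_mono2)
        fix l assume "l \<in> {1..2*n} - (\<lambda>s. Suc (t-s)) ` {s. s < n \<and> s \<le> t}"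
        then show "0 \<le> \<theta> l" using potter_pos[OF P, of l] by simp
      qed (use t in auto)
      finally show ?thesis using C3(2) n by force
    qed
    \<comment> \<open>Each argument \<open>Suc (t - s)\<close> is at least \<open>t + 1 - n\<close>,
      where \<open>\<theta>\<close> is largest up to a constant; \<open>t >= 2 * n\<close> keeps
      this argument above \<open>n\<close>.\<close>
    have large: "W n t \<le> real n * (C1 * \<theta> (t+1-n))" if t: "t \<ge> 2*n" for t
    proof -
      have "W n t \<le> (\<Sum>s | s < n \<and> s \<le> t. C1 * \<theta> (t+1-n))"
        unfolding W_def using C1(2) t n by (intro sum_mono) auto
      also have "\<dots> = real (card {s. s < n \<and> s \<le> t}) * (C1 * \<theta> (t+1-n))" by simp
      also have "{s. s < n \<and> s \<le> t} = {..<n}" using t by auto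
      finally show ?thesis by simp
    qed
    have "(\<Sum>t<N. (W n t)\<^sup>2) \<le> (\<Sum>t\<in>{..<2*n} \<union> {2*n..<2*n+N}. (W n t)\<^sup>2)"
      by (intro sum_mono2) auto
    also have "\<dots> = (\<Sum>t<2*n. (W n t)\<^sup>2) + (\<Sum>t=2*n..<2*n+N. (W n t)\<^sup>2)"
      by (intro sum.union_disjoint) auto
    finally have split: "(\<Sum>t<N. (W n t)\<^sup>2) \<le> (\<Sum>t<2*n. (W n t)\<^sup>2) + (\<Sum>t=2*n..<2*n+N. (W n t)\<^sup>2)" .
    have "(\<Sum>t<2*n. (W n t)\<^sup>2) \<le> (\<Sum>t<2*n. (C3 * psum \<theta> n)\<^sup>2)"
      using small W0 by (intro sum_mono power_mono) auto
    also have "\<dots> = 2 * C3\<^sup>2 * real n * (psum \<theta> n)\<^sup>2" by (simp add: power_mult_distrib)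
    finally have A1: "(\<Sum>t<2*n. (W n t)\<^sup>2) \<le> 2 * C3\<^sup>2 * real n * (psum \<theta> n)\<^sup>2" .
    have "(\<Sum>t=2*n..<2*n+N. (\<theta> (t+1-n))\<^sup>2) = (\<Sum>l\<in>(\<lambda>t. t+1-n) ` {2*n..<2*n+N}. (\<theta> l)\<^sup>2)"
      by (subst sum.reindex) (auto simp: inj_on_def)
    also have "\<dots> \<le> (\<Sum>l=n..2*n+N. (\<theta> l)\<^sup>2)" by (intro sum_mono2) auto
    also have "\<dots> \<le> C4 * real n * (\<theta> n)\<^sup>2" using C4 n by blast
    finally have tl: "(\<Sum>t=2*n..<2*n+N. (\<theta> (t+1-n))\<^sup>2) \<le> C4 * real n * (\<theta> n)\<^sup>2" .
    have "(\<Sum>t=2*n..<2*n+N. (W n t)\<^sup>2) \<le> (\<Sum>t=2*n..<2*n+N. (real n * (C1 * \<theta> (t+1-n)))\<^sup>2)"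
      using large W0 by (intro sum_mono power_mono) auto
    also have "\<dots> = (real n)\<^sup>2 * C1\<^sup>2 * (\<Sum>t=2*n..<2*n+N. (\<theta> (t+1-n))\<^sup>2)"
      by (simp add: power_mult_distrib sum_distrib_left mult_ac)
    also have "\<dots> \<le> (real n)\<^sup>2 * C1\<^sup>2 * (C4 * real n * (\<theta> n)\<^sup>2)"
      by (rule mult_left_mono[OF tl]) simp
    also have "(real n)\<^sup>2 * C1\<^sup>2 * (C4 * real n * (\<theta> n)\<^sup>2) = C1\<^sup>2 * C4 * real n * (real n * \<theta> n)\<^sup>2"
      by (simp add: power_mult_distrib mult_ac)
    also have "\<dots> \<le> C1\<^sup>2 * C4 * real n * (C2 * psum \<theta> n)\<^sup>2"
      using C2 C4(1) n potter_pos[OF P n] by (intro mult_left_mono power_mono) auto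
    finally have A2: "(\<Sum>t=2*n..<2*n+N. (W n t)\<^sup>2) \<le> C1\<^sup>2 * C4 * real n * (C2 * psum \<theta> n)\<^sup>2" .
    show ?thesis
      using split A1 A2 by (simp add: power_mult_distrib algebra_simps)
  qed
  moreover have "2 * C3\<^sup>2 + C1\<^sup>2 * C4 * C2\<^sup>2 > 0" using C1 C2 C3 C4 by (auto intro!: add_pos_pos mult_pos_pos)
  ultimately show ?thesis unfolding W_def by blast
qed

text \<open>Fatou's lemma, used to pass from finitely many lags to the whole series.\<close>

lemma nn_integral_square_limit_le:
  fixes S :: "nat \<Rightarrow> 'a \<Rightarrow> real"
  assumes [measurable]: "\<And>N. S N \<in> borel_measurable M"
    and lim: "AE \<omega> in M. (\<lambda>N. S N \<omega>) \<longlonglongrightarrow> L \<omega>"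
    and bd: "\<And>N. (\<integral>\<^sup>+\<omega>. ennreal ((S N \<omega>)\<^sup>2) \<partial>M) \<le> B"
  shows "(\<integral>\<^sup>+\<omega>. ennreal ((L \<omega>)\<^sup>2) \<partial>M) \<le> B"
proof -
  have "(\<integral>\<^sup>+\<omega>. ennreal ((L \<omega>)\<^sup>2) \<partial>M) = (\<integral>\<^sup>+\<omega>. liminf (\<lambda>N. ennreal ((S N \<omega>)\<^sup>2)) \<partial>M)"
  proof (rule nn_integral_cong_AE)
    show "AE \<omega> in M. ennreal ((L \<omega>)\<^sup>2) = liminf (\<lambda>N. ennreal ((S N \<omega>)\<^sup>2))"
      using lim
    proof eventually_elim
      case (elim \<omega>)
      have "(\<lambda>N. ennreal ((S N \<omega>)\<^sup>2)) \<longlonglongrightarrow> ennreal ((L \<omega>)\<^sup>2)"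
        by (intro tendsto_ennrealI tendsto_intros elim)
      then show ?case by (intro lim_imp_Liminf[symmetric]) simp_all
    qed
  qed
  also have "\<dots> \<le> liminf (\<lambda>N. (\<integral>\<^sup>+\<omega>. ennreal ((S N \<omega>)\<^sup>2) \<partial>M))"
    by (rule nn_integral_liminf) measurable
  also have "\<dots> \<le> limsup (\<lambda>N. (\<integral>\<^sup>+\<omega>. ennreal ((S N \<omega>)\<^sup>2) \<partial>M))"
    by (rule Liminf_le_Limsup) simp
  also have "\<dots> \<le> B"
    by (rule Limsup_bounded, rule always_eventually, rule allI, rule bd)
  finally show ?thesis .
qed

lemma integrable_mult_of_squares:
  fixes f h :: "'a \<Rightarrow> real"
  assumes [measurable]: "f \<in> borel_measurable M" "h \<in> borel_measurable M"
    and "integrable M (\<lambda>\<omega>. (f \<omega>)\<^sup>2)" "integrable M (\<lambda>\<omega>. (h \<omega>)\<^sup>2)"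
  shows "integrable M (\<lambda>\<omega>. f \<omega> * h \<omega>)"
proof (rule Bochner_Integration.integrable_bound)
  show "integrable M (\<lambda>\<omega>. (f \<omega>)\<^sup>2 + (h \<omega>)\<^sup>2)" by (intro Bochner_Integration.integrable_add assms)
  show "AE \<omega> in M. norm (f \<omega> * h \<omega>) \<le> norm ((f \<omega>)\<^sup>2 + (h \<omega>)\<^sup>2)"
  proof (rule AE_I2)
    fix \<omega>
    have "2 * (\<bar>f \<omega>\<bar> * \<bar>h \<omega>\<bar>) \<le> \<bar>f \<omega>\<bar>\<^sup>2 + \<bar>h \<omega>\<bar>\<^sup>2" using sum_squares_bound[of "\<bar>f \<omega>\<bar>" "\<bar>h \<omega>\<bar>"] by simp
    moreover have "0 \<le> \<bar>f \<omega>\<bar> * \<bar>h \<omega>\<bar>" by simp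
    ultimately have "\<bar>f \<omega>\<bar> * \<bar>h \<omega>\<bar> \<le> (f \<omega>)\<^sup>2 + (h \<omega>)\<^sup>2" unfolding power2_abs by linarith
    then show "norm (f \<omega> * h \<omega>) \<le> norm ((f \<omega>)\<^sup>2 + (h \<omega>)\<^sup>2)" by (simp add: abs_mult)
  qed
qed simp

lemma integral_sum_square_orthogonal:
  fixes W :: "'i \<Rightarrow> 'a \<Rightarrow> real"
  assumes A: "finite A" and [measurable]: "\<And>t. t \<in> A \<Longrightarrow> W t \<in> borel_measurable M"
    and sq: "\<And>t. t \<in> A \<Longrightarrow> integrable M (\<lambda>\<omega>. (W t \<omega>)\<^sup>2)"
    and orth: "\<And>t t'. t \<in> A \<Longrightarrow> t' \<in> A \<Longrightarrow> t \<noteq> t' \<Longrightarrow> (\<integral>\<omega>. W t \<omega> * W t' \<omega> \<partial>M) = 0"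
  shows "integrable M (\<lambda>\<omega>. (\<Sum>t\<in>A. W t \<omega>)\<^sup>2)"
    "(\<integral>\<omega>. (\<Sum>t\<in>A. W t \<omega>)\<^sup>2 \<partial>M) = (\<Sum>t\<in>A. \<integral>\<omega>. (W t \<omega>)\<^sup>2 \<partial>M)"
proof -
  have e: "(\<Sum>t\<in>A. W t \<omega>)\<^sup>2 = (\<Sum>t\<in>A. \<Sum>t'\<in>A. W t \<omega> * W t' \<omega>)" for \<omega>
    by (simp add: power2_eq_square sum_product)
  have i: "integrable M (\<lambda>\<omega>. W t \<omega> * W t' \<omega>)" if "t \<in> A" "t' \<in> A" for t t'
    using that sq by (intro integrable_mult_of_squares) auto
  show "integrable M (\<lambda>\<omega>. (\<Sum>t\<in>A. W t \<omega>)\<^sup>2)"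
    unfolding e by (intro Bochner_Integration.integrable_sum i)
  have "(\<integral>\<omega>. (\<Sum>t\<in>A. W t \<omega>)\<^sup>2 \<partial>M) = (\<Sum>t\<in>A. \<integral>\<omega>. (\<Sum>t'\<in>A. W t \<omega> * W t' \<omega>) \<partial>M)"
    unfolding e by (intro Bochner_Integration.integral_sum Bochner_Integration.integrable_sum i)
  also have "\<dots> = (\<Sum>t\<in>A. \<Sum>t'\<in>A. \<integral>\<omega>. W t \<omega> * W t' \<omega> \<partial>M)"
    by (intro sum.cong refl Bochner_Integration.integral_sum i)
  also have "\<dots> = (\<Sum>t\<in>A. \<Sum>t'\<in>A. if t' = t then (\<integral>\<omega>. (W t \<omega>)\<^sup>2 \<partial>M) else 0)"
  proof (intro sum.cong refl)
    fix t t' assume "t \<in> A" "t' \<in> A"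
    then show "(\<integral>\<omega>. W t \<omega> * W t' \<omega> \<partial>M) = (if t' = t then (\<integral>\<omega>. (W t \<omega>)\<^sup>2 \<partial>M) else 0)"
      using orth[of t t'] by (auto simp: power2_eq_square)
  qed
  also have "\<dots> = (\<Sum>t\<in>A. \<integral>\<omega>. (W t \<omega>)\<^sup>2 \<partial>M)" using A by simp
  finally show "(\<integral>\<omega>. (\<Sum>t\<in>A. W t \<omega>)\<^sup>2 \<partial>M) = (\<Sum>t\<in>A. \<integral>\<omega>. (W t \<omega>)\<^sup>2 \<partial>M)" .
qed

text \<open>\<open>\<theta>\<close> provides a regularly varying majorant of the coefficients,
  shifted by one so that \<open>a 0\<close> is covered by \<open>\<theta> 1\<close>.\<close>

locale linear_innovations = innovations M \<epsilon> g
  for M :: "'a measure" and \<epsilon> g +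
  fixes a :: "nat \<Rightarrow> real" and \<beta> Ca :: real and \<theta> :: "nat \<Rightarrow> real"
  assumes \<beta>_gt: "1/2 < \<beta>" and \<beta>_lt: "\<beta> < 1" and potter_\<theta>: "potter \<beta> \<theta>"
    and Ca: "Ca > 0" and abs_a: "\<And>j. \<bar>a j\<bar> \<le> Ca * \<theta> (Suc j)"
begin

lemma \<beta>_pos: "\<beta> > 0" using \<beta>_gt by simp

lemma \<theta>_Suc_pos: "\<theta> (Suc j) > 0" using potter_pos[OF potter_\<theta>, of "Suc j"] by simp

lemma a_sq_le: "(a j)\<^sup>2 \<le> Ca\<^sup>2 * (\<theta> (Suc j))\<^sup>2"
  using power_mono[OF abs_a[of j], of 2] by (simp add: power_mult_distrib)

text \<open>The part of the linear process at time \<open>i\<close> from lag \<open>j\<close> on: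
  \<open>R i 0\<close> is X_i, and \<open>R i j\<close> depends only on innovations up to time
  \<open>i - j\<close>.\<close>

definition R :: "int \<Rightarrow> nat \<Rightarrow> 'a \<Rightarrow> real" where
  "R i j \<omega> = (\<Sum>m. a (j+m) * \<epsilon> (i - int (j+m)) \<omega>)"

lemma R_past: "i - int j < k \<Longrightarrow> R i j \<in> borel_measurable (past k)"
proof -
  assume k: "i - int j < k"
  have "\<epsilon> (i - int (j+m)) \<in> borel_measurable (past k)" for m
    by (rule eps_past) (use k in simp)
  then show ?thesis unfolding R_def[abs_def] by measurable
qed

lemma R_measurable[measurable]: "R i j \<in> borel_measurable M"
  using measurable_past_M[OF R_past[of i j "i - int j + 1"]] by simp

text \<open>The dyadic block starting at \<open>2^d\<close> has geometrically small variance, and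
  the maximal inequality with unit weights loses only a factor \<open>(d+1)^2\<close>. Hence the
  partial sums within the blocks are almost surely geometrically small.\<close>

lemma AE_summable: "AE \<omega> in M. summable (\<lambda>m. a m * \<epsilon> (i - int m) \<omega>)"
proof -
  \<comment> \<open>Any exponent strictly between 1/2 and \<open>\<beta>\<close>. With
    \<open>\<kappa> = p - 1/2\<close> the squared coefficients of block \<open>d\<close> are at most
    of order \<open>\<rho>^(2*d) / 2^d\<close>, so the block variance is at most of order
    \<open>\<rho>^(2*d)\<close>.\<close>
  define p where "p = (1/2 + \<beta>)/2"
  have p: "p < \<beta>" "p > 1/2" using \<beta>_gt by (auto simp: p_def)
  obtain C where C: "C > 0" "\<forall>n\<ge>1. \<theta> n \<le> C * real n powr (-p)" using potter_upper[OF potter_\<theta> \<beta>_pos p(1)] by blast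
  define \<kappa> where "\<kappa> = (2*p - 1)/2"
  have \<kappa>: "\<kappa> > 0" using p by (simp add: \<kappa>_def)
  define \<rho> where "\<rho> = (2::real) powr (-\<kappa>)"
  have \<rho>: "0 < \<rho>" "\<rho> < 1" using \<kappa> by (auto simp: \<rho>_def powr_less_one)
  have e: "(2 powr x) ^ d = 2 powr (x * real d)" for x :: real and d :: nat
    by (subst powr_realpow[symmetric]) (auto simp: powr_powr)
  define c0 where "c0 = s2 * (Ca * C)\<^sup>2"
  have c0: "c0 \<ge> 0" using s2_nonneg by (simp add: c0_def)
  define Z where "Z = (\<lambda>d l \<omega>. a (2^d + l) * \<epsilon> (i - int (2^d + l)) \<omega>)"
  have [measurable]: "Z d l \<in> borel_measurable M" for d l unfolding Z_def by measurable
  have asq: "(a (2^d + l))\<^sup>2 \<le> (Ca * C)\<^sup>2 * (\<rho>\<^sup>2 ^ d / 2^d)" for d l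
  proof -
    have "\<bar>a (2^d+l)\<bar> \<le> Ca * (C * real (Suc (2^d+l)) powr (-p))"
      using abs_a[of "2^d+l"] C(2) Ca by (smt (verit) le_numeral_extra(4) mult_left_mono One_nat_def Suc_le_mono zero_le)
    also have "real (Suc (2^d+l)) powr (-p) \<le> (2^d) powr (-p)" using p by (intro powr_mono2') auto
    finally have "\<bar>a (2^d+l)\<bar> \<le> Ca * (C * (2^d) powr (-p))" using Ca C by (simp add: mult_left_mono)
    then have "\<bar>a (2^d+l)\<bar>\<^sup>2 \<le> (Ca * (C * (2^d) powr (-p)))\<^sup>2" by (intro power_mono) auto
    also have "\<dots> = (Ca * C)\<^sup>2 * ((2^d) powr (-p))\<^sup>2" by (simp add: power_mult_distrib)
    also have "((2^d) powr (-p))\<^sup>2 = \<rho>\<^sup>2 ^ d / (2::real)^d"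
    proof -
      have sq: "(2 powr x)\<^sup>2 = 2 powr (2 * x)" for x :: real by (simp add: power2_eq_square flip: powr_add)
      have d2: "(2::real)^d = 2 powr real d" by (simp add: powr_realpow)
      have "((2^d) powr (-p))\<^sup>2 = 2 powr (- 2 * p * real d)"
        unfolding d2 powr_powr sq by (simp add: algebra_simps)
      moreover have "\<rho>\<^sup>2 ^ d / 2^d = 2 powr (2 * -\<kappa> * real d - real d)"
        unfolding \<rho>_def sq unfolding e d2 powr_diff by (rule refl)
      moreover have "2 * -\<kappa> * real d - real d = - 2 * p * real d" by (simp add: \<kappa>_def field_simps)
      ultimately show ?thesis by simp
    qed
    finally show ?thesis by simp
  qed
  have int: "(\<integral>\<^sup>+\<omega>. ennreal (dyadic_form (\<lambda>_. 1) (\<lambda>l. Z d l \<omega>) d) \<partial>M) \<le> ennreal (c0 * \<rho>\<^sup>2 ^ d * (real d + 1)\<^sup>2)" for d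
  proof -
    have "(\<integral>\<^sup>+\<omega>. ennreal (dyadic_form (\<lambda>_. 1) (\<lambda>l. Z d l \<omega>) d) \<partial>M) \<le> ennreal (c0 * (\<rho>\<^sup>2 ^ d / 2^d) * 2^d * (\<Sum>r\<le>d. 1)\<^sup>2)"
    proof (rule nn_integral_dyadic_form[where V="\<lambda>_. 1"])
      fix u n :: nat
      have "(\<integral>\<^sup>+\<omega>. ennreal ((\<Sum>l=u..<u+n. Z d l \<omega>)\<^sup>2) \<partial>M) = ennreal (s2 * (\<Sum>l=u..<u+n. (a (2^d+l))\<^sup>2))"
        unfolding Z_def by (rule nn_integral_eps_sum_sq) (auto simp: inj_on_def)
      also have "\<dots> \<le> ennreal (s2 * (\<Sum>l=u..<u+n. (Ca * C)\<^sup>2 * (\<rho>\<^sup>2 ^ d / 2^d)))"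
        using s2_nonneg by (intro ennreal_leI mult_left_mono sum_mono asq) auto
      finally show "(\<integral>\<^sup>+\<omega>. ennreal ((\<Sum>l=u..<u+n. Z d l \<omega>)\<^sup>2) \<partial>M) \<le> ennreal (c0 * (\<rho>\<^sup>2 ^ d / 2^d) * real n * 1)"
        by (simp add: c0_def mult_ac)
    qed (use c0 in auto)
    also have "c0 * (\<rho>\<^sup>2 ^ d / 2^d) * 2^d * (\<Sum>r\<le>d. 1)\<^sup>2 = c0 * \<rho>\<^sup>2 ^ d * (real d + 1)\<^sup>2" by (simp add: add.commute)
    finally show ?thesis .
  qed
  \<comment> \<open>Half of the geometric decay is given up for almost sure boundedness; the other
    half remains for the block sums.\<close>
  have "AE \<omega> in M. \<exists>K\<ge>0. \<forall>d. ennreal (dyadic_form (\<lambda>_. 1) (\<lambda>l. Z d l \<omega>) d) * ennreal (1 / \<rho>^d) \<le> ennreal K"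
  proof (rule AE_bounded_of_summable_nn_integral)
    show "(\<lambda>\<omega>. ennreal (dyadic_form (\<lambda>_. 1) (\<lambda>l. Z d l \<omega>) d) * ennreal (1 / \<rho>^d)) \<in> borel_measurable M" for d
      unfolding dyadic_form_def by measurable
    show "(\<integral>\<^sup>+\<omega>. ennreal (dyadic_form (\<lambda>_. 1) (\<lambda>l. Z d l \<omega>) d) * ennreal (1 / \<rho>^d) \<partial>M) \<le> ennreal (c0 * ((real d + 1)\<^sup>2 * \<rho> ^ d))" for d
    proof -
      have "(\<integral>\<^sup>+\<omega>. ennreal (dyadic_form (\<lambda>_. 1) (\<lambda>l. Z d l \<omega>) d) * ennreal (1 / \<rho>^d) \<partial>M)
         = (\<integral>\<^sup>+\<omega>. ennreal (dyadic_form (\<lambda>_. 1) (\<lambda>l. Z d l \<omega>) d) \<partial>M) * ennreal (1 / \<rho>^d)"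
        unfolding dyadic_form_def by (rule nn_integral_multc) measurable
      also have "\<dots> \<le> ennreal (c0 * \<rho>\<^sup>2 ^ d * (real d + 1)\<^sup>2) * ennreal (1 / \<rho>^d)"
        by (intro mult_right_mono int) auto
      also have "\<dots> = ennreal (c0 * \<rho>\<^sup>2 ^ d * (real d + 1)\<^sup>2 * (1 / \<rho>^d))"
        using c0 \<rho> by (subst ennreal_mult[symmetric]) auto
      also have "c0 * \<rho>\<^sup>2 ^ d * (real d + 1)\<^sup>2 * (1 / \<rho>^d) = c0 * ((real d + 1)\<^sup>2 * \<rho> ^ d)"
        using \<rho> by (simp add: power2_eq_square power_mult_distrib)
      finally show ?thesis .
    qed
    have "summable (\<lambda>d. (real d + 1)\<^sup>2 * \<rho> ^ d)"
    proof (rule summable_comparison_test_bigo)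
      show "summable (\<lambda>d. norm ((2 powr (-\<kappa>/2)) ^ d))" using \<kappa> by (simp add: norm_power powr_less_one)
      have "(\<lambda>d. (real d + 1)\<^sup>2 * 2 powr (-\<kappa> * real d)) \<in> O(\<lambda>d. 2 powr (-\<kappa>/2 * real d))"
        using \<kappa> by real_asymp
      then show "(\<lambda>d. (real d + 1)\<^sup>2 * \<rho> ^ d) \<in> O(\<lambda>d. (2 powr (-\<kappa>/2)) ^ d)"
        unfolding \<rho>_def e .
    qed
    then show "summable (\<lambda>d. c0 * ((real d + 1)\<^sup>2 * \<rho> ^ d))" by (rule summable_mult)
    show "0 \<le> c0 * ((real d + 1)\<^sup>2 * \<rho> ^ d)" for d using c0 \<rho> by simp
  qed
  then show ?thesis
  proof eventually_elim
    case (elim \<omega>)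
    then obtain K where K: "K \<ge> 0" "\<And>d. ennreal (dyadic_form (\<lambda>_. 1) (\<lambda>l. Z d l \<omega>) d) * ennreal (1 / \<rho>^d) \<le> ennreal K" by blast
    show ?case
    proof (rule summable_of_dyadic_blocks[where q="sqrt \<rho>" and C="sqrt K"])
      fix d n :: nat assume n: "n \<le> 2^d"
      have nn: "0 \<le> dyadic_form (\<lambda>_. 1) (\<lambda>l. Z d l \<omega>) d" by (rule dyadic_form_nonneg) simp
      have "ennreal (dyadic_form (\<lambda>_. 1) (\<lambda>l. Z d l \<omega>) d * (1 / \<rho>^d)) \<le> ennreal K"
        using K(2)[of d] ennreal_mult[OF nn, of "1 / \<rho>^d"] \<rho> by simp
      then have "dyadic_form (\<lambda>_. 1) (\<lambda>l. Z d l \<omega>) d * (1 / \<rho>^d) \<le> K"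
        using K(1) by (simp add: ennreal_le_iff)
      then have "dyadic_form (\<lambda>_. 1) (\<lambda>l. Z d l \<omega>) d \<le> K * \<rho>^d" using \<rho> by (simp add: divide_simps)
      moreover have "(\<Sum>l<n. Z d l \<omega>)\<^sup>2 \<le> dyadic_form (\<lambda>_. 1) (\<lambda>l. Z d l \<omega>) d"
        using n by (intro dyadic_maximal) auto
      ultimately have "(\<Sum>l<n. Z d l \<omega>)\<^sup>2 \<le> K * \<rho>^d" by linarith
      then have "\<bar>\<Sum>l<n. Z d l \<omega>\<bar> \<le> sqrt (K * \<rho>^d)" by (metis real_sqrt_abs real_sqrt_le_iff)
      then show "\<bar>\<Sum>l<n. a (2^d + l) * \<epsilon> (i - int (2^d + l)) \<omega>\<bar> \<le> sqrt K * sqrt \<rho> ^ d"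
        by (simp add: Z_def real_sqrt_mult real_sqrt_power)
    qed (use \<rho> K in auto)
  qed
qed

lemma R_eq_diff:
  assumes "summable (\<lambda>m. a m * \<epsilon> (i - int m) \<omega>)"
  shows "R i j \<omega> = R i 0 \<omega> - (\<Sum>m<j. a m * \<epsilon> (i - int m) \<omega>)"
  unfolding R_def using suminf_minus_initial_segment[OF assms, of j] by (simp add: add.commute)

lemma R_Suc:
  assumes "summable (\<lambda>m. a m * \<epsilon> (i - int m) \<omega>)"
  shows "R i j \<omega> = a j * \<epsilon> (i - int j) \<omega> + R i (Suc j) \<omega>"
  using R_eq_diff[OF assms, of j] R_eq_diff[OF assms, of "Suc j"] by simp

lemma R_tendsto_0:
  assumes "summable (\<lambda>m. a m * \<epsilon> (i - int m) \<omega>)"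
  shows "(\<lambda>j. R i j \<omega>) \<longlonglongrightarrow> 0"
proof -
  have "(\<lambda>j. R i 0 \<omega> - (\<Sum>m<j. a m * \<epsilon> (i - int m) \<omega>)) \<longlonglongrightarrow> R i 0 \<omega> - (\<Sum>m. a m * \<epsilon> (i - int m) \<omega>)"
    by (intro tendsto_intros summable_LIMSEQ assms)
  moreover have "R i 0 \<omega> = (\<Sum>m. a m * \<epsilon> (i - int m) \<omega>)" by (simp add: R_def)
  moreover have "(\<lambda>j. R i j \<omega>) = (\<lambda>j. R i 0 \<omega> - (\<Sum>m<j. a m * \<epsilon> (i - int m) \<omega>))"
    by (rule ext) (rule R_eq_diff[OF assms])
  ultimately show ?thesis by (metis diff_self)
qed

lemma R_partial_tendsto:
  assumes "summable (\<lambda>m. a m * \<epsilon> (i - int m) \<omega>)"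
  shows "(\<lambda>N. \<Sum>m<N. a (j+m) * \<epsilon> (i - int (j+m)) \<omega>) \<longlonglongrightarrow> R i j \<omega>"
  unfolding R_def using summable_LIMSEQ[OF summable_ignore_initial_segment[OF assms, of j]] by (simp add: add.commute)

lemma R_square_bound: "\<exists>V>0. \<forall>i j. (\<integral>\<^sup>+\<omega>. ennreal ((R i j \<omega>)\<^sup>2) \<partial>M) \<le> ennreal (V * real (Suc j) * (\<theta> (Suc j))\<^sup>2)"
proof -
  obtain C4 where C4: "C4 > 0" "\<forall>n\<ge>1. \<forall>N. (\<Sum>l=n..N. (\<theta> l)\<^sup>2) \<le> C4 * real n * (\<theta> n)\<^sup>2"
    using potter_sum_squares[OF potter_\<theta> \<beta>_pos \<beta>_gt] by blast
  have tail: "(\<Sum>m<N. (a (j+m))\<^sup>2) \<le> Ca\<^sup>2 * (C4 * real (Suc j) * (\<theta> (Suc j))\<^sup>2)" for j N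
  proof -
    have "(\<Sum>m<N. (a (j+m))\<^sup>2) \<le> (\<Sum>m<N. Ca\<^sup>2 * (\<theta> (Suc (j+m)))\<^sup>2)" by (intro sum_mono a_sq_le)
    also have "\<dots> = Ca\<^sup>2 * (\<Sum>m<N. (\<theta> (Suc (j+m)))\<^sup>2)" by (simp add: sum_distrib_left)
    also have "(\<Sum>m<N. (\<theta> (Suc (j+m)))\<^sup>2) = (\<Sum>l\<in>(\<lambda>m. Suc (j+m)) ` {..<N}. (\<theta> l)\<^sup>2)"
      by (subst sum.reindex) (auto simp: inj_on_def)
    also have "\<dots> \<le> (\<Sum>l=Suc j..Suc (j+N). (\<theta> l)\<^sup>2)" by (intro sum_mono2) auto
    also have "\<dots> \<le> C4 * real (Suc j) * (\<theta> (Suc j))\<^sup>2" by (rule C4(2)[rule_format]) simp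
    finally show ?thesis by (simp add: mult_left_mono)
  qed
  have "(\<integral>\<^sup>+\<omega>. ennreal ((R i j \<omega>)\<^sup>2) \<partial>M) \<le> ennreal (s2 * Ca\<^sup>2 * C4 * real (Suc j) * (\<theta> (Suc j))\<^sup>2)" for i j
  proof -
    let ?S = "\<lambda>N \<omega>. \<Sum>m<N. a (j+m) * \<epsilon> (i - int (j+m)) \<omega>"
    show ?thesis
    proof (rule nn_integral_square_limit_le[where S="?S"])
      show "AE \<omega> in M. (\<lambda>N. ?S N \<omega>) \<longlonglongrightarrow> R i j \<omega>"
        using AE_summable[of i] by eventually_elim (rule R_partial_tendsto)
      fix N
      have "(\<integral>\<^sup>+\<omega>. ennreal ((?S N \<omega>)\<^sup>2) \<partial>M) = ennreal (s2 * (\<Sum>m<N. (a (j+m))\<^sup>2))"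
        by (rule nn_integral_eps_sum_sq) (auto simp: inj_on_def)
      also have "\<dots> \<le> ennreal (s2 * (Ca\<^sup>2 * (C4 * real (Suc j) * (\<theta> (Suc j))\<^sup>2)))"
        using s2_nonneg by (intro ennreal_leI mult_left_mono tail) auto
      finally show "(\<integral>\<^sup>+\<omega>. ennreal ((?S N \<omega>)\<^sup>2) \<partial>M) \<le> ennreal (s2 * Ca\<^sup>2 * C4 * real (Suc j) * (\<theta> (Suc j))\<^sup>2)"
        by (simp add: mult_ac)
    qed measurable
  qed
  moreover have "s2 * Ca\<^sup>2 * C4 > 0" using s2_pos Ca C4 by simp
  ultimately show ?thesis by blast
qed

text \<open>The double sum over block indices and lags is regrouped by the innovation involved.
  Different innovations give orthogonal groups; within a group no orthogonality is available, and
  Cauchy-Schwarz with weights \<open>\<psi>\<close> leads to \<open>lag_sums\<close>.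
  \<open>K\<close> is fixed before \<open>d\<close> and \<open>T\<close>, so the bound is uniform in
  the point \<open>x\<close> on which these will depend.\<close>

lemma block_bound:
  assumes P: "potter \<gamma> \<psi>" and \<gamma>: "\<gamma> > 1/2"
  obtains K where "K > 0"
    "\<And>c d T u n. c \<ge> 0 \<Longrightarrow> (\<And>j. case_prod (d j) \<in> borel_measurable (borel \<Otimes>\<^sub>M borel)) \<Longrightarrow>
      (\<And>j r. (\<integral>e. d j e r \<partial>\<mu>) = 0) \<Longrightarrow>
      (\<And>i j. (\<integral>\<^sup>+\<omega>. ennreal ((d j (\<epsilon> (i - int j) \<omega>) (R i (Suc j) \<omega>))\<^sup>2) \<partial>M) \<le> ennreal (c * (\<psi> (Suc j))\<^sup>2)) \<Longrightarrow>
      (\<And>i. AE \<omega> in M. (\<lambda>J. \<Sum>j<J. d j (\<epsilon> (i - int j) \<omega>) (R i (Suc j) \<omega>)) \<longlonglongrightarrow> T i \<omega>) \<Longrightarrow> n \<ge> 1 \<Longrightarrow>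
      (\<integral>\<^sup>+\<omega>. ennreal ((\<Sum>i=u..<u+n. T (int i) \<omega>)\<^sup>2) \<partial>M) \<le> ennreal (c * K * real n * (psum \<psi> n)\<^sup>2)"
proof -
  obtain K where K: "K > 0" "\<forall>n\<ge>1. \<forall>N. (\<Sum>t<N. (\<Sum>s | s < n \<and> s \<le> t. \<psi> (Suc (t-s)))\<^sup>2) \<le> K * real n * (psum \<psi> n)\<^sup>2"
    using lag_sums[OF P \<gamma>] by blast
  have vpos: "\<psi> (Suc j) > 0" for j using potter_pos[OF P, of "Suc j"] by simp
  show ?thesis
  proof (rule that[OF K(1)])
    fix c :: real and d :: "nat \<Rightarrow> real \<Rightarrow> real \<Rightarrow> real" and T :: "int \<Rightarrow> 'a \<Rightarrow> real" and u n :: nat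
    assume c: "c \<ge> 0" and dm[measurable]: "\<And>j. case_prod (d j) \<in> borel_measurable (borel \<Otimes>\<^sub>M borel)"
      and d0: "\<And>j r. (\<integral>e. d j e r \<partial>\<mu>) = 0"
      and dsq: "\<And>i j. (\<integral>\<^sup>+\<omega>. ennreal ((d j (\<epsilon> (i - int j) \<omega>) (R i (Suc j) \<omega>))\<^sup>2) \<partial>M) \<le> ennreal (c * (\<psi> (Suc j))\<^sup>2)"
      and lim: "\<And>i. AE \<omega> in M. (\<lambda>J. \<Sum>j<J. d j (\<epsilon> (i - int j) \<omega>) (R i (Suc j) \<omega>)) \<longlonglongrightarrow> T i \<omega>"
      and n: "n \<ge> 1"
    define D where "D = (\<lambda>i j \<omega>. d j (\<epsilon> (i - int j) \<omega>) (R i (Suc j) \<omega>))"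
    have Dm[measurable]: "D i j \<in> borel_measurable M" for i j unfolding D_def by measurable
    have Dint: "integrable M (\<lambda>\<omega>. (D i j \<omega>)\<^sup>2)" for i j
    proof (rule integrableI_nonneg)
      show "(\<integral>\<^sup>+\<omega>. ennreal ((D i j \<omega>)\<^sup>2) \<partial>M) < \<infinity>"
        using dsq[of j i] unfolding D_def by (rule le_less_trans) simp
    qed auto
    have DE: "expectation (\<lambda>\<omega>. (D i j \<omega>)\<^sup>2) \<le> c * (\<psi> (Suc j))\<^sup>2" for i j
    proof -
      have "ennreal (expectation (\<lambda>\<omega>. (D i j \<omega>)\<^sup>2)) = (\<integral>\<^sup>+\<omega>. ennreal ((D i j \<omega>)\<^sup>2) \<partial>M)"
        by (rule nn_integral_eq_integral[symmetric, OF Dint]) simp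
      also have "\<dots> \<le> ennreal (c * (\<psi> (Suc j))\<^sup>2)" unfolding D_def by (rule dsq)
      finally show ?thesis using c by (simp add: ennreal_le_iff)
    qed
    have Dprod: "integrable M (\<lambda>\<omega>. D i j \<omega> * D i' j' \<omega>)" for i j i' j'
      by (intro integrable_mult_of_squares Dm Dint)
    have orth1: "expectation (\<lambda>\<omega>. D i j \<omega> * D i' j' \<omega>) = 0" if "i' - int j' < i - int j" for i j i' j'
    proof -
      have 1: "R i (Suc j) \<in> borel_measurable (past (i - int j))" by (rule R_past) simp
      have 2: "\<epsilon> (i' - int j') \<in> borel_measurable (past (i - int j))" by (rule eps_past[OF that])
      have 3: "R i' (Suc j') \<in> borel_measurable (past (i - int j))" by (rule R_past) (use that in simp)
      have "D i' j' \<in> borel_measurable (past (i - int j))" unfolding D_def using 2 3 by measurable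
      from orthogonal_past[OF dm 1 this d0] Dprod[of i j i' j'] show ?thesis unfolding D_def by blast
    qed
    have orth: "expectation (\<lambda>\<omega>. D i j \<omega> * D i' j' \<omega>) = 0" if "i' - int j' \<noteq> i - int j" for i j i' j'
      using orth1[of i' j' i j] orth1[of i j i' j'] that by (cases "i' - int j' < i - int j") (simp_all add: mult.commute)
    \<comment> \<open>Block indices are counted backwards from the last one, so that all pairs of
      \<open>s\<close> and lag \<open>j\<close> with \<open>s + j = t\<close> meet in the single
      innovation at time \<open>u + n - 1 - t\<close>.\<close>
    define \<iota> where "\<iota> = (\<lambda>s. int (u + n - 1 - s))"
    define A where "A = (\<lambda>J t. {s. s < n \<and> s \<le> t \<and> t - s < (J::nat)})"
    have finA: "finite (A J t)" for J t unfolding A_def by simp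
    define W where "W = (\<lambda>J t \<omega>. \<Sum>s\<in>A J t. D (\<iota> s) (t - s) \<omega>)"
    define S where "S = (\<lambda>J \<omega>. \<Sum>i=u..<u+n. \<Sum>j<J. D (int i) j \<omega>)"
    \<comment> \<open>Only lags below \<open>J\<close> occur here, so \<open>t\<close> stays below
      \<open>n + J\<close>; Fatou's lemma removes \<open>J\<close> at the end.\<close>
    have regroup: "S J \<omega> = (\<Sum>t<n+J. W J t \<omega>)" for J \<omega>
    proof -
      have "S J \<omega> = (\<Sum>s<n. \<Sum>j<J. D (\<iota> s) j \<omega>)"
        unfolding S_def \<iota>_def
        by (rule sum.reindex_bij_witness[of _ "\<lambda>s. u+n-1-s" "\<lambda>i. u+n-1-i"]) auto
      also have "\<dots> = (\<Sum>(s,j)\<in>{..<n}\<times>{..<J}. D (\<iota> s) j \<omega>)" by (simp add: sum.cartesian_product)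
      also have "\<dots> = (\<Sum>(t,s)\<in>(SIGMA t:{..<n+J}. A J t). D (\<iota> s) (t - s) \<omega>)"
        by (rule sum.reindex_bij_witness[of _ "\<lambda>(t,s). (s, t-s)" "\<lambda>(s,j). (s+j, s)"]) (auto simp: A_def)
      also have "\<dots> = (\<Sum>t<n+J. W J t \<omega>)" unfolding W_def by (subst sum.Sigma) (auto simp: finA)
      finally show ?thesis .
    qed
    have Wm[measurable]: "W J t \<in> borel_measurable M" for J t unfolding W_def by measurable
    have Wle: "(W J t \<omega>)\<^sup>2 \<le> (\<Sum>s\<in>A J t. \<psi> (Suc (t-s))) * (\<Sum>s\<in>A J t. (D (\<iota> s) (t-s) \<omega>)\<^sup>2 / \<psi> (Suc (t-s)))" for J t \<omega>
      unfolding W_def by (rule weighted_Cauchy_Schwarz) (rule vpos)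
    have Wbint: "integrable M (\<lambda>\<omega>. (\<Sum>s\<in>A J t. \<psi> (Suc (t-s))) * (\<Sum>s\<in>A J t. (D (\<iota> s) (t-s) \<omega>)\<^sup>2 / \<psi> (Suc (t-s))))" for J t
      by (intro integrable_mult_right Bochner_Integration.integrable_sum integrable_divide Dint)
    have Wint: "integrable M (\<lambda>\<omega>. (W J t \<omega>)\<^sup>2)" for J t
    proof (rule Bochner_Integration.integrable_bound[OF Wbint[of t J]])
      show "AE \<omega> in M. norm ((W J t \<omega>)\<^sup>2) \<le> norm ((\<Sum>s\<in>A J t. \<psi> (Suc (t-s))) * (\<Sum>s\<in>A J t. (D (\<iota> s) (t-s) \<omega>)\<^sup>2 / \<psi> (Suc (t-s))))"
      proof (rule AE_I2)
        fix \<omega>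
        show "norm ((W J t \<omega>)\<^sup>2) \<le> norm ((\<Sum>s\<in>A J t. \<psi> (Suc (t-s))) * (\<Sum>s\<in>A J t. (D (\<iota> s) (t-s) \<omega>)\<^sup>2 / \<psi> (Suc (t-s))))"
          using Wle[of J t \<omega>] by simp
      qed
    qed simp
    have WE: "expectation (\<lambda>\<omega>. (W J t \<omega>)\<^sup>2) \<le> c * (\<Sum>s | s < n \<and> s \<le> t. \<psi> (Suc (t-s)))\<^sup>2" for J t
    proof -
      have "expectation (\<lambda>\<omega>. (W J t \<omega>)\<^sup>2) \<le> expectation (\<lambda>\<omega>. (\<Sum>s\<in>A J t. \<psi> (Suc (t-s))) * (\<Sum>s\<in>A J t. (D (\<iota> s) (t-s) \<omega>)\<^sup>2 / \<psi> (Suc (t-s))))"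
        by (intro integral_mono Wint Wbint Wle)
      also have "\<dots> = (\<Sum>s\<in>A J t. \<psi> (Suc (t-s))) * (\<Sum>s\<in>A J t. expectation (\<lambda>\<omega>. (D (\<iota> s) (t-s) \<omega>)\<^sup>2) / \<psi> (Suc (t-s)))"
        by (subst integral_mult_right_zero, subst Bochner_Integration.integral_sum) (auto intro!: integrable_divide Dint)
      also have "\<dots> \<le> (\<Sum>s\<in>A J t. \<psi> (Suc (t-s))) * (\<Sum>s\<in>A J t. c * (\<psi> (Suc (t-s)))\<^sup>2 / \<psi> (Suc (t-s)))"
        using vpos by (intro mult_left_mono sum_mono divide_right_mono DE sum_nonneg) (auto intro: less_imp_le)
      also have "(\<Sum>s\<in>A J t. c * (\<psi> (Suc (t-s)))\<^sup>2 / \<psi> (Suc (t-s))) = (\<Sum>s\<in>A J t. c * \<psi> (Suc (t-s)))"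
        using vpos by (intro sum.cong refl) (simp add: power2_eq_square less_imp_neq[symmetric])
      also have "(\<Sum>s\<in>A J t. \<psi> (Suc (t-s))) * (\<Sum>s\<in>A J t. c * \<psi> (Suc (t-s))) = c * (\<Sum>s\<in>A J t. \<psi> (Suc (t-s)))\<^sup>2"
        by (simp add: power2_eq_square flip: sum_distrib_left)
      also have "\<dots> \<le> c * (\<Sum>s | s < n \<and> s \<le> t. \<psi> (Suc (t-s)))\<^sup>2"
        using vpos c by (intro mult_left_mono power_mono sum_mono2 sum_nonneg) (auto simp: A_def intro: less_imp_le)
      finally show ?thesis .
    qed
    have Worth: "expectation (\<lambda>\<omega>. W J t \<omega> * W J t' \<omega>) = 0" if "t \<noteq> t'" for J t t'
    proof -
      have "expectation (\<lambda>\<omega>. W J t \<omega> * W J t' \<omega>) = expectation (\<lambda>\<omega>. \<Sum>s\<in>A J t. \<Sum>s'\<in>A J t'. D (\<iota> s) (t-s) \<omega> * D (\<iota> s') (t'-s') \<omega>)"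
        unfolding W_def by (simp add: sum_product)
      also have "\<dots> = (\<Sum>s\<in>A J t. expectation (\<lambda>\<omega>. \<Sum>s'\<in>A J t'. D (\<iota> s) (t-s) \<omega> * D (\<iota> s') (t'-s') \<omega>))"
        by (intro Bochner_Integration.integral_sum Bochner_Integration.integrable_sum Dprod)
      also have "\<dots> = (\<Sum>s\<in>A J t. \<Sum>s'\<in>A J t'. expectation (\<lambda>\<omega>. D (\<iota> s) (t-s) \<omega> * D (\<iota> s') (t'-s') \<omega>))"
        by (intro sum.cong refl Bochner_Integration.integral_sum Dprod)
      also have "\<dots> = 0"
      proof (intro sum.neutral ballI)
        fix s s' assume "s \<in> A J t" "s' \<in> A J t'"
        then show "expectation (\<lambda>\<omega>. D (\<iota> s) (t-s) \<omega> * D (\<iota> s') (t'-s') \<omega>) = 0"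
          using that by (intro orth) (auto simp: A_def \<iota>_def)
      qed
      finally show ?thesis .
    qed
    have SE: "(\<integral>\<^sup>+\<omega>. ennreal ((S J \<omega>)\<^sup>2) \<partial>M) \<le> ennreal (c * K * real n * (psum \<psi> n)\<^sup>2)" for J
    proof -
      have "(\<integral>\<^sup>+\<omega>. ennreal ((S J \<omega>)\<^sup>2) \<partial>M) = ennreal (expectation (\<lambda>\<omega>. (S J \<omega>)\<^sup>2))"
        unfolding regroup
        by (intro nn_integral_eq_integral integral_sum_square_orthogonal(1)) (auto simp: Wint Worth)
      also have "expectation (\<lambda>\<omega>. (S J \<omega>)\<^sup>2) = (\<Sum>t<n+J. expectation (\<lambda>\<omega>. (W J t \<omega>)\<^sup>2))"
        unfolding regroup by (intro integral_sum_square_orthogonal(2)) (auto simp: Wint Worth)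
      also have "\<dots> \<le> (\<Sum>t<n+J. c * (\<Sum>s | s < n \<and> s \<le> t. \<psi> (Suc (t-s)))\<^sup>2)" by (intro sum_mono WE)
      also have "\<dots> = c * (\<Sum>t<n+J. (\<Sum>s | s < n \<and> s \<le> t. \<psi> (Suc (t-s)))\<^sup>2)" by (simp add: sum_distrib_left)
      also have "\<dots> \<le> c * (K * real n * (psum \<psi> n)\<^sup>2)" using K(2) n c by (intro mult_left_mono) auto
      finally show ?thesis by (simp add: mult_ac ennreal_leI)
    qed
    show "(\<integral>\<^sup>+\<omega>. ennreal ((\<Sum>i=u..<u+n. T (int i) \<omega>)\<^sup>2) \<partial>M) \<le> ennreal (c * K * real n * (psum \<psi> n)\<^sup>2)"
    proof (rule nn_integral_square_limit_le[where S=S])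
      show "S J \<in> borel_measurable M" for J unfolding S_def by measurable
      have "AE \<omega> in M. \<forall>i. (\<lambda>J. \<Sum>j<J. D i j \<omega>) \<longlonglongrightarrow> T i \<omega>"
        unfolding AE_all_countable D_def using lim by blast
      then show "AE \<omega> in M. (\<lambda>J. S J \<omega>) \<longlonglongrightarrow> (\<Sum>i=u..<u+n. T (int i) \<omega>)"
        unfolding S_def by eventually_elim (intro tendsto_sum, blast)
    qed (rule SE)
  qed
qed

end

section \<open>Smoothing by the innovation density\<close>

text \<open>Dominated convergence: the mean value theorem bounds the difference quotients by
  \<open>B\<close>. \<open>h'\<close> is only bounded and measurable, since it will also be the
  second derivative of the density.\<close>

lemma (in prob_space) has_derivative_expectation_shift:
  fixes Z :: "'a \<Rightarrow> real"
  assumes [measurable]: "Z \<in> borel_measurable M" "h' \<in> borel_measurable borel"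
    and deriv: "\<And>y. (h has_real_derivative h' y) (at y)"
    and B: "\<And>y. \<bar>h y\<bar> \<le> B" "\<And>y. \<bar>h' y\<bar> \<le> B"
  shows "((\<lambda>y. expectation (\<lambda>\<omega>. h (y - Z \<omega>))) has_real_derivative expectation (\<lambda>\<omega>. h' (y - Z \<omega>))) (at y)"
proof -
  have "continuous_on UNIV h" using deriv by (meson DERIV_isCont continuous_at_imp_continuous_on)
  then have [measurable]: "h \<in> borel_measurable borel" by (rule borel_measurable_continuous_onI)
  have int: "integrable M (\<lambda>\<omega>. h (x - Z \<omega>))" for x
    by (rule integrable_const_bound[where B=B]) (auto simp: B)
  have lip: "\<bar>h u - h v\<bar> \<le> B * \<bar>u - v\<bar>" for u v
    using field_differentiable_bound[of UNIV h h' B u v] deriv B by (auto simp: has_field_derivative_at_within)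
  have "((\<lambda>t. (expectation (\<lambda>\<omega>. h (y + t - Z \<omega>)) - expectation (\<lambda>\<omega>. h (y - Z \<omega>))) / t) \<longlongrightarrow> expectation (\<lambda>\<omega>. h' (y - Z \<omega>))) (at 0)"
    unfolding tendsto_at_iff_sequentially comp_def
  proof (intro allI impI)
    fix X :: "nat \<Rightarrow> real" assume X: "\<forall>i. X i \<in> UNIV - {0}" "X \<longlonglongrightarrow> 0"
    have "(\<lambda>n. expectation (\<lambda>\<omega>. (h (y + X n - Z \<omega>) - h (y - Z \<omega>)) / X n)) \<longlonglongrightarrow> expectation (\<lambda>\<omega>. h' (y - Z \<omega>))"
    proof (rule integral_dominated_convergence[where w="\<lambda>_. B"])
      show "AE \<omega> in M. (\<lambda>n. (h (y + X n - Z \<omega>) - h (y - Z \<omega>)) / X n) \<longlonglongrightarrow> h' (y - Z \<omega>)"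
      proof (rule AE_I2)
        fix \<omega>
        have "((\<lambda>t. (h (y - Z \<omega> + t) - h (y - Z \<omega>)) / t) \<longlongrightarrow> h' (y - Z \<omega>)) (at 0)"
          using deriv[of "y - Z \<omega>"] by (simp add: DERIV_def)
        then have "(\<lambda>n. (h (y - Z \<omega> + X n) - h (y - Z \<omega>)) / X n) \<longlonglongrightarrow> h' (y - Z \<omega>)"
          using X unfolding tendsto_at_iff_sequentially comp_def by blast
        then show "(\<lambda>n. (h (y + X n - Z \<omega>) - h (y - Z \<omega>)) / X n) \<longlonglongrightarrow> h' (y - Z \<omega>)"
          by (simp add: algebra_simps)
      qed
      show "AE \<omega> in M. norm ((h (y + X n - Z \<omega>) - h (y - Z \<omega>)) / X n) \<le> B" for n
      proof (rule AE_I2)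
        fix \<omega>
        have "X n \<noteq> 0" using X by auto
        then show "norm ((h (y + X n - Z \<omega>) - h (y - Z \<omega>)) / X n) \<le> B"
          using lip[of "y + X n - Z \<omega>" "y - Z \<omega>"] by (simp add: divide_simps)
      qed
    qed auto
    moreover have "expectation (\<lambda>\<omega>. (h (y + X n - Z \<omega>) - h (y - Z \<omega>)) / X n) = (expectation (\<lambda>\<omega>. h (y + X n - Z \<omega>)) - expectation (\<lambda>\<omega>. h (y - Z \<omega>))) / X n" for n
      by (simp add: int)
    ultimately show "(\<lambda>n. (expectation (\<lambda>\<omega>. h (y + X n - Z \<omega>)) - expectation (\<lambda>\<omega>. h (y - Z \<omega>))) / X n) \<longlonglongrightarrow> expectation (\<lambda>\<omega>. h' (y - Z \<omega>))"
      by (simp only:)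
  qed
  then show ?thesis by (simp add: DERIV_def)
qed

text \<open>Integrating out an innovation with nonzero coefficient is to turn bounded functions into
  Lipschitz ones: \<open>g_L1_modulus\<close> measures that gain, and \<open>a_nonzero\<close>
  provides such an innovation beyond lag 0.\<close>

locale smooth_linear = linear_innovations M \<epsilon> g a \<beta> Ca \<theta>
  for M :: "'a measure" and \<epsilon> g a \<beta> Ca \<theta> +
  fixes G1 :: real
  assumes g_measurable[measurable]: "g \<in> borel_measurable borel" and G1_nonneg: "G1 \<ge> 0"
    and g_L1_modulus: "\<And>t. (\<integral>\<^sup>+u. ennreal \<bar>g (u + t) - g u\<bar> \<partial>lborel) \<le> ennreal (G1 * \<bar>t\<bar>)"
    and a_nonzero: "\<exists>j. a (Suc j) \<noteq> 0"
begin

lemma measure_\<mu>_UNIV[simp]: "measure \<mu> UNIV = 1"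
  using \<mu>.prob_space by simp

text \<open>\<open>hs h j (x - R i (Suc j))\<close> is the conditional expectation of \<open>h (x - R i 1)\<close> given the
  innovations up to time \<open>i - Suc j\<close>.\<close>

primrec hs :: "(real \<Rightarrow> real) \<Rightarrow> nat \<Rightarrow> real \<Rightarrow> real" where
  "hs h 0 = h"
| "hs h (Suc j) = (\<lambda>y. \<integral>e. hs h j (y - a (Suc j) * e) \<partial>\<mu>)"

lemma hs_measurable[measurable]: "h \<in> borel_measurable borel \<Longrightarrow> hs h j \<in> borel_measurable borel"
proof (induction j)
  case (Suc j)
  then have [measurable]: "hs h j \<in> borel_measurable borel" by simp
  have "(\<lambda>y. \<integral>e. hs h j (y - a (Suc j) * e) \<partial>\<mu>) \<in> borel_measurable borel"
    by (rule \<mu>.borel_measurable_lebesgue_integral) measurable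
  then show ?case by simp
qed simp

lemma hs_bound:
  assumes "h \<in> borel_measurable borel" "\<And>y. \<bar>h y\<bar> \<le> B"
  shows "\<bar>hs h j y\<bar> \<le> B"
proof (induction j arbitrary: y)
  case (Suc j)
  have [measurable]: "hs h j \<in> borel_measurable borel" using assms(1) by simp
  have "\<bar>\<integral>e. hs h j (y - a (Suc j) * e) \<partial>\<mu>\<bar> \<le> (\<integral>e. \<bar>hs h j (y - a (Suc j) * e)\<bar> \<partial>\<mu>)"
    by (rule integral_abs_bound)
  also have "\<dots> \<le> (\<integral>e. B \<partial>\<mu>)"
  proof (rule integral_mono)
    show "integrable \<mu> (\<lambda>e. \<bar>hs h j (y - a (Suc j) * e)\<bar>)"
      by (rule \<mu>.integrable_const_bound[where B=B]) (auto simp: Suc)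
  qed (auto simp: Suc)
  finally show ?case by (simp add: \<mu>.prob_space)
qed (use assms in simp)

lemma hs_integrable:
  assumes "h \<in> borel_measurable borel" "\<And>y. \<bar>h y\<bar> \<le> B"
  shows "integrable \<mu> (\<lambda>e. hs h j (y - b * e))"
proof -
  have [measurable]: "hs h j \<in> borel_measurable borel" using assms(1) by simp
  show ?thesis by (rule \<mu>.integrable_const_bound[where B=B]) (auto intro: hs_bound assms)
qed

lemma hs_deriv:
  assumes h': "h' \<in> borel_measurable borel" and deriv: "\<And>y. (h has_real_derivative h' y) (at y)"
    and B: "\<And>y. \<bar>h y\<bar> \<le> B" "\<And>y. \<bar>h' y\<bar> \<le> B"
  shows "(hs h j has_real_derivative hs h' j y) (at y)"
proof (induction j arbitrary: y)
  case (Suc j)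
  have "continuous_on UNIV h" using deriv by (meson DERIV_isCont continuous_at_imp_continuous_on)
  then have hm: "h \<in> borel_measurable borel" by (rule borel_measurable_continuous_onI)
  have [measurable]: "hs h' j \<in> borel_measurable borel" using h' by simp
  show ?case unfolding hs.simps
    by (rule \<mu>.has_derivative_expectation_shift) (auto intro: Suc hs_bound hm h' B)
qed (use deriv in simp)

text \<open>Tower property: each further smoothing integrates out the most recent innovation left in
  \<open>R i (Suc j)\<close>, which does not change the expectation.\<close>

lemma expectation_hs:
  assumes h[measurable]: "h \<in> borel_measurable borel" and B: "\<And>y. \<bar>h y\<bar> \<le> B"
  shows "expectation (\<lambda>\<omega>. hs h j (x - R i (Suc j) \<omega>)) = expectation (\<lambda>\<omega>. h (x - R i 1 \<omega>))"
proof (induction j)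
  case (Suc j)
  have [measurable]: "hs h k \<in> borel_measurable borel" for k using h by simp
  have "expectation (\<lambda>\<omega>. hs h j (x - R i (Suc j) \<omega>)) = expectation (\<lambda>\<omega>. hs h j (x - a (Suc j) * \<epsilon> (i - int (Suc j)) \<omega> - R i (Suc (Suc j)) \<omega>))"
  proof (rule integral_cong_AE)
    show "AE \<omega> in M. hs h j (x - R i (Suc j) \<omega>) = hs h j (x - a (Suc j) * \<epsilon> (i - int (Suc j)) \<omega> - R i (Suc (Suc j)) \<omega>)"
      using AE_summable[of i]
    proof eventually_elim
      case (elim \<omega>)
      show ?case using R_Suc[OF elim, of "Suc j"] by (simp add: algebra_simps)
    qed
  qed measurable
  also have "\<dots> = expectation (\<lambda>\<omega>. (\<lambda>(e,r). hs h j (x - a (Suc j) * e - r)) (\<epsilon> (i - int (Suc j)) \<omega>, R i (Suc (Suc j)) \<omega>))" by simp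
  also have "\<dots> = expectation (\<lambda>\<omega>. \<integral>e. (\<lambda>(e,r). hs h j (x - a (Suc j) * e - r)) (e, R i (Suc (Suc j)) \<omega>) \<partial>\<mu>)"
  proof (rule freeze_int)
    show "R i (Suc (Suc j)) \<in> borel_measurable (past (i - int (Suc j)))" by (rule R_past) simp
    show "integrable M (\<lambda>\<omega>. (\<lambda>(e,r). hs h j (x - a (Suc j) * e - r)) (\<epsilon> (i - int (Suc j)) \<omega>, R i (Suc (Suc j)) \<omega>))"
      by (rule integrable_const_bound[where B=B]) (simp_all add: hs_bound[OF h B])
  qed measurable
  also have "\<dots> = expectation (\<lambda>\<omega>. hs h (Suc j) (x - R i (Suc (Suc j)) \<omega>))"
    by (simp add: algebra_simps)
  finally show ?case using Suc by simp
qed simp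

lemma hs_lipschitz_Suc:
  assumes h: "h \<in> borel_measurable borel" and B: "\<And>y. \<bar>h y\<bar> \<le> B"
    and L: "\<And>u v. \<bar>hs h j u - hs h j v\<bar> \<le> L * \<bar>u - v\<bar>"
  shows "\<bar>hs h (Suc j) u - hs h (Suc j) v\<bar> \<le> L * \<bar>u - v\<bar>"
proof -
  have [measurable]: "hs h j \<in> borel_measurable borel" using h by simp
  note i = hs_integrable[OF h B]
  have "\<bar>hs h (Suc j) u - hs h (Suc j) v\<bar> = \<bar>\<integral>e. hs h j (u - a (Suc j) * e) - hs h j (v - a (Suc j) * e) \<partial>\<mu>\<bar>"
    using i by simp
  also have "\<dots> \<le> (\<integral>e. \<bar>hs h j (u - a (Suc j) * e) - hs h j (v - a (Suc j) * e)\<bar> \<partial>\<mu>)" by (rule integral_abs_bound)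
  also have "\<dots> \<le> (\<integral>e. L * \<bar>u - v\<bar> \<partial>\<mu>)"
  proof (intro integral_mono)
    fix e show "\<bar>hs h j (u - a (Suc j) * e) - hs h j (v - a (Suc j) * e)\<bar> \<le> L * \<bar>u - v\<bar>"
      using L[of "u - a (Suc j) * e" "v - a (Suc j) * e"] by simp
  qed (use i in auto)
  finally show ?thesis by (simp add: \<mu>.prob_space)
qed

lemma g_integrable: "integrable lborel g"
proof (rule integrableI_nonneg)
  have "(\<integral>\<^sup>+x. ennreal (g x) \<partial>lborel) = emeasure \<mu> UNIV"
    unfolding \<mu>_def by (subst emeasure_density) auto
  also have "\<dots> = 1" using \<mu>.emeasure_space_1 by simp
  finally show "(\<integral>\<^sup>+x. ennreal (g x) \<partial>lborel) < \<infinity>" by simp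
qed (auto simp: g_nonneg)

text \<open>A shift of the argument by \<open>u - v\<close> equals a shift of the integration
  variable by \<open>t = (u - v) / b\<close>. The change of variables moves it from the rough
  function to the density, where the L1 modulus applies.\<close>

lemma hs_lipschitz_smoothing:
  assumes h: "h \<in> borel_measurable borel" and B: "\<And>y. \<bar>h y\<bar> \<le> B" and a: "a (Suc j) \<noteq> 0"
  shows "\<bar>hs h (Suc j) u - hs h (Suc j) v\<bar> \<le> B * G1 / \<bar>a (Suc j)\<bar> * \<bar>u - v\<bar>"
proof -
  have m[measurable]: "hs h j \<in> borel_measurable borel" using h by simp
  have B0: "B \<ge> 0" using B[of 0] by linarith
  define b where "b = a (Suc j)"
  have b: "b \<noteq> 0" using a by (simp add: b_def)
  define t where "t = (u - v) / b"
  have hb: "\<bar>hs h j y\<bar> \<le> B" for y by (rule hs_bound[OF h B])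
  have gt: "integrable lborel (\<lambda>e. g (e + t))"
    using g_integrable lborel_integrable_real_affine[of g 1 t] by (simp add: add.commute)
  have dens: "hs h (Suc j) y = (\<integral>e. g e * hs h j (y - b * e) \<partial>lborel)" for y
    unfolding \<mu>_def hs.simps b_def by (subst integral_density) (auto simp: g_nonneg)
  have ib: "integrable lborel (\<lambda>e. k e * hs h j (y - b * e))" if k: "integrable lborel k" for k :: "real \<Rightarrow> real" and y
  proof (rule Bochner_Integration.integrable_bound)
    show "integrable lborel (\<lambda>e. B * \<bar>k e\<bar>)" using k by simp
    show "AE e in lborel. norm (k e * hs h j (y - b * e)) \<le> norm (B * \<bar>k e\<bar>)"
    proof (rule AE_I2)
      fix e
      have "\<bar>k e\<bar> * \<bar>hs h j (y - b * e)\<bar> \<le> \<bar>k e\<bar> * B" by (intro mult_left_mono hb) auto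
      then show "norm (k e * hs h j (y - b * e)) \<le> norm (B * \<bar>k e\<bar>)" using B0 by (simp add: abs_mult mult.commute)
    qed
    show "(\<lambda>e. k e * hs h j (y - b * e)) \<in> borel_measurable lborel"
      using borel_measurable_integrable[OF k] by measurable
  qed
  have "hs h (Suc j) u = (\<integral>e. g (e + t) * hs h j (v - b * e) \<partial>lborel)"
  proof -
    have "hs h (Suc j) u = (\<integral>e. g (t + 1 * e) * hs h j (u - b * (t + 1 * e)) \<partial>lborel)"
      unfolding dens using lborel_integral_real_affine[of 1 "\<lambda>e. g e * hs h j (u - b * e)" t] by simp
    also have "\<dots> = (\<integral>e. g (e + t) * hs h j (v - b * e) \<partial>lborel)"
    proof (intro Bochner_Integration.integral_cong refl)
      fix e
      have "u - b * (t + 1 * e) = v - b * e" using b by (simp add: t_def field_simps)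
      then show "g (t + 1 * e) * hs h j (u - b * (t + 1 * e)) = g (e + t) * hs h j (v - b * e)"
        by (simp add: add.commute)
    qed
    finally show ?thesis .
  qed
  then have "hs h (Suc j) u - hs h (Suc j) v = (\<integral>e. g (e + t) * hs h j (v - b * e) - g e * hs h j (v - b * e) \<partial>lborel)"
    unfolding dens[of v] using ib[OF gt] ib[OF g_integrable] by simp
  also have "\<dots> = (\<integral>e. (g (e + t) - g e) * hs h j (v - b * e) \<partial>lborel)" by (simp add: algebra_simps)
  finally have "\<bar>hs h (Suc j) u - hs h (Suc j) v\<bar> \<le> (\<integral>e. \<bar>(g (e + t) - g e) * hs h j (v - b * e)\<bar> \<partial>lborel)"
    using integral_abs_bound[of lborel "\<lambda>e. (g (e + t) - g e) * hs h j (v - b * e)"] by simp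
  also have "\<dots> \<le> (\<integral>e. B * \<bar>g (e + t) - g e\<bar> \<partial>lborel)"
  proof (intro integral_mono)
    show "integrable lborel (\<lambda>e. \<bar>(g (e + t) - g e) * hs h j (v - b * e)\<bar>)"
      by (intro integrable_abs ib Bochner_Integration.integrable_diff gt g_integrable)
    show "integrable lborel (\<lambda>e. B * \<bar>g (e + t) - g e\<bar>)" using gt g_integrable by simp
    fix e
    have "\<bar>g (e + t) - g e\<bar> * \<bar>hs h j (v - b * e)\<bar> \<le> \<bar>g (e + t) - g e\<bar> * B" by (intro mult_left_mono hb) auto
    then show "\<bar>(g (e + t) - g e) * hs h j (v - b * e)\<bar> \<le> B * \<bar>g (e + t) - g e\<bar>" by (simp add: abs_mult mult.commute)
  qed
  also have "\<dots> = B * (\<integral>e. \<bar>g (e + t) - g e\<bar> \<partial>lborel)" by simp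
  also have "\<dots> \<le> B * (G1 * \<bar>t\<bar>)"
  proof (intro mult_left_mono B0)
    have "ennreal (\<integral>e. \<bar>g (e + t) - g e\<bar> \<partial>lborel) = (\<integral>\<^sup>+e. ennreal \<bar>g (e + t) - g e\<bar> \<partial>lborel)"
      using gt g_integrable by (intro nn_integral_eq_integral[symmetric]) auto
    also have "\<dots> \<le> ennreal (G1 * \<bar>t\<bar>)" by (rule g_L1_modulus)
    finally show "(\<integral>e. \<bar>g (e + t) - g e\<bar> \<partial>lborel) \<le> G1 * \<bar>t\<bar>" using G1_nonneg by (simp add: ennreal_le_iff)
  qed
  also have "\<dots> = B * G1 / \<bar>a (Suc j)\<bar> * \<bar>u - v\<bar>" by (simp add: t_def b_def abs_divide)
  finally show ?thesis .
qed

text \<open>One smoothing creates a Lipschitz constant and later ones preserve it, so from lag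
  \<open>q\<close> on it is the same for all lags and proportional to the bound of
  \<open>h\<close>.\<close>

lemma hs_eventually_lipschitz:
  obtains q A where "A \<ge> 0"
    "\<And>h B j u v. h \<in> borel_measurable borel \<Longrightarrow> (\<And>y. \<bar>h y\<bar> \<le> B) \<Longrightarrow> q \<le> j \<Longrightarrow> \<bar>hs h j u - hs h j v\<bar> \<le> B * A * \<bar>u - v\<bar>"
proof -
  obtain p where p: "a (Suc p) \<noteq> 0" using a_nonzero by blast
  define A where "A = G1 / \<bar>a (Suc p)\<bar>"
  have "\<bar>hs h j u - hs h j v\<bar> \<le> B * A * \<bar>u - v\<bar>"
    if "h \<in> borel_measurable borel" "\<And>y. \<bar>h y\<bar> \<le> B" "Suc p \<le> j" for h B j u v
    using that(3)
  proof (induction j arbitrary: u v rule: dec_induct)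
    case base then show ?case using hs_lipschitz_smoothing[OF that(1,2) p] by (simp add: A_def)
  next
    case (step n) then show ?case using hs_lipschitz_Suc[OF that(1,2)] by blast
  qed
  moreover have "A \<ge> 0" using G1_nonneg by (simp add: A_def)
  ultimately show ?thesis using that by blast
qed

end

section \<open>Variance bounds for blocks\<close>

lemma real_lipschitz_of_deriv_bound:
  fixes h h' :: "real \<Rightarrow> real"
  assumes "\<And>y. (h has_real_derivative h' y) (at y)" "\<And>y. \<bar>h' y\<bar> \<le> B"
  shows "\<bar>h u - h v\<bar> \<le> B * \<bar>u - v\<bar>"
  using field_differentiable_bound[of UNIV h h' B u v] assms by (auto simp: has_field_derivative_at_within)

lemma taylor1_of_lipschitz_deriv:
  fixes h h' :: "real \<Rightarrow> real"
  assumes d: "\<And>y. (h has_real_derivative h' y) (at y)" and L: "\<And>u v. \<bar>h' u - h' v\<bar> \<le> L * \<bar>u - v\<bar>"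
  shows "\<bar>h (y + t) - h y - t * h' y\<bar> \<le> L * t\<^sup>2"
proof (cases "t = 0")
  case False
  have L0: "L \<ge> 0" using order_trans[OF abs_ge_zero L[of 1 0]] by simp
  have "\<exists>z. \<bar>z - y\<bar> \<le> \<bar>t\<bar> \<and> h (y + t) - h y = t * h' z"
  proof (cases "t > 0")
    case True
    then obtain z where "y < z" "z < y + t" "h (y+t) - h y = (y + t - y) * h' z"
      using MVT2[of y "y+t" h h'] d by auto
    then show ?thesis by (intro exI[of _ z]) auto
  next
    case f: False
    then obtain z where "y + t < z" "z < y" "h y - h (y+t) = (y - (y + t)) * h' z"
      using MVT2[of "y+t" y h h'] d False by auto
    then show ?thesis by (intro exI[of _ z]) auto
  qed
  then obtain z where z: "\<bar>z - y\<bar> \<le> \<bar>t\<bar>" "h (y + t) - h y = t * h' z" by blast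
  have "\<bar>h (y + t) - h y - t * h' y\<bar> = \<bar>t\<bar> * \<bar>h' z - h' y\<bar>"
    unfolding z(2) by (simp add: abs_mult[symmetric] right_diff_distrib)
  also have "\<dots> \<le> \<bar>t\<bar> * (L * \<bar>t\<bar>)"
    using L[of z y] z(1) L0 by (intro mult_left_mono) (auto intro: order_trans mult_left_mono)
  also have "\<dots> = L * t\<^sup>2" by (simp add: power2_eq_square)
  finally show ?thesis .
qed simp

context linear_innovations
begin

text \<open>The product of the size \<open>\<theta> n\<close> of a lag-\<open>n\<close> coefficient
  and the size \<open>sqrt n * \<theta> n\<close> of the remainder \<open>R\<close> behind it: the
  L2 order of a second order lag projection.\<close>

definition \<psi> :: "nat \<Rightarrow> real" where "\<psi> n = sqrt (real n) * (\<theta> n)\<^sup>2"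

lemma potter_\<psi>: "potter (2 * \<beta> - 1/2) \<psi>"
  unfolding \<psi>_def[abs_def] by (rule potter_sqrt_square[OF potter_\<theta>])

lemma R_moments:
  obtains V where "V > 0"
    "\<And>i j. integrable M (\<lambda>\<omega>. (R i j \<omega>)\<^sup>2)"
    "\<And>i j. expectation (\<lambda>\<omega>. (R i j \<omega>)\<^sup>2) \<le> V * real (Suc j) * (\<theta> (Suc j))\<^sup>2"
    "\<And>i j. integrable M (R i j)"
    "\<And>i j. expectation (\<lambda>\<omega>. \<bar>R i j \<omega>\<bar>) \<le> sqrt (V * real (Suc j)) * \<theta> (Suc j)"
proof -
  obtain V where V: "V > 0" "\<And>i j. (\<integral>\<^sup>+\<omega>. ennreal ((R i j \<omega>)\<^sup>2) \<partial>M) \<le> ennreal (V * real (Suc j) * (\<theta> (Suc j))\<^sup>2)"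
    using R_square_bound by blast
  have i2: "integrable M (\<lambda>\<omega>. (R i j \<omega>)\<^sup>2)" for i j
  proof (rule integrableI_nonneg)
    show "(\<integral>\<^sup>+\<omega>. ennreal ((R i j \<omega>)\<^sup>2) \<partial>M) < \<infinity>" using V(2)[of i j] by (rule le_less_trans) simp
  qed auto
  have e2: "expectation (\<lambda>\<omega>. (R i j \<omega>)\<^sup>2) \<le> V * real (Suc j) * (\<theta> (Suc j))\<^sup>2" for i j
  proof -
    have "ennreal (expectation (\<lambda>\<omega>. (R i j \<omega>)\<^sup>2)) = (\<integral>\<^sup>+\<omega>. ennreal ((R i j \<omega>)\<^sup>2) \<partial>M)"
      by (rule nn_integral_eq_integral[symmetric, OF i2]) simp
    also have "\<dots> \<le> ennreal (V * real (Suc j) * (\<theta> (Suc j))\<^sup>2)" by (rule V(2))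
    finally show ?thesis using V(1) by (subst (asm) ennreal_le_iff) auto
  qed
  have i1: "integrable M (R i j)" for i j by (rule square_integrable_imp_integrable[OF _ i2]) simp
  have e1: "expectation (\<lambda>\<omega>. \<bar>R i j \<omega>\<bar>) \<le> sqrt (V * real (Suc j)) * \<theta> (Suc j)" for i j
  proof -
    define \<rho> where "\<rho> = sqrt (V * real (Suc j)) * \<theta> (Suc j)"
    have \<rho>: "\<rho> > 0" using V(1) \<theta>_Suc_pos by (simp add: \<rho>_def)
    have \<rho>2: "\<rho>\<^sup>2 = V * real (Suc j) * (\<theta> (Suc j))\<^sup>2"
      using V(1) by (simp add: \<rho>_def power_mult_distrib)
    \<comment> \<open>Arithmetic-geometric mean with \<open>\<rho>\<close> the L2 bound, in place of
      Cauchy-Schwarz.\<close>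
    have "expectation (\<lambda>\<omega>. \<bar>R i j \<omega>\<bar>) \<le> expectation (\<lambda>\<omega>. ((R i j \<omega>)\<^sup>2 / \<rho> + \<rho>) / 2)"
    proof (rule integral_mono)
      show "\<bar>R i j \<omega>\<bar> \<le> ((R i j \<omega>)\<^sup>2 / \<rho> + \<rho>) / 2" for \<omega>
        using sum_squares_bound[of "\<bar>R i j \<omega>\<bar>" \<rho>] \<rho> by (simp add: field_simps power2_eq_square)
    qed (use i1 i2 in auto)
    also have "\<dots> = (expectation (\<lambda>\<omega>. (R i j \<omega>)\<^sup>2) / \<rho> + \<rho>) / 2"
      using i2 by (simp add: prob_space)
    also have "\<dots> \<le> (\<rho>\<^sup>2 / \<rho> + \<rho>) / 2"
      using e2[of i j] \<rho> unfolding \<rho>2 by (intro divide_right_mono add_right_mono) auto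
    also have "\<dots> = \<rho>" using \<rho> by (simp add: power2_eq_square)
    finally show ?thesis by (simp add: \<rho>_def)
  qed
  show ?thesis by (rule that[OF V(1) i2 e2 i1 e1])
qed

text \<open>This sequence bounds the mean of \<open>\<bar>R i j \<omega>\<bar>\<close>; its decay
  makes the telescoping sum of projections converge to the centred variable.\<close>

lemma sqrt_mult_\<theta>_tendsto_0: "(\<lambda>j. sqrt (V * real (Suc j)) * \<theta> (Suc j)) \<longlonglongrightarrow> 0"
proof -
  define p where "p = (1/2 + \<beta>)/2"
  have p: "p < \<beta>" "p > 1/2" using \<beta>_gt by (auto simp: p_def)
  obtain C where C: "C > 0" "\<forall>n\<ge>1. \<theta> n \<le> C * real n powr (-p)" using potter_upper[OF potter_\<theta> \<beta>_pos p(1)] by blast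
  have "(\<lambda>j. \<bar>sqrt V\<bar> * C * real (Suc j) powr (-(p - 1/2))) \<longlonglongrightarrow> \<bar>sqrt V\<bar> * C * 0"
    using p by (intro tendsto_intros tendsto_neg_powr filterlim_compose[OF filterlim_real_sequentially filterlim_Suc]) auto
  then have lim: "(\<lambda>j. \<bar>sqrt V\<bar> * C * real (Suc j) powr (-(p - 1/2))) \<longlonglongrightarrow> 0" by simp
  show ?thesis
  proof (rule Lim_null_comparison[OF _ lim], rule always_eventually, rule allI)
    fix j
    have "norm (sqrt (V * real (Suc j)) * \<theta> (Suc j)) = \<bar>sqrt V\<bar> * sqrt (real (Suc j)) * \<theta> (Suc j)"
      using \<theta>_Suc_pos[of j] by (simp add: real_sqrt_mult abs_mult)
    also have "\<dots> \<le> \<bar>sqrt V\<bar> * sqrt (real (Suc j)) * (C * real (Suc j) powr (-p))"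
      using C by (intro mult_left_mono) auto
    also have "\<dots> = \<bar>sqrt V\<bar> * C * (real (Suc j) powr (1/2) * real (Suc j) powr (-p))"
      by (simp add: powr_half_sqrt)
    also have "real (Suc j) powr (1/2) * real (Suc j) powr (-p) = real (Suc j) powr (-(p - 1/2))"
      by (simp flip: powr_add)
    finally show "norm (sqrt (V * real (Suc j)) * \<theta> (Suc j)) \<le> \<bar>sqrt V\<bar> * C * real (Suc j) powr (-(p - 1/2))" .
  qed
qed

text \<open>The linear case of the block bound: the lag-\<open>j\<close> projection of X_i is the
  term \<open>a j * \<epsilon> (i - int j)\<close> itself.\<close>

lemma X_block_bound:
  obtains K where "K > 0"
    "\<And>u n. n \<ge> 1 \<Longrightarrow> (\<integral>\<^sup>+\<omega>. ennreal ((\<Sum>i=u..<u+n. R (int i) 0 \<omega>)\<^sup>2) \<partial>M) \<le> ennreal (K * real n * (psum \<theta> n)\<^sup>2)"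
proof -
  obtain K where K: "K > 0" and main: "\<And>c d T u n. c \<ge> 0 \<Longrightarrow> (\<And>j. case_prod (d j) \<in> borel_measurable (borel \<Otimes>\<^sub>M borel)) \<Longrightarrow>
      (\<And>j r. (\<integral>e. d j e r \<partial>\<mu>) = 0) \<Longrightarrow>
      (\<And>i j. (\<integral>\<^sup>+\<omega>. ennreal ((d j (\<epsilon> (i - int j) \<omega>) (R i (Suc j) \<omega>))\<^sup>2) \<partial>M) \<le> ennreal (c * (\<theta> (Suc j))\<^sup>2)) \<Longrightarrow>
      (\<And>i. AE \<omega> in M. (\<lambda>J. \<Sum>j<J. d j (\<epsilon> (i - int j) \<omega>) (R i (Suc j) \<omega>)) \<longlonglongrightarrow> T i \<omega>) \<Longrightarrow> n \<ge> 1 \<Longrightarrow>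
      (\<integral>\<^sup>+\<omega>. ennreal ((\<Sum>i=u..<u+n. T (int i) \<omega>)\<^sup>2) \<partial>M) \<le> ennreal (c * K * real n * (psum \<theta> n)\<^sup>2)"
    by (rule block_bound[OF potter_\<theta> \<beta>_gt]) blast
  define c where "c = Ca\<^sup>2 * s2"
  have c: "c > 0" using Ca s2_pos by (simp add: c_def)
  have "(\<integral>\<^sup>+\<omega>. ennreal ((\<Sum>i=u..<u+n. R (int i) 0 \<omega>)\<^sup>2) \<partial>M) \<le> ennreal (c * K * real n * (psum \<theta> n)\<^sup>2)" if n: "n \<ge> 1" for u n
  proof (rule main[of c "\<lambda>j e r. a j * e" "\<lambda>i. R i 0" n u])
    show "(\<integral>e. a j * e \<partial>\<mu>) = 0" for j by (simp add: integral_\<mu>_id)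
    show "(\<integral>\<^sup>+\<omega>. ennreal ((a j * \<epsilon> (i - int j) \<omega>)\<^sup>2) \<partial>M) \<le> ennreal (c * (\<theta> (Suc j))\<^sup>2)" for i j
    proof -
      have "(\<integral>\<^sup>+\<omega>. ennreal ((a j * \<epsilon> (i - int j) \<omega>)\<^sup>2) \<partial>M) = ennreal (s2 * (a j)\<^sup>2)"
        using nn_integral_eps_sum_sq[of "{j}" "\<lambda>j. i - int j" a] by simp
      also have "\<dots> \<le> ennreal (s2 * (Ca\<^sup>2 * (\<theta> (Suc j))\<^sup>2))" using s2_nonneg by (intro ennreal_leI mult_left_mono a_sq_le)
      finally show ?thesis by (simp add: c_def mult_ac)
    qed
    show "AE \<omega> in M. (\<lambda>J. \<Sum>j<J. a j * \<epsilon> (i - int j) \<omega>) \<longlonglongrightarrow> R i 0 \<omega>" for i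
      using AE_summable[of i]
    proof eventually_elim
      case (elim \<omega>) show ?case using R_partial_tendsto[OF elim, of 0] by simp
    qed
  qed (use c n in auto)
  then show ?thesis using that[of "c * K"] c K by auto
qed

end

context smooth_linear
begin

text \<open>Smoothing with a centred variable has no first order effect. What remains is the Taylor
  error, the Lipschitz constant of the derivative times the second moment of the shift.\<close>

lemma hs_Suc_integral_bound:
  assumes "h' \<in> borel_measurable borel" "\<And>y. (h has_real_derivative h' y) (at y)"
    and "\<And>y. \<bar>h y\<bar> \<le> B" "\<And>y. \<bar>h' y\<bar> \<le> B"
    and L: "\<And>u v. \<bar>hs h' j u - hs h' j v\<bar> \<le> L * \<bar>u - v\<bar>"
  shows "\<bar>hs h (Suc j) y - hs h j y\<bar> \<le> L * (a (Suc j))\<^sup>2 * s2"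
proof -
  have "continuous_on UNIV h" using assms(2) by (meson DERIV_isCont continuous_at_imp_continuous_on)
  then have hm: "h \<in> borel_measurable borel" by (rule borel_measurable_continuous_onI)
  let ?b = "a (Suc j)"
  have T: "\<bar>hs h j (y + t) - hs h j y - t * hs h' j y\<bar> \<le> L * t\<^sup>2" for t
    by (rule taylor1_of_lipschitz_deriv[OF hs_deriv[OF assms(1-4)] L])
  note i = hs_integrable[OF hm assms(3)]
  have e: "hs h (Suc j) y - hs h j y = (\<integral>e. hs h j (y - ?b * e) - hs h j y + ?b * hs h' j y * e \<partial>\<mu>)"
    using i integrable_\<mu>_id by (simp add: integral_\<mu>_id)
  have "\<bar>hs h (Suc j) y - hs h j y\<bar> \<le> (\<integral>e. \<bar>hs h j (y - ?b * e) - hs h j y + ?b * hs h' j y * e\<bar> \<partial>\<mu>)"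
    unfolding e by (rule integral_abs_bound)
  also have "\<dots> \<le> (\<integral>e. L * ?b\<^sup>2 * e\<^sup>2 \<partial>\<mu>)"
  proof (rule integral_mono)
    show "\<bar>hs h j (y - ?b * e) - hs h j y + ?b * hs h' j y * e\<bar> \<le> L * ?b\<^sup>2 * e\<^sup>2" for e
      using T[of "- ?b * e"] by (simp add: power_mult_distrib mult_ac)
  qed (use i integrable_\<mu>_id integrable_\<mu>_sq in auto)
  also have "\<dots> = L * ?b\<^sup>2 * s2" by (simp add: s2_def)
  finally show ?thesis .
qed

text \<open>At \<open>y = x - r\<close> the linearized projection splits into the Taylor error of
  \<open>hs h j\<close>, the smoothing error of its mean, and \<open>b * e\<close> times the
  difference between \<open>c\<close> and the derivative at \<open>y\<close>. The first two are of
  order \<open>b^2\<close>. The third carries the factor \<open>|r| + \<rho>\<close>, because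
  \<open>c\<close> is also the mean of the Lipschitz function \<open>hs h' j\<close> at the
  remainder.\<close>

lemma hs_remainder:
  assumes hm': "h' \<in> borel_measurable borel" and der: "\<And>y. (h has_real_derivative h' y) (at y)"
    and B: "\<And>y. \<bar>h y\<bar> \<le> B" "\<And>y. \<bar>h' y\<bar> \<le> B"
    and L: "\<And>u v. \<bar>hs h' j u - hs h' j v\<bar> \<le> L * \<bar>u - v\<bar>"
    and \<rho>: "expectation (\<lambda>\<omega>. \<bar>R 0 (Suc j) \<omega>\<bar>) \<le> \<rho>" "integrable M (R 0 (Suc j))"
    and c: "c = expectation (\<lambda>\<omega>. h' (x - R 0 1 \<omega>))"
  defines "b \<equiv> a (Suc j)"
  shows "(hs h j (x - b * e - r) - hs h (Suc j) (x - r) + c * b * e)\<^sup>2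
     \<le> 2 * L\<^sup>2 * b^4 * (e\<^sup>2 + s2)\<^sup>2 + 4 * L\<^sup>2 * b\<^sup>2 * e\<^sup>2 * (r\<^sup>2 + \<rho>\<^sup>2)"
proof -
  have L0: "L \<ge> 0" using order_trans[OF abs_ge_zero L[of 1 0]] by simp
  have [measurable]: "hs h' j \<in> borel_measurable borel" using hm' by simp
  have T: "\<bar>hs h j (y + t) - hs h j y - t * hs h' j y\<bar> \<le> L * t\<^sup>2" for y t
    by (rule taylor1_of_lipschitz_deriv[OF hs_deriv[OF hm' der B] L])
  define y where "y = x - r"
  have 1: "\<bar>hs h j (y - b * e) - hs h j y + b * e * hs h' j y\<bar> \<le> L * b\<^sup>2 * e\<^sup>2"
    using T[of y "- b * e"] by (simp add: power_mult_distrib)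
  have 2: "\<bar>hs h (Suc j) y - hs h j y\<bar> \<le> L * b\<^sup>2 * s2"
    unfolding b_def by (rule hs_Suc_integral_bound[OF hm' der B L])
  have "c = expectation (\<lambda>\<omega>. hs h' j (x - R 0 (Suc j) \<omega>))" unfolding c using expectation_hs[OF hm' B(2)] by simp
  then have e: "c - hs h' j y = expectation (\<lambda>\<omega>. hs h' j (x - R 0 (Suc j) \<omega>) - hs h' j y)"
    using integrable_const_bound[of "\<lambda>\<omega>. hs h' j (x - R 0 (Suc j) \<omega>)" B] by (simp add: hs_bound[OF hm' B(2)] prob_space)
  have "\<bar>c - hs h' j y\<bar> \<le> expectation (\<lambda>\<omega>. \<bar>hs h' j (x - R 0 (Suc j) \<omega>) - hs h' j y\<bar>)"
    unfolding e by (rule integral_abs_bound)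
  also have "\<dots> \<le> expectation (\<lambda>\<omega>. L * (\<bar>r\<bar> + \<bar>R 0 (Suc j) \<omega>\<bar>))"
  proof (rule integral_mono)
    show "integrable M (\<lambda>\<omega>. \<bar>hs h' j (x - R 0 (Suc j) \<omega>) - hs h' j y\<bar>)"
      using integrable_const_bound[of "\<lambda>\<omega>. hs h' j (x - R 0 (Suc j) \<omega>)" B] by (simp add: hs_bound[OF hm' B(2)])
    fix \<omega>
    have "\<bar>x - R 0 (Suc j) \<omega> - y\<bar> \<le> \<bar>r\<bar> + \<bar>R 0 (Suc j) \<omega>\<bar>" unfolding y_def by linarith
    then have "L * \<bar>x - R 0 (Suc j) \<omega> - y\<bar> \<le> L * (\<bar>r\<bar> + \<bar>R 0 (Suc j) \<omega>\<bar>)" using L0 by (rule mult_left_mono)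
    then show "\<bar>hs h' j (x - R 0 (Suc j) \<omega>) - hs h' j y\<bar> \<le> L * (\<bar>r\<bar> + \<bar>R 0 (Suc j) \<omega>\<bar>)"
      using L[of "x - R 0 (Suc j) \<omega>" y] by linarith
  qed (use \<rho>(2) in auto)
  also have "\<dots> = L * (\<bar>r\<bar> + expectation (\<lambda>\<omega>. \<bar>R 0 (Suc j) \<omega>\<bar>))" using \<rho>(2) by (simp add: prob_space)
  also have "\<dots> \<le> L * (\<bar>r\<bar> + \<rho>)" using L0 \<rho> by (intro mult_left_mono) auto
  finally have 3: "\<bar>c - hs h' j y\<bar> \<le> L * (\<bar>r\<bar> + \<rho>)" .
  define P where "P = L * b\<^sup>2 * (e\<^sup>2 + s2)"
  define Q where "Q = \<bar>b * e\<bar> * (L * (\<bar>r\<bar> + \<rho>))"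
  have "\<bar>b * e * (c - hs h' j y)\<bar> \<le> Q" unfolding Q_def abs_mult[of "b * e"] by (intro mult_left_mono 3) auto
  moreover have "hs h j (x - b * e - r) - hs h (Suc j) (x - r) + c * b * e
     = (hs h j (y - b * e) - hs h j y + b * e * hs h' j y) - (hs h (Suc j) y - hs h j y) + b * e * (c - hs h' j y)"
    by (simp add: y_def algebra_simps)
  ultimately have "\<bar>hs h j (x - b * e - r) - hs h (Suc j) (x - r) + c * b * e\<bar> \<le> P + Q"
    using 1 2 unfolding P_def by (simp only: distrib_left)
  then have "(hs h j (x - b * e - r) - hs h (Suc j) (x - r) + c * b * e)\<^sup>2 \<le> (P + Q)\<^sup>2"
    by (metis abs_ge_zero power2_abs power_mono)
  also have "\<dots> \<le> 2 * P\<^sup>2 + 2 * Q\<^sup>2" using sum_squares_bound[of P Q] by (simp add: power2_sum)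
  also have "2 * P\<^sup>2 = 2 * L\<^sup>2 * b^4 * (e\<^sup>2 + s2)\<^sup>2" by (simp add: P_def power_mult_distrib)
  also have "2 * Q\<^sup>2 \<le> 4 * L\<^sup>2 * b\<^sup>2 * e\<^sup>2 * (r\<^sup>2 + \<rho>\<^sup>2)"
  proof -
    have "(\<bar>r\<bar> + \<rho>)\<^sup>2 \<le> 2 * (r\<^sup>2 + \<rho>\<^sup>2)" using sum_squares_bound[of "\<bar>r\<bar>" \<rho>] by (simp add: power2_sum)
    then have "2 * (b\<^sup>2 * e\<^sup>2 * L\<^sup>2) * (\<bar>r\<bar> + \<rho>)\<^sup>2 \<le> 2 * (b\<^sup>2 * e\<^sup>2 * L\<^sup>2) * (2 * (r\<^sup>2 + \<rho>\<^sup>2))" by (intro mult_left_mono) auto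
    moreover have "2 * Q\<^sup>2 = 2 * (b\<^sup>2 * e\<^sup>2 * L\<^sup>2) * (\<bar>r\<bar> + \<rho>)\<^sup>2" by (simp add: Q_def power_mult_distrib)
    moreover have "2 * (b\<^sup>2 * e\<^sup>2 * L\<^sup>2) * (2 * (r\<^sup>2 + \<rho>\<^sup>2)) = 4 * L\<^sup>2 * b\<^sup>2 * e\<^sup>2 * (r\<^sup>2 + \<rho>\<^sup>2)" by algebra
    ultimately show ?thesis by linarith
  qed
  finally show ?thesis by simp
qed

text \<open>The summand is the limit of its telescoping lag projections. At small lags the smoothed
  derivative need not be Lipschitz yet, and a crude bound is absorbed into the constant; beyond them
  \<open>hs_remainder\<close> gives the order \<open>\<psi>\<close>.\<close>

lemma T_block_bound:
  assumes hm': "h' \<in> borel_measurable borel" and der: "\<And>y. (h has_real_derivative h' y) (at y)"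
    and B: "\<And>y. \<bar>h y\<bar> \<le> B" "\<And>y. \<bar>h' y\<bar> \<le> B"
  obtains K where "K > 0"
    "\<And>x m c u n. (\<And>i. expectation (\<lambda>\<omega>. h (x - R i 1 \<omega>)) = m) \<Longrightarrow> (\<And>i. expectation (\<lambda>\<omega>. h' (x - R i 1 \<omega>)) = c) \<Longrightarrow> n \<ge> 1 \<Longrightarrow>
      (\<integral>\<^sup>+\<omega>. ennreal ((\<Sum>i=u..<u+n. h (x - R (int i) 1 \<omega>) - m + c * R (int i) 0 \<omega>)\<^sup>2) \<partial>M) \<le> ennreal (K * real n * (psum \<psi> n)\<^sup>2)"
proof -
  have "continuous_on UNIV h" using der by (meson DERIV_isCont continuous_at_imp_continuous_on)
  then have hm: "h \<in> borel_measurable borel" by (rule borel_measurable_continuous_onI)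
  have B0: "B \<ge> 0" using order_trans[OF abs_ge_zero B(1)[of 0]] .
  have hsm[measurable]: "hs h j \<in> borel_measurable borel" "hs h' j \<in> borel_measurable borel" for j using hm hm' by simp_all
  have g2: "2 * \<beta> - 1/2 > 1/2" using \<beta>_gt by simp
  obtain K where K: "K > 0" and main: "\<And>c d T u n. c \<ge> 0 \<Longrightarrow> (\<And>j. case_prod (d j) \<in> borel_measurable (borel \<Otimes>\<^sub>M borel)) \<Longrightarrow>
      (\<And>j r. (\<integral>e. d j e r \<partial>\<mu>) = 0) \<Longrightarrow>
      (\<And>i j. (\<integral>\<^sup>+\<omega>. ennreal ((d j (\<epsilon> (i - int j) \<omega>) (R i (Suc j) \<omega>))\<^sup>2) \<partial>M) \<le> ennreal (c * (\<psi> (Suc j))\<^sup>2)) \<Longrightarrow>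
      (\<And>i. AE \<omega> in M. (\<lambda>J. \<Sum>j<J. d j (\<epsilon> (i - int j) \<omega>) (R i (Suc j) \<omega>)) \<longlonglongrightarrow> T i \<omega>) \<Longrightarrow> n \<ge> 1 \<Longrightarrow>
      (\<integral>\<^sup>+\<omega>. ennreal ((\<Sum>i=u..<u+n. T (int i) \<omega>)\<^sup>2) \<partial>M) \<le> ennreal (c * K * real n * (psum \<psi> n)\<^sup>2)"
    by (rule block_bound[OF potter_\<psi> g2]) blast
  obtain V where V: "V > 0" and Ri2: "\<And>i j. integrable M (\<lambda>\<omega>. (R i j \<omega>)\<^sup>2)"
    and Re2: "\<And>i j. expectation (\<lambda>\<omega>. (R i j \<omega>)\<^sup>2) \<le> V * real (Suc j) * (\<theta> (Suc j))\<^sup>2"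
    and Ri1: "\<And>i j. integrable M (R i j)"
    and Re1: "\<And>i j. expectation (\<lambda>\<omega>. \<bar>R i j \<omega>\<bar>) \<le> sqrt (V * real (Suc j)) * \<theta> (Suc j)"
    by (rule R_moments) blast
  obtain q A where A: "A \<ge> 0" and lip0: "\<And>h B j u v. h \<in> borel_measurable borel \<Longrightarrow> (\<And>y. \<bar>h y\<bar> \<le> B) \<Longrightarrow> q \<le> j \<Longrightarrow> \<bar>hs h j u - hs h j v\<bar> \<le> B * A * \<bar>u - v\<bar>"
    by (rule hs_eventually_lipschitz) blast
  define L where "L = B * A"
  have lip: "\<bar>hs h' j u - hs h' j v\<bar> \<le> L * \<bar>u - v\<bar>" if "q \<le> j" for j u v
    unfolding L_def by (rule lip0[OF hm' B(2) that])
  obtain Cd where Cd: "Cd > 0" "\<forall>m n. 1 \<le> m \<longrightarrow> m \<le> n \<longrightarrow> \<theta> n \<le> Cd * \<theta> m"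
    using potter_decreasing[OF potter_\<theta> \<beta>_pos] by blast
  define amax where "amax = Ca\<^sup>2 * (Cd * \<theta> 1)\<^sup>2"
  have amax: "(a j)\<^sup>2 \<le> amax" for j
  proof -
    have "(\<theta> (Suc j))\<^sup>2 \<le> (Cd * \<theta> 1)\<^sup>2" using Cd(2) \<theta>_Suc_pos[of j] by (intro power_mono) auto
    then show ?thesis unfolding amax_def using a_sq_le[of j] by (meson mult_left_mono order_trans zero_le_power2)
  qed
  define M4 where "M4 = (\<integral>e. (e\<^sup>2 + s2)\<^sup>2 \<partial>\<mu>)"
  have iM4: "integrable \<mu> (\<lambda>e. (e\<^sup>2 + s2)\<^sup>2)"
  proof -
    have "integrable \<mu> (\<lambda>e. e^4 + 2 * s2 * e\<^sup>2 + s2\<^sup>2)" using integrable_\<mu>_4 integrable_\<mu>_sq by simp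
    then show ?thesis by (simp add: power2_sum algebra_simps)
  qed
  have M4: "M4 \<ge> 0" unfolding M4_def by simp
  define Csmall where "Csmall = 8 * B\<^sup>2 + 2 * B\<^sup>2 * amax * s2"
  have Csmall: "Csmall \<ge> 0" using s2_nonneg by (simp add: Csmall_def amax_def)
  define Cbig where "Cbig = 2 * L\<^sup>2 * Ca^4 * M4 + 4 * L\<^sup>2 * Ca\<^sup>2 * s2 * V * (2 * Cd\<^sup>2 + 1)"
  have Cbig: "Cbig \<ge> 0" using s2_nonneg V M4 by (simp add: Cbig_def)
  have \<psi>pos: "\<psi> (Suc j) > 0" for j using potter_pos[OF potter_\<psi>, of "Suc j"] by simp
  \<comment> \<open>Dividing by the square of \<open>\<psi>\<close> at the finitely many small lags
    turns the crude bound \<open>Csmall\<close> into one of the required shape.\<close>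
  define c0 where "c0 = 1 + Cbig + (\<Sum>j\<le>q. Csmall / (\<psi> (Suc j))\<^sup>2)"
  have snn: "0 \<le> (\<Sum>j\<le>q. Csmall / (\<psi> (Suc j))\<^sup>2)" using Csmall by (intro sum_nonneg) auto
  have c0: "c0 > 0" unfolding c0_def using Cbig snn by linarith
  have c0small: "Csmall \<le> c0 * (\<psi> (Suc j))\<^sup>2" if "j \<le> q" for j
  proof -
    have "Csmall / (\<psi> (Suc j))\<^sup>2 \<le> (\<Sum>j\<le>q. Csmall / (\<psi> (Suc j))\<^sup>2)"
      using that Csmall by (intro member_le_sum[of j _ "\<lambda>j. Csmall / (\<psi> (Suc j))\<^sup>2"]) auto
    then have "Csmall / (\<psi> (Suc j))\<^sup>2 \<le> c0" unfolding c0_def using Cbig by linarith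
    then show ?thesis using \<psi>pos[of j] by (simp add: divide_simps)
  qed
  have c0big: "Cbig * (\<psi> (Suc j))\<^sup>2 \<le> c0 * (\<psi> (Suc j))\<^sup>2" for j
    unfolding c0_def using snn by (intro mult_right_mono) auto
  have main2: "(\<integral>\<^sup>+\<omega>. ennreal ((\<Sum>i=u..<u+n. h (x - R (int i) 1 \<omega>) - m + c * R (int i) 0 \<omega>)\<^sup>2) \<partial>M) \<le> ennreal (c0 * K * real n * (psum \<psi> n)\<^sup>2)"
    if m: "\<And>i. expectation (\<lambda>\<omega>. h (x - R i 1 \<omega>)) = m" and c: "\<And>i. expectation (\<lambda>\<omega>. h' (x - R i 1 \<omega>)) = c" and n: "n \<ge> 1"
    for x m c u n
  proof -
    have cB: "\<bar>c\<bar> \<le> B"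
    proof -
      have "\<bar>c\<bar> \<le> expectation (\<lambda>\<omega>. \<bar>h' (x - R 0 1 \<omega>)\<bar>)" unfolding c[of 0, symmetric] by (rule integral_abs_bound)
      also have "\<dots> \<le> expectation (\<lambda>\<omega>. B)"
        using hm' B B0 by (intro integral_mono integrable_const_bound[where B=B]) auto
      finally show ?thesis by (simp add: prob_space)
    qed
    \<comment> \<open>Lag 0 has only a linear part, because \<open>h (x - R i 1 \<omega>)\<close>
      does not involve \<open>\<epsilon> i\<close>. Lag \<open>Suc k\<close> adds the change from
      \<open>hs h k\<close> to \<open>hs h (Suc k)\<close>.\<close>
    define d where "d = (\<lambda>j e r. case j of 0 \<Rightarrow> c * a 0 * e | Suc k \<Rightarrow> hs h k (x - a (Suc k) * e - r) - hs h (Suc k) (x - r) + c * a (Suc k) * e)"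
    have d0: "d 0 = (\<lambda>e r. c * a 0 * e)" and dS: "\<And>k. d (Suc k) = (\<lambda>e r. hs h k (x - a (Suc k) * e - r) - hs h (Suc k) (x - r) + c * a (Suc k) * e)"
      by (auto simp: d_def)
    have dm[measurable]: "case_prod (d j) \<in> borel_measurable (borel \<Otimes>\<^sub>M borel)" for j
      by (cases j) (simp_all only: d0 dS, measurable)
    have dmean: "(\<integral>e. d j e r \<partial>\<mu>) = 0" for j r
    proof (cases j)
      case 0 then show ?thesis by (simp add: d0 integral_\<mu>_id)
    next
      case (Suc k)
      have "integrable \<mu> (\<lambda>e. hs h k ((x - r) - a (Suc k) * e))" by (rule hs_integrable[OF hm B(1)])
      then have "integrable \<mu> (\<lambda>e. hs h k (x - a (Suc k) * e - r))" by (simp add: algebra_simps)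
      then have "(\<integral>e. d j e r \<partial>\<mu>) = (\<integral>e. hs h k (x - a (Suc k) * e - r) \<partial>\<mu>) - hs h (Suc k) (x - r)"
        unfolding Suc dS using integrable_\<mu>_id by (simp add: integral_\<mu>_id)
      also have "(\<integral>e. hs h k (x - a (Suc k) * e - r) \<partial>\<mu>) = hs h (Suc k) (x - r)" by (simp add: algebra_simps)
      finally show ?thesis by simp
    qed
    have dsmall: "(d j e r)\<^sup>2 \<le> 8 * B\<^sup>2 + 2 * B\<^sup>2 * amax * e\<^sup>2" for j e r
    proof -
      have ce: "(c * a j * e)\<^sup>2 \<le> B\<^sup>2 * amax * e\<^sup>2"
      proof -
        have "c\<^sup>2 \<le> B\<^sup>2" using power_mono[OF cB, of 2] by simp
        then have "c\<^sup>2 * (a j)\<^sup>2 * e\<^sup>2 \<le> B\<^sup>2 * amax * e\<^sup>2" using amax[of j] by (intro mult_right_mono mult_mono) auto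
        then show ?thesis by (simp add: power_mult_distrib)
      qed
      show ?thesis
      proof (cases j)
        case 0
        have "0 \<le> B\<^sup>2 * amax * e\<^sup>2" by (simp add: amax_def)
        moreover have "0 \<le> 8 * B\<^sup>2" by simp
        ultimately show ?thesis using ce 0 by (simp only: d0)
      next
        case (Suc k)
        define P where "P = hs h k (x - a (Suc k) * e - r) - hs h (Suc k) (x - r)"
        have "\<bar>P\<bar> \<le> 2 * B" unfolding P_def using hs_bound[OF hm B(1), of k "x - a (Suc k) * e - r"] hs_bound[OF hm B(1), of "Suc k" "x - r"] by linarith
        then have "P\<^sup>2 \<le> (2 * B)\<^sup>2" by (metis abs_ge_zero power2_abs power_mono)
        moreover have "(P + c * a j * e)\<^sup>2 \<le> 2 * P\<^sup>2 + 2 * (c * a j * e)\<^sup>2" using sum_squares_bound[of P "c * a j * e"] by (simp add: power2_sum)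
        moreover have "d j e r = P + c * a j * e" by (simp add: Suc dS P_def)
        ultimately show ?thesis using ce by (simp add: power_mult_distrib)
      qed
    qed
    have nsmall: "(\<integral>\<^sup>+\<omega>. ennreal ((d j (\<epsilon> (i - int j) \<omega>) (R i (Suc j) \<omega>))\<^sup>2) \<partial>M) \<le> ennreal Csmall" for i j
    proof -
      have "(\<integral>\<^sup>+\<omega>. ennreal ((d j (\<epsilon> (i - int j) \<omega>) (R i (Suc j) \<omega>))\<^sup>2) \<partial>M) \<le> (\<integral>\<^sup>+\<omega>. ennreal (8 * B\<^sup>2 + 2 * B\<^sup>2 * amax * (\<epsilon> (i - int j) \<omega>)\<^sup>2) \<partial>M)"
        by (intro nn_integral_mono ennreal_leI dsmall)
      also have "\<dots> = ennreal (expectation (\<lambda>\<omega>. 8 * B\<^sup>2 + 2 * B\<^sup>2 * amax * (\<epsilon> (i - int j) \<omega>)\<^sup>2))"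
        using sq_integrable by (intro nn_integral_eq_integral) (auto simp: amax_def)
      also have "expectation (\<lambda>\<omega>. 8 * B\<^sup>2 + 2 * B\<^sup>2 * amax * (\<epsilon> (i - int j) \<omega>)\<^sup>2) = Csmall"
        using sq_integrable by (simp add: Csmall_def prob_space expectation_eps_sq)
      finally show ?thesis .
    qed
    \<comment> \<open>The two parts of the remainder bound are of order \<open>b^4\<close> and
      \<open>b^2\<close> times the second moment of \<open>R\<close>. Both are at most a multiple of
      \<open>n * \<theta> n ^ 4\<close> with \<open>n = Suc (Suc k)\<close>, the square of
      \<open>\<psi>\<close>. The fourth moment of the innovations enters through
      \<open>M4\<close>.\<close>
    have nbig: "(\<integral>\<^sup>+\<omega>. ennreal ((d (Suc k) (\<epsilon> (i - int (Suc k)) \<omega>) (R i (Suc (Suc k)) \<omega>))\<^sup>2) \<partial>M) \<le> ennreal (Cbig * (\<psi> (Suc (Suc k)))\<^sup>2)"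
      if k: "q \<le> k" for i k
    proof -
      define t where "t = \<theta> (Suc (Suc k))"
      define b where "b = a (Suc k)"
      define \<rho> where "\<rho> = sqrt (V * real (Suc (Suc k))) * t"
      have t: "t > 0" unfolding t_def by (rule \<theta>_Suc_pos)
      have \<rho>2: "\<rho>\<^sup>2 = V * real (Suc (Suc k)) * t\<^sup>2" using V by (simp add: \<rho>_def power_mult_distrib)
      define \<alpha> where "\<alpha> = 2 * L\<^sup>2 * b^4"
      define \<gamma> where "\<gamma> = 4 * L\<^sup>2 * b\<^sup>2"
      have ag: "\<alpha> \<ge> 0" "\<gamma> \<ge> 0" by (simp_all add: \<alpha>_def \<gamma>_def)
      have dle: "(d (Suc k) e r)\<^sup>2 \<le> \<alpha> * (e\<^sup>2 + s2)\<^sup>2 + \<gamma> * e\<^sup>2 * (r\<^sup>2 + \<rho>\<^sup>2)" for e r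
        unfolding dS \<alpha>_def \<gamma>_def b_def
        by (rule hs_remainder[OF hm' der B lip[OF k] _ _ c[symmetric]]) (use Re1[of 0 "Suc k"] Ri1 in \<open>simp_all add: \<rho>_def t_def\<close>)
      have "(\<integral>\<^sup>+\<omega>. ennreal ((d (Suc k) (\<epsilon> (i - int (Suc k)) \<omega>) (R i (Suc (Suc k)) \<omega>))\<^sup>2) \<partial>M)
        \<le> (\<integral>\<^sup>+\<omega>. (\<lambda>(e,r). ennreal (\<alpha> * (e\<^sup>2 + s2)\<^sup>2 + \<gamma> * e\<^sup>2 * (r\<^sup>2 + \<rho>\<^sup>2))) (\<epsilon> (i - int (Suc k)) \<omega>, R i (Suc (Suc k)) \<omega>) \<partial>M)"
        by (intro nn_integral_mono) (simp only: split_conv, intro ennreal_leI dle)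
      also have "\<dots> = (\<integral>\<^sup>+\<omega>. (\<integral>\<^sup>+e. (\<lambda>(e,r). ennreal (\<alpha> * (e\<^sup>2 + s2)\<^sup>2 + \<gamma> * e\<^sup>2 * (r\<^sup>2 + \<rho>\<^sup>2))) (e, R i (Suc (Suc k)) \<omega>) \<partial>\<mu>) \<partial>M)"
      proof (rule freeze_nn)
        show "R i (Suc (Suc k)) \<in> borel_measurable (past (i - int (Suc k)))" by (rule R_past) simp
      qed measurable
      also have "\<dots> = (\<integral>\<^sup>+\<omega>. ennreal (\<alpha> * M4 + \<gamma> * s2 * ((R i (Suc (Suc k)) \<omega>)\<^sup>2 + \<rho>\<^sup>2)) \<partial>M)"
      proof (rule nn_integral_cong)
        fix \<omega>
        let ?r = "(R i (Suc (Suc k)) \<omega>)\<^sup>2 + \<rho>\<^sup>2"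
        have "(\<integral>\<^sup>+e. ennreal (\<alpha> * (e\<^sup>2 + s2)\<^sup>2 + \<gamma> * e\<^sup>2 * ?r) \<partial>\<mu>) = ennreal (\<integral>e. \<alpha> * (e\<^sup>2 + s2)\<^sup>2 + \<gamma> * e\<^sup>2 * ?r \<partial>\<mu>)"
          using iM4 integrable_\<mu>_sq ag by (intro nn_integral_eq_integral) auto
        also have "(\<integral>e. \<alpha> * (e\<^sup>2 + s2)\<^sup>2 + \<gamma> * e\<^sup>2 * ?r \<partial>\<mu>) = \<alpha> * M4 + \<gamma> * s2 * ?r"
          using iM4 integrable_\<mu>_sq by (simp add: M4_def s2_def)
        finally show "(\<integral>\<^sup>+e. (\<lambda>(e,r). ennreal (\<alpha> * (e\<^sup>2 + s2)\<^sup>2 + \<gamma> * e\<^sup>2 * (r\<^sup>2 + \<rho>\<^sup>2))) (e, R i (Suc (Suc k)) \<omega>) \<partial>\<mu>) = ennreal (\<alpha> * M4 + \<gamma> * s2 * ?r)"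
          by simp
      qed
      also have "\<dots> = ennreal (expectation (\<lambda>\<omega>. \<alpha> * M4 + \<gamma> * s2 * ((R i (Suc (Suc k)) \<omega>)\<^sup>2 + \<rho>\<^sup>2)))"
        using Ri2 ag M4 s2_nonneg by (intro nn_integral_eq_integral) auto
      also have "expectation (\<lambda>\<omega>. \<alpha> * M4 + \<gamma> * s2 * ((R i (Suc (Suc k)) \<omega>)\<^sup>2 + \<rho>\<^sup>2)) = \<alpha> * M4 + \<gamma> * s2 * (expectation (\<lambda>\<omega>. (R i (Suc (Suc k)) \<omega>)\<^sup>2) + \<rho>\<^sup>2)"
        using Ri2 by (simp add: prob_space)
      also have "ennreal \<dots> \<le> ennreal (Cbig * (\<psi> (Suc (Suc k)))\<^sup>2)"
      proof (rule ennreal_leI)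
        let ?n = "real (Suc (Suc k))"
        have b2: "b\<^sup>2 \<le> Ca\<^sup>2 * t\<^sup>2" unfolding b_def t_def by (rule a_sq_le)
        have b4: "b^4 \<le> Ca^4 * (?n * t^4)"
        proof -
          have "(b\<^sup>2)\<^sup>2 \<le> (Ca\<^sup>2 * t\<^sup>2)\<^sup>2" by (rule power_mono[OF b2]) simp
          also have "\<dots> = Ca^4 * (1 * t^4)" by (simp add: power_mult_distrib)
          also have "\<dots> \<le> Ca^4 * (?n * t^4)" using Ca t by (intro mult_left_mono mult_right_mono) auto
          finally show ?thesis by simp
        qed
        have "expectation (\<lambda>\<omega>. (R i (Suc (Suc k)) \<omega>)\<^sup>2) \<le> V * real (Suc (Suc (Suc k))) * (\<theta> (Suc (Suc (Suc k))))\<^sup>2" by (rule Re2)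
        also have "\<dots> \<le> V * (2 * ?n) * (Cd * t)\<^sup>2"
          using V Cd \<theta>_Suc_pos[of "Suc (Suc k)"] unfolding t_def by (intro mult_mono power_mono) auto
        finally have r2: "expectation (\<lambda>\<omega>. (R i (Suc (Suc k)) \<omega>)\<^sup>2) + \<rho>\<^sup>2 \<le> V * ?n * t\<^sup>2 * (2 * Cd\<^sup>2 + 1)"
          unfolding \<rho>2 by (simp add: power_mult_distrib algebra_simps)
        have "\<alpha> * M4 \<le> 2 * L\<^sup>2 * (Ca^4 * (?n * t^4)) * M4"
          unfolding \<alpha>_def using b4 M4 by (intro mult_right_mono mult_left_mono) auto
        moreover have "\<gamma> * s2 * (expectation (\<lambda>\<omega>. (R i (Suc (Suc k)) \<omega>)\<^sup>2) + \<rho>\<^sup>2) \<le> 4 * L\<^sup>2 * (Ca\<^sup>2 * t\<^sup>2) * s2 * (V * ?n * t\<^sup>2 * (2 * Cd\<^sup>2 + 1))"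
          unfolding \<gamma>_def using b2 r2 s2_nonneg by (intro mult_mono) auto
        moreover have "2 * L\<^sup>2 * (Ca^4 * (?n * t^4)) * M4 + 4 * L\<^sup>2 * (Ca\<^sup>2 * t\<^sup>2) * s2 * (V * ?n * t\<^sup>2 * (2 * Cd\<^sup>2 + 1)) = Cbig * (?n * t^4)"
          unfolding Cbig_def by algebra
        moreover have "(\<psi> (Suc (Suc k)))\<^sup>2 = ?n * t^4" by (simp add: \<psi>_def t_def power_mult_distrib)
        ultimately show "\<alpha> * M4 + \<gamma> * s2 * (expectation (\<lambda>\<omega>. (R i (Suc (Suc k)) \<omega>)\<^sup>2) + \<rho>\<^sup>2) \<le> Cbig * (\<psi> (Suc (Suc k)))\<^sup>2" by simp
      qed
      finally show ?thesis .
    qed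
    show ?thesis
    proof (rule main[of c0 d "\<lambda>i \<omega>. h (x - R i 1 \<omega>) - m + c * R i 0 \<omega>" n u])
      show "0 \<le> c0" using c0 by simp
      show "(\<integral>\<^sup>+\<omega>. ennreal ((d j (\<epsilon> (i - int j) \<omega>) (R i (Suc j) \<omega>))\<^sup>2) \<partial>M) \<le> ennreal (c0 * (\<psi> (Suc j))\<^sup>2)" for i j
      proof (cases "j \<le> q")
        case True
        show ?thesis by (rule order_trans[OF nsmall ennreal_leI[OF c0small[OF True]]])
      next
        case False
        then obtain k where "j = Suc k" "q \<le> k" by (cases j) auto
        then show ?thesis using nbig[of k i] ennreal_leI[OF c0big[of j]] by (metis order_trans)
      qed
      fix i
      show "AE \<omega> in M. (\<lambda>J. \<Sum>j<J. d j (\<epsilon> (i - int j) \<omega>) (R i (Suc j) \<omega>)) \<longlonglongrightarrow> h (x - R i 1 \<omega>) - m + c * R i 0 \<omega>"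
        using AE_summable[of i]
      proof eventually_elim
        case (elim \<omega>)
        have tele: "(\<Sum>j<Suc J. d j (\<epsilon> (i - int j) \<omega>) (R i (Suc j) \<omega>)) = c * (\<Sum>j<Suc J. a j * \<epsilon> (i - int j) \<omega>) + h (x - R i 1 \<omega>) - hs h J (x - R i (Suc J) \<omega>)" for J
        proof (induction J)
          case 0 then show ?case by (simp add: d0)
        next
          case (Suc J)
          have "R i (Suc J) \<omega> = a (Suc J) * \<epsilon> (i - int (Suc J)) \<omega> + R i (Suc (Suc J)) \<omega>" by (rule R_Suc[OF elim])
          then have "x - R i (Suc J) \<omega> = x - a (Suc J) * \<epsilon> (i - int (Suc J)) \<omega> - R i (Suc (Suc J)) \<omega>" by simp
          then show ?case using Suc unfolding sum.lessThan_Suc[of _ "Suc J"] dS by (simp add: algebra_simps)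
        qed
        \<comment> \<open>By the Lipschitz bound, \<open>hs h J\<close> at the remainder differs
          from its mean \<open>m\<close> by at most \<open>B\<close> times the sum of
          \<open>|R|\<close> and its mean, which vanishes as the lag grows.\<close>
        have "(\<lambda>J. hs h J (x - R i (Suc J) \<omega>) - m) \<longlonglongrightarrow> 0"
        proof (rule Lim_null_comparison)
          have "(\<lambda>J. B * (\<bar>R i (Suc J) \<omega>\<bar> + sqrt (V * real (Suc (Suc J))) * \<theta> (Suc (Suc J)))) \<longlonglongrightarrow> B * (\<bar>0\<bar> + 0)"
            by (intro tendsto_intros LIMSEQ_Suc[OF R_tendsto_0[OF elim]] LIMSEQ_Suc[OF sqrt_mult_\<theta>_tendsto_0])
          then show "(\<lambda>J. B * (\<bar>R i (Suc J) \<omega>\<bar> + sqrt (V * real (Suc (Suc J))) * \<theta> (Suc (Suc J)))) \<longlonglongrightarrow> 0" by simp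
          show "\<forall>\<^sub>F J in sequentially. norm (hs h J (x - R i (Suc J) \<omega>) - m) \<le> B * (\<bar>R i (Suc J) \<omega>\<bar> + sqrt (V * real (Suc (Suc J))) * \<theta> (Suc (Suc J)))"
          proof (rule always_eventually, rule allI)
            fix J
            let ?y = "x - R i (Suc J) \<omega>"
            have int: "integrable M (\<lambda>\<omega>'. hs h J (x - R i (Suc J) \<omega>'))"
              by (rule integrable_const_bound[where B=B]) (simp_all add: hs_bound[OF hm B(1)])
            have "m = expectation (\<lambda>\<omega>'. hs h J (x - R i (Suc J) \<omega>'))" using m[of i] expectation_hs[OF hm B(1), of J x i] by simp
            then have e: "hs h J ?y - m = expectation (\<lambda>\<omega>'. hs h J ?y - hs h J (x - R i (Suc J) \<omega>'))"
              using int by (simp add: prob_space)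
            have "\<bar>hs h J ?y - m\<bar> \<le> expectation (\<lambda>\<omega>'. \<bar>hs h J ?y - hs h J (x - R i (Suc J) \<omega>')\<bar>)"
              unfolding e by (rule integral_abs_bound)
            also have "\<dots> \<le> expectation (\<lambda>\<omega>'. B * (\<bar>R i (Suc J) \<omega>\<bar> + \<bar>R i (Suc J) \<omega>'\<bar>))"
            proof (rule integral_mono)
              fix \<omega>'
              have "\<bar>hs h J ?y - hs h J (x - R i (Suc J) \<omega>')\<bar> \<le> B * \<bar>?y - (x - R i (Suc J) \<omega>')\<bar>"
                by (rule real_lipschitz_of_deriv_bound[OF hs_deriv[OF hm' der B] hs_bound[OF hm' B(2)]])
              also have "\<dots> \<le> B * (\<bar>R i (Suc J) \<omega>\<bar> + \<bar>R i (Suc J) \<omega>'\<bar>)" using B0 by (intro mult_left_mono) auto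
              finally show "\<bar>hs h J ?y - hs h J (x - R i (Suc J) \<omega>')\<bar> \<le> B * (\<bar>R i (Suc J) \<omega>\<bar> + \<bar>R i (Suc J) \<omega>'\<bar>)" .
            qed (use int Ri1 in auto)
            also have "\<dots> = B * (\<bar>R i (Suc J) \<omega>\<bar> + expectation (\<lambda>\<omega>'. \<bar>R i (Suc J) \<omega>'\<bar>))"
              using Ri1 by (simp add: prob_space)
            also have "\<dots> \<le> B * (\<bar>R i (Suc J) \<omega>\<bar> + sqrt (V * real (Suc (Suc J))) * \<theta> (Suc (Suc J)))"
              using B0 by (intro mult_left_mono add_left_mono Re1)
            finally show "norm (hs h J ?y - m) \<le> B * (\<bar>R i (Suc J) \<omega>\<bar> + sqrt (V * real (Suc (Suc J))) * \<theta> (Suc (Suc J)))" by simp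
          qed
        qed
        then have l1: "(\<lambda>J. hs h J (x - R i (Suc J) \<omega>)) \<longlonglongrightarrow> m" by (rule LIM_zero_cancel)
        have "(\<lambda>J. \<Sum>j<J. a j * \<epsilon> (i - int j) \<omega>) \<longlonglongrightarrow> R i 0 \<omega>" using R_partial_tendsto[OF elim, of 0] by simp
        then have l2: "(\<lambda>J. \<Sum>j<Suc J. a j * \<epsilon> (i - int j) \<omega>) \<longlonglongrightarrow> R i 0 \<omega>" by (rule LIMSEQ_Suc)
        have "(\<lambda>J. \<Sum>j<Suc J. d j (\<epsilon> (i - int j) \<omega>) (R i (Suc j) \<omega>)) \<longlonglongrightarrow> c * R i 0 \<omega> + h (x - R i 1 \<omega>) - m"
          unfolding tele by (intro tendsto_intros l1 l2)
        then have "(\<lambda>J. \<Sum>j<J. d j (\<epsilon> (i - int j) \<omega>) (R i (Suc j) \<omega>)) \<longlonglongrightarrow> c * R i 0 \<omega> + h (x - R i 1 \<omega>) - m"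
          by (rule LIMSEQ_imp_Suc)
        then show ?case by (simp add: algebra_simps)
      qed
    qed (use dmean n in auto)
  qed
  show ?thesis by (rule that[of "c0 * K"]) (use c0 K main2 in auto)
qed

end

section \<open>Almost sure rates\<close>

text \<open>For \<open>\<gamma> < 1\<close> the weights \<open>psum \<theta> (2^r)\<close> of the dyadic maximal inequality grow
  geometrically; otherwise their sum costs one more logarithm, which is squared here.\<close>

definition rate :: "real \<Rightarrow> (nat \<Rightarrow> real) \<Rightarrow> nat \<Rightarrow> real" where
  "rate \<gamma> \<theta> n = real n * (psum \<theta> n)\<^sup>2 * (if \<gamma> < 1 then 1 else (ln (real n))\<^sup>2) * ln (real n) * (ln (ln (real n)))\<^sup>2"

text \<open>27 = 3^3 and e <= 3. From 27 on \<open>ln n\<close> is at least 3 and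
  \<open>ln (ln n)\<close> at least 1, whence this threshold in all rates.\<close>

lemma ln_ge_3: "n \<ge> 27 \<Longrightarrow> 3 \<le> ln (real n)"
proof -
  assume n: "n \<ge> 27"
  have "exp (3::real) = exp 1 ^ 3" by (simp flip: exp_of_nat_mult)
  also have "\<dots> \<le> 3 ^ 3" by (rule power_mono[OF exp_le]) simp
  also have "\<dots> \<le> real n" using n by simp
  finally show ?thesis using n by (subst ln_ge_iff) auto
qed

lemma rate_nonneg: "n \<ge> 27 \<Longrightarrow> 0 \<le> rate \<gamma> \<theta> n"
  using ln_ge_3[of n] unfolding rate_def by (auto intro!: mult_nonneg_nonneg)

text \<open>Passage from the level \<open>D\<close> to \<open>n\<close>: \<open>D\<close> is of
  order \<open>ln n\<close>, and \<open>psum\<close> at \<open>2^D\<close> is bounded by a multiple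
  of \<open>psum\<close> at \<open>n\<close> by doubling. From index 1 on the sum over the levels is
  estimated by \<open>D + 1\<close> times its largest term.\<close>

lemma dyadic_rate_le:
  assumes P: "potter \<gamma> \<theta>" and \<gamma>: "\<gamma> > 0"
  shows "\<exists>C>0. \<forall>n\<ge>27. \<forall>D. n \<le> 2^D \<longrightarrow> 2^D \<le> 2*n \<longrightarrow>
     2^D * (\<Sum>r\<le>D. psum \<theta> (2^r))\<^sup>2 * (real D * (ln (real D))\<^sup>2) \<le> C * rate \<gamma> \<theta> n"
proof -
  obtain C3 where C3: "C3 > 0" "\<forall>n\<ge>1. psum \<theta> (2*n) \<le> C3 * psum \<theta> n"
    using psum_double[OF P \<gamma>] by blast
  obtain C4 where C4: "C4 > 0" "\<gamma> < 1 \<longrightarrow> (\<forall>d. (\<Sum>r\<le>d. psum \<theta> (2^r)) \<le> C4 * psum \<theta> (2^d))"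
  proof (cases "\<gamma> < 1")
    case True then show ?thesis using psum_dyadic_sum[OF P \<gamma> True] that by blast
  next
    case False then show ?thesis using that[of 1] by simp
  qed
  define Cw where "Cw = C4 + 4"
  have Cw: "Cw > 0" using C4 by (simp add: Cw_def)
  have "2^D * (\<Sum>r\<le>D. psum \<theta> (2^r))\<^sup>2 * (real D * (ln (real D))\<^sup>2) \<le> (16 * (Cw * C3)\<^sup>2) * rate \<gamma> \<theta> n"
    if n: "n \<ge> 27" and D: "n \<le> 2^D" "2^D \<le> 2*n" for n D
  proof -
    define ln1 where "ln1 = (if \<gamma> < 1 then 1 else ln (real n))"
    have l3: "3 \<le> ln (real n)" by (rule ln_ge_3[OF n])
    \<comment> \<open>\<open>ln 2 >= 2/3\<close> explains the factor 3/2; the bound is below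
      \<open>2 * ln n\<close> once \<open>ln n >= 3\<close>.\<close>
    have D1: "real D \<le> 1 + 3/2 * ln (real n)"
    proof -
      have "real (2^D) \<le> real (2*n)" using D(2) by (rule of_nat_mono)
      then have "ln (2^D) \<le> ln (2 * real n)" by (subst ln_le_cancel_iff) (use n in auto)
      then have "real D * ln 2 \<le> ln 2 + ln (real n)" using n by (simp add: ln_realpow ln_mult)
      then have "(real D - 1) * ln 2 \<le> ln (real n)" by (simp add: algebra_simps)
      moreover have "(real D - 1) * (2/3) \<le> (real D - 1) * ln 2"
      proof (rule mult_left_mono[OF ln2_ge_two_thirds])
        have "D \<noteq> 0" using D(1) n by (intro notI) simp
        then show "0 \<le> real D - 1" by simp
      qed
      ultimately have "(real D - 1) * (2/3) \<le> ln (real n)" by (rule order_trans[rotated])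
      then show ?thesis by (simp add: field_simps)
    qed
    have Dpos: "1 \<le> real D" using D(1) n by (cases D) auto
    have D2: "real D \<le> 2 * ln (real n)" using D1 l3 by linarith
    have lD: "ln (real D) \<le> 2 * ln (ln (real n))"
    proof -
      have "ln (real D) \<le> ln (2 * ln (real n))" using D2 Dpos by (subst ln_le_cancel_iff) auto
      also have "\<dots> = ln 2 + ln (ln (real n))" using l3 by (subst ln_mult) auto
      also have "ln 2 \<le> ln (ln (real n))" using l3 by (subst ln_le_cancel_iff) auto
      finally show ?thesis by simp
    qed
    have pw: "psum \<theta> (2^D) \<le> C3 * psum \<theta> n"
      using psum_mono_potter[OF P \<gamma> D(2)] C3(2)[rule_format, of n] n by linarith
    have p0: "0 \<le> psum \<theta> m" for m by (rule psum_nonneg_potter[OF P \<gamma>])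
    have W: "(\<Sum>r\<le>D. psum \<theta> (2^r)) \<le> Cw * ln1 * psum \<theta> (2^D)"
    proof (cases "\<gamma> < 1")
      case True
      then have "(\<Sum>r\<le>D. psum \<theta> (2^r)) \<le> C4 * psum \<theta> (2^D)" using C4 by blast
      also have "\<dots> \<le> Cw * psum \<theta> (2^D)" using p0 by (intro mult_right_mono) (auto simp: Cw_def)
      finally show ?thesis using True by (simp add: ln1_def)
    next
      case False
      have "(\<Sum>r\<le>D. psum \<theta> (2^r)) \<le> (\<Sum>r\<le>D. psum \<theta> (2^D))"
        by (intro sum_mono psum_mono_potter[OF P \<gamma>]) (auto intro: power_increasing)
      also have "\<dots> = (real D + 1) * psum \<theta> (2^D)" by (simp add: algebra_simps)
      also have "\<dots> \<le> (Cw * ln (real n)) * psum \<theta> (2^D)"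
      proof (intro mult_right_mono p0)
        have "real D + 1 \<le> 4 * ln (real n)" using D1 l3 by linarith
        also have "\<dots> \<le> Cw * ln (real n)" using C4 l3 by (intro mult_right_mono) (auto simp: Cw_def)
        finally show "real D + 1 \<le> Cw * ln (real n)" .
      qed
      finally show ?thesis using False by (simp add: ln1_def)
    qed
    have ln1: "ln1 \<ge> 0" using l3 by (simp add: ln1_def)
    have "(\<Sum>r\<le>D. psum \<theta> (2^r)) \<le> Cw * ln1 * (C3 * psum \<theta> n)"
      using W pw Cw ln1 by (smt (verit) mult_left_mono mult_nonneg_nonneg)
    then have W2: "(\<Sum>r\<le>D. psum \<theta> (2^r))\<^sup>2 \<le> (Cw * ln1 * (C3 * psum \<theta> n))\<^sup>2"
      by (intro power_mono sum_nonneg p0)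
    have two: "(2::real)^D \<le> 2 * real n" using of_nat_mono[OF D(2), where 'a=real] by simp
    have LD: "real D * (ln (real D))\<^sup>2 \<le> 2 * ln (real n) * (2 * ln (ln (real n)))\<^sup>2"
      using D2 lD Dpos l3 by (intro mult_mono power_mono) auto
    have "2^D * (\<Sum>r\<le>D. psum \<theta> (2^r))\<^sup>2 * (real D * (ln (real D))\<^sup>2)
      \<le> (2 * real n) * (Cw * ln1 * (C3 * psum \<theta> n))\<^sup>2 * (2 * ln (real n) * (2 * ln (ln (real n)))\<^sup>2)"
      using l3 by (intro mult_mono[OF mult_mono[OF two W2] LD]) auto
    also have "\<dots> = 16 * (Cw * C3)\<^sup>2 * (real n * (psum \<theta> n)\<^sup>2 * ln1\<^sup>2 * ln (real n) * (ln (ln (real n)))\<^sup>2)"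
      by (simp add: power_mult_distrib mult_ac)
    also have "real n * (psum \<theta> n)\<^sup>2 * ln1\<^sup>2 * ln (real n) * (ln (ln (real n)))\<^sup>2 = rate \<gamma> \<theta> n"
      by (simp add: rate_def ln1_def)
    finally show ?thesis .
  qed
  moreover have "16 * (Cw * C3)\<^sup>2 > 0" using Cw C3 by simp
  ultimately show ?thesis by blast
qed

text \<open>The level used is the first with \<open>n < 2^D\<close>, where the dyadic rate becomes
  one in \<open>n\<close>. Only \<open>n <= 2^D\<close> is recorded, as the maximal inequality asks
  for no more.\<close>

lemma AE_rate:
  assumes P: "potter \<gamma> \<theta>" and \<gamma>: "\<gamma> > 0" and Q: "\<And>d. Q d \<in> borel_measurable M" and K: "K \<ge> 0"
    and le: "\<And>d. (\<integral>\<^sup>+\<omega>. Q d \<omega> \<partial>M) \<le> ennreal (K * 2^d * (\<Sum>r\<le>d. psum \<theta> (2^r))\<^sup>2)"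
  shows "AE \<omega> in M. \<exists>C\<ge>0. \<forall>n\<ge>27. \<exists>D. n \<le> 2^D \<and> Q D \<omega> \<le> ennreal (C * rate \<gamma> \<theta> n)"
proof -
  obtain C0 where C0: "C0 > 0" "\<forall>n\<ge>27. \<forall>D. n \<le> 2^D \<longrightarrow> 2^D \<le> 2*n \<longrightarrow>
     2^D * (\<Sum>r\<le>D. psum \<theta> (2^r))\<^sup>2 * (real D * (ln (real D))\<^sup>2) \<le> C0 * rate \<gamma> \<theta> n"
    using dyadic_rate_le[OF P \<gamma>] by blast
  define G where "G = (\<lambda>d. sqrt (2^d) * (\<Sum>r\<le>d. psum \<theta> (2^r)))"
  have G2: "(G d)\<^sup>2 = 2^d * (\<Sum>r\<le>d. psum \<theta> (2^r))\<^sup>2" for d by (simp add: G_def power_mult_distrib)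
  have Gpos: "G d > 0" for d
    unfolding G_def by (intro mult_pos_pos sum_pos psum_pos_potter[OF P \<gamma>]) auto
  have "AE \<omega> in M. \<exists>C\<ge>0. \<forall>d\<ge>3. Q d \<omega> \<le> ennreal (C * (G d)\<^sup>2 * (real d * (ln (real d))\<^sup>2))"
    by (rule AE_dyadic_rate[OF Q Gpos K]) (use le in \<open>simp add: G2 mult_ac\<close>)
  then show ?thesis
  proof eventually_elim
    case (elim \<omega>)
    then obtain C where C: "C \<ge> 0" "\<forall>d\<ge>3. Q d \<omega> \<le> ennreal (C * (G d)\<^sup>2 * (real d * (ln (real d))\<^sup>2))" by blast
    have "\<exists>D. n \<le> 2^D \<and> Q D \<omega> \<le> ennreal ((C * C0) * rate \<gamma> \<theta> n)" if n: "n \<ge> 27" for n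
    proof -
      obtain d where d: "2^d \<le> n" "n < 2^Suc d" using ex_power_ivl1[of 2 n] n by auto
      have d3: "3 \<le> Suc d"
      proof (rule ccontr)
        assume "\<not> 3 \<le> Suc d"
        then have "(2::nat)^Suc d \<le> 2^3" by (intro power_increasing) linarith+
        then show False using d n by simp
      qed
      then have "Q (Suc d) \<omega> \<le> ennreal (C * (G (Suc d))\<^sup>2 * (real (Suc d) * (ln (real (Suc d)))\<^sup>2))" using C(2) d3 by blast
      also have "\<dots> \<le> ennreal (C * (C0 * rate \<gamma> \<theta> n))"
      proof (rule ennreal_leI)
        have "2^Suc d * (\<Sum>r\<le>Suc d. psum \<theta> (2^r))\<^sup>2 * (real (Suc d) * (ln (real (Suc d)))\<^sup>2) \<le> C0 * rate \<gamma> \<theta> n"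
          using C0(2)[rule_format, of n "Suc d"] n d by simp
        then show "C * (G (Suc d))\<^sup>2 * (real (Suc d) * (ln (real (Suc d)))\<^sup>2) \<le> C * (C0 * rate \<gamma> \<theta> n)"
          unfolding G2 mult.assoc[of C] using C(1) by (intro mult_left_mono) auto
      qed
      finally show ?thesis using d by (intro exI[of _ "Suc d"]) (auto simp: mult.assoc)
    qed
    then show ?case using C(1) C0(1) by (intro exI[of _ "C * C0"]) auto
  qed
qed

lemma sum_shift_Suc: "(\<Sum>i=u..<u+n. f (Suc i)) = (\<Sum>i=Suc u..<Suc u+n. f i)" for f :: "nat \<Rightarrow> real"
  by (rule sum.reindex_bij_witness[of _ "\<lambda>i. i - 1" Suc]) auto

lemma sum_lessThan_Suc_eq: "(\<Sum>i<n. f (Suc i)) = (\<Sum>i=1..n. f i)" for f :: "nat \<Rightarrow> real"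
  by (rule sum.reindex_bij_witness[of _ "\<lambda>i. i - 1" Suc]) auto

lemma (in linear_innovations) X_rate:
  "AE \<omega> in M. \<exists>C\<ge>0. \<forall>n\<ge>27. (\<Sum>i=1..n. R (int i) 0 \<omega>)\<^sup>2 \<le> C * rate \<beta> \<theta> n"
proof -
  obtain K where K: "K > 0" and bd:
    "\<And>u n. n \<ge> 1 \<Longrightarrow> (\<integral>\<^sup>+\<omega>. ennreal ((\<Sum>i=u..<u+n. R (int i) 0 \<omega>)\<^sup>2) \<partial>M) \<le> ennreal (K * real n * (psum \<theta> n)\<^sup>2)"
    by (rule X_block_bound) blast
  define w where "w = (\<lambda>r::nat. psum \<theta> (2^r))"
  have w: "w r > 0" for r unfolding w_def by (rule psum_pos_potter[OF potter_\<theta> \<beta>_pos]) simp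
  define Q where "Q = (\<lambda>d \<omega>. ennreal (dyadic_form w (\<lambda>l. R (int (Suc l)) 0 \<omega>) d))"
  have "AE \<omega> in M. \<exists>C\<ge>0. \<forall>n\<ge>27. \<exists>D. n \<le> 2^D \<and> Q D \<omega> \<le> ennreal (C * rate \<beta> \<theta> n)"
  proof (rule AE_rate[OF potter_\<theta> \<beta>_pos, where K=K])
    show "Q d \<in> borel_measurable M" for d unfolding Q_def dyadic_form_def by measurable
    show "(\<integral>\<^sup>+\<omega>. Q d \<omega> \<partial>M) \<le> ennreal (K * 2^d * (\<Sum>r\<le>d. psum \<theta> (2^r))\<^sup>2)" for d
      unfolding Q_def w_def[symmetric]
    proof (rule order_trans[OF nn_integral_dyadic_form[where c=K and V="\<lambda>n. (psum \<theta> n)\<^sup>2"]])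
      fix u n :: nat assume n: "n \<ge> 1"
      show "(\<integral>\<^sup>+\<omega>. ennreal ((\<Sum>i=u..<u+n. R (int (Suc i)) 0 \<omega>)\<^sup>2) \<partial>M) \<le> ennreal (K * real n * (psum \<theta> n)\<^sup>2)"
        using bd[OF n, of "Suc u"] unfolding sum_shift_Suc[where f="\<lambda>i. R (int i) 0 _"] .
    qed (use w K in \<open>auto simp: w_def\<close>)
  qed (use K in simp)
  then show ?thesis
  proof eventually_elim
    case (elim \<omega>)
    then obtain C where C: "C \<ge> 0" "\<forall>n\<ge>27. \<exists>D. n \<le> 2^D \<and> Q D \<omega> \<le> ennreal (C * rate \<beta> \<theta> n)" by blast
    have "(\<Sum>i=1..n. R (int i) 0 \<omega>)\<^sup>2 \<le> C * rate \<beta> \<theta> n" if n: "n \<ge> 27" for n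
    proof -
      obtain D where D: "n \<le> 2^D" "Q D \<omega> \<le> ennreal (C * rate \<beta> \<theta> n)" using C(2) n by blast
      have "(\<Sum>i=1..n. R (int i) 0 \<omega>)\<^sup>2 = (\<Sum>i<n. R (int (Suc i)) 0 \<omega>)\<^sup>2"
        using sum_lessThan_Suc_eq[of "\<lambda>i. R (int i) 0 \<omega>" n] by simp
      also have "\<dots> \<le> dyadic_form w (\<lambda>l. R (int (Suc l)) 0 \<omega>) D" by (rule dyadic_maximal[OF w D(1)])
      also have "\<dots> \<le> C * rate \<beta> \<theta> n"
        using D(2) C(1) rate_nonneg[OF n] unfolding Q_def by (subst (asm) ennreal_le_iff) auto
      finally show ?thesis .
    qed
    then show ?case using C(1) by blast
  qed
qed

text \<open>The difference of \<open>s^2\<close> at two points is at most the integral of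
  \<open>s^2 + s'^2\<close>; averaging over the second point gives a one-dimensional Sobolev
  embedding. It replaces a supremum over \<open>x\<close> by integrals that can be exchanged with
  the expectation.\<close>

lemma sobolev_sup:
  fixes s s' :: "real \<Rightarrow> real"
  assumes der: "\<And>t. (s has_real_derivative s' t) (at t)" and cont: "continuous_on UNIV s'"
    and K: "K \<ge> 1/2" and x: "x \<in> {-K..K}"
  shows "ennreal ((s x)\<^sup>2) \<le> (\<integral>\<^sup>+t. indicator {-K..K} t * ennreal (2 * (s t)\<^sup>2 + (s' t)\<^sup>2) \<partial>lborel)"
proof -
  have cs: "continuous_on A s" for A using der by (meson DERIV_isCont continuous_at_imp_continuous_on)
  have cs': "continuous_on A s'" for A using cont continuous_on_subset by blast
  have iI: "f integrable_on {-K..K}" if "continuous_on {-K..K} f" for f :: "real \<Rightarrow> real"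
    using that by (rule integrable_continuous_interval)
  let ?f = "\<lambda>t. (s t)\<^sup>2 + (s' t)\<^sup>2"
  define I where "I = integral {-K..K} ?f"
  have diff: "\<bar>(s b)\<^sup>2 - (s a)\<^sup>2\<bar> \<le> I" if ab: "-K \<le> a" "a \<le> b" "b \<le> K" for a b
  proof -
    have "((\<lambda>t. 2 * s t * s' t) has_integral (s b)\<^sup>2 - (s a)\<^sup>2) {a..b}"
    proof (rule fundamental_theorem_of_calculus[OF ab(2)])
      fix t
      have "((\<lambda>t. (s t)\<^sup>2) has_real_derivative 2 * s t * s' t) (at t)"
        using DERIV_power[OF der[of t], of 2] by (simp add: mult_ac)
      then show "((\<lambda>t. (s t)\<^sup>2) has_vector_derivative 2 * s t * s' t) (at t within {a..b})"
        by (simp add: has_real_derivative_iff_has_vector_derivative has_vector_derivative_at_within)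
    qed
    then have e: "(s b)\<^sup>2 - (s a)\<^sup>2 = integral {a..b} (\<lambda>t. 2 * s t * s' t)" by (simp add: integral_unique)
    have "norm (integral {a..b} (\<lambda>t. 2 * s t * s' t)) \<le> integral {a..b} ?f"
    proof (rule integral_norm_bound_integral)
      show "(\<lambda>t. 2 * s t * s' t) integrable_on {a..b}" "?f integrable_on {a..b}"
        by (intro integrable_continuous_interval continuous_intros cs cs')+
      fix t
      show "norm (2 * s t * s' t) \<le> ?f t"
        using sum_squares_bound[of "\<bar>s t\<bar>" "\<bar>s' t\<bar>"] by (simp add: abs_mult)
    qed
    also have "\<dots> \<le> I" unfolding I_def
      by (rule integral_subset_le) (use ab in \<open>auto intro!: integrable_continuous_interval continuous_intros cs cs'\<close>)
    finally show ?thesis unfolding e by simp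
  qed
  have le: "(s x)\<^sup>2 \<le> (s y)\<^sup>2 + I" if "y \<in> {-K..K}" for y
    using diff[of x y] diff[of y x] that x by (cases "x \<le> y") (auto simp: abs_le_iff)
  have "integral {-K..K} (\<lambda>y. (s x)\<^sup>2) \<le> integral {-K..K} (\<lambda>y. (s y)\<^sup>2 + I)"
    by (rule integral_le) (use le in \<open>auto intro!: iI continuous_intros cs\<close>)
  also have "\<dots> = integral {-K..K} (\<lambda>y. (s y)\<^sup>2) + integral {-K..K} (\<lambda>y. I)"
    by (rule Henstock_Kurzweil_Integration.integral_add) (auto intro!: iI continuous_intros cs)
  finally have "(2 * K) * (s x)\<^sup>2 \<le> integral {-K..K} (\<lambda>y. (s y)\<^sup>2) + (2 * K) * I"
    using K by simp
  \<comment> \<open>The interval has length \<open>2 * K >= 1\<close>, so the average of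
    \<open>s^2\<close> is at most its integral.\<close>
  moreover have "1 * integral {-K..K} (\<lambda>y. (s y)\<^sup>2) \<le> (2 * K) * integral {-K..K} (\<lambda>y. (s y)\<^sup>2)"
    using K by (intro mult_right_mono integral_nonneg iI) (auto intro!: continuous_intros cs)
  ultimately have "(2 * K) * (s x)\<^sup>2 \<le> (2 * K) * (integral {-K..K} (\<lambda>y. (s y)\<^sup>2) + I)" by (simp add: distrib_left)
  then have "(s x)\<^sup>2 \<le> integral {-K..K} (\<lambda>y. (s y)\<^sup>2) + I" using K by (simp add: mult_le_cancel_left)
  also have "\<dots> = integral {-K..K} (\<lambda>t. (s t)\<^sup>2 + ?f t)"
    unfolding I_def by (rule Henstock_Kurzweil_Integration.integral_add[symmetric]) (auto intro!: iI continuous_intros cs cs')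
  also have "\<dots> = integral {-K..K} (\<lambda>t. 2 * (s t)\<^sup>2 + (s' t)\<^sup>2)" by (simp add: algebra_simps)
  finally have A: "(s x)\<^sup>2 \<le> integral {-K..K} (\<lambda>t. 2 * (s t)\<^sup>2 + (s' t)\<^sup>2)" .
  have "((\<lambda>t. 2 * (s t)\<^sup>2 + (s' t)\<^sup>2) has_integral integral {-K..K} (\<lambda>t. 2 * (s t)\<^sup>2 + (s' t)\<^sup>2)) {-K..K}"
    by (intro integrable_integral iI continuous_intros cs cs')
  then have "((\<lambda>t. if t \<in> {-K..K} then 2 * (s t)\<^sup>2 + (s' t)\<^sup>2 else 0) has_integral integral {-K..K} (\<lambda>t. 2 * (s t)\<^sup>2 + (s' t)\<^sup>2)) UNIV"
    by (subst has_integral_restrict_UNIV)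
  then have "(\<integral>\<^sup>+t. ennreal (if t \<in> {-K..K} then 2 * (s t)\<^sup>2 + (s' t)\<^sup>2 else 0) \<partial>lborel) = ennreal (integral {-K..K} (\<lambda>t. 2 * (s t)\<^sup>2 + (s' t)\<^sup>2))"
    by (intro nn_integral_has_integral_lborel) (use borel_measurable_continuous_onI[OF cs] borel_measurable_continuous_onI[OF cont] in \<open>auto\<close>)
  also have "(\<lambda>t. ennreal (if t \<in> {-K..K} then 2 * (s t)\<^sup>2 + (s' t)\<^sup>2 else 0)) = (\<lambda>t. indicator {-K..K} t * ennreal (2 * (s t)\<^sup>2 + (s' t)\<^sup>2))"
    by (auto simp: indicator_def)
  finally show ?thesis using A by (simp add: ennreal_leI)
qed

text \<open>The maximal forms of the sum and of its derivative in \<open>x\<close> are integrated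
  over \<open>x\<close> inside the expectation, by Fubini. The Sobolev bound then controls all
  \<open>x\<close> and all \<open>n <= 2^D\<close> together. Both forms are instances of one block
  bound, for the pairs \<open>(h, h1)\<close> and \<open>(h1, h2)\<close>.\<close>

lemma (in smooth_linear) T_rate:
  fixes h h1 h2 m0 m1 m2 :: "real \<Rightarrow> real"
  assumes d1: "\<And>y. (h has_real_derivative h1 y) (at y)" and d2: "\<And>y. (h1 has_real_derivative h2 y) (at y)"
    and h2[measurable]: "h2 \<in> borel_measurable borel"
    and B: "\<And>y. \<bar>h y\<bar> \<le> B" "\<And>y. \<bar>h1 y\<bar> \<le> B" "\<And>y. \<bar>h2 y\<bar> \<le> B"
    and m: "\<And>i x. expectation (\<lambda>\<omega>. h (x - R i 1 \<omega>)) = m0 x" "\<And>i x. expectation (\<lambda>\<omega>. h1 (x - R i 1 \<omega>)) = m1 x"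
      "\<And>i x. expectation (\<lambda>\<omega>. h2 (x - R i 1 \<omega>)) = m2 x"
    and dm: "\<And>x. (m0 has_real_derivative m1 x) (at x)" "\<And>x. (m1 has_real_derivative m2 x) (at x)"
    and cm2: "continuous_on UNIV m2" and K0: "K0 \<ge> 1/2"
  shows "AE \<omega> in M. \<exists>C\<ge>0. \<forall>n\<ge>27. \<forall>x\<in>{-K0..K0}. (\<Sum>i=1..n. h (x - R (int i) 1 \<omega>) - m0 x + m1 x * R (int i) 0 \<omega>)\<^sup>2 \<le> C * rate (2 * \<beta> - 1/2) \<psi> n"
proof -
  have \<gamma>: "2 * \<beta> - 1/2 > 0" using \<beta>_gt by simp
  have c1: "continuous_on UNIV h1" using d2 by (meson DERIV_isCont continuous_at_imp_continuous_on)
  have h1[measurable]: "h1 \<in> borel_measurable borel" by (rule borel_measurable_continuous_onI[OF c1])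
  have h[measurable]: "h \<in> borel_measurable borel"
    by (rule borel_measurable_continuous_onI) (use d1 in \<open>meson DERIV_isCont continuous_at_imp_continuous_on\<close>)
  have [measurable]: "m0 \<in> borel_measurable borel"
    by (rule borel_measurable_continuous_onI) (use dm in \<open>meson DERIV_isCont continuous_at_imp_continuous_on\<close>)
  have cm1: "continuous_on UNIV m1" using dm by (meson DERIV_isCont continuous_at_imp_continuous_on)
  have [measurable]: "m1 \<in> borel_measurable borel" by (rule borel_measurable_continuous_onI[OF cm1])
  have [measurable]: "m2 \<in> borel_measurable borel" by (rule borel_measurable_continuous_onI[OF cm2])
  obtain K1 where K1: "K1 > 0" and bd1: "\<And>x m c u n. (\<And>i. expectation (\<lambda>\<omega>. h (x - R i 1 \<omega>)) = m) \<Longrightarrow> (\<And>i. expectation (\<lambda>\<omega>. h1 (x - R i 1 \<omega>)) = c) \<Longrightarrow> n \<ge> 1 \<Longrightarrow>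
      (\<integral>\<^sup>+\<omega>. ennreal ((\<Sum>i=u..<u+n. h (x - R (int i) 1 \<omega>) - m + c * R (int i) 0 \<omega>)\<^sup>2) \<partial>M) \<le> ennreal (K1 * real n * (psum \<psi> n)\<^sup>2)"
    by (rule T_block_bound[OF h1 d1 B(1) B(2)]) blast
  obtain K2 where K2: "K2 > 0" and bd2: "\<And>x m c u n. (\<And>i. expectation (\<lambda>\<omega>. h1 (x - R i 1 \<omega>)) = m) \<Longrightarrow> (\<And>i. expectation (\<lambda>\<omega>. h2 (x - R i 1 \<omega>)) = c) \<Longrightarrow> n \<ge> 1 \<Longrightarrow>
      (\<integral>\<^sup>+\<omega>. ennreal ((\<Sum>i=u..<u+n. h1 (x - R (int i) 1 \<omega>) - m + c * R (int i) 0 \<omega>)\<^sup>2) \<partial>M) \<le> ennreal (K2 * real n * (psum \<psi> n)\<^sup>2)"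
    by (rule T_block_bound[OF h2 d2 B(2) B(3)]) blast
  define T0 where "T0 = (\<lambda>x l \<omega>. h (x - R (int (Suc l)) 1 \<omega>) - m0 x + m1 x * R (int (Suc l)) 0 \<omega>)"
  define T1 where "T1 = (\<lambda>x l \<omega>. h1 (x - R (int (Suc l)) 1 \<omega>) - m1 x + m2 x * R (int (Suc l)) 0 \<omega>)"
  define w where "w = (\<lambda>r::nat. psum \<psi> (2^r))"
  have w: "w r > 0" for r unfolding w_def by (rule psum_pos_potter[OF potter_\<psi> \<gamma>]) simp
  define D0 where "D0 = (\<lambda>d x \<omega>. dyadic_form w (\<lambda>l. T0 x l \<omega>) d)"
  define D1 where "D1 = (\<lambda>d x \<omega>. dyadic_form w (\<lambda>l. T1 x l \<omega>) d)"
  have D0nn: "0 \<le> D0 d x \<omega>" and D1nn: "0 \<le> D1 d x \<omega>" for d x \<omega>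
    unfolding D0_def D1_def by (intro dyadic_form_nonneg w)+
  have [measurable]: "T0 x l \<in> borel_measurable M" "T1 x l \<in> borel_measurable M" for x l
    unfolding T0_def T1_def by measurable
  have mm[measurable]: "(\<lambda>(x, \<omega>). D0 d x \<omega>) \<in> borel_measurable (lborel \<Otimes>\<^sub>M M)" "(\<lambda>(x, \<omega>). D1 d x \<omega>) \<in> borel_measurable (lborel \<Otimes>\<^sub>M M)" for d
    unfolding D0_def D1_def dyadic_form_def T0_def T1_def by measurable
  have mx[measurable]: "D0 d x \<in> borel_measurable M" "D1 d x \<in> borel_measurable M" for d x
    unfolding D0_def D1_def dyadic_form_def by measurable
  have E0: "(\<integral>\<^sup>+\<omega>. ennreal (D0 d x \<omega>) \<partial>M) \<le> ennreal (K1 * 2^d * (\<Sum>r\<le>d. w r)\<^sup>2)" for d x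
    unfolding D0_def
  proof (rule nn_integral_dyadic_form[where V="\<lambda>n. (psum \<psi> n)\<^sup>2"])
    fix u n :: nat assume n: "n \<ge> 1"
    show "(\<integral>\<^sup>+\<omega>. ennreal ((\<Sum>i=u..<u+n. T0 x i \<omega>)\<^sup>2) \<partial>M) \<le> ennreal (K1 * real n * (psum \<psi> n)\<^sup>2)"
      unfolding T0_def sum_shift_Suc[where f="\<lambda>i. h (x - R (int i) 1 _) - m0 x + m1 x * R (int i) 0 _"]
      by (rule bd1[OF m(1) m(2) n])
  qed (use w K1 in \<open>auto simp: w_def\<close>)
  have E1: "(\<integral>\<^sup>+\<omega>. ennreal (D1 d x \<omega>) \<partial>M) \<le> ennreal (K2 * 2^d * (\<Sum>r\<le>d. w r)\<^sup>2)" for d x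
    unfolding D1_def
  proof (rule nn_integral_dyadic_form[where V="\<lambda>n. (psum \<psi> n)\<^sup>2"])
    fix u n :: nat assume n: "n \<ge> 1"
    show "(\<integral>\<^sup>+\<omega>. ennreal ((\<Sum>i=u..<u+n. T1 x i \<omega>)\<^sup>2) \<partial>M) \<le> ennreal (K2 * real n * (psum \<psi> n)\<^sup>2)"
      unfolding T1_def sum_shift_Suc[where f="\<lambda>i. h1 (x - R (int i) 1 _) - m1 x + m2 x * R (int i) 0 _"]
      by (rule bd2[OF m(2) m(3) n])
  qed (use w K2 in \<open>auto simp: w_def\<close>)
  define Q where "Q = (\<lambda>d \<omega>. \<integral>\<^sup>+x. indicator {-K0..K0} x * ennreal (2 * D0 d x \<omega> + D1 d x \<omega>) \<partial>lborel)"
  define K where "K = (2 * K0) * (2 * K1 + K2)"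
  have K: "K \<ge> 0" using K0 K1 K2 by (simp add: K_def)
  interpret LM: pair_sigma_finite lborel M by unfold_locales
  have Qm: "Q d \<in> borel_measurable M" for d
    unfolding Q_def by measurable
  have "AE \<omega> in M. \<exists>C\<ge>0. \<forall>n\<ge>27. \<exists>D. n \<le> 2^D \<and> Q D \<omega> \<le> ennreal (C * rate (2 * \<beta> - 1/2) \<psi> n)"
  proof (rule AE_rate[OF potter_\<psi> \<gamma> Qm K])
    fix d
    let ?W = "2^d * (\<Sum>r\<le>d. w r)\<^sup>2"
    have "(\<integral>\<^sup>+\<omega>. Q d \<omega> \<partial>M) = (\<integral>\<^sup>+x. (\<integral>\<^sup>+\<omega>. indicator {-K0..K0} x * ennreal (2 * D0 d x \<omega> + D1 d x \<omega>) \<partial>M) \<partial>lborel)"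
      unfolding Q_def by (rule LM.Fubini') measurable
    also have "\<dots> = (\<integral>\<^sup>+x. indicator {-K0..K0} x * (\<integral>\<^sup>+\<omega>. ennreal (2 * D0 d x \<omega> + D1 d x \<omega>) \<partial>M) \<partial>lborel)"
      by (intro nn_integral_cong nn_integral_cmult) measurable
    also have "\<dots> \<le> (\<integral>\<^sup>+x. indicator {-K0..K0} x * ennreal ((2 * K1 + K2) * ?W) \<partial>lborel)"
    proof (intro nn_integral_mono mult_left_mono)
      fix x
      have "(\<integral>\<^sup>+\<omega>. ennreal (2 * D0 d x \<omega> + D1 d x \<omega>) \<partial>M) = (\<integral>\<^sup>+\<omega>. ennreal 2 * ennreal (D0 d x \<omega>) + ennreal (D1 d x \<omega>) \<partial>M)"
        using D0nn D1nn by (intro nn_integral_cong) (subst ennreal_mult[symmetric], simp, simp, subst ennreal_plus[symmetric], auto)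
      also have "\<dots> = ennreal 2 * (\<integral>\<^sup>+\<omega>. ennreal (D0 d x \<omega>) \<partial>M) + (\<integral>\<^sup>+\<omega>. ennreal (D1 d x \<omega>) \<partial>M)"
        by (subst nn_integral_add) (auto simp: nn_integral_cmult simp del: ennreal_numeral)
      also have "\<dots> \<le> ennreal 2 * ennreal (K1 * 2^d * (\<Sum>r\<le>d. w r)\<^sup>2) + ennreal (K2 * 2^d * (\<Sum>r\<le>d. w r)\<^sup>2)"
        by (intro add_mono mult_left_mono E0 E1) auto
      also have "\<dots> = ennreal (2 * (K1 * 2^d * (\<Sum>r\<le>d. w r)\<^sup>2) + K2 * 2^d * (\<Sum>r\<le>d. w r)\<^sup>2)"
        using K1 K2 by (subst ennreal_mult[symmetric], simp, simp, subst ennreal_plus[symmetric], auto)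
      also have "2 * (K1 * 2^d * (\<Sum>r\<le>d. w r)\<^sup>2) + K2 * 2^d * (\<Sum>r\<le>d. w r)\<^sup>2 = (2 * K1 + K2) * ?W" by (simp add: algebra_simps)
      finally show "(\<integral>\<^sup>+\<omega>. ennreal (2 * D0 d x \<omega> + D1 d x \<omega>) \<partial>M) \<le> ennreal ((2 * K1 + K2) * ?W)" .
    qed simp
    also have "\<dots> = ennreal (2 * K0) * ennreal ((2 * K1 + K2) * ?W)"
      using K0 by (simp add: nn_integral_multc)
    also have "\<dots> = ennreal ((2 * K0) * ((2 * K1 + K2) * ?W))"
      using K0 K1 K2 by (intro ennreal_mult[symmetric]) auto
    also have "(2 * K0) * ((2 * K1 + K2) * ?W) = K * 2^d * (\<Sum>r\<le>d. psum \<psi> (2^r))\<^sup>2" by (simp add: K_def w_def mult_ac)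
    finally show "(\<integral>\<^sup>+\<omega>. Q d \<omega> \<partial>M) \<le> ennreal (K * 2^d * (\<Sum>r\<le>d. psum \<psi> (2^r))\<^sup>2)" .
  qed
  then show ?thesis
  proof eventually_elim
    case (elim \<omega>)
    then obtain C where C: "C \<ge> 0" "\<forall>n\<ge>27. \<exists>D. n \<le> 2^D \<and> Q D \<omega> \<le> ennreal (C * rate (2 * \<beta> - 1/2) \<psi> n)" by blast
    have "(\<Sum>i=1..n. h (x - R (int i) 1 \<omega>) - m0 x + m1 x * R (int i) 0 \<omega>)\<^sup>2 \<le> C * rate (2 * \<beta> - 1/2) \<psi> n" if n: "n \<ge> 27" and x: "x \<in> {-K0..K0}" for n x
    proof -
      obtain D where D: "n \<le> 2^D" "Q D \<omega> \<le> ennreal (C * rate (2 * \<beta> - 1/2) \<psi> n)" using C(2) n by blast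
      define s where "s = (\<lambda>x. \<Sum>l<n. T0 x l \<omega>)"
      define s1 where "s1 = (\<lambda>x. \<Sum>l<n. T1 x l \<omega>)"
      have sd: "(s has_real_derivative s1 t) (at t)" for t
      proof -
        have "((\<lambda>x. h (x - r)) has_real_derivative h1 (t - r)) (at t)" for r
        proof -
          have "((\<lambda>x. x - r) has_real_derivative 1) (at t)" by (auto intro!: derivative_eq_intros)
          from DERIV_chain2[OF d1 this] show ?thesis by simp
        qed
        then have "((\<lambda>x. T0 x l \<omega>) has_real_derivative T1 t l \<omega>) (at t)" for l
          unfolding T0_def T1_def by (intro DERIV_add DERIV_diff DERIV_cmult_right dm)
        then show ?thesis unfolding s_def s1_def by (intro DERIV_sum) auto
      qed
      have s1c: "continuous_on UNIV s1"
        unfolding s1_def T1_def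
        by (intro continuous_intros continuous_on_compose2[OF c1] cm1 cm2) auto
      have "ennreal ((s x)\<^sup>2) \<le> (\<integral>\<^sup>+t. indicator {-K0..K0} t * ennreal (2 * (s t)\<^sup>2 + (s1 t)\<^sup>2) \<partial>lborel)"
        by (rule sobolev_sup[OF sd s1c K0 x])
      also have "\<dots> \<le> Q D \<omega>"
        unfolding Q_def
      proof (intro nn_integral_mono mult_left_mono ennreal_leI)
        fix t
        have "(s t)\<^sup>2 \<le> D0 D t \<omega>" unfolding s_def D0_def by (rule dyadic_maximal[OF w D(1)])
        moreover have "(s1 t)\<^sup>2 \<le> D1 D t \<omega>" unfolding s1_def D1_def by (rule dyadic_maximal[OF w D(1)])
        ultimately show "2 * (s t)\<^sup>2 + (s1 t)\<^sup>2 \<le> 2 * D0 D t \<omega> + D1 D t \<omega>" by linarith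
      qed simp
      also note D(2)
      finally have "(s x)\<^sup>2 \<le> C * rate (2 * \<beta> - 1/2) \<psi> n"
        using C(1) rate_nonneg[OF n] by (subst (asm) ennreal_le_iff) auto
      moreover have "s x = (\<Sum>i=1..n. h (x - R (int i) 1 \<omega>) - m0 x + m1 x * R (int i) 0 \<omega>)"
        unfolding s_def T0_def by (rule sum_lessThan_Suc_eq[of "\<lambda>i. h (x - R (int i) 1 \<omega>) - m0 x + m1 x * R (int i) 0 \<omega>"])
      ultimately show ?thesis by simp
    qed
    then show ?case using C(1) by blast
  qed
qed

section \<open>The martingale part of the empirical distribution function\<close>

lemma exp_le_quadratic:
  fixes x :: real
  assumes "\<bar>x\<bar> \<le> 1"
  shows "exp x \<le> 1 + x + x\<^sup>2"
proof (cases "x \<ge> 0")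
  case True then show ?thesis using exp_bound[of x] assms by auto
next
  case False
  define y where "y = - x"
  have y: "0 < y" "y \<le> 1" using False assms by (auto simp: y_def)
  have "1 + y \<le> exp y" by (rule exp_ge_add_one_self)
  then have "exp (- y) \<le> 1 / (1 + y)" using y by (simp add: exp_minus field_simps)
  also have "\<dots> \<le> 1 - y + y\<^sup>2"
  proof -
    have "1 \<le> 1 + y ^ 3" using y by simp
    also have "\<dots> = (1 - y + y\<^sup>2) * (1 + y)" by (simp add: power2_eq_square power3_eq_cube algebra_simps)
    finally show ?thesis using y by (simp add: divide_simps)
  qed
  finally show ?thesis by (simp add: y_def)
qed

lemma ennreal_exp_mult: "ennreal (exp a) * ennreal (exp b) = ennreal (exp (a + b))"
  unfolding exp_add by (rule ennreal_mult[symmetric]) simp_all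

context linear_innovations
begin

text \<open>At \<open>r = R i 1 \<omega>\<close> this is the conditional probability of
  \<open>\<epsilon> i + R i 1\<close> lying in \<open>A\<close> given the past of
  \<open>i\<close>.\<close>

definition P :: "real set \<Rightarrow> real \<Rightarrow> real" where
  "P A r = (\<integral>e. indicat_real A (e + r) \<partial>\<mu>)"

text \<open>If \<open>a 0 = 1\<close>, then almost surely \<open>\<epsilon> i + R i 1 = R i 0\<close>, so the first term is the indicator
  of \<open>R i 0 \<in> A\<close>.\<close>

definition md :: "real set \<Rightarrow> nat \<Rightarrow> 'a \<Rightarrow> real" where
  "md A i \<omega> = indicat_real A (\<epsilon> (int i) \<omega> + R (int i) 1 \<omega>) - P A (R (int i) 1 \<omega>)"

lemma P_measurable[measurable]:
  assumes [measurable]: "A \<in> sets borel"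
  shows "P A \<in> borel_measurable borel"
  unfolding P_def[abs_def] by (rule \<mu>.borel_measurable_lebesgue_integral) measurable

lemma integrable_indicator_shift: "A \<in> sets borel \<Longrightarrow> integrable \<mu> (\<lambda>e. indicat_real A (e + r))"
  by (rule \<mu>.integrable_const_bound[where B=1]) (auto simp: indicator_def)

lemma P_bounds: "A \<in> sets borel \<Longrightarrow> 0 \<le> P A r" "A \<in> sets borel \<Longrightarrow> P A r \<le> 1"
proof -
  assume A: "A \<in> sets borel"
  show "0 \<le> P A r" unfolding P_def by simp
  have "P A r \<le> (\<integral>e. 1 \<partial>\<mu>)"
    unfolding P_def by (rule integral_mono[OF integrable_indicator_shift[OF A]]) (auto simp: indicator_def)
  then show "P A r \<le> 1" using \<mu>.prob_space by simp
qed

lemma md_measurable[measurable]: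
  assumes [measurable]: "A \<in> sets borel"
  shows "md A i \<in> borel_measurable M"
  unfolding md_def[abs_def] by measurable

lemma md_past:
  assumes [measurable]: "A \<in> sets borel" and k: "int i < k"
  shows "md A i \<in> borel_measurable (past k)"
proof -
  have [measurable]: "\<epsilon> (int i) \<in> borel_measurable (past k)" "R (int i) 1 \<in> borel_measurable (past k)"
    using k by (auto intro: eps_past R_past)
  show ?thesis unfolding md_def[abs_def] by measurable
qed

text \<open>In the quadratic majorant of the exponential the linear term integrates to zero and the
  conditional variance \<open>p - p^2\<close> is at most \<open>v\<close>. Keeping \<open>v\<close>
  makes small sets cheap, as the modulus of continuity needs.\<close>

lemma exp_md_integral:
  assumes A[measurable]: "A \<in> sets borel" and l: "\<bar>l\<bar> \<le> 1" and v: "\<And>r. P A r \<le> v"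
  shows "(\<integral>\<^sup>+e. ennreal (exp (l * (indicat_real A (e + r) - P A r))) \<partial>\<mu>) \<le> ennreal (exp (l\<^sup>2 * v))"
proof -
  let ?I = "\<lambda>e. indicat_real A (e + r)" and ?p = "P A r"
  have i: "integrable \<mu> ?I" by (rule integrable_indicator_shift[OF A])
  have p: "0 \<le> ?p" "?p \<le> 1" using P_bounds[OF A] by auto
  have I2: "(?I e)\<^sup>2 = ?I e" for e by (simp add: indicator_def)
  have "(\<integral>\<^sup>+e. ennreal (exp (l * (?I e - ?p))) \<partial>\<mu>) \<le> (\<integral>\<^sup>+e. ennreal (1 + l * (?I e - ?p) + l\<^sup>2 * (?I e - 2 * ?p * ?I e + ?p\<^sup>2)) \<partial>\<mu>)"
  proof (intro nn_integral_mono ennreal_leI)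
    fix e
    have "\<bar>?I e - ?p\<bar> \<le> 1" using p by (auto simp: indicator_def)
    then have "\<bar>l * (?I e - ?p)\<bar> \<le> 1" using l mult_mono[of "\<bar>l\<bar>" 1 "\<bar>?I e - ?p\<bar>" 1] by (simp add: abs_mult)
    then have "exp (l * (?I e - ?p)) \<le> 1 + l * (?I e - ?p) + (l * (?I e - ?p))\<^sup>2" by (rule exp_le_quadratic)
    also have "(l * (?I e - ?p))\<^sup>2 = l\<^sup>2 * (?I e - 2 * ?p * ?I e + ?p\<^sup>2)"
      using I2[of e] by (simp add: power_mult_distrib power2_diff)
    finally show "exp (l * (?I e - ?p)) \<le> 1 + l * (?I e - ?p) + l\<^sup>2 * (?I e - 2 * ?p * ?I e + ?p\<^sup>2)" .
  qed
  also have "\<dots> = ennreal (\<integral>e. 1 + l * (?I e - ?p) + l\<^sup>2 * (?I e - 2 * ?p * ?I e + ?p\<^sup>2) \<partial>\<mu>)"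
  proof (rule nn_integral_eq_integral)
    show "integrable \<mu> (\<lambda>e. 1 + l * (?I e - ?p) + l\<^sup>2 * (?I e - 2 * ?p * ?I e + ?p\<^sup>2))" using i by simp
    show "AE e in \<mu>. 0 \<le> 1 + l * (?I e - ?p) + l\<^sup>2 * (?I e - 2 * ?p * ?I e + ?p\<^sup>2)"
    proof (rule AE_I2)
      fix e
      have "?I e - 2 * ?p * ?I e + ?p\<^sup>2 = (?I e - ?p)\<^sup>2" using I2[of e] by (simp add: power2_diff)
      moreover have "\<bar>l * (?I e - ?p)\<bar> \<le> 1" using l mult_mono[of "\<bar>l\<bar>" 1 "\<bar>?I e - ?p\<bar>" 1] p by (auto simp: abs_mult indicator_def)
      moreover have "0 \<le> l\<^sup>2 * (?I e - ?p)\<^sup>2" by simp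
      ultimately show "0 \<le> 1 + l * (?I e - ?p) + l\<^sup>2 * (?I e - 2 * ?p * ?I e + ?p\<^sup>2)" by (simp only:)
    qed
  qed
  also have "(\<integral>e. 1 + l * (?I e - ?p) + l\<^sup>2 * (?I e - 2 * ?p * ?I e + ?p\<^sup>2) \<partial>\<mu>) = 1 + l\<^sup>2 * (?p - ?p\<^sup>2)"
  proof -
    have "(\<integral>e. 1 + l * (?I e - ?p) + l\<^sup>2 * (?I e - 2 * ?p * ?I e + ?p\<^sup>2) \<partial>\<mu>) = 1 + l * ((\<integral>e. ?I e \<partial>\<mu>) - ?p) + l\<^sup>2 * ((\<integral>e. ?I e \<partial>\<mu>) - 2 * ?p * (\<integral>e. ?I e \<partial>\<mu>) + ?p\<^sup>2)"
      using i \<mu>.prob_space by simp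
    also have "(\<integral>e. ?I e \<partial>\<mu>) = ?p" by (simp add: P_def)
    finally show ?thesis by (simp add: power2_eq_square)
  qed
  also have "ennreal (1 + l\<^sup>2 * (?p - ?p\<^sup>2)) \<le> ennreal (exp (l\<^sup>2 * v))"
  proof (rule ennreal_leI)
    have "l\<^sup>2 * (?p - ?p\<^sup>2) \<le> l\<^sup>2 * v" using v[of r] by (intro mult_left_mono) (auto intro: order_trans[of _ ?p])
    then show "1 + l\<^sup>2 * (?p - ?p\<^sup>2) \<le> exp (l\<^sup>2 * v)" using exp_ge_add_one_self[of "l\<^sup>2 * v"] by linarith
  qed
  finally show ?thesis .
qed

text \<open>Induction along the martingale: the sum of the first \<open>n\<close> differences
  belongs to the past of time \<open>n + 1\<close>, so the last factor is integrated out
  alone.\<close>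

lemma exp_md_sum:
  assumes A[measurable]: "A \<in> sets borel" and l: "\<bar>l\<bar> \<le> 1" and v: "\<And>r. P A r \<le> v"
  shows "(\<integral>\<^sup>+\<omega>. ennreal (exp (l * (\<Sum>i=1..n. md A i \<omega>))) \<partial>M) \<le> ennreal (exp (real n * l\<^sup>2 * v))"
proof (induction n)
  case 0 then show ?case using emeasure_space_1 by simp
next
  case (Suc n)
  define S where "S = (\<lambda>\<omega>. \<Sum>i=1..n. md A i \<omega>)"
  define k where "k = int (Suc n)"
  have Sp: "S \<in> borel_measurable (past k)"
    unfolding S_def by (intro borel_measurable_sum md_past A) (auto simp: k_def)
  have Sm[measurable]: "S \<in> borel_measurable M" by (rule measurable_past_M[OF Sp])
  have Rp: "R k 1 \<in> borel_measurable (past k)" by (rule R_past) simp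
  have W: "(\<lambda>\<omega>. (R k 1 \<omega>, S \<omega>)) \<in> measurable (past k) (borel \<Otimes>\<^sub>M borel)" using Rp Sp by measurable
  define \<phi> where "\<phi> = (\<lambda>(e, r, s). ennreal (exp (l * s)) * ennreal (exp (l * (indicat_real A (e + r) - P A r))))"
  have \<phi>[measurable]: "\<phi> \<in> borel_measurable (borel \<Otimes>\<^sub>M borel \<Otimes>\<^sub>M borel)" unfolding \<phi>_def by measurable
  have "(\<integral>\<^sup>+\<omega>. ennreal (exp (l * (\<Sum>i=1..Suc n. md A i \<omega>))) \<partial>M) = (\<integral>\<^sup>+\<omega>. \<phi> (\<epsilon> k \<omega>, R k 1 \<omega>, S \<omega>) \<partial>M)"
    by (intro nn_integral_cong) (simp add: \<phi>_def S_def md_def k_def distrib_left ennreal_exp_mult)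
  also have "\<dots> = (\<integral>\<^sup>+\<omega>. (\<integral>\<^sup>+e. \<phi> (e, R k 1 \<omega>, S \<omega>) \<partial>\<mu>) \<partial>M)"
    by (rule freeze_nn[OF W \<phi>])
  also have "\<dots> \<le> (\<integral>\<^sup>+\<omega>. ennreal (exp (l * S \<omega>)) * ennreal (exp (l\<^sup>2 * v)) \<partial>M)"
  proof (rule nn_integral_mono)
    fix \<omega>
    have "(\<integral>\<^sup>+e. \<phi> (e, R k 1 \<omega>, S \<omega>) \<partial>\<mu>) = ennreal (exp (l * S \<omega>)) * (\<integral>\<^sup>+e. ennreal (exp (l * (indicat_real A (e + R k 1 \<omega>) - P A (R k 1 \<omega>)))) \<partial>\<mu>)"
      unfolding \<phi>_def by (simp add: nn_integral_cmult)
    also have "\<dots> \<le> ennreal (exp (l * S \<omega>)) * ennreal (exp (l\<^sup>2 * v))"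
      by (intro mult_left_mono exp_md_integral[OF A l v]) auto
    finally show "(\<integral>\<^sup>+e. \<phi> (e, R k 1 \<omega>, S \<omega>) \<partial>\<mu>) \<le> ennreal (exp (l * S \<omega>)) * ennreal (exp (l\<^sup>2 * v))" .
  qed
  also have "\<dots> = (\<integral>\<^sup>+\<omega>. ennreal (exp (l * S \<omega>)) \<partial>M) * ennreal (exp (l\<^sup>2 * v))"
    by (rule nn_integral_multc) measurable
  also have "\<dots> \<le> ennreal (exp (real n * l\<^sup>2 * v)) * ennreal (exp (l\<^sup>2 * v))"
    using Suc unfolding S_def by (rule mult_right_mono) simp
  also have "\<dots> = ennreal (exp (real (Suc n) * l\<^sup>2 * v))"
    unfolding ennreal_exp_mult by (simp add: algebra_simps)
  finally show ?case .
qed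

text \<open>Markov's inequality for the exponential. The sign of \<open>l\<close> selects the tail,
  so one statement serves both.\<close>

lemma md_tail_one_sided:
  assumes A[measurable]: "A \<in> sets borel" and l: "0 < \<bar>l\<bar>" "\<bar>l\<bar> \<le> 1" and v: "\<And>r. P A r \<le> v"
  shows "emeasure M {\<omega>\<in>space M. \<bar>l\<bar> * t \<le> l * (\<Sum>i=1..n. md A i \<omega>)} \<le> ennreal (exp (real n * l\<^sup>2 * v - \<bar>l\<bar> * t))"
proof -
  let ?S = "\<lambda>\<omega>. \<Sum>i=1..n. md A i \<omega>"
  have "emeasure M {\<omega>\<in>space M. \<bar>l\<bar> * t \<le> l * ?S \<omega>} = (\<integral>\<^sup>+\<omega>. indicator {\<omega>\<in>space M. \<bar>l\<bar> * t \<le> l * ?S \<omega>} \<omega> \<partial>M)"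
    by (rule nn_integral_indicator[symmetric]) measurable
  also have "\<dots> \<le> (\<integral>\<^sup>+\<omega>. ennreal (exp (l * ?S \<omega>)) * ennreal (exp (- \<bar>l\<bar> * t)) \<partial>M)"
  proof (rule nn_integral_mono)
    fix \<omega>
    have "ennreal (exp (l * ?S \<omega>)) * ennreal (exp (- \<bar>l\<bar> * t)) = ennreal (exp (l * ?S \<omega> - \<bar>l\<bar> * t))"
      unfolding ennreal_exp_mult by simp
    moreover have "indicator {\<omega>\<in>space M. \<bar>l\<bar> * t \<le> l * ?S \<omega>} \<omega> \<le> ennreal (exp (l * ?S \<omega> - \<bar>l\<bar> * t))"
    proof (cases "\<bar>l\<bar> * t \<le> l * ?S \<omega>")
      case True
      then have "1 \<le> exp (l * ?S \<omega> - \<bar>l\<bar> * t)" by simp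
      then have "ennreal 1 \<le> ennreal (exp (l * ?S \<omega> - \<bar>l\<bar> * t))" by (rule ennreal_leI)
      moreover have "indicator {\<omega>\<in>space M. \<bar>l\<bar> * t \<le> l * ?S \<omega>} \<omega> \<le> ennreal 1" by (simp add: indicator_def)
      ultimately show ?thesis by (rule order_trans[rotated])
    qed simp
    ultimately show "indicator {\<omega>\<in>space M. \<bar>l\<bar> * t \<le> l * ?S \<omega>} \<omega> \<le> ennreal (exp (l * ?S \<omega>)) * ennreal (exp (- \<bar>l\<bar> * t))" by simp
  qed
  also have "\<dots> = (\<integral>\<^sup>+\<omega>. ennreal (exp (l * ?S \<omega>)) \<partial>M) * ennreal (exp (- \<bar>l\<bar> * t))"
    by (rule nn_integral_multc) measurable
  also have "\<dots> \<le> ennreal (exp (real n * l\<^sup>2 * v)) * ennreal (exp (- \<bar>l\<bar> * t))"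
    by (intro mult_right_mono exp_md_sum[OF A l(2) v]) auto
  also have "\<dots> = ennreal (exp (real n * l\<^sup>2 * v - \<bar>l\<bar> * t))"
    unfolding ennreal_exp_mult by simp
  finally show ?thesis .
qed

lemma md_tail:
  assumes A[measurable]: "A \<in> sets borel" and l: "0 < l" "l \<le> 1" and v: "\<And>r. P A r \<le> v"
  shows "prob {\<omega>\<in>space M. t \<le> \<bar>\<Sum>i=1..n. md A i \<omega>\<bar>} \<le> 2 * exp (real n * l\<^sup>2 * v - l * t)"
proof -
  let ?S = "\<lambda>\<omega>. \<Sum>i=1..n. md A i \<omega>"
  let ?U = "{\<omega>\<in>space M. l * t \<le> l * ?S \<omega>}" and ?V = "{\<omega>\<in>space M. l * t \<le> - l * ?S \<omega>}"
  have e: "{\<omega>\<in>space M. t \<le> \<bar>?S \<omega>\<bar>} = ?U \<union> ?V"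
  proof -
    have "t \<le> \<bar>s\<bar> \<longleftrightarrow> l * t \<le> l * s \<or> l * t \<le> - l * s" for s
    proof -
      have "l * t \<le> l * s \<longleftrightarrow> t \<le> s" "l * t \<le> l * (- s) \<longleftrightarrow> t \<le> - s"
        by (rule mult_le_cancel_left_pos[OF l(1)])+
      then show ?thesis by auto
    qed
    then show ?thesis by auto
  qed
  have U: "prob ?U \<le> exp (real n * l\<^sup>2 * v - l * t)"
    using md_tail_one_sided[OF A, of l v t n] l v by (simp add: emeasure_eq_measure)
  have V: "prob ?V \<le> exp (real n * l\<^sup>2 * v - l * t)"
    using md_tail_one_sided[OF A, of "-l" v t n] l v by (simp add: emeasure_eq_measure)
  have "prob (?U \<union> ?V) \<le> prob ?U + prob ?V" by (rule measure_Un_le) measurable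
  then show ?thesis unfolding e using U V by linarith
qed

text \<open>The choice of \<open>l\<close> below balances the two terms of the exponent to \<open>ln n - 5 ln n\<close>,
  which beats the cardinality \<open>c n\<^sup>2\<close> of the family by a summable factor.\<close>

lemma AE_md_family_bound:
  fixes J :: "nat \<Rightarrow> 'j set" and A :: "nat \<Rightarrow> 'j \<Rightarrow> real set" and v :: "nat \<Rightarrow> real"
  assumes fin: "\<And>n. finite (J n)" and card: "\<And>n. n \<ge> 1 \<Longrightarrow> real (card (J n)) \<le> c * (real n)\<^sup>2"
    and A[measurable]: "\<And>n j. A n j \<in> sets borel"
    and v: "\<And>n j r. j \<in> J n \<Longrightarrow> P (A n j) r \<le> v n"
    and large: "\<forall>\<^sub>F n in sequentially. ln (real n) \<le> real n * v n"
  shows "AE \<omega> in M. \<forall>\<^sub>F n in sequentially. \<forall>j\<in>J n. \<bar>\<Sum>i=1..n. md (A n j) i \<omega>\<bar> \<le> 5 * sqrt (real n * v n * ln (real n))"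
proof -
  obtain N where N: "\<And>n. n \<ge> N \<Longrightarrow> ln (real n) \<le> real n * v n" using large by (auto simp: eventually_sequentially)
  define N1 where "N1 = max N 2"
  define T where "T = (\<lambda>n. 5 * sqrt (real n * v n * ln (real n)))"
  define E where "E = (\<lambda>n. if n < N1 then {} else (\<Union>j\<in>J n. {\<omega>\<in>space M. T n \<le> \<bar>\<Sum>i=1..n. md (A n j) i \<omega>\<bar>}))"
  have E[measurable]: "E n \<in> sets M" for n
    unfolding E_def using fin[of n] by (auto intro!: sets.finite_UN)
  have c0: "c \<ge> 0"
  proof -
    have "real (card (J 1)) \<le> c" using card[of 1] by simp
    then show ?thesis by (rule order_trans[OF of_nat_0_le_iff])
  qed
  have pE: "prob (E n) \<le> 2 * c * real n powr (-2)" for n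
  proof (cases "n < N1")
    case True then show ?thesis using c0 by (simp add: E_def)
  next
    case False
    then have n: "n \<ge> N" "n \<ge> 2" by (auto simp: N1_def)
    have ln0: "ln (real n) > 0" using n by simp
    have nv: "ln (real n) \<le> real n * v n" by (rule N[OF n(1)])
    then have nv0: "real n * v n > 0" using ln0 by linarith
    define l where "l = sqrt (ln (real n) / (real n * v n))"
    have l: "0 < l" "l \<le> 1" using ln0 nv nv0 by (auto simp: l_def)
    have nz: "real n * v n \<noteq> 0" using nv0 by linarith
    have l2: "real n * l\<^sup>2 * v n = ln (real n)"
    proof -
      have "l\<^sup>2 = ln (real n) / (real n * v n)" using ln0 nv0 by (simp add: l_def)
      moreover have "real n * (y / (real n * v n)) * v n = y" for y using nz by simp
      ultimately show ?thesis by simp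
    qed
    have lT: "l * T n = 5 * ln (real n)"
    proof -
      have "l * T n = 5 * sqrt ((ln (real n) / (real n * v n)) * (real n * v n * ln (real n)))"
        unfolding l_def T_def real_sqrt_mult by simp
      also have "(ln (real n) / (real n * v n)) * (real n * v n * ln (real n)) = (ln (real n))\<^sup>2"
        using nz by (simp add: power2_eq_square)
      finally show ?thesis using ln0 by simp
    qed
    have each: "prob {\<omega>\<in>space M. T n \<le> \<bar>\<Sum>i=1..n. md (A n j) i \<omega>\<bar>} \<le> 2 * real n powr (-4)" if "j \<in> J n" for j
    proof -
      have "prob {\<omega>\<in>space M. T n \<le> \<bar>\<Sum>i=1..n. md (A n j) i \<omega>\<bar>} \<le> 2 * exp (real n * l\<^sup>2 * v n - l * T n)"
        by (rule md_tail[OF A l v[OF that]])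
      also have "exp (real n * l\<^sup>2 * v n - l * T n) = real n powr (-4)"
        unfolding l2 lT using n by (simp add: powr_def)
      finally show ?thesis .
    qed
    have "prob (E n) \<le> (\<Sum>j\<in>J n. prob {\<omega>\<in>space M. T n \<le> \<bar>\<Sum>i=1..n. md (A n j) i \<omega>\<bar>})"
      using False fin[of n] unfolding E_def by (simp only: if_False) (rule measure_UNION_le, auto)
    also have "\<dots> \<le> (\<Sum>j\<in>J n. 2 * real n powr (-4))" by (intro sum_mono each)
    also have "\<dots> = real (card (J n)) * (2 * real n powr (-4))" by simp
    also have "\<dots> \<le> c * (real n)\<^sup>2 * (2 * real n powr (-4))"
      using card[of n] n by (intro mult_right_mono) auto
    also have "\<dots> = 2 * c * (real n powr 2 * real n powr (-4))" using n by (simp add: powr_numeral)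
    also have "real n powr 2 * real n powr (-4) = real n powr (-2)" unfolding powr_add[symmetric] by simp
    finally show ?thesis .
  qed
  have "AE \<omega> in M. \<forall>\<^sub>F n in sequentially. \<omega> \<in> space M - E n"
  proof (rule borel_cantelli_AE1[OF E])
    show "emeasure M (E n) < \<infinity>" for n by (simp add: emeasure_eq_measure)
    have "summable (\<lambda>n. 2 * c * real n powr (-2))" by (intro summable_mult) (simp add: summable_real_powr_iff)
    then show "summable (\<lambda>n. measure M (E n))"
      by (rule summable_comparison_test'[where N=0]) (use pE in auto)
  qed
  then show ?thesis
  proof eventually_elim
    case (elim \<omega>)
    show ?case using elim eventually_ge_at_top[of N1]
      by eventually_elim (auto simp: E_def T_def not_less intro: less_imp_le)
  qed
qed

section \<open>Uniformity in the argument through a grid\<close>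

definition Mn :: "nat \<Rightarrow> real \<Rightarrow> 'a \<Rightarrow> real" where
  "Mn n x \<omega> = (\<Sum>i=1..n. md {..x} i \<omega>)"

text \<open>With mesh \<open>1 / n\<close> the compensator of \<open>Mn\<close> changes by at most a
  constant between neighbours. The indices up to \<open>2 * K * n + 1\<close> cover the interval
  from \<open>-K\<close> to \<open>K\<close> with one point to spare on the right.\<close>

definition grid :: "nat \<Rightarrow> nat \<Rightarrow> nat \<Rightarrow> real" where
  "grid K n k = real k / real n - real K"

lemma P_Ioc: "x \<le> y \<Longrightarrow> P {x<..y} r = P {..y} r - P {..x} r"
proof -
  assume "x \<le> y"
  then have "indicat_real {x<..y} (e + r) = indicat_real {..y} (e + r) - indicat_real {..x} (e + r)" for e
    by (auto simp: indicator_def)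
  then show ?thesis unfolding P_def
    by (simp add: integrable_indicator_shift)
qed

lemma md_Ioc: "x \<le> y \<Longrightarrow> md {x<..y} i \<omega> = md {..y} i \<omega> - md {..x} i \<omega>"
  unfolding md_def P_Ioc by (auto simp: indicator_def)

lemma Mn_diff: "x \<le> y \<Longrightarrow> (\<Sum>i=1..n. md {x<..y} i \<omega>) = Mn n y \<omega> - Mn n x \<omega>"
  by (simp add: Mn_def md_Ioc sum_subtractf)

lemma P_Ioc_le:
  assumes \<kappa>: "\<And>x. g x \<le> \<kappa>" and xy: "x \<le> y"
  shows "P {x<..y} r \<le> \<kappa> * (y - x)"
proof -
  have [measurable]: "g \<in> borel_measurable borel"
  proof -
    have "(\<lambda>x. ennreal (g x)) \<in> borel_measurable borel"
      using distributed_borel_measurable[OF dist_eps[of 0]] by simp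
    then have "(\<lambda>x. enn2real (ennreal (g x))) \<in> borel_measurable borel" by measurable
    then show ?thesis using g_nonneg by simp
  qed
  have \<kappa>0: "\<kappa> \<ge> 0" using \<kappa>[of 0] g_nonneg[of 0] by linarith
  have "P {x<..y} r = (\<integral>e. indicator {x - r<..y - r} e \<partial>\<mu>)"
    unfolding P_def by (intro Bochner_Integration.integral_cong) (auto simp: indicator_def)
  also have "\<dots> = measure \<mu> {x - r<..y - r}" by simp
  finally have P: "P {x<..y} r = measure \<mu> {x - r<..y - r}" .
  have "emeasure \<mu> {x - r<..y - r} = (\<integral>\<^sup>+e. ennreal (g e) * indicator {x - r<..y - r} e \<partial>lborel)"
    unfolding \<mu>_def by (rule emeasure_density) auto
  also have "\<dots> \<le> (\<integral>\<^sup>+e. ennreal \<kappa> * indicator {x - r<..y - r} e \<partial>lborel)"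
    using \<kappa> by (intro nn_integral_mono mult_right_mono ennreal_leI) auto
  also have "\<dots> = ennreal \<kappa> * ennreal (y - x)" using xy by (simp add: nn_integral_cmult)
  also have "\<dots> = ennreal (\<kappa> * (y - x))" using \<kappa>0 xy by (simp add: ennreal_mult)
  finally show ?thesis unfolding P using \<kappa>0 xy by (simp add: \<mu>.emeasure_eq_measure)
qed

text \<open>The counting part of \<open>Mn\<close> increases with the argument and the compensator
  grows at most at rate \<open>n * \<kappa>\<close>. Monotonicity up to this error suffices to pass
  from grid points to all points.\<close>

lemma Mn_mono_error:
  assumes \<kappa>: "\<And>x. g x \<le> \<kappa>" and xy: "x \<le> y"
  shows "Mn n x \<omega> \<le> Mn n y \<omega> + real n * (\<kappa> * (y - x))"
proof -
  have "md {x<..y} i \<omega> \<ge> - (\<kappa> * (y - x))" for i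
    unfolding md_def using P_Ioc_le[OF \<kappa> xy, of "R (int i) 1 \<omega>"] by (auto simp: indicator_def)
  then have "(\<Sum>i=1..n. - (\<kappa> * (y - x))) \<le> (\<Sum>i=1..n. md {x<..y} i \<omega>)" by (intro sum_mono) auto
  then show ?thesis unfolding Mn_diff[OF xy] by simp
qed

lemma grid_neighbour:
  assumes x: "x \<in> {- real K..real K}" and n: "n \<ge> 1"
  obtains k where "k \<le> 2 * K * n" "grid K n k \<le> x" "x \<le> grid K n (Suc k)" "grid K n (Suc k) = grid K n k + 1 / real n"
proof -
  define k where "k = nat \<lfloor>(x + real K) * real n\<rfloor>"
  have nn: "0 \<le> (x + real K) * real n" using x by simp
  have k1: "real k \<le> (x + real K) * real n" unfolding k_def using nn by simp
  have k2: "(x + real K) * real n \<le> real k + 1" unfolding k_def using nn by linarith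
  have "(x + real K) * real n \<le> (2 * real K) * real n" using x by (intro mult_right_mono) auto
  then have "real k \<le> real (2 * K * n)" using k1 by simp
  then have "k \<le> 2 * K * n" by (rule of_nat_le_iff[THEN iffD1])
  moreover have "grid K n k \<le> x" using k1 n by (simp add: grid_def field_simps)
  moreover have "x \<le> grid K n (Suc k)" using k2 n by (simp add: grid_def field_simps)
  moreover have "grid K n (Suc k) = grid K n k + 1 / real n" by (simp add: grid_def add_divide_distrib)
  ultimately show ?thesis using that by blast
qed

text \<open>An increment over an interval of length of order \<open>b n\<close> is a martingale sum
  whose variance proxy is of that order. The quantifier over \<open>C0\<close> stands inside the
  almost sure statement and ranges over naturals, because the constant it must exceed will depend on
  the path.\<close>

lemma martingale_modulus:
  fixes b :: "nat \<Rightarrow> real" and K :: nat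
  assumes \<kappa>: "\<And>x. g x \<le> \<kappa>" and b: "\<forall>\<^sub>F n in sequentially. ln (real n) \<le> real n * b n"
  shows "AE \<omega> in M. \<forall>C0::nat. \<exists>C\<ge>0. \<forall>\<^sub>F n in sequentially. \<forall>x\<in>{- real K..real K}. \<forall>y\<in>{- real K..real K}.
     \<bar>x - y\<bar> \<le> real C0 * b n \<longrightarrow> \<bar>Mn n y \<omega> - Mn n x \<omega>\<bar> \<le> C * sqrt (real n * b n * ln (real n))"
proof (subst AE_all_countable, rule allI)
  fix C0 :: nat
  have \<kappa>0: "\<kappa> \<ge> 0" using \<kappa>[of 0] g_nonneg[of 0] by linarith
  \<comment> \<open>Rounding the two endpoints to the grid lengthens the interval by at most
    \<open>2 / n <= 2 * b n\<close>.\<close>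
  define m where "m = real C0 + 2"
  have m: "m \<ge> 2" by (simp add: m_def)
  \<comment> \<open>\<open>\<kappa> + 1\<close> keeps the factor at least 1, so that
    \<open>ln n <= n * v n\<close> follows from the same inequality for \<open>b\<close>.\<close>
  define v where "v = (\<lambda>n. (\<kappa> + 1) * (m * b n))"
  define J where "J = (\<lambda>n. {(k,l). k \<le> 2 * K * n + 1 \<and> l \<le> 2 * K * n + 1 \<and> grid K n k \<le> grid K n l \<and> grid K n l - grid K n k \<le> m * b n})"
  define A where "A = (\<lambda>n (k,l). {grid K n k<..grid K n l})"
  have sub: "J n \<subseteq> {..2*K*n+1} \<times> {..2*K*n+1}" for n by (auto simp: J_def)
  have fam: "AE \<omega> in M. \<forall>\<^sub>F n in sequentially. \<forall>j\<in>J n. \<bar>\<Sum>i=1..n. md (A n j) i \<omega>\<bar> \<le> 5 * sqrt (real n * v n * ln (real n))"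
  proof (rule AE_md_family_bound[where c="(2 * real K + 2)\<^sup>2"])
    show "finite (J n)" for n using sub[of n] by (rule finite_subset) simp
    show "real (card (J n)) \<le> (2 * real K + 2)\<^sup>2 * (real n)\<^sup>2" if n: "n \<ge> 1" for n
    proof -
      have "card (J n) \<le> card ({..2*K*n+1} \<times> {..2*K*n+1})" by (rule card_mono[OF _ sub]) simp
      also have "\<dots> = (2*K*n+2) * (2*K*n+2)" by simp
      also have "\<dots> \<le> ((2*K+2)*n) * ((2*K+2)*n)" using n by (intro mult_mono) (auto simp: algebra_simps)
      finally have "real (card (J n)) \<le> real (((2*K+2)*n) * ((2*K+2)*n))" by (rule of_nat_mono)
      then show ?thesis by (simp add: power2_eq_square algebra_simps)
    qed
    show "A n j \<in> sets borel" for n j by (cases j) (simp add: A_def)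
    show "P (A n j) r \<le> v n" if j: "j \<in> J n" for n j r
    proof -
      obtain k l where kl: "j = (k,l)" "grid K n k \<le> grid K n l" "grid K n l - grid K n k \<le> m * b n" using j by (auto simp: J_def)
      have "P (A n j) r \<le> \<kappa> * (grid K n l - grid K n k)" unfolding A_def kl(1) split_conv by (rule P_Ioc_le[OF \<kappa> kl(2)])
      also have "\<dots> \<le> (\<kappa> + 1) * (m * b n)" using \<kappa>0 kl by (intro mult_mono) auto
      finally show ?thesis by (simp add: v_def)
    qed
    show "\<forall>\<^sub>F n in sequentially. ln (real n) \<le> real n * v n"
      using b eventually_ge_at_top[of 1]
    proof eventually_elim
      case (elim n)
      have nb: "0 \<le> real n * b n" using elim ln_ge_zero[of "real n"] by linarith
      have "1 * 1 \<le> (\<kappa> + 1) * m" using \<kappa>0 m by (intro mult_mono) auto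
      then have "1 * (real n * b n) \<le> (\<kappa> + 1) * m * (real n * b n)" using nb by (intro mult_right_mono) auto
      moreover have "real n * v n = (\<kappa> + 1) * m * (real n * b n)" by (simp add: v_def mult_ac)
      ultimately show ?case using elim by linarith
    qed
  qed
  define C where "C = 5 * sqrt ((\<kappa> + 1) * m) + 2 * \<kappa>"
  have C: "C \<ge> 0" using \<kappa>0 m by (simp add: C_def)
  show "AE \<omega> in M. \<exists>C\<ge>0. \<forall>\<^sub>F n in sequentially. \<forall>x\<in>{- real K..real K}. \<forall>y\<in>{- real K..real K}.
     \<bar>x - y\<bar> \<le> real C0 * b n \<longrightarrow> \<bar>Mn n y \<omega> - Mn n x \<omega>\<bar> \<le> C * sqrt (real n * b n * ln (real n))"
    using fam
  proof eventually_elim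
    case (elim \<omega>)
    have "\<forall>\<^sub>F n in sequentially. \<forall>x\<in>{- real K..real K}. \<forall>y\<in>{- real K..real K}.
     \<bar>x - y\<bar> \<le> real C0 * b n \<longrightarrow> \<bar>Mn n y \<omega> - Mn n x \<omega>\<bar> \<le> C * sqrt (real n * b n * ln (real n))"
      using elim b eventually_ge_at_top[of 27]
    proof eventually_elim
      case (elim n)
      have l3: "3 \<le> ln (real n)" using elim by (intro ln_ge_3)
      have n1: "n \<ge> 1" using elim by simp
      have b1: "1 / real n \<le> b n" using elim l3 n1 by (simp add: divide_simps mult.commute)
      have Ssq: "1 \<le> real n * b n * ln (real n)"
        using elim l3 mult_mono[of 1 "real n * b n" 1 "ln (real n)"] by simp
      define S where "S = sqrt (real n * b n * ln (real n))"
      have S1: "1 \<le> S" unfolding S_def using Ssq by simp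
      have T: "5 * sqrt (real n * v n * ln (real n)) = 5 * sqrt ((\<kappa> + 1) * m) * S"
        unfolding S_def v_def by (simp add: real_sqrt_mult[symmetric] mult_ac)
      have pair: "\<bar>Mn n (grid K n l) \<omega> - Mn n (grid K n k) \<omega>\<bar> \<le> 5 * sqrt ((\<kappa> + 1) * m) * S"
        if "k \<le> 2*K*n+1" "l \<le> 2*K*n+1" "\<bar>grid K n l - grid K n k\<bar> \<le> m * b n" for k l
      proof (cases "grid K n k \<le> grid K n l")
        case True
        then have "(k,l) \<in> J n" using that by (auto simp: J_def)
        then have "\<bar>\<Sum>i=1..n. md (A n (k,l)) i \<omega>\<bar> \<le> 5 * sqrt ((\<kappa> + 1) * m) * S" using elim(1) T by auto
        then show ?thesis unfolding A_def split_conv Mn_diff[OF True] .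
      next
        case False
        then have le: "grid K n l \<le> grid K n k" by simp
        then have "(l,k) \<in> J n" using that by (auto simp: J_def)
        then have "\<bar>\<Sum>i=1..n. md (A n (l,k)) i \<omega>\<bar> \<le> 5 * sqrt ((\<kappa> + 1) * m) * S" using elim(1) T by auto
        then show ?thesis unfolding A_def split_conv Mn_diff[OF le] by (simp add: abs_minus_commute)
      qed
      have half: "Mn n y \<omega> - Mn n x \<omega> \<le> C * S"
        if x: "x \<in> {- real K..real K}" and y: "y \<in> {- real K..real K}" and xy: "\<bar>x - y\<bar> \<le> real C0 * b n" for x y
      proof -
        obtain k where k: "k \<le> 2 * K * n" "grid K n k \<le> x" "x \<le> grid K n (Suc k)" "grid K n (Suc k) = grid K n k + 1 / real n"
          by (rule grid_neighbour[OF x n1])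
        obtain l where l: "l \<le> 2 * K * n" "grid K n l \<le> y" "y \<le> grid K n (Suc l)" "grid K n (Suc l) = grid K n l + 1 / real n"
          by (rule grid_neighbour[OF y n1])
        have "real n * (\<kappa> * (grid K n (Suc l) - y)) \<le> real n * (\<kappa> * (1 / real n))"
          using l \<kappa>0 by (intro mult_left_mono) auto
        then have 1: "Mn n y \<omega> \<le> Mn n (grid K n (Suc l)) \<omega> + \<kappa>"
          using Mn_mono_error[OF \<kappa> l(3), of n \<omega>] n1 by simp
        have "real n * (\<kappa> * (x - grid K n k)) \<le> real n * (\<kappa> * (1 / real n))"
          using k \<kappa>0 by (intro mult_left_mono) auto
        then have 2: "Mn n (grid K n k) \<omega> \<le> Mn n x \<omega> + \<kappa>"
          using Mn_mono_error[OF \<kappa> k(2), of n \<omega>] n1 by simp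
        have "\<bar>grid K n (Suc l) - grid K n k\<bar> \<le> real C0 * b n + 2 / real n"
          using k l xy by linarith
        also have "\<dots> \<le> m * b n" using b1 by (simp add: m_def algebra_simps)
        finally have "\<bar>Mn n (grid K n (Suc l)) \<omega> - Mn n (grid K n k) \<omega>\<bar> \<le> 5 * sqrt ((\<kappa> + 1) * m) * S"
          using k l by (intro pair) auto
        moreover have "2 * \<kappa> \<le> 2 * \<kappa> * S" using S1 \<kappa>0 by (simp add: mult_le_cancel_left1)
        ultimately show ?thesis using 1 2 unfolding C_def distrib_right by linarith
      qed
      show ?case
      proof (intro ballI impI)
        fix x y assume "x \<in> {- real K..real K}" "y \<in> {- real K..real K}" "\<bar>x - y\<bar> \<le> real C0 * b n"
        then have "Mn n y \<omega> - Mn n x \<omega> \<le> C * S" "Mn n x \<omega> - Mn n y \<omega> \<le> C * S"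
          using half[of x y] half[of y x] by (simp_all add: abs_minus_commute)
        then show "\<bar>Mn n y \<omega> - Mn n x \<omega>\<bar> \<le> C * sqrt (real n * b n * ln (real n))" unfolding S_def by linarith
      qed
    qed
    then show ?case using C by blast
  qed
qed

text \<open>Half-lines in place of short intervals, with the trivial variance proxy 1.\<close>

lemma martingale_sup:
  fixes K :: nat
  assumes \<kappa>: "\<And>x. g x \<le> \<kappa>"
  shows "AE \<omega> in M. \<exists>C\<ge>0. \<forall>\<^sub>F n in sequentially. \<forall>x\<in>{- real K..real K}. \<bar>Mn n x \<omega>\<bar> \<le> C * sqrt (real n * ln (real n))"
proof -
  have \<kappa>0: "\<kappa> \<ge> 0" using \<kappa>[of 0] g_nonneg[of 0] by linarith
  have fam: "AE \<omega> in M. \<forall>\<^sub>F n in sequentially. \<forall>k\<in>{..2*K*n+1}. \<bar>\<Sum>i=1..n. md {..grid K n k} i \<omega>\<bar> \<le> 5 * sqrt (real n * 1 * ln (real n))"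
  proof (rule AE_md_family_bound[where c="2 * real K + 2"])
    show "real (card {..2*K*n+1}) \<le> (2 * real K + 2) * (real n)\<^sup>2" if n: "n \<ge> 1" for n
    proof -
      have "2*K*n \<le> 2*K*(n*n)" "2 \<le> 2*(n*n)" using n by simp_all
      then have "2*K*n+2 \<le> (2*K+2) * (n * n)" unfolding distrib_right by linarith
      then have "real (2*K*n+2) \<le> real ((2*K+2) * (n * n))" by (rule of_nat_mono)
      then show ?thesis by (simp add: power2_eq_square algebra_simps)
    qed
    show "\<forall>\<^sub>F n in sequentially. ln (real n) \<le> real n * 1"
      using eventually_ge_at_top[of 1]
    proof eventually_elim
      case (elim n)
      then show ?case using ln_le_minus_one[of "real n"] by simp
    qed
  qed (auto intro: P_bounds)
  show ?thesis
    using fam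
  proof eventually_elim
    case (elim \<omega>)
    have "\<forall>\<^sub>F n in sequentially. \<forall>x\<in>{- real K..real K}. \<bar>Mn n x \<omega>\<bar> \<le> (5 + \<kappa>) * sqrt (real n * ln (real n))"
      using elim eventually_ge_at_top[of 27]
    proof eventually_elim
      case (elim n)
      have l3: "3 \<le> ln (real n)" using elim by (intro ln_ge_3)
      have n1: "n \<ge> 1" using elim by simp
      define S where "S = sqrt (real n * ln (real n))"
      have "1 \<le> real n * ln (real n)" using n1 l3 mult_mono[of 1 "real n" 1 "ln (real n)"] by simp
      then have S1: "1 \<le> S" unfolding S_def by simp
      have pt: "\<bar>Mn n (grid K n k) \<omega>\<bar> \<le> 5 * S" if "k \<le> 2*K*n+1" for k
        using elim(1) that by (simp add: Mn_def S_def)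
      show ?case
      proof
        fix x assume x: "x \<in> {- real K..real K}"
        obtain k where k: "k \<le> 2 * K * n" "grid K n k \<le> x" "x \<le> grid K n (Suc k)" "grid K n (Suc k) = grid K n k + 1 / real n"
          by (rule grid_neighbour[OF x n1])
        have "real n * (\<kappa> * (grid K n (Suc k) - x)) \<le> real n * (\<kappa> * (1 / real n))"
          using k \<kappa>0 by (intro mult_left_mono) auto
        then have 1: "Mn n x \<omega> \<le> Mn n (grid K n (Suc k)) \<omega> + \<kappa>"
          using Mn_mono_error[OF \<kappa> k(3), of n \<omega>] n1 by simp
        have "real n * (\<kappa> * (x - grid K n k)) \<le> real n * (\<kappa> * (1 / real n))"
          using k \<kappa>0 by (intro mult_left_mono) auto
        then have 2: "Mn n (grid K n k) \<omega> \<le> Mn n x \<omega> + \<kappa>"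
          using Mn_mono_error[OF \<kappa> k(2), of n \<omega>] n1 by simp
        have 3: "\<kappa> \<le> \<kappa> * S" using S1 \<kappa>0 by (simp add: mult_le_cancel_left1)
        show "\<bar>Mn n x \<omega>\<bar> \<le> (5 + \<kappa>) * sqrt (real n * ln (real n))"
          using 1 2 3 pt[of k] pt[of "Suc k"] k(1) unfolding S_def[symmetric] distrib_right by linarith
      qed
    qed
    moreover have "5 + \<kappa> \<ge> 0" using \<kappa>0 by simp
    ultimately show ?case by blast
  qed
qed

end

section \<open>Comparison of the rates\<close>

text \<open>Potter's bound compares every term with the last, and the remaining power sum has
  exponent above -1. With \<open>potter_term_le_psum\<close> this is a weak form of Karamata's
  theorem.\<close>

lemma psum_le_term:
  assumes P: "potter \<gamma> \<theta>" and \<gamma>: "0 < \<gamma>" "\<gamma> < 1"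
  shows "\<exists>C>0. \<forall>n\<ge>1. psum \<theta> n \<le> C * (real n * \<theta> n)"
proof -
  define \<eta> where "\<eta> = (1-\<gamma>)/2"
  have \<eta>: "\<eta> > 0" "\<eta> + \<gamma> < 1" using \<gamma> by (auto simp: \<eta>_def field_simps)
  define s where "s = \<eta> + \<gamma>"
  have s: "0 \<le> s" "s < 1" using \<eta> \<gamma> by (auto simp: s_def)
  obtain C where C: "C > 0"
    "\<And>m n. 1 \<le> m \<Longrightarrow> m \<le> n \<Longrightarrow> \<theta> m \<le> C * (real n / real m) powr (\<eta> + \<gamma>) * \<theta> n"
    by (rule potterE[OF P \<eta>(1)]) blast
  have "psum \<theta> n \<le> C / (1-s) * (real n * \<theta> n)" if n: "n \<ge> 1" for n
  proof -
    have "psum \<theta> n \<le> (\<Sum>j=1..n. C * \<theta> n * real n powr s * real j powr (-s))"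
      unfolding psum_def
    proof (intro sum_mono)
      fix j assume j: "j \<in> {1..n}"
      have "\<theta> j \<le> C * (real n / real j) powr s * \<theta> n" using C(2)[of j n] j by (auto simp: s_def)
      also have "\<dots> = C * \<theta> n * real n powr s * real j powr (-s)"
        using j n by (simp add: powr_divide powr_minus field_simps)
      finally show "\<theta> j \<le> C * \<theta> n * real n powr s * real j powr (-s)" .
    qed
    also have "\<dots> = C * \<theta> n * real n powr s * (\<Sum>j=1..n. real j powr (-s))" by (simp add: sum_distrib_left)
    also have "\<dots> \<le> C * \<theta> n * real n powr s * (real n powr (1-s) / (1-s))"
      using C(1) potter_pos[OF P n] sum_powr_le[OF s, of n] by (intro mult_left_mono) auto
    also have "\<dots> = C / (1-s) * (\<theta> n * (real n powr s * real n powr (1-s)))" by simp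
    also have "real n powr s * real n powr (1-s) = real n" using n by (simp flip: powr_add)
    finally show ?thesis by (simp add: mult_ac)
  qed
  moreover have "C / (1-s) > 0" using C s by simp
  ultimately show ?thesis by blast
qed

text \<open>The initial segments differ by a constant, and a constant is a multiple of
  \<open>\<theta> n0\<close>, which bounds both sums from below. This leads back from
  \<open>\<psi>\<close> to the sum with \<open>L\<close> in \<open>Psi\<close>.\<close>

lemma psum_upto_cong_bound:
  fixes \<theta> \<phi> :: "nat \<Rightarrow> real"
  assumes pos: "\<And>n. n \<ge> 1 \<Longrightarrow> 0 < \<theta> n" and eq: "\<And>n. n \<ge> n0 \<Longrightarrow> \<phi> n = \<theta> n" and nn: "\<And>n. 0 \<le> \<phi> n" and n0: "n0 \<ge> 1"
  shows "\<exists>C>0. \<forall>n\<ge>n0. psum \<theta> n \<le> C * psum \<phi> n \<and> psum \<phi> n \<le> C * psum \<theta> n"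
proof -
  define A where "A = psum \<theta> n0 + psum \<phi> n0"
  have t0: "\<theta> n0 > 0" using pos n0 by simp
  have A: "A \<ge> 0" unfolding A_def psum_def using pos nn by (intro add_nonneg_nonneg sum_nonneg) (auto intro: less_imp_le)
  define C where "C = 1 + A / \<theta> n0"
  have split: "psum f n = psum f n0 + (\<Sum>j=n0+1..n. f j)" if "n \<ge> n0" for f n
    unfolding psum_def using sum.ub_add_nat[of 1 n0 f "n - n0"] that by simp
  have eqs: "(\<Sum>j=n0+1..n. \<theta> j) = (\<Sum>j=n0+1..n. \<phi> j)" for n by (intro sum.cong refl) (auto simp: eq)
  have big: "\<theta> n0 \<le> psum \<theta> n" "\<theta> n0 \<le> psum \<phi> n" if "n \<ge> n0" for n
  proof -
    show "\<theta> n0 \<le> psum \<theta> n" unfolding psum_def using that n0 pos by (intro member_le_sum) (auto intro: less_imp_le)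
    have "\<phi> n0 \<le> psum \<phi> n" unfolding psum_def using that n0 nn by (intro member_le_sum) auto
    then show "\<theta> n0 \<le> psum \<phi> n" using eq by simp
  qed
  have key: "psum f n \<le> C * psum h n" if n: "n \<ge> n0" and f: "psum f n0 \<le> A" and h: "0 \<le> psum h n0" "\<theta> n0 \<le> psum h n"
    and e: "(\<Sum>j=n0+1..n. f j) = (\<Sum>j=n0+1..n. h j)" for f h n
  proof -
    have "psum f n \<le> A + psum h n" using split[OF n, of f] split[OF n, of h] f h e by linarith
    also have "A = A / \<theta> n0 * \<theta> n0" using t0 by simp
    also have "\<dots> \<le> A / \<theta> n0 * psum h n" using h A t0 by (intro mult_left_mono) auto
    finally show ?thesis by (simp add: C_def algebra_simps)
  qed
  have p0: "0 \<le> psum \<theta> n0" "0 \<le> psum \<phi> n0" unfolding psum_def using pos nn by (auto intro!: sum_nonneg intro: less_imp_le)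
  have "C > 0" using A t0 by (simp add: C_def add_pos_nonneg)
  moreover have "psum \<theta> n \<le> C * psum \<phi> n \<and> psum \<phi> n \<le> C * psum \<theta> n" if n: "n \<ge> n0" for n
    using key[OF n, of \<theta> \<phi>] key[OF n, of \<phi> \<theta>] p0 big[OF n] eqs[of n] by (auto simp: A_def)
  ultimately show ?thesis by blast
qed

context linear_innovations
begin

text \<open>Only the lag-\<open>J\<close> term correlates with the innovation: lags up to
  \<open>J\<close> by the covariances of the innovations, the remainder beyond \<open>J\<close> by
  orthogonality to the past.\<close>

lemma expectation_R_eps:
  shows "integrable M (\<lambda>\<omega>. R i 0 \<omega> * \<epsilon> (i - int J) \<omega>)" "expectation (\<lambda>\<omega>. R i 0 \<omega> * \<epsilon> (i - int J) \<omega>) = a J * s2"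
proof -
  obtain V :: real where Ri2: "\<And>i j. integrable M (\<lambda>\<omega>. (R i j \<omega>)\<^sup>2)" by (rule R_moments) blast
  have int: "integrable M (\<lambda>\<omega>. R i j \<omega> * \<epsilon> k \<omega>)" for j k
    by (rule integrable_mult_of_squares[OF _ _ Ri2 sq_integrable]) auto
  show "integrable M (\<lambda>\<omega>. R i 0 \<omega> * \<epsilon> (i - int J) \<omega>)" by (rule int)
  have int2: "integrable M (\<lambda>\<omega>. \<epsilon> k \<omega> * \<epsilon> l \<omega>)" for k l
    by (rule integrable_mult_of_squares[OF _ _ sq_integrable sq_integrable]) auto
  have "expectation (\<lambda>\<omega>. R i 0 \<omega> * \<epsilon> (i - int J) \<omega>)
     = expectation (\<lambda>\<omega>. (\<Sum>m<Suc J. a m * (\<epsilon> (i - int m) \<omega> * \<epsilon> (i - int J) \<omega>)) + \<epsilon> (i - int J) \<omega> * R i (Suc J) \<omega>)"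
  proof (rule integral_cong_AE)
    show "AE \<omega> in M. R i 0 \<omega> * \<epsilon> (i - int J) \<omega> = (\<Sum>m<Suc J. a m * (\<epsilon> (i - int m) \<omega> * \<epsilon> (i - int J) \<omega>)) + \<epsilon> (i - int J) \<omega> * R i (Suc J) \<omega>"
      using AE_summable[of i]
    proof eventually_elim
      case (elim \<omega>)
      have "R i 0 \<omega> = (\<Sum>m<Suc J. a m * \<epsilon> (i - int m) \<omega>) + R i (Suc J) \<omega>" using R_eq_diff[OF elim, of "Suc J"] by simp
      then have "R i 0 \<omega> * \<epsilon> (i - int J) \<omega> = (\<Sum>m<Suc J. a m * \<epsilon> (i - int m) \<omega>) * \<epsilon> (i - int J) \<omega> + R i (Suc J) \<omega> * \<epsilon> (i - int J) \<omega>"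
        by (simp only: distrib_right)
      then show ?case by (simp only: sum_distrib_right mult.assoc mult.commute[of "R i (Suc J) \<omega>"])
    qed
  qed measurable
  also have "\<dots> = (\<Sum>m<Suc J. a m * expectation (\<lambda>\<omega>. \<epsilon> (i - int m) \<omega> * \<epsilon> (i - int J) \<omega>)) + expectation (\<lambda>\<omega>. \<epsilon> (i - int J) \<omega> * R i (Suc J) \<omega>)"
  proof (subst Bochner_Integration.integral_add)
    show "integrable M (\<lambda>\<omega>. \<epsilon> (i - int J) \<omega> * R i (Suc J) \<omega>)" using int[of "Suc J" "i - int J"] by (simp add: mult.commute)
    show "integrable M (\<lambda>\<omega>. \<Sum>m<Suc J. a m * (\<epsilon> (i - int m) \<omega> * \<epsilon> (i - int J) \<omega>))"
      by (intro Bochner_Integration.integrable_sum integrable_mult_right int2)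
    show "expectation (\<lambda>\<omega>. \<Sum>m<Suc J. a m * (\<epsilon> (i - int m) \<omega> * \<epsilon> (i - int J) \<omega>)) + expectation (\<lambda>\<omega>. \<epsilon> (i - int J) \<omega> * R i (Suc J) \<omega>) =
      (\<Sum>m<Suc J. a m * expectation (\<lambda>\<omega>. \<epsilon> (i - int m) \<omega> * \<epsilon> (i - int J) \<omega>)) + expectation (\<lambda>\<omega>. \<epsilon> (i - int J) \<omega> * R i (Suc J) \<omega>)"
      by (subst Bochner_Integration.integral_sum) (auto intro!: integrable_mult_right int2)
  qed
  also have "(\<Sum>m<Suc J. a m * expectation (\<lambda>\<omega>. \<epsilon> (i - int m) \<omega> * \<epsilon> (i - int J) \<omega>)) = (\<Sum>m<Suc J. if m = J then a m * s2 else 0)"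
  proof (intro sum.cong refl)
    fix m
    show "a m * expectation (\<lambda>\<omega>. \<epsilon> (i - int m) \<omega> * \<epsilon> (i - int J) \<omega>) = (if m = J then a m * s2 else 0)"
      using expectation_eps_mult(2)[of "i - int m" "i - int J"] expectation_eps_sq[of "i - int J"]
      by (auto simp: power2_eq_square)
  qed
  also have "\<dots> = a J * s2" by (subst sum.delta) auto
  also have "expectation (\<lambda>\<omega>. \<epsilon> (i - int J) \<omega> * R i (Suc J) \<omega>) = 0"
  proof -
    have p: "R i (Suc J) \<in> borel_measurable (past (i - int J))" by (rule R_past) simp
    show ?thesis
      by (rule orthogonal_past[of "\<lambda>e r. e" "\<lambda>_. 0"]) (use p int[of "Suc J" "i - int J"] in \<open>simp_all add: integral_\<mu>_id mult.commute\<close>)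
  qed
  finally show "expectation (\<lambda>\<omega>. R i 0 \<omega> * \<epsilon> (i - int J) \<omega>) = a J * s2" by simp
qed

definition SX :: "nat \<Rightarrow> 'a \<Rightarrow> real" where "SX n \<omega> = (\<Sum>i=1..n. R (int i) 0 \<omega>)"

lemma SX_measurable[measurable]: "SX n \<in> borel_measurable M"
  unfolding SX_def[abs_def] by measurable

lemma SX_upper: "\<exists>K>0. \<forall>n\<ge>1. integrable M (\<lambda>\<omega>. (SX n \<omega>)\<^sup>2) \<and> expectation (\<lambda>\<omega>. (SX n \<omega>)\<^sup>2) \<le> K * real n * (psum \<theta> n)\<^sup>2"
proof -
  obtain K where K: "K > 0" and bd:
    "\<And>u n. n \<ge> 1 \<Longrightarrow> (\<integral>\<^sup>+\<omega>. ennreal ((\<Sum>i=u..<u+n. R (int i) 0 \<omega>)\<^sup>2) \<partial>M) \<le> ennreal (K * real n * (psum \<theta> n)\<^sup>2)"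
    by (rule X_block_bound) blast
  have "integrable M (\<lambda>\<omega>. (SX n \<omega>)\<^sup>2) \<and> expectation (\<lambda>\<omega>. (SX n \<omega>)\<^sup>2) \<le> K * real n * (psum \<theta> n)\<^sup>2" if n: "n \<ge> 1" for n
  proof -
    have "{1..n} = {1..<1+n}" by auto
    then have le: "(\<integral>\<^sup>+\<omega>. ennreal ((SX n \<omega>)\<^sup>2) \<partial>M) \<le> ennreal (K * real n * (psum \<theta> n)\<^sup>2)"
      using bd[OF n, of 1] unfolding SX_def by simp
    have i: "integrable M (\<lambda>\<omega>. (SX n \<omega>)\<^sup>2)"
    proof (rule integrableI_nonneg)
      show "(\<integral>\<^sup>+\<omega>. ennreal ((SX n \<omega>)\<^sup>2) \<partial>M) < \<infinity>" using le by (rule le_less_trans) simp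
    qed auto
    have "ennreal (expectation (\<lambda>\<omega>. (SX n \<omega>)\<^sup>2)) = (\<integral>\<^sup>+\<omega>. ennreal ((SX n \<omega>)\<^sup>2) \<partial>M)"
      by (rule nn_integral_eq_integral[symmetric, OF i]) simp
    then have "ennreal (expectation (\<lambda>\<omega>. (SX n \<omega>)\<^sup>2)) \<le> ennreal (K * real n * (psum \<theta> n)\<^sup>2)"
      using le by simp
    then have "expectation (\<lambda>\<omega>. (SX n \<omega>)\<^sup>2) \<le> K * real n * (psum \<theta> n)\<^sup>2"
      using K by (subst (asm) ennreal_le_iff) auto
    then show ?thesis using i by simp
  qed
  then show ?thesis using K by blast
qed

text \<open>Lower bound for the variance of \<open>SX n\<close> by projecting on the innovations
  \<open>\<epsilon>\<^sub>-\<^sub>l\<close>, \<open>n \<le> l < 2n\<close>, all of whose weights are of the order \<open>n \<theta>\<^sub>n\<close>.\<close>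

lemma SX_lower:
  assumes a: "\<And>n. n \<ge> n0 \<Longrightarrow> a n = \<theta> n" and n0: "n0 \<ge> 1"
  shows "\<exists>c>0. \<forall>n\<ge>n0. c * real n * (psum \<theta> n)\<^sup>2 \<le> expectation (\<lambda>\<omega>. (SX n \<omega>)\<^sup>2)"
proof -
  obtain C where C: "C > 0"
    "\<And>m n. 1 \<le> m \<Longrightarrow> m \<le> n \<Longrightarrow> \<theta> m \<le> C * (real n / real m) powr (1 + \<beta>) * \<theta> n"
    by (rule potterE[OF potter_\<theta> zero_less_one]) blast
  obtain C1 where C1: "C1 > 0" "\<forall>n\<ge>1. psum \<theta> n \<le> C1 * (real n * \<theta> n)"
    using psum_le_term[OF potter_\<theta> \<beta>_pos \<beta>_lt] by blast
  obtain K where K: "\<And>n. n \<ge> 1 \<Longrightarrow> integrable M (\<lambda>\<omega>. (SX n \<omega>)\<^sup>2)" using SX_upper by blast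
  \<comment> \<open>The weights used below have index \<open>i + l\<close> with
    \<open>i <= n\<close> and \<open>n <= l < 2 * n\<close>, hence between \<open>n\<close> and
    \<open>3 * n\<close>.\<close>
  define B where "B = C * 3 powr (1 + \<beta>)"
  have B: "B > 0" using C by (simp add: B_def)
  have "s2 / (B * C1)\<^sup>2 * real n * (psum \<theta> n)\<^sup>2 \<le> expectation (\<lambda>\<omega>. (SX n \<omega>)\<^sup>2)" if n: "n \<ge> n0" for n
  proof -
    have n1: "n \<ge> 1" using n n0 by simp
    have lag: "\<theta> n / B \<le> a j" if j: "n \<le> j" "j \<le> 3 * n" for j
    proof -
      have "\<theta> n \<le> C * (real j / real n) powr (1 + \<beta>) * \<theta> j" using C(2)[of n j] n1 j by simp
      also have "\<dots> \<le> B * \<theta> j"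
        unfolding B_def using C j n1 \<beta>_pos potter_pos[OF potter_\<theta>, of j]
        by (intro mult_right_mono mult_left_mono powr_mono2) (auto simp: divide_simps)
      finally show ?thesis using a[of j] j n B by (simp add: divide_simps mult.commute)
    qed
    define c where "c = (\<lambda>l. \<Sum>i=1..n. a (i + l))"
    have cl: "real n * \<theta> n / B \<le> c l" if l: "l \<in> {n..<2*n}" for l
    proof -
      have "(\<Sum>i=1..n. \<theta> n / B) \<le> c l" unfolding c_def using l by (intro sum_mono lag) auto
      then show ?thesis by simp
    qed
    define W where "W = (\<lambda>\<omega>. \<Sum>l=n..<2*n. c l * \<epsilon> (- int l) \<omega>)"
    have [measurable]: "W \<in> borel_measurable M" unfolding W_def by measurable
    have W2: "integrable M (\<lambda>\<omega>. (W \<omega>)\<^sup>2)" "expectation (\<lambda>\<omega>. (W \<omega>)\<^sup>2) = s2 * (\<Sum>l=n..<2*n. (c l)\<^sup>2)"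
      unfolding W_def by (rule expectation_eps_sum_sq; simp add: inj_on_def)+
    have RE: "integrable M (\<lambda>\<omega>. R (int i) 0 \<omega> * \<epsilon> (- int l) \<omega>)" "expectation (\<lambda>\<omega>. R (int i) 0 \<omega> * \<epsilon> (- int l) \<omega>) = a (i + l) * s2" for i l
      using expectation_R_eps[of "int i" "i + l"] by simp_all
    have "expectation (\<lambda>\<omega>. SX n \<omega> * W \<omega>) = expectation (\<lambda>\<omega>. \<Sum>l=n..<2*n. \<Sum>i=1..n. c l * (R (int i) 0 \<omega> * \<epsilon> (- int l) \<omega>))"
      unfolding SX_def W_def by (simp add: sum_product sum_distrib_left mult_ac)
    also have "\<dots> = (\<Sum>l=n..<2*n. expectation (\<lambda>\<omega>. \<Sum>i=1..n. c l * (R (int i) 0 \<omega> * \<epsilon> (- int l) \<omega>)))"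
      by (intro Bochner_Integration.integral_sum Bochner_Integration.integrable_sum integrable_mult_right RE)
    also have "\<dots> = (\<Sum>l=n..<2*n. \<Sum>i=1..n. expectation (\<lambda>\<omega>. c l * (R (int i) 0 \<omega> * \<epsilon> (- int l) \<omega>)))"
      by (intro sum.cong refl Bochner_Integration.integral_sum integrable_mult_right RE)
    also have "\<dots> = (\<Sum>l=n..<2*n. \<Sum>i=1..n. c l * (a (i+l) * s2))" by (simp add: RE)
    also have "\<dots> = s2 * (\<Sum>l=n..<2*n. (c l)\<^sup>2)"
      unfolding sum_distrib_left
    proof (rule sum.cong[OF refl])
      fix l
      have "(\<Sum>i=1..n. c l * (a (i+l) * s2)) = c l * s2 * (\<Sum>i=1..n. a (i+l))" by (simp add: sum_distrib_left mult_ac)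
      then show "(\<Sum>i=1..n. c l * (a (i+l) * s2)) = s2 * (c l)\<^sup>2" by (simp add: c_def power2_eq_square mult_ac)
    qed
    finally have SW: "expectation (\<lambda>\<omega>. SX n \<omega> * W \<omega>) = s2 * (\<Sum>l=n..<2*n. (c l)\<^sup>2)" .
    have iSW: "integrable M (\<lambda>\<omega>. SX n \<omega> * W \<omega>)"
      by (rule integrable_mult_of_squares[OF _ _ K[OF n1] W2(1)]) auto
    \<comment> \<open>\<open>W\<close> is the orthogonal projection of \<open>SX n\<close> on the
      chosen innovations: the mean of \<open>SX n * W\<close> equals that of \<open>W^2\<close>.
      Expanding the square therefore bounds the second moment of \<open>SX n\<close> below by that
      of \<open>W\<close>.\<close>
    have "0 \<le> expectation (\<lambda>\<omega>. (SX n \<omega> - W \<omega>)\<^sup>2)" by simp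
    also have "\<dots> = expectation (\<lambda>\<omega>. (SX n \<omega>)\<^sup>2 - 2 * (SX n \<omega> * W \<omega>) + (W \<omega>)\<^sup>2)" by (simp add: power2_diff algebra_simps)
    also have "\<dots> = expectation (\<lambda>\<omega>. (SX n \<omega>)\<^sup>2) - 2 * expectation (\<lambda>\<omega>. SX n \<omega> * W \<omega>) + expectation (\<lambda>\<omega>. (W \<omega>)\<^sup>2)"
      using K[OF n1] W2(1) iSW by simp
    finally have low: "s2 * (\<Sum>l=n..<2*n. (c l)\<^sup>2) \<le> expectation (\<lambda>\<omega>. (SX n \<omega>)\<^sup>2)" unfolding SW W2(2) by simp
    have "psum \<theta> n / (B * C1) \<le> real n * \<theta> n / B"
      using C1 n1 B by (simp add: divide_simps mult_ac)
    then have pc: "psum \<theta> n / (B * C1) \<le> c l" if "l \<in> {n..<2*n}" for l using cl[OF that] by linarith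
    have p0: "0 \<le> psum \<theta> n / (B * C1)" using psum_nonneg_potter[OF potter_\<theta> \<beta>_pos] B C1 by simp
    have "(\<Sum>l=n..<2*n. (psum \<theta> n / (B * C1))\<^sup>2) \<le> (\<Sum>l=n..<2*n. (c l)\<^sup>2)"
      using pc p0 by (intro sum_mono power_mono) auto
    then have "s2 * (real n * (psum \<theta> n / (B * C1))\<^sup>2) \<le> s2 * (\<Sum>l=n..<2*n. (c l)\<^sup>2)"
      using s2_nonneg by (intro mult_left_mono) auto
    then show ?thesis using low by (simp add: power_divide mult_ac)
  qed
  moreover have "s2 / (B * C1)\<^sup>2 > 0" using s2_pos B C1 by simp
  ultimately show ?thesis by blast
qed

lemma SX_norm_bounds:
  assumes a: "\<And>n. n \<ge> n0 \<Longrightarrow> a n = \<theta> n" and n0: "n0 \<ge> 1"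
  shows "\<exists>c>0. \<exists>C>0. \<forall>n\<ge>n0. c * (sqrt (real n) * psum \<theta> n) \<le> sqrt (expectation (\<lambda>\<omega>. (SX n \<omega>)\<^sup>2))
      \<and> sqrt (expectation (\<lambda>\<omega>. (SX n \<omega>)\<^sup>2)) \<le> C * (sqrt (real n) * psum \<theta> n)"
proof -
  obtain c where c: "c > 0" "\<forall>n\<ge>n0. c * real n * (psum \<theta> n)\<^sup>2 \<le> expectation (\<lambda>\<omega>. (SX n \<omega>)\<^sup>2)" using SX_lower[OF a n0] by blast
  obtain K where K: "K > 0" "\<forall>n\<ge>1. integrable M (\<lambda>\<omega>. (SX n \<omega>)\<^sup>2) \<and> expectation (\<lambda>\<omega>. (SX n \<omega>)\<^sup>2) \<le> K * real n * (psum \<theta> n)\<^sup>2" using SX_upper by blast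
  have p: "0 \<le> psum \<theta> n" for n by (rule psum_nonneg_potter[OF potter_\<theta> \<beta>_pos])
  have e: "sqrt (k * real n * (psum \<theta> n)\<^sup>2) = sqrt k * (sqrt (real n) * psum \<theta> n)" for k n
    using p[of n] by (simp add: real_sqrt_mult)
  have "sqrt c * (sqrt (real n) * psum \<theta> n) \<le> sqrt (expectation (\<lambda>\<omega>. (SX n \<omega>)\<^sup>2)) \<and> sqrt (expectation (\<lambda>\<omega>. (SX n \<omega>)\<^sup>2)) \<le> sqrt K * (sqrt (real n) * psum \<theta> n)"
    if "n \<ge> n0" for n
    unfolding e[symmetric] using c(2) K(2) that n0 by (auto intro!: real_sqrt_le_mono)
  moreover have "sqrt c > 0" "sqrt K > 0" using c K by auto
  ultimately show ?thesis by blast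
qed

lemma ln_ln_ge_1: "n \<ge> 27 \<Longrightarrow> 1 \<le> ln (ln (real n))"
proof -
  assume n: "n \<ge> 27"
  have "exp 1 \<le> ln (real n)" using ln_ge_3[OF n] exp_le by linarith
  then show ?thesis using ln_ge_3[OF n] by (subst ln_ge_iff) auto
qed

text \<open>Both 1 and the index \<open>2 * \<beta> - 1/2\<close> of \<open>\<psi>\<close> exceed
  \<open>\<beta>\<close>, so \<open>psum \<psi>\<close> is smaller than \<open>psum \<theta>\<close>
  by a power of \<open>n\<close>, which swallows the logarithm.\<close>

lemma psum_\<psi>_ln_le: "\<exists>C>0. \<forall>\<^sub>F n in sequentially. psum \<psi> n * ln (real n) \<le> C * psum \<theta> n"
proof -
  define u where "u = min 1 (2*\<beta> - 1/2)"
  have u: "\<beta> < u" using \<beta>_gt \<beta>_lt by (auto simp: u_def)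
  define d where "d = (u - \<beta>)/3"
  have d: "d > 0" using u by (simp add: d_def)
  define s1 where "s1 = \<beta> + d"
  define s2' where "s2' = \<beta> + 2 * d"
  have "3 * d = u - \<beta>" by (simp add: d_def)
  then have s2u: "s2' < u" unfolding s2'_def using d by linarith
  then have s2b: "s2' < 2*\<beta> - 1/2" "s2' < 1" "0 \<le> s2'" using d \<beta>_pos by (auto simp: u_def s2'_def)
  have g: "2*\<beta> - 1/2 > 0" using \<beta>_gt by simp
  obtain C1 where C1: "C1 > 0" "\<forall>n\<ge>1. psum \<psi> n \<le> C1 * real n powr (1-s2')"
    using psum_upper[OF potter_\<psi> g s2b(1) s2b(3) s2b(2)] by blast
  have "\<beta> < s1" using d by (simp add: s1_def)
  then obtain C2 where C2: "C2 > 0" "\<forall>n\<ge>1. real n powr (1-s1) \<le> C2 * psum \<theta> n"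
    using psum_lower[OF potter_\<theta> \<beta>_pos] by blast
  have ln: "\<forall>\<^sub>F n in sequentially. ln (real n) \<le> real n powr d" using d by real_asymp
  have "\<forall>\<^sub>F n in sequentially. psum \<psi> n * ln (real n) \<le> (C1 * C2) * psum \<theta> n"
    using ln eventually_ge_at_top[of 27]
  proof eventually_elim
    case (elim n)
    have n: "n \<ge> 1" using elim by simp
    have l0: "0 \<le> ln (real n)" using n by simp
    have "psum \<psi> n * ln (real n) \<le> (C1 * real n powr (1-s2')) * real n powr d"
      using C1 n elim l0 by (intro mult_mono) auto
    also have "\<dots> = C1 * (real n powr (1-s2') * real n powr d)" by simp
    also have "real n powr (1-s2') * real n powr d = real n powr (1-s1)"
    proof -
      have "1 - s2' + d = 1 - s1" by (simp add: s1_def s2'_def)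
      then show ?thesis unfolding powr_add[symmetric] by (simp only:)
    qed
    also have "C1 * real n powr (1-s1) \<le> C1 * (C2 * psum \<theta> n)" using C1 C2 n by (intro mult_left_mono) auto
    finally show ?case by simp
  qed
  then show ?thesis using C1 C2 by (intro exI[of _ "C1 * C2"]) auto
qed

section \<open>Comparison of the rates with \<open>b\<close>, given only the exact order of
  \<open>\<sigma>\<close>\<close>

context
  fixes \<sigma> b :: "nat \<Rightarrow> real" and c C :: real and n0 :: nat
  assumes c: "c > 0" "\<And>n. n \<ge> n0 \<Longrightarrow> c * (sqrt (real n) * psum \<theta> n) \<le> \<sigma> n"
    and C: "C > 0" "\<And>n. n \<ge> n0 \<Longrightarrow> \<sigma> n \<le> C * (sqrt (real n) * psum \<theta> n)"
    and b: "\<And>n. b n = \<sigma> n * sqrt (ln (real n)) * ln (ln (real n)) / real n"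
begin

lemma nb_lower:
  assumes n: "n \<ge> 27" "n \<ge> n0"
  shows "c * (sqrt (real n) * psum \<theta> n * sqrt (ln (real n)) * ln (ln (real n))) \<le> real n * b n"
proof -
  have l3: "3 \<le> ln (real n)" and ll: "1 \<le> ln (ln (real n))" using ln_ge_3 ln_ln_ge_1 n(1) by blast+
  have "real n * b n = \<sigma> n * (sqrt (ln (real n)) * ln (ln (real n)))" using n by (simp add: b)
  moreover have "c * (sqrt (real n) * psum \<theta> n) * (sqrt (ln (real n)) * ln (ln (real n))) \<le> \<sigma> n * (sqrt (ln (real n)) * ln (ln (real n)))"
    using c(2)[OF n(2)] l3 ll by (intro mult_right_mono) auto
  ultimately show ?thesis by (simp add: mult_ac)
qed

text \<open>\<open>psum \<theta>\<close> is bounded below by its first term, so \<open>b n\<close>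
  is at least of order \<open>sqrt (ln n / n)\<close>, the size of the martingale part.\<close>

lemma sqrt_n_ln_le_nb: "\<exists>K>0. \<forall>\<^sub>F n in sequentially. sqrt (real n * ln (real n)) \<le> K * (real n * b n)"
proof -
  have t1: "\<theta> 1 > 0" using potter_pos[OF potter_\<theta>] by simp
  have "\<forall>\<^sub>F n in sequentially. sqrt (real n * ln (real n)) \<le> (1 / (c * \<theta> 1)) * (real n * b n)"
    using eventually_ge_at_top[of "max 27 n0"]
  proof eventually_elim
    case (elim n)
    have n: "n \<ge> 27" "n \<ge> n0" "n \<ge> 1" using elim by auto
    have l3: "3 \<le> ln (real n)" and ll: "1 \<le> ln (ln (real n))" using ln_ge_3 ln_ln_ge_1 n(1) by blast+
    have p1: "\<theta> 1 \<le> psum \<theta> n" using psum_mono_potter[OF potter_\<theta> \<beta>_pos n(3)] by (simp add: psum_def)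
    have "c * (sqrt (real n) * \<theta> 1 * sqrt (ln (real n)) * 1) \<le> c * (sqrt (real n) * psum \<theta> n * sqrt (ln (real n)) * ln (ln (real n)))"
      using c(1) l3 ll p1 t1 by (intro mult_left_mono mult_mono) auto
    also have "\<dots> \<le> real n * b n" by (rule nb_lower[OF n(1,2)])
    finally have "(c * \<theta> 1) * sqrt (real n * ln (real n)) \<le> real n * b n" by (simp add: real_sqrt_mult mult_ac)
    then show ?case using c(1) t1 by (simp add: field_simps)
  qed
  then show ?thesis using c t1 by (intro exI[of _ "1 / (c * \<theta> 1)"]) auto
qed

lemma ln_le_nb: "\<forall>\<^sub>F n in sequentially. ln (real n) \<le> real n * b n"
proof -
  obtain K where K: "K > 0" "\<forall>\<^sub>F n in sequentially. sqrt (real n * ln (real n)) \<le> K * (real n * b n)"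
    using sqrt_n_ln_le_nb by blast
  have "\<forall>\<^sub>F n in sequentially. K * ln (real n) \<le> sqrt (real n * ln (real n))" by real_asymp
  then show ?thesis using K(2)
  proof eventually_elim
    case (elim n)
    then have "K * ln (real n) \<le> K * (real n * b n)" by linarith
    then show ?case using K(1) by simp
  qed
qed

text \<open>As \<open>\<beta> < 1\<close>, the case factor of \<open>rate\<close> is 1, and the
  square root of what remains is the lower bound of \<open>nb_lower\<close> up to the factor
  \<open>c\<close>. This is how the sample mean acquires the scale \<open>b\<close>.\<close>

lemma sqrt_rate_\<theta>_le_nb: "\<exists>K>0. \<forall>\<^sub>F n in sequentially. sqrt (rate \<beta> \<theta> n) \<le> K * (real n * b n)"
proof -
  have "\<forall>\<^sub>F n in sequentially. sqrt (rate \<beta> \<theta> n) \<le> (1/c) * (real n * b n)"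
    using eventually_ge_at_top[of "max 27 n0"]
  proof eventually_elim
    case (elim n)
    have n: "n \<ge> 27" "n \<ge> n0" using elim by auto
    have l3: "3 \<le> ln (real n)" and ll: "1 \<le> ln (ln (real n))" using ln_ge_3 ln_ln_ge_1 n(1) by blast+
    have "sqrt (rate \<beta> \<theta> n) = sqrt (real n) * psum \<theta> n * sqrt (ln (real n)) * ln (ln (real n))"
      unfolding rate_def using \<beta>_lt ll psum_nonneg_potter[OF potter_\<theta> \<beta>_pos, of n] by (simp add: real_sqrt_mult)
    then show ?case using nb_lower[OF n] c(1) by (simp add: field_simps)
  qed
  then show ?thesis using c by (intro exI[of _ "1/c"]) auto
qed

text \<open>The possible extra factor \<open>ln n\<close> in the square root of the rate is covered
  by the power gap between \<open>psum \<psi>\<close> and \<open>psum \<theta>\<close>.\<close>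

lemma sqrt_rate_\<psi>_le_nb: "\<exists>K>0. \<forall>\<^sub>F n in sequentially. sqrt (rate (2*\<beta> - 1/2) \<psi> n) \<le> K * (real n * b n)"
proof -
  have g: "2*\<beta> - 1/2 > 0" using \<beta>_gt by simp
  obtain C1 where C1: "C1 > 0" "\<forall>\<^sub>F n in sequentially. psum \<psi> n * ln (real n) \<le> C1 * psum \<theta> n" using psum_\<psi>_ln_le by blast
  have "\<forall>\<^sub>F n in sequentially. sqrt (rate (2*\<beta> - 1/2) \<psi> n) \<le> (C1/c) * (real n * b n)"
    using C1(2) eventually_ge_at_top[of "max 27 n0"]
  proof eventually_elim
    case (elim n)
    have n: "n \<ge> 27" "n \<ge> n0" using elim by auto
    have l3: "3 \<le> ln (real n)" and ll: "1 \<le> ln (ln (real n))" using ln_ge_3 ln_ln_ge_1 n(1) by blast+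
    have p: "0 \<le> psum \<psi> n" by (rule psum_nonneg_potter[OF potter_\<psi> g])
    define e where "e = (if 2*\<beta> - 1/2 < 1 then 1 else ln (real n))"
    have e: "0 \<le> e" "e \<le> ln (real n)" using l3 by (auto simp: e_def)
    have "rate (2*\<beta> - 1/2) \<psi> n = real n * (psum \<psi> n)\<^sup>2 * e\<^sup>2 * ln (real n) * (ln (ln (real n)))\<^sup>2"
      by (simp add: rate_def e_def)
    then have "sqrt (rate (2*\<beta> - 1/2) \<psi> n) = sqrt (real n) * psum \<psi> n * e * sqrt (ln (real n)) * ln (ln (real n))"
      using ll p e by (simp add: real_sqrt_mult)
    also have "\<dots> = sqrt (real n) * (psum \<psi> n * e) * (sqrt (ln (real n)) * ln (ln (real n)))" by simp
    also have "psum \<psi> n * e \<le> psum \<psi> n * ln (real n)" using p e by (intro mult_left_mono) auto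
    also have "\<dots> \<le> C1 * psum \<theta> n" by (rule elim(1))
    finally have "sqrt (rate (2*\<beta> - 1/2) \<psi> n) \<le> sqrt (real n) * (C1 * psum \<theta> n) * (sqrt (ln (real n)) * ln (ln (real n)))"
      using ll l3 by (simp add: mult_left_mono mult_right_mono)
    also have "\<dots> = C1 / c * (c * (sqrt (real n) * psum \<theta> n * sqrt (ln (real n)) * ln (ln (real n))))"
      using c(1) by simp
    also have "\<dots> \<le> C1 / c * (real n * b n)" using nb_lower[OF n] C1(1) c(1) by (intro mult_left_mono) auto
    finally show ?case .
  qed
  then show ?thesis using c C1 by (intro exI[of _ "C1/c"]) auto
qed

lemma b_tendsto_0: "b \<longlonglongrightarrow> 0"
proof -
  define s where "s = (1/2 + \<beta>)/2"
  have s: "s < \<beta>" "s > 1/2" "0 \<le> s" "s < 1" using \<beta>_gt \<beta>_lt by (auto simp: s_def)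
  obtain C1 where C1: "C1 > 0" "\<forall>n\<ge>1. psum \<theta> n \<le> C1 * real n powr (1-s)"
    using psum_upper[OF potter_\<theta> \<beta>_pos s(1) s(3) s(4)] by blast
  have lim: "(\<lambda>n. C * C1 * (sqrt (real n) * real n powr (1-s) * sqrt (ln (real n)) * ln (ln (real n)) / real n)) \<longlonglongrightarrow> 0"
    using s(2) by real_asymp
  show ?thesis
  proof (rule Lim_null_comparison[OF _ lim])
    show "\<forall>\<^sub>F n in sequentially. norm (b n) \<le> C * C1 * (sqrt (real n) * real n powr (1-s) * sqrt (ln (real n)) * ln (ln (real n)) / real n)"
      using eventually_ge_at_top[of "max 27 n0"]
    proof eventually_elim
      case (elim n)
      have n: "n \<ge> 27" "n \<ge> n0" "n \<ge> 1" using elim by auto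
      have l3: "3 \<le> ln (real n)" and ll: "1 \<le> ln (ln (real n))" using ln_ge_3 ln_ln_ge_1 n(1) by blast+
      have p: "0 \<le> psum \<theta> n" by (rule psum_nonneg_potter[OF potter_\<theta> \<beta>_pos])
      have "0 \<le> c * (sqrt (real n) * psum \<theta> n)" using c p by simp
      then have \<sigma>0: "0 \<le> \<sigma> n" using c(2)[OF n(2)] by linarith
      have "\<sigma> n \<le> C * (sqrt (real n) * (C1 * real n powr (1-s)))"
        using C(2)[OF n(2)] C(1) C1(2)[rule_format, OF n(3)] by (meson mult_left_mono order_trans real_sqrt_ge_zero of_nat_0_le_iff less_imp_le)
      then have "\<sigma> n * (sqrt (ln (real n)) * ln (ln (real n)) / real n) \<le> C * (sqrt (real n) * (C1 * real n powr (1-s))) * (sqrt (ln (real n)) * ln (ln (real n)) / real n)"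
        using l3 ll by (intro mult_right_mono) auto
      moreover have "norm (b n) = \<sigma> n * (sqrt (ln (real n)) * ln (ln (real n)) / real n)" using \<sigma>0 l3 ll by (simp add: b)
      ultimately show ?case by (simp add: mult_ac)
    qed
  qed
qed

end

text \<open>\<open>2 * \<beta> - 1/2 < 1\<close> is the same as \<open>\<beta> < 3/4\<close>, so the
  case distinctions of \<open>rate\<close> and \<open>A_seq\<close> coincide; the summands differ
  only below \<open>n0\<close>.\<close>

lemma rate_\<psi>_le_A_seq:
  assumes n0: "n0 \<ge> 1" and L: "\<And>n. n \<ge> n0 \<Longrightarrow> \<theta> n = real n powr (-\<beta>) * L (real n)"
  shows "\<exists>K>0. \<forall>\<^sub>F n in sequentially. rate (2*\<beta> - 1/2) \<psi> n \<le> K * A_seq \<beta> L n"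
proof -
  define \<phi> where "\<phi> = (\<lambda>k. real k powr (1/2 - 2*\<beta>) * (L (real k))\<^sup>2)"
  have eq: "\<phi> n = \<psi> n" if n: "n \<ge> n0" for n
  proof -
    have "\<psi> n = sqrt (real n) * (real n powr (-\<beta>))\<^sup>2 * (L (real n))\<^sup>2" by (simp add: \<psi>_def L[OF n] power_mult_distrib)
    also have "sqrt (real n) * (real n powr (-\<beta>))\<^sup>2 = real n powr (1/2) * (real n powr (-\<beta>) * real n powr (-\<beta>))"
      by (simp add: powr_half_sqrt power2_eq_square)
    also have "\<dots> = real n powr (1/2 - 2*\<beta>)" unfolding powr_add[symmetric] by simp
    finally show ?thesis by (simp add: \<phi>_def)
  qed
  have \<phi>0: "0 \<le> \<phi> n" for n by (simp add: \<phi>_def)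
  obtain K where K: "K > 0" "\<forall>n\<ge>n0. psum \<psi> n \<le> K * psum \<phi> n \<and> psum \<phi> n \<le> K * psum \<psi> n"
    using psum_upto_cong_bound[of \<psi> n0 \<phi>, OF potter_pos[OF potter_\<psi>] eq \<phi>0 n0] by blast
  have g: "2*\<beta> - 1/2 > 0" using \<beta>_gt by simp
  have "\<forall>\<^sub>F n in sequentially. rate (2*\<beta> - 1/2) \<psi> n \<le> K\<^sup>2 * A_seq \<beta> L n"
    using eventually_ge_at_top[of "max 27 n0"]
  proof eventually_elim
    case (elim n)
    have n: "n \<ge> 27" "n \<ge> n0" using elim by auto
    have l3: "3 \<le> ln (real n)" using n by (intro ln_ge_3)
    define e where "e = (if \<beta> < 3/4 then 1 else (ln (real n))\<^sup>2)"
    have e: "0 \<le> e" by (simp add: e_def)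
    have "Psi \<beta> L n = sqrt (real n) * psum \<phi> n" by (simp add: Psi_def psum_def \<phi>_def)
    then have A: "A_seq \<beta> L n = real n * (psum \<phi> n)\<^sup>2 * e * ln (real n) * (ln (ln (real n)))\<^sup>2"
      by (simp add: A_seq_def e_def power_mult_distrib power3_eq_cube power2_eq_square)
    have r: "rate (2*\<beta> - 1/2) \<psi> n = real n * (psum \<psi> n)\<^sup>2 * e * ln (real n) * (ln (ln (real n)))\<^sup>2"
      by (simp add: rate_def e_def)
    have "(psum \<psi> n)\<^sup>2 \<le> (K * psum \<phi> n)\<^sup>2"
      using K(2) n psum_nonneg_potter[OF potter_\<psi> g, of n] by (intro power_mono) auto
    then have "real n * (psum \<psi> n)\<^sup>2 * e * ln (real n) * (ln (ln (real n)))\<^sup>2 \<le> real n * (K * psum \<phi> n)\<^sup>2 * e * ln (real n) * (ln (ln (real n)))\<^sup>2"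
      using l3 e by (intro mult_right_mono mult_left_mono) auto
    then show ?case unfolding A r by (simp add: power_mult_distrib mult_ac)
  qed
  then show ?thesis using K(1) by (intro exI[of _ "K\<^sup>2"]) auto
qed

end

section \<open>The smooth part of the empirical distribution function\<close>

text \<open>The Taylor bound is evaluated at the minimizer \<open>- g' x / (2 * L)\<close> of its
  quadratic majorant, which must still be nonnegative there.\<close>

lemma nonneg_deriv_square_le:
  fixes g g' :: "real \<Rightarrow> real"
  assumes nn: "\<And>x. 0 \<le> g x" and d: "\<And>y. (g has_real_derivative g' y) (at y)"
    and L: "\<And>u v. \<bar>g' u - g' v\<bar> \<le> L * \<bar>u - v\<bar>" and L0: "L > 0"
  shows "(g' x)\<^sup>2 \<le> 4 * L * g x"
proof -
  define t where "t = - g' x / (2 * L)"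
  have "\<bar>g (x + t) - g x - t * g' x\<bar> \<le> L * t\<^sup>2" by (rule taylor1_of_lipschitz_deriv[OF d L])
  then have "0 \<le> g x + t * g' x + L * t\<^sup>2" using nn[of "x + t"] by linarith
  also have "\<dots> = g x - (g' x)\<^sup>2 / (4 * L)" using L0 by (simp add: t_def power2_eq_square field_simps)
  finally show ?thesis using L0 by (simp add: field_simps)
qed

text \<open>An increment is the integral of the derivative over the shift; Tonelli and translation
  invariance give the length of the shift times the L1 norm.\<close>

lemma L1_modulus_of_deriv:
  fixes g g' :: "real \<Rightarrow> real"
  assumes d: "\<And>y. (g has_real_derivative g' y) (at y)" and c: "continuous_on UNIV g'"
    and G: "(\<integral>\<^sup>+u. ennreal \<bar>g' u\<bar> \<partial>lborel) \<le> ennreal G1" and G1: "G1 \<ge> 0"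
  shows "(\<integral>\<^sup>+u. ennreal \<bar>g (u + t) - g u\<bar> \<partial>lborel) \<le> ennreal (G1 * \<bar>t\<bar>)"
proof -
  have cg: "continuous_on UNIV g" using d by (meson DERIV_isCont continuous_at_imp_continuous_on)
  have [measurable]: "g \<in> borel_measurable borel" "g' \<in> borel_measurable borel"
    using borel_measurable_continuous_onI[OF cg] borel_measurable_continuous_onI[OF c] by auto
  have pos: "(\<integral>\<^sup>+u. ennreal \<bar>g (u + t) - g u\<bar> \<partial>lborel) \<le> ennreal (G1 * t)" if t: "t \<ge> 0" for t
  proof -
    have ptw: "ennreal \<bar>g (u + t) - g u\<bar> \<le> (\<integral>\<^sup>+s. indicator {0..t} s * ennreal \<bar>g' (u + s)\<bar> \<partial>lborel)" for u
    proof -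
      have cs: "continuous_on A (\<lambda>s. g' (u + s))" for A
        by (rule continuous_on_compose2[OF c]) (auto intro!: continuous_intros)
      have "((\<lambda>s. g' (u + s)) has_integral g (u + t) - g (u + 0)) {0..t}"
      proof (rule fundamental_theorem_of_calculus[OF t])
        fix s
        have "((\<lambda>s. g (u + s)) has_real_derivative g' (u + s)) (at s)"
          using DERIV_shift[of g "g' (u + s)" s u] d[of "u + s"] by (simp add: add.commute)
        then show "((\<lambda>s. g (u + s)) has_vector_derivative g' (u + s)) (at s within {0..t})"
          by (simp add: has_real_derivative_iff_has_vector_derivative has_vector_derivative_at_within)
      qed
      then have e: "g (u + t) - g u = integral {0..t} (\<lambda>s. g' (u + s))" by (simp add: integral_unique)
      have "norm (integral {0..t} (\<lambda>s. g' (u + s))) \<le> integral {0..t} (\<lambda>s. \<bar>g' (u + s)\<bar>)"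
        by (rule integral_norm_bound_integral) (auto intro!: integrable_continuous_interval continuous_intros cs)
      then have le: "\<bar>g (u + t) - g u\<bar> \<le> integral {0..t} (\<lambda>s. \<bar>g' (u + s)\<bar>)" unfolding e by simp
      have "((\<lambda>s. \<bar>g' (u + s)\<bar>) has_integral integral {0..t} (\<lambda>s. \<bar>g' (u + s)\<bar>)) {0..t}"
        by (intro integrable_integral integrable_continuous_interval continuous_intros cs)
      then have "((\<lambda>s. if s \<in> {0..t} then \<bar>g' (u + s)\<bar> else 0) has_integral integral {0..t} (\<lambda>s. \<bar>g' (u + s)\<bar>)) UNIV"
        by (subst has_integral_restrict_UNIV)
      then have "(\<integral>\<^sup>+s. ennreal (if s \<in> {0..t} then \<bar>g' (u + s)\<bar> else 0) \<partial>lborel) = ennreal (integral {0..t} (\<lambda>s. \<bar>g' (u + s)\<bar>))"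
        by (intro nn_integral_has_integral_lborel) auto
      also have "(\<lambda>s. ennreal (if s \<in> {0..t} then \<bar>g' (u + s)\<bar> else 0)) = (\<lambda>s. indicator {0..t} s * ennreal \<bar>g' (u + s)\<bar>)"
        by (auto simp: indicator_def)
      finally show ?thesis using le by (simp add: ennreal_leI)
    qed
    have "(\<integral>\<^sup>+u. ennreal \<bar>g (u + t) - g u\<bar> \<partial>lborel) \<le> (\<integral>\<^sup>+u. (\<integral>\<^sup>+s. indicator {0..t} s * ennreal \<bar>g' (u + s)\<bar> \<partial>lborel) \<partial>lborel)"
      by (intro nn_integral_mono ptw)
    also have "\<dots> = (\<integral>\<^sup>+s. (\<integral>\<^sup>+u. indicator {0..t} s * ennreal \<bar>g' (u + s)\<bar> \<partial>lborel) \<partial>lborel)"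
      by (rule lborel_pair.Fubini') measurable
    also have "\<dots> = (\<integral>\<^sup>+s. indicator {0..t} s * (\<integral>\<^sup>+u. ennreal \<bar>g' (u + s)\<bar> \<partial>lborel) \<partial>lborel)"
      by (intro nn_integral_cong nn_integral_cmult) measurable
    also have "\<dots> \<le> (\<integral>\<^sup>+s. indicator {0..t} s * ennreal G1 \<partial>lborel)"
    proof (intro nn_integral_mono mult_left_mono)
      fix s
      have "(\<integral>\<^sup>+u. ennreal \<bar>g' (u + s)\<bar> \<partial>lborel) = (\<integral>\<^sup>+u. ennreal \<bar>g' u\<bar> \<partial>lborel)"
        using nn_integral_real_affine[of "\<lambda>u. ennreal \<bar>g' u\<bar>" 1 s] by (simp add: add.commute)
      then show "(\<integral>\<^sup>+u. ennreal \<bar>g' (u + s)\<bar> \<partial>lborel) \<le> ennreal G1" using G by simp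
    qed simp
    also have "\<dots> = ennreal t * ennreal G1" using t by (simp add: nn_integral_multc)
    also have "\<dots> = ennreal (G1 * t)" using t G1 by (simp add: ennreal_mult mult.commute)
    finally show ?thesis .
  qed
  show ?thesis
  proof (cases "t \<ge> 0")
    case True then show ?thesis using pos[of t] by simp
  next
    case False
    \<comment> \<open>Translating \<open>u\<close> by \<open>- t\<close> exchanges the two arguments
      and reduces the claim to a positive shift.\<close>
    have "(\<integral>\<^sup>+u. ennreal \<bar>g (u + t) - g u\<bar> \<partial>lborel) = (\<integral>\<^sup>+u. ennreal \<bar>g (- t + 1 * u + t) - g (- t + 1 * u)\<bar> \<partial>lborel)"
      using nn_integral_real_affine[of "\<lambda>u. ennreal \<bar>g (u + t) - g u\<bar>" 1 "- t"] by simp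
    also have "\<dots> = (\<integral>\<^sup>+u. ennreal \<bar>g (u + (- t)) - g u\<bar> \<partial>lborel)"
      by (intro nn_integral_cong) (simp add: abs_minus_commute add.commute)
    also have "\<dots> \<le> ennreal (G1 * (- t))" using False by (intro pos) simp
    finally show ?thesis using False by simp
  qed
qed

text \<open>A derivative is a pointwise limit of difference quotients. The case of interest is the
  second derivative of the density, of which only boundedness is known.\<close>

lemma borel_measurable_of_derivative:
  fixes h h' :: "real \<Rightarrow> real"
  assumes d: "\<And>y. (h has_real_derivative h' y) (at y)"
  shows "h' \<in> borel_measurable borel"
proof -
  have "continuous_on UNIV h" using d by (meson DERIV_isCont continuous_at_imp_continuous_on)
  then have [measurable]: "h \<in> borel_measurable borel" by (rule borel_measurable_continuous_onI)
  show ?thesis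
  proof (rule borel_measurable_LIMSEQ_real)
    fix x
    have "((\<lambda>t. (h (x + t) - h x) / t) \<longlongrightarrow> h' x) (at 0)" using d[of x] by (simp add: DERIV_def)
    moreover have "filterlim (\<lambda>n. 1 / real (Suc n)) (at 0) sequentially"
      unfolding filterlim_at using LIMSEQ_inverse_real_of_nat by (auto simp: inverse_eq_divide)
    ultimately show "(\<lambda>n. (h (x + 1 / real (Suc n)) - h x) / (1 / real (Suc n))) \<longlonglongrightarrow> h' x"
      by (rule filterlim_compose)
  qed measurable
qed

text \<open>Near a continuity point the mass of a short interval is squeezed between its length
  times \<open>f x - e\<close> and its length times \<open>f x + e\<close>.\<close>

lemma density_cdf_has_derivative:
  fixes f :: "real \<Rightarrow> real"
  assumes nn: "\<And>x. 0 \<le> f x" and m[measurable]: "f \<in> borel_measurable borel" and fin: "finite_measure (density lborel (\<lambda>x. ennreal (f x)))"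
    and c: "isCont f x"
  shows "((\<lambda>x. measure (density lborel (\<lambda>x. ennreal (f x))) {..x}) has_real_derivative f x) (at x)"
proof -
  define \<nu> where "\<nu> = density lborel (\<lambda>x. ennreal (f x))"
  interpret finite_measure \<nu> unfolding \<nu>_def by (rule fin)
  have [simp, measurable_cong]: "sets \<nu> = sets borel" by (simp add: \<nu>_def)
  define C where "C = (\<lambda>x. measure \<nu> {..x})"
  have diff: "C b - C a = measure \<nu> {a<..b}" if "a \<le> b" for a b
  proof -
    have "measure \<nu> ({..b} - {..a}) = measure \<nu> {..b} - measure \<nu> {..a}" using that by (intro finite_measure_Diff) auto
    moreover have "{..b} - {..a} = {a<..b}" by auto
    ultimately show ?thesis by (simp add: C_def)
  qed
  have bound: "\<bar>C b - C a - k * (b - a)\<bar> \<le> e * (b - a)"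
    if ab: "a \<le> b" and ke: "\<And>y. y \<in> {a<..b} \<Longrightarrow> \<bar>f y - k\<bar> \<le> e" and k: "k \<ge> 0" "e \<ge> 0" for a b k e
  proof -
    have em: "ennreal (measure \<nu> {a<..b}) = (\<integral>\<^sup>+y. ennreal (f y) * indicator {a<..b} y \<partial>lborel)"
      unfolding emeasure_eq_measure[symmetric] unfolding \<nu>_def by (rule emeasure_density) auto
    have "(\<integral>\<^sup>+y. ennreal (f y) * indicator {a<..b} y \<partial>lborel) \<le> (\<integral>\<^sup>+y. ennreal (k + e) * indicator {a<..b} y \<partial>lborel)"
    proof (rule nn_integral_mono)
      fix y show "ennreal (f y) * indicator {a<..b} y \<le> ennreal (k + e) * indicator {a<..b} y"
        using ke[of y] by (cases "y \<in> {a<..b}") (auto intro!: ennreal_leI)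
    qed
    also have "\<dots> = ennreal ((k + e) * (b - a))" using ab k by (simp add: nn_integral_cmult ennreal_mult)
    finally have up: "measure \<nu> {a<..b} \<le> (k + e) * (b - a)" unfolding em[symmetric] using ab k by (subst (asm) ennreal_le_iff) auto
    \<comment> \<open>The maximum keeps the factor nonnegative, as \<open>ennreal\<close> would cut
      off a negative one.\<close>
    have "ennreal (max 0 (k - e) * (b - a)) = (\<integral>\<^sup>+y. ennreal (max 0 (k - e)) * indicator {a<..b} y \<partial>lborel)"
      using ab by (simp add: nn_integral_cmult ennreal_mult)
    also have "\<dots> \<le> (\<integral>\<^sup>+y. ennreal (f y) * indicator {a<..b} y \<partial>lborel)"
    proof (rule nn_integral_mono)
      fix y show "ennreal (max 0 (k - e)) * indicator {a<..b} y \<le> ennreal (f y) * indicator {a<..b} y"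
        using ke[of y] nn[of y] by (cases "y \<in> {a<..b}") (auto intro!: ennreal_leI)
    qed
    finally have lo: "max 0 (k - e) * (b - a) \<le> measure \<nu> {a<..b}" unfolding em[symmetric] by (subst (asm) ennreal_le_iff) auto
    have "(k - e) * (b - a) \<le> max 0 (k - e) * (b - a)" using ab by (intro mult_right_mono) auto
    then have "(k - e) * (b - a) \<le> C b - C a" "C b - C a \<le> (k + e) * (b - a)" using lo up diff[OF ab] by auto
    then show ?thesis by (simp add: abs_le_iff algebra_simps)
  qed
  have "((\<lambda>t. (C (x + t) - C x) / t) \<longlongrightarrow> f x) (at 0)"
  proof (rule tendstoI)
    fix e :: real assume e: "e > 0"
    obtain d where d: "d > 0" "\<And>y. \<bar>y - x\<bar> < d \<Longrightarrow> \<bar>f y - f x\<bar> < e/2"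
      using c e unfolding continuous_at_eps_delta dist_real_def by (meson half_gt_zero)
    have "dist ((C (x + t) - C x) / t) (f x) < e" if t: "t \<noteq> 0" "\<bar>t\<bar> < d" for t
    proof -
      have "\<bar>C (x + t) - C x - f x * t\<bar> \<le> e/2 * \<bar>t\<bar>"
      proof (cases "t > 0")
        case True
        have "\<bar>C (x + t) - C x - f x * (x + t - x)\<bar> \<le> e/2 * (x + t - x)"
        proof (rule bound)
          fix y assume "y \<in> {x<..x + t}"
          then have "\<bar>y - x\<bar> < d" using t by auto
          then show "\<bar>f y - f x\<bar> \<le> e/2" using d(2)[of y] by linarith
        qed (use True e nn in auto)
        then show ?thesis using True by simp
      next
        case False
        have "\<bar>C x - C (x + t) - f x * (x - (x + t))\<bar> \<le> e/2 * (x - (x + t))"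
        proof (rule bound)
          fix y assume "y \<in> {x + t<..x}"
          then have "\<bar>y - x\<bar> < d" using t by auto
          then show "\<bar>f y - f x\<bar> \<le> e/2" using d(2)[of y] by linarith
        qed (use False e nn in auto)
        then show ?thesis using False by (simp add: abs_minus_commute abs_if split: if_splits)
      qed
      moreover have "((C (x + t) - C x) / t - f x) * t = C (x + t) - C x - f x * t" using t by (simp add: field_simps)
      ultimately have "\<bar>(C (x + t) - C x) / t - f x\<bar> * \<bar>t\<bar> \<le> e/2 * \<bar>t\<bar>"
        unfolding abs_mult[symmetric] by (simp only:)
      then have "\<bar>(C (x + t) - C x) / t - f x\<bar> \<le> e/2" using t by (simp add: mult_le_cancel_right)
      then show ?thesis using e by (simp add: dist_real_def)
    qed
    then show "\<forall>\<^sub>F t in at 0. dist ((C (x + t) - C x) / t) (f x) < e"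
      using d(1) unfolding eventually_at by (intro exI[of _ d]) (auto simp: dist_real_def)
  qed
  then have "(C has_real_derivative f x) (at x)" by (simp add: DERIV_def)
  then show ?thesis unfolding C_def \<nu>_def .
qed

locale lrd_linear = smooth_linear M \<epsilon> g a \<beta> Ca \<theta> G1
  for M :: "'a measure" and \<epsilon> g a \<beta> Ca \<theta> G1 +
  fixes g1 g2 f F L :: "real \<Rightarrow> real" and \<kappa> p0 p1 :: real and n0 :: nat
  assumes g_deriv: "\<And>y. (g has_real_derivative g1 y) (at y)" and g1_deriv: "\<And>y. (g1 has_real_derivative g2 y) (at y)"
    and g_bounds: "\<And>y. g y \<le> \<kappa>" "\<And>y. \<bar>g1 y\<bar> \<le> \<kappa>" "\<And>y. \<bar>g2 y\<bar> \<le> \<kappa>" and \<kappa>1: "1 \<le> \<kappa>"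
    and a_0: "a 0 = 1" and n0: "n0 \<ge> 1" and a_eq: "\<And>n. n \<ge> n0 \<Longrightarrow> a n = \<theta> n"
    and \<theta>_eq: "\<And>n. n \<ge> n0 \<Longrightarrow> \<theta> n = real n powr (-\<beta>) * L (real n)"
    and F_cdf: "\<And>k. F = cdf (distr M borel (R k 0))"
    and f_nonneg: "\<And>x. 0 \<le> f x" and f_dist: "\<And>k. distributed M lborel (R k 0) (\<lambda>x. ennreal (f x))"
    and f_cont: "continuous_on UNIV f"
    and p01: "0 < p0" "p0 < p1" "p1 < 1"
    and f_pos: "(INF p\<in>{p0..p1}. f (quantile F p)) > 0"
begin

lemma g2_measurable[measurable]: "g2 \<in> borel_measurable borel"
  by (rule borel_measurable_of_derivative[OF g1_deriv])
lemma g1_measurable[measurable]: "g1 \<in> borel_measurable borel"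
  by (rule borel_measurable_of_derivative[OF g_deriv])

lemma abs_g: "\<bar>g y\<bar> \<le> \<kappa>" using g_bounds(1)[of y] g_nonneg[of y] by simp

definition G :: "real \<Rightarrow> real" where "G x = measure \<mu> {..x}"

lemma G_deriv: "(G has_real_derivative g x) (at x)"
  unfolding G_def[abs_def] \<mu>_def
proof (rule density_cdf_has_derivative)
  show "finite_measure (density lborel (\<lambda>x. ennreal (g x)))"
    using \<mu>.finite_measure_axioms unfolding \<mu>_def .
  show "isCont g x" using g_deriv DERIV_isCont by blast
qed (auto simp: g_nonneg)

lemma abs_G: "\<bar>G y\<bar> \<le> \<kappa>"
  unfolding G_def using order_trans[OF \<mu>.prob_le_1 \<kappa>1] by simp

lemma G_measurable[measurable]: "G \<in> borel_measurable borel"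
  by (rule borel_measurable_continuous_onI) (use G_deriv in \<open>meson DERIV_isCont continuous_at_imp_continuous_on\<close>)

lemma P_atMost: "P {..x} r = G (x - r)"
proof -
  have "P {..x} r = (\<integral>e. indicator {..x - r} e \<partial>\<mu>)"
    unfolding P_def by (intro Bochner_Integration.integral_cong) (auto simp: indicator_def)
  then show ?thesis by (simp add: G_def)
qed

lemma AE_R0: "AE \<omega> in M. \<forall>i. R i 0 \<omega> = \<epsilon> i \<omega> + R i 1 \<omega>"
  unfolding AE_all_countable
proof
  fix i
  show "AE \<omega> in M. R i 0 \<omega> = \<epsilon> i \<omega> + R i 1 \<omega>"
    using AE_summable[of i] by eventually_elim (use R_Suc[of i _ 0] a_0 in simp)
qed

lemma F_eq: "F x = expectation (\<lambda>\<omega>. G (x - R i 1 \<omega>))"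
proof -
  have "F x = prob (R i 0 -` {..x} \<inter> space M)"
    by (subst F_cdf[of i]) (simp add: cdf_def measure_distr)
  also have "\<dots> = expectation (\<lambda>\<omega>. indicator (R i 0 -` {..x} \<inter> space M) \<omega>)" by simp
  also have "\<dots> = expectation (\<lambda>\<omega>. (\<lambda>(e,r). indicat_real {..x} (e + r)) (\<epsilon> i \<omega>, R i 1 \<omega>))"
  proof (rule integral_cong_AE)
    show "AE \<omega> in M. indicat_real (R i 0 -` {..x} \<inter> space M) \<omega> = (\<lambda>(e,r). indicat_real {..x} (e + r)) (\<epsilon> i \<omega>, R i 1 \<omega>)"
      using AE_R0 AE_space by eventually_elim (auto simp: indicator_def)
  qed measurable
  also have "\<dots> = expectation (\<lambda>\<omega>. \<integral>e. (\<lambda>(e,r). indicat_real {..x} (e + r)) (e, R i 1 \<omega>) \<partial>\<mu>)"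
  proof (rule freeze_int)
    show "R i 1 \<in> borel_measurable (past i)" by (rule R_past) simp
    show "integrable M (\<lambda>\<omega>. (\<lambda>(e,r). indicat_real {..x} (e + r)) (\<epsilon> i \<omega>, R i 1 \<omega>))"
      by (rule integrable_const_bound[where B=1]) (auto simp: indicator_def)
  qed measurable
  also have "\<dots> = expectation (\<lambda>\<omega>. G (x - R i 1 \<omega>))"
    using P_atMost by (simp add: P_def)
  finally show ?thesis .
qed

lemma F_deriv_expectation: "(F has_real_derivative expectation (\<lambda>\<omega>. g (x - R i 1 \<omega>))) (at x)"
proof -
  have "F = (\<lambda>x. expectation (\<lambda>\<omega>. G (x - R i 1 \<omega>)))" using F_eq by auto
  then show ?thesis
    using has_derivative_expectation_shift[of "R i 1" g G \<kappa> x] G_deriv abs_G abs_g by simp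
qed

text \<open>A density is determined only almost everywhere; continuity makes \<open>f\<close> the
  derivative of \<open>F\<close> at every point. Comparison with the derivative taken under the
  expectation then identifies \<open>f\<close> pointwise with the smoothed innovation
  density.\<close>

lemma F_deriv: "(F has_real_derivative f x) (at x)"
proof -
  have e: "distr M borel (R 0 0) = density lborel (\<lambda>x. ennreal (f x))"
  proof -
    have "distr M borel (R 0 0) = distr M lborel (R 0 0)" by (rule distr_cong) auto
    then show ?thesis using distributed_distr_eq_density[OF f_dist[of 0]] by simp
  qed
  interpret D: prob_space "distr M borel (R 0 0)" by (rule prob_space_distr) simp
  have "F = (\<lambda>x. measure (density lborel (\<lambda>x. ennreal (f x))) {..x})"
    unfolding F_cdf[of 0] e[symmetric] by (auto simp: cdf_def)
  moreover have "((\<lambda>x. measure (density lborel (\<lambda>x. ennreal (f x))) {..x}) has_real_derivative f x) (at x)"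
  proof (rule density_cdf_has_derivative)
    show "finite_measure (density lborel (\<lambda>x. ennreal (f x)))" unfolding e[symmetric] by unfold_locales
    show "isCont f x" using f_cont by (simp add: continuous_on_eq_continuous_at)
    show "f \<in> borel_measurable borel" by (rule borel_measurable_continuous_onI[OF f_cont])
  qed (rule f_nonneg)
  ultimately show ?thesis by simp
qed

lemma f_eq: "expectation (\<lambda>\<omega>. g (x - R i 1 \<omega>)) = f x"
  by (rule DERIV_unique[OF F_deriv_expectation F_deriv])

definition f1 :: "real \<Rightarrow> real" where "f1 x = expectation (\<lambda>\<omega>. g1 (x - R 0 1 \<omega>))"
definition f2 :: "real \<Rightarrow> real" where "f2 x = expectation (\<lambda>\<omega>. g2 (x - R 0 1 \<omega>))"

lemma f_deriv_expectation: "(f has_real_derivative expectation (\<lambda>\<omega>. g1 (x - R i 1 \<omega>))) (at x)"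
proof -
  have "f = (\<lambda>x. expectation (\<lambda>\<omega>. g (x - R i 1 \<omega>)))" using f_eq by auto
  then show ?thesis
    using has_derivative_expectation_shift[of "R i 1" g1 g \<kappa> x] g_deriv abs_g g_bounds(2) by simp
qed

lemma f_deriv: "(f has_real_derivative f1 x) (at x)"
  unfolding f1_def by (rule f_deriv_expectation)

lemma f1_eq: "expectation (\<lambda>\<omega>. g1 (x - R i 1 \<omega>)) = f1 x"
  by (rule DERIV_unique[OF f_deriv_expectation f_deriv])

lemma f1_deriv_expectation: "(f1 has_real_derivative expectation (\<lambda>\<omega>. g2 (x - R i 1 \<omega>))) (at x)"
proof -
  have "f1 = (\<lambda>x. expectation (\<lambda>\<omega>. g1 (x - R i 1 \<omega>)))" using f1_eq by auto
  then show ?thesis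
    using has_derivative_expectation_shift[of "R i 1" g2 g1 \<kappa> x] g1_deriv g_bounds by simp
qed

lemma f1_deriv: "(f1 has_real_derivative f2 x) (at x)"
  unfolding f2_def by (rule f1_deriv_expectation)

lemma f2_eq: "expectation (\<lambda>\<omega>. g2 (x - R i 1 \<omega>)) = f2 x"
  by (rule DERIV_unique[OF f1_deriv_expectation f1_deriv])

lemma expectation_abs_le:
  assumes [measurable]: "h \<in> borel_measurable borel" and "\<And>y. \<bar>h y\<bar> \<le> \<kappa>"
  shows "\<bar>expectation (\<lambda>\<omega>. h (x - R i 1 \<omega>))\<bar> \<le> \<kappa>"
proof -
  have "\<bar>expectation (\<lambda>\<omega>. h (x - R i 1 \<omega>))\<bar> \<le> expectation (\<lambda>\<omega>. \<bar>h (x - R i 1 \<omega>)\<bar>)" by (rule integral_abs_bound)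
  also have "\<dots> \<le> expectation (\<lambda>\<omega>. \<kappa>)"
    using assms(2) \<kappa>1 by (intro integral_mono integrable_const_bound[where B=\<kappa>]) auto
  finally show ?thesis by (simp add: prob_space)
qed

lemma f_bounds: "\<bar>f x\<bar> \<le> \<kappa>" "\<bar>f1 x\<bar> \<le> \<kappa>" "\<bar>f2 x\<bar> \<le> \<kappa>"
  using expectation_abs_le[of g x 0] expectation_abs_le[of g1 x 0] expectation_abs_le[of g2 x 0]
    abs_g g_bounds unfolding f_eq f1_eq f2_eq by auto

text \<open>\<open>g2\<close> is only bounded and measurable, but \<open>f2\<close> is also the mean
  of its smoothed version \<open>hs g2 q\<close>, which is Lipschitz. The Sobolev bound for the
  derivative of the smooth part needs this.\<close>

lemma f2_continuous: "continuous_on UNIV f2"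
proof -
  obtain q A where A: "A \<ge> 0" and lip: "\<And>h B j u v. h \<in> borel_measurable borel \<Longrightarrow> (\<And>y. \<bar>h y\<bar> \<le> B) \<Longrightarrow> q \<le> j \<Longrightarrow> \<bar>hs h j u - hs h j v\<bar> \<le> B * A * \<bar>u - v\<bar>"
    by (rule hs_eventually_lipschitz) blast
  have hsm[measurable]: "hs g2 q \<in> borel_measurable borel" by simp
  have int: "integrable M (\<lambda>\<omega>. hs g2 q (x - R 0 (Suc q) \<omega>))" for x
    by (rule integrable_const_bound[where B=\<kappa>]) (simp_all add: hs_bound[OF g2_measurable g_bounds(3)])
  have e: "f2 x = expectation (\<lambda>\<omega>. hs g2 q (x - R 0 (Suc q) \<omega>))" for x
    using expectation_hs[OF g2_measurable g_bounds(3), of q x 0] by (simp add: f2_def)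
  have "\<bar>f2 x - f2 y\<bar> \<le> \<kappa> * A * \<bar>x - y\<bar>" for x y
  proof -
    have d: "f2 x - f2 y = expectation (\<lambda>\<omega>. hs g2 q (x - R 0 (Suc q) \<omega>) - hs g2 q (y - R 0 (Suc q) \<omega>))"
      unfolding e using int by simp
    have "\<bar>f2 x - f2 y\<bar> \<le> expectation (\<lambda>\<omega>. \<bar>hs g2 q (x - R 0 (Suc q) \<omega>) - hs g2 q (y - R 0 (Suc q) \<omega>)\<bar>)"
      unfolding d by (rule integral_abs_bound)
    also have "\<dots> \<le> expectation (\<lambda>\<omega>. \<kappa> * A * \<bar>x - y\<bar>)"
    proof (rule integral_mono)
      fix \<omega>
      show "\<bar>hs g2 q (x - R 0 (Suc q) \<omega>) - hs g2 q (y - R 0 (Suc q) \<omega>)\<bar> \<le> \<kappa> * A * \<bar>x - y\<bar>"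
        using lip[OF g2_measurable g_bounds(3), of q "x - R 0 (Suc q) \<omega>" "y - R 0 (Suc q) \<omega>"] by simp
    qed (use int in auto)
    finally show ?thesis by (simp add: prob_space)
  qed
  then have "(\<kappa> * A)-lipschitz_on UNIV f2"
    using A \<kappa>1 by (intro lipschitz_onI) (auto simp: dist_real_def)
  then show ?thesis by (rule lipschitz_on_continuous_on)
qed

definition Nn :: "nat \<Rightarrow> real \<Rightarrow> 'a \<Rightarrow> real" where
  "Nn n x \<omega> = (\<Sum>i=1..n. G (x - R (int i) 1 \<omega>) - F x + f x * R (int i) 0 \<omega>)"

definition Nd :: "nat \<Rightarrow> real \<Rightarrow> 'a \<Rightarrow> real" where
  "Nd n x \<omega> = (\<Sum>i=1..n. g (x - R (int i) 1 \<omega>) - f x + f1 x * R (int i) 0 \<omega>)"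

lemma Nn_bound: "K \<ge> 1/2 \<Longrightarrow> AE \<omega> in M. \<exists>C\<ge>0. \<forall>n\<ge>27. \<forall>x\<in>{-K..K}. (Nn n x \<omega>)\<^sup>2 \<le> C * rate (2 * \<beta> - 1/2) \<psi> n"
  unfolding Nn_def
  by (rule T_rate[OF G_deriv g_deriv g1_measurable abs_G abs_g g_bounds(2) F_eq[symmetric] f_eq f1_eq F_deriv f_deriv])
     (use f1_deriv in \<open>meson DERIV_isCont continuous_at_imp_continuous_on\<close>)

lemma Nd_bound: "K \<ge> 1/2 \<Longrightarrow> AE \<omega> in M. \<exists>C\<ge>0. \<forall>n\<ge>27. \<forall>x\<in>{-K..K}. (Nd n x \<omega>)\<^sup>2 \<le> C * rate (2 * \<beta> - 1/2) \<psi> n"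
  unfolding Nd_def
  by (rule T_rate[OF g_deriv g1_deriv g2_measurable abs_g g_bounds(2) g_bounds(3) f_eq f1_eq f2_eq f_deriv f1_deriv f2_continuous])

lemma Nn_deriv: "((\<lambda>x. Nn n x \<omega>) has_real_derivative Nd n x \<omega>) (at x)"
proof -
  have G: "((\<lambda>x. G (x - r)) has_real_derivative g (x - r)) (at x)" for r
  proof -
    have "((\<lambda>x. x - r) has_real_derivative 1) (at x)" by (auto intro!: derivative_eq_intros)
    from DERIV_chain2[OF G_deriv this] show ?thesis by simp
  qed
  show ?thesis unfolding Nn_def Nd_def
    by (intro DERIV_sum DERIV_add DERIV_diff DERIV_cmult_right G F_deriv f_deriv)
qed

lemma Nn_diff:
  assumes bd: "\<And>x. x \<in> {-K..K} \<Longrightarrow> \<bar>Nd n x \<omega>\<bar> \<le> B" and xy: "x \<in> {-K..K}" "y \<in> {-K..K}"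
  shows "\<bar>Nn n x \<omega> - Nn n y \<omega>\<bar> \<le> B * \<bar>x - y\<bar>"
  using field_differentiable_bound[of "{-K..K}" "\<lambda>x. Nn n x \<omega>" "\<lambda>x. Nd n x \<omega>" B x y] Nn_deriv bd xy
  by (auto intro: has_field_derivative_at_within)

lemma empirical_cdf_decomposition:
  assumes R0: "\<forall>i. R i 0 \<omega> = \<epsilon> i \<omega> + R i 1 \<omega>" and n: "n \<ge> 1"
  shows "empirical_cdf (\<lambda>k. R k 0) n \<omega> x = F x - f x * sample_mean (\<lambda>k. R k 0) n \<omega> + (Mn n x \<omega> + Nn n x \<omega>) / real n"
proof -
  have "(\<Sum>i=1..n. indicat_real {..x} (R (int i) 0 \<omega>)) = Mn n x \<omega> + (\<Sum>i=1..n. G (x - R (int i) 1 \<omega>))"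
    unfolding Mn_def md_def P_atMost sum.distrib[symmetric] using R0 by simp
  also have "(\<Sum>i=1..n. G (x - R (int i) 1 \<omega>)) = Nn n x \<omega> + real n * F x - f x * (\<Sum>i=1..n. R (int i) 0 \<omega>)"
    unfolding Nn_def by (simp add: sum.distrib sum_subtractf sum_distrib_left)
  finally have e: "(\<Sum>i=1..n. indicat_real {..x} (R (int i) 0 \<omega>)) = Mn n x \<omega> + (Nn n x \<omega> + real n * F x - f x * (\<Sum>i=1..n. R (int i) 0 \<omega>))" .
  show ?thesis
    unfolding empirical_cdf_def sample_mean_def e using n by (simp add: field_simps)
qed

end

section \<open>The Bahadur representation\<close>

text \<open>The error, as a function of the increment, has derivative at most
  \<open>\<kappa> * t^2\<close> between \<open>-|t|\<close> and \<open>|t|\<close> by the first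
  order bound for \<open>f\<close>.\<close>

lemma taylor2_of_lipschitz_deriv:
  fixes F f f1 :: "real \<Rightarrow> real"
  assumes F: "\<And>y. (F has_real_derivative f y) (at y)" and f: "\<And>y. (f has_real_derivative f1 y) (at y)"
    and L: "\<And>u v. \<bar>f1 u - f1 v\<bar> \<le> \<kappa> * \<bar>u - v\<bar>"
  shows "\<bar>F (x + t) - F x - f x * t - f1 x * t\<^sup>2 / 2\<bar> \<le> \<kappa> * \<bar>t\<bar>^3"
proof -
  have k0: "\<kappa> \<ge> 0" using order_trans[OF abs_ge_zero L[of 1 0]] by simp
  let ?h = "\<lambda>s. F (x + s) - f x * s - f1 x * s\<^sup>2 / 2"
  have "norm (?h t - ?h 0) \<le> (\<kappa> * t\<^sup>2) * norm (t - 0)"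
  proof (rule field_differentiable_bound)
    show "convex {-\<bar>t\<bar>..\<bar>t\<bar>}" by simp
    show "t \<in> {-\<bar>t\<bar>..\<bar>t\<bar>}" "0 \<in> {-\<bar>t\<bar>..\<bar>t\<bar>}" by auto
    fix s assume s: "s \<in> {-\<bar>t\<bar>..\<bar>t\<bar>}"
    have "((\<lambda>s. F (x + s)) has_real_derivative f (x + s)) (at s)"
      using DERIV_shift[of F "f (x + s)" s x] F[of "x + s"] by (simp add: add.commute)
    then have "(?h has_real_derivative f (x + s) - f x - f1 x * s) (at s)"
      by (auto intro!: derivative_eq_intros)
    then show "(?h has_field_derivative f (x + s) - f x - f1 x * s) (at s within {-\<bar>t\<bar>..\<bar>t\<bar>})"
      by (rule has_field_derivative_at_within)
    have "\<bar>f (x + s) - f x - s * f1 x\<bar> \<le> \<kappa> * s\<^sup>2" by (rule taylor1_of_lipschitz_deriv[OF f L])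
    also have "\<dots> \<le> \<kappa> * t\<^sup>2"
    proof -
      have "\<bar>s\<bar> \<le> \<bar>t\<bar>" using s by auto
      then show ?thesis using k0 by (intro mult_left_mono) (simp_all add: abs_le_square_iff)
    qed
    finally show "norm (f (x + s) - f x - f1 x * s) \<le> \<kappa> * t\<^sup>2" by (simp add: mult.commute)
  qed
  moreover have "\<kappa> * t\<^sup>2 * \<bar>t\<bar> = \<kappa> * \<bar>t\<bar>^3" by (simp add: power3_eq_cube power2_eq_square mult.assoc[symmetric])
  ultimately show ?thesis by simp
qed

text \<open>The pathwise core, free of probability. \<open>b\<close> is the scale of
  \<open>Xb\<close> and of the quantile deviation, \<open>E1\<close> the modulus of \<open>D\<close>
  on that scale, \<open>e0\<close> the size of \<open>D\<close> at \<open>\<xi>\<close>, and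
  \<open>\<delta>\<close> a small distance that bypasses the jumps of \<open>Fn\<close>.\<close>

lemma bahadur_deterministic:
  fixes F f f1 Fn D :: "real \<Rightarrow> real" and \<xi> :: real
  assumes F: "\<And>y. (F has_real_derivative f y) (at y)" and f: "\<And>y. (f has_real_derivative f1 y) (at y)"
    and L: "\<And>u v. \<bar>f1 u - f1 v\<bar> \<le> \<kappa> * \<bar>u - v\<bar>" and fb: "\<And>y. \<bar>f y\<bar> \<le> \<kappa>" "\<And>y. \<bar>f1 y\<bar> \<le> \<kappa>"
    and mono: "mono Fn" and Fn: "\<And>x. Fn x = F x - f x * Xb + D x"
    and \<xi>: "F \<xi> = p" "\<bar>\<xi>\<bar> \<le> K - 1" and c0: "c0 > 0" "c0 \<le> f \<xi>"
    and b: "b > 0" and Xb: "\<bar>Xb\<bar> \<le> C3 * b" and Dsup: "\<And>x. \<bar>x\<bar> \<le> K \<Longrightarrow> \<bar>D x\<bar> \<le> C1 * b" and D\<xi>: "\<bar>D \<xi>\<bar> \<le> e0"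
    and modulus: "\<And>x y. \<bar>x\<bar> \<le> K \<Longrightarrow> \<bar>y\<bar> \<le> K \<Longrightarrow> \<bar>x - y\<bar> \<le> C0 * b \<Longrightarrow> \<bar>D x - D y\<bar> \<le> E1"
    and C2: "C2 = 2 * (\<kappa> * C3 + C1 + 1) / c0" and C0: "C2 + 1 \<le> C0"
    and small: "C2 * b \<le> 1/2" "\<kappa> * (C2 * b) \<le> c0 / 2" and \<delta>: "0 < \<delta>" "\<delta> \<le> b" "\<delta> \<le> 1/2"
    and E3: "E3 = E1 + \<kappa> * \<delta> + \<kappa> * \<delta> * (C3 * b) + \<kappa> * (C2^3 + C2\<^sup>2 * C3) * b^3"
  shows "\<bar>quantile Fn p - \<xi> - (p - Fn \<xi>) / f \<xi> - Xb\<^sup>2 / 2 * (f1 \<xi> / f \<xi>)\<bar>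
     \<le> (E3 + \<kappa> / 2 * ((C2 + C3) * b * ((E3 + \<kappa> * (C2\<^sup>2 + C2 * C3) * b\<^sup>2 + e0) / c0))) / c0"
proof -
  have k0: "\<kappa> \<ge> 0" using order_trans[OF abs_ge_zero fb(1)[of 0]] .
  have C3b: "0 \<le> C3 * b" using order_trans[OF abs_ge_zero Xb] .
  then have C30: "C3 \<ge> 0" using b by (simp add: zero_le_mult_iff)
  have "0 \<le> C1 * b" using order_trans[OF abs_ge_zero Dsup[of \<xi>]] \<xi>(2) by simp
  then have C10: "C1 \<ge> 0" using b by (simp add: zero_le_mult_iff)
  have C2pos: "C2 > 0" unfolding C2 using c0 k0 C30 C10 by (intro divide_pos_pos mult_pos_pos add_nonneg_pos add_nonneg_nonneg) auto
  have C2c: "c0 * C2 = 2 * (\<kappa> * C3 + C1 + 1)" unfolding C2 using c0 by simp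
  have flip: "\<bar>f u - f v\<bar> \<le> \<kappa> * \<bar>u - v\<bar>" for u v by (rule real_lipschitz_of_deriv_bound[OF f fb(2)])
  have Flip: "\<bar>F u - F v\<bar> \<le> \<kappa> * \<bar>u - v\<bar>" for u v by (rule real_lipschitz_of_deriv_bound[OF F fb(1)])
  have FnF: "\<bar>Fn x - F x\<bar> \<le> (\<kappa> * C3 + C1) * b" if "\<bar>x\<bar> \<le> K" for x
  proof -
    have "\<bar>f x * Xb\<bar> \<le> \<kappa> * (C3 * b)" unfolding abs_mult using fb(1)[of x] Xb k0 by (intro mult_mono) auto
    then have "\<bar>D x - f x * Xb\<bar> \<le> \<kappa> * (C3 * b) + C1 * b" using Dsup[OF that] by linarith
    moreover have "Fn x - F x = D x - f x * Xb" using Fn[of x] by simp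
    ultimately show ?thesis by (simp add: algebra_simps)
  qed
  have T1: "\<bar>F (\<xi> + s) - p - s * f \<xi>\<bar> \<le> \<kappa> * s\<^sup>2" for s
    using taylor1_of_lipschitz_deriv[OF F flip, of \<xi> s] \<xi>(1) by simp
  \<comment> \<open>\<open>C2\<close> is chosen so that moving by \<open>C2 * b\<close> changes
    \<open>F\<close> to first order by at least twice the largest deviation of \<open>Fn\<close>
    from \<open>F\<close> plus \<open>b\<close>. Smallness of \<open>b\<close> lets the quadratic
    error consume at most half of this.\<close>
  have dom: "\<kappa> * (C2 * b)\<^sup>2 \<le> C2 * b * f \<xi> - (\<kappa> * C3 + C1 + 1) * b"
  proof -
    have "\<kappa> * (C2 * b)\<^sup>2 = (\<kappa> * (C2 * b)) * (C2 * b)" by (simp add: power2_eq_square)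
    also have "\<dots> \<le> c0 / 2 * (C2 * b)" using small(2) C2pos b by (intro mult_right_mono) auto
    also have "\<dots> = c0 * (C2 * b) - (c0 * C2) / 2 * b" by (simp add: field_simps)
    also have "(c0 * C2) / 2 * b = (\<kappa> * C3 + C1 + 1) * b" unfolding C2c by simp
    finally have "\<kappa> * (C2 * b)\<^sup>2 \<le> c0 * (C2 * b) - (\<kappa> * C3 + C1 + 1) * b" .
    moreover have "c0 * (C2 * b) \<le> f \<xi> * (C2 * b)" using c0 C2pos b by (intro mult_right_mono) auto
    ultimately show ?thesis by (simp add: mult.commute)
  qed
  have C2b0: "0 \<le> C2 * b" using C2pos b by simp
  have dom3: "\<kappa> * (C2 * b)\<^sup>2 + (\<kappa> * C3 + C1) * b + b \<le> C2 * b * f \<xi>" using dom by (simp add: distrib_right)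
  have up: "p \<le> Fn (\<xi> + C2 * b)"
  proof -
    have "\<bar>\<xi> + C2 * b\<bar> \<le> K" using \<xi>(2) small(1) C2b0 by linarith
    from FnF[OF this] T1[of "C2 * b"] dom3 b show ?thesis by linarith
  qed
  have lo: "Fn (\<xi> - C2 * b) < p"
  proof -
    have "\<bar>\<xi> + - (C2 * b)\<bar> \<le> K" using \<xi>(2) small(1) C2b0 by linarith
    from FnF[OF this] T1[of "- (C2 * b)", unfolded power2_minus mult_minus_left] dom3 b
    show ?thesis unfolding diff_conv_add_uminus by linarith
  qed
  define S where "S = {x. p \<le> Fn x}"
  define q where "q = quantile Fn p"
  have q: "q = Inf S" by (simp add: q_def quantile_def S_def)
  have S_ne: "\<xi> + C2 * b \<in> S" using up by (simp add: S_def)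
  have S_lb: "\<xi> - C2 * b \<le> x" if "x \<in> S" for x
  proof (rule ccontr)
    assume "\<not> \<xi> - C2 * b \<le> x"
    then have "Fn x \<le> Fn (\<xi> - C2 * b)" using mono by (simp add: monoD)
    then show False using that lo by (simp add: S_def)
  qed
  have bdd: "bdd_below S" using S_lb by (meson bdd_belowI)
  have q_up: "q \<le> \<xi> + C2 * b" unfolding q by (rule cInf_lower[OF S_ne bdd])
  have q_lo: "\<xi> - C2 * b \<le> q" unfolding q using S_ne S_lb by (intro cInf_greatest) auto
  define t where "t = q - \<xi>"
  have t: "\<bar>t\<bar> \<le> C2 * b" using q_up q_lo by (auto simp: t_def abs_le_iff)
  \<comment> \<open>\<open>Fn\<close> jumps, so its value at \<open>q\<close> need not be
    \<open>p\<close>. The infimum only gives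
    \<open>Fn (q - \<delta>) <= p <= Fn (q + \<delta>)\<close>, which costs terms proportional to
    \<open>\<delta>\<close>.\<close>
  have Fn_ge: "p \<le> Fn (q + \<delta>)"
  proof -
    have "Inf S < q + \<delta>" using q \<delta> by simp
    then obtain x where "x \<in> S" "x < q + \<delta>" using cInf_lessD[of S "q + \<delta>"] S_ne by auto
    then have "p \<le> Fn x" "Fn x \<le> Fn (q + \<delta>)" using mono by (auto simp: S_def intro: monoD)
    then show ?thesis by (rule order_trans)
  qed
  have Fn_le: "Fn (q - \<delta>) \<le> p"
  proof (rule ccontr)
    assume "\<not> Fn (q - \<delta>) \<le> p"
    then have "q - \<delta> \<in> S" by (simp add: S_def)
    then have "q \<le> q - \<delta>" unfolding q by (rule cInf_lower[OF _ bdd])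
    then show False using \<delta> by simp
  qed
  have C0b: "(C2 + 1) * b \<le> C0 * b" using C0 b by (intro mult_right_mono) auto
  have shift: "\<bar>Fn (q + e) - (F q - f q * Xb + D \<xi>)\<bar> \<le> E1 + \<kappa> * \<delta> + \<kappa> * \<delta> * (C3 * b)" if e: "\<bar>e\<bar> \<le> \<delta>" for e
  proof -
    have "\<bar>q + e - \<xi>\<bar> \<le> C2 * b + \<delta>" using t e unfolding t_def by linarith
    also have "\<dots> \<le> (C2 + 1) * b" using \<delta> by (simp add: algebra_simps)
    finally have d: "\<bar>q + e - \<xi>\<bar> \<le> C0 * b" using C0b by linarith
    have "\<bar>q + e\<bar> \<le> K" using t e small(1) \<delta>(3) \<xi>(2) unfolding t_def by linarith
    then have m: "\<bar>D (q + e) - D \<xi>\<bar> \<le> E1" using modulus[of "q + e" \<xi>] d \<xi>(2) by simp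
    have "\<kappa> * \<bar>e\<bar> \<le> \<kappa> * \<delta>" using e k0 by (rule mult_left_mono)
    then have F1: "\<bar>F (q + e) - F q\<bar> \<le> \<kappa> * \<delta>" using Flip[of "q + e" q] by simp
    have "\<bar>f (q + e) - f q\<bar> \<le> \<kappa> * \<delta>" using flip[of "q + e" q] \<open>\<kappa> * \<bar>e\<bar> \<le> \<kappa> * \<delta>\<close> by simp
    then have "\<bar>(f (q + e) - f q) * Xb\<bar> \<le> \<kappa> * \<delta> * (C3 * b)" unfolding abs_mult using Xb k0 \<delta> by (intro mult_mono) auto
    moreover have "Fn (q + e) - (F q - f q * Xb + D \<xi>) = (F (q + e) - F q) - (f (q + e) - f q) * Xb + (D (q + e) - D \<xi>)"
      using Fn[of "q + e"] by (simp add: algebra_simps)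
    ultimately show ?thesis using m F1 by linarith
  qed
  have E2: "\<bar>F q - f q * Xb + D \<xi> - p\<bar> \<le> E1 + \<kappa> * \<delta> + \<kappa> * \<delta> * (C3 * b)"
    using shift[of \<delta>] shift[of "- \<delta>"] Fn_ge Fn_le \<delta> by simp
  have t3: "\<bar>t\<bar>^3 \<le> (C2 * b)^3" and t2: "t\<^sup>2 \<le> (C2 * b)\<^sup>2"
    using power_mono[OF t abs_ge_zero, of 3] power_mono[OF t abs_ge_zero, of 2] unfolding power2_abs by auto
  have A1: "\<bar>F q - p - f \<xi> * t - f1 \<xi> * t\<^sup>2 / 2\<bar> \<le> \<kappa> * (C2 * b)^3"
  proof -
    have "\<bar>F q - p - f \<xi> * t - f1 \<xi> * t\<^sup>2 / 2\<bar> \<le> \<kappa> * \<bar>t\<bar>^3"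
      using taylor2_of_lipschitz_deriv[OF F f L, of \<xi> t] \<xi>(1) by (simp add: t_def)
    also have "\<dots> \<le> \<kappa> * (C2 * b)^3" using t3 k0 by (rule mult_left_mono)
    finally show ?thesis .
  qed
  have A2: "\<bar>(f q - f \<xi> - t * f1 \<xi>) * Xb\<bar> \<le> \<kappa> * (C2 * b)\<^sup>2 * (C3 * b)"
  proof -
    have "\<bar>f q - f \<xi> - t * f1 \<xi>\<bar> \<le> \<kappa> * t\<^sup>2"
      using taylor1_of_lipschitz_deriv[OF f L, of \<xi> t] by (simp add: t_def)
    also have "\<dots> \<le> \<kappa> * (C2 * b)\<^sup>2" using t2 k0 by (simp add: mult_left_mono)
    finally show ?thesis unfolding abs_mult using Xb k0 by (intro mult_mono) auto
  qed
  have Fn\<xi>: "D \<xi> = Fn \<xi> - p + f \<xi> * Xb" using Fn[of \<xi>] \<xi>(1) by simp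
  have e3: "\<kappa> * (C2 * b)^3 + \<kappa> * (C2 * b)\<^sup>2 * (C3 * b) = \<kappa> * (C2^3 + C2\<^sup>2 * C3) * b^3"
    by (simp add: power_mult_distrib power3_eq_cube power2_eq_square algebra_simps)
  have main: "\<bar>f \<xi> * t - (p - Fn \<xi>) + f1 \<xi> * (t\<^sup>2 / 2 - t * Xb)\<bar> \<le> E3"
  proof -
    have "f \<xi> * t - (p - Fn \<xi>) + f1 \<xi> * (t\<^sup>2 / 2 - t * Xb)
       = (F q - f q * Xb + D \<xi> - p) - (F q - p - f \<xi> * t - f1 \<xi> * t\<^sup>2 / 2) + (f q - f \<xi> - t * f1 \<xi>) * Xb"
      unfolding Fn\<xi> by (simp add: algebra_simps)
    then show ?thesis using E2 A1 A2 e3 unfolding E3 by linarith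
  qed
  have quad: "\<bar>f1 \<xi> * (t\<^sup>2 / 2 - t * Xb)\<bar> \<le> \<kappa> * (C2\<^sup>2 + C2 * C3) * b\<^sup>2"
  proof -
    have "\<bar>t * Xb\<bar> \<le> (C2 * b) * (C3 * b)" unfolding abs_mult using t Xb C2pos b by (intro mult_mono) auto
    moreover have "0 \<le> t\<^sup>2" by simp
    ultimately have "\<bar>t\<^sup>2 / 2 - t * Xb\<bar> \<le> (C2 * b)\<^sup>2 + (C2 * b) * (C3 * b)" using t2 by linarith
    then have "\<bar>f1 \<xi>\<bar> * \<bar>t\<^sup>2 / 2 - t * Xb\<bar> \<le> \<kappa> * ((C2 * b)\<^sup>2 + (C2 * b) * (C3 * b))"
      using fb(2)[of \<xi>] k0 by (intro mult_mono) auto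
    also have "\<kappa> * ((C2 * b)\<^sup>2 + (C2 * b) * (C3 * b)) = \<kappa> * (C2\<^sup>2 + C2 * C3) * b\<^sup>2"
      by (simp add: power2_eq_square algebra_simps)
    finally show ?thesis unfolding abs_mult .
  qed
  define H where "H = (E3 + \<kappa> * (C2\<^sup>2 + C2 * C3) * b\<^sup>2 + e0) / c0"
  \<comment> \<open>First order information: \<open>t\<close> equals \<open>Xb\<close> up to
    \<open>D \<xi> / f \<xi>\<close> and second order terms.\<close>
  have tX: "\<bar>t - Xb\<bar> \<le> H"
  proof -
    have "f \<xi> * (t - Xb) = (f \<xi> * t - (p - Fn \<xi>) + f1 \<xi> * (t\<^sup>2 / 2 - t * Xb)) - f1 \<xi> * (t\<^sup>2 / 2 - t * Xb) - D \<xi>"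
      unfolding Fn\<xi> by (simp add: algebra_simps)
    then have "\<bar>f \<xi> * (t - Xb)\<bar> \<le> E3 + \<kappa> * (C2\<^sup>2 + C2 * C3) * b\<^sup>2 + e0"
      using main quad D\<xi> by linarith
    moreover have "c0 * \<bar>t - Xb\<bar> \<le> \<bar>f \<xi> * (t - Xb)\<bar>" unfolding abs_mult using c0 by (intro mult_right_mono) auto
    ultimately have "c0 * \<bar>t - Xb\<bar> \<le> E3 + \<kappa> * (C2\<^sup>2 + C2 * C3) * b\<^sup>2 + e0" by linarith
    then show ?thesis unfolding H_def using c0 by (simp add: pos_le_divide_eq mult.commute)
  qed
  \<comment> \<open>One factor is bounded by the scale \<open>b\<close>, the other by
    \<open>H\<close>, so the error \<open>e0\<close> enters only multiplied by
    \<open>b\<close>.\<close>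
  have tX2: "(t - Xb)\<^sup>2 \<le> (C2 + C3) * b * H"
  proof -
    have "\<bar>t - Xb\<bar> \<le> (C2 + C3) * b" using t Xb unfolding distrib_right by linarith
    then have "\<bar>t - Xb\<bar> * \<bar>t - Xb\<bar> \<le> (C2 + C3) * b * H" using tX C2pos C30 b by (intro mult_mono) auto
    then show ?thesis by (simp add: power2_eq_square abs_mult[symmetric])
  qed
  have fin: "\<bar>f \<xi> * t - (p - Fn \<xi>) - Xb\<^sup>2 / 2 * f1 \<xi>\<bar> \<le> E3 + \<kappa> / 2 * ((C2 + C3) * b * H)"
  proof -
    \<comment> \<open>Completing the square,
      \<open>t^2 / 2 - t * Xb = (t - Xb)^2 / 2 - Xb^2 / 2\<close>, produces the quadratic term of
      the expansion.\<close>
    have "f \<xi> * t - (p - Fn \<xi>) - Xb\<^sup>2 / 2 * f1 \<xi> = (f \<xi> * t - (p - Fn \<xi>) + f1 \<xi> * (t\<^sup>2 / 2 - t * Xb)) - f1 \<xi> / 2 * (t - Xb)\<^sup>2"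
      by (simp add: power2_eq_square field_simps)
    moreover have "\<bar>f1 \<xi> / 2 * (t - Xb)\<^sup>2\<bar> \<le> \<kappa> / 2 * ((C2 + C3) * b * H)"
      unfolding abs_mult using fb(2)[of \<xi>] tX2 k0 by (intro mult_mono) auto
    ultimately show ?thesis using main by linarith
  qed
  have f0: "f \<xi> > 0" using c0 by linarith
  have "quantile Fn p - \<xi> - (p - Fn \<xi>) / f \<xi> - Xb\<^sup>2 / 2 * (f1 \<xi> / f \<xi>) = (f \<xi> * t - (p - Fn \<xi>) - Xb\<^sup>2 / 2 * f1 \<xi>) / f \<xi>"
    using f0 unfolding t_def q_def[symmetric] by (simp add: field_simps)
  also have "\<bar>(f \<xi> * t - (p - Fn \<xi>) - Xb\<^sup>2 / 2 * f1 \<xi>) / f \<xi>\<bar> \<le> (E3 + \<kappa> / 2 * ((C2 + C3) * b * H)) / c0"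
    unfolding abs_divide using fin c0 f0 by (intro frac_le) (auto intro: order_trans[OF abs_ge_zero])
  finally show ?thesis unfolding H_def .
qed

text \<open>\<open>e0\<close>, the size of \<open>D\<close> itself, may exceed the target rate
  \<open>\<rho>\<close>; only \<open>b * e0\<close> is compared with it. Surplus factors
  \<open>b\<close> are absorbed by \<open>b <= 1\<close>.\<close>

lemma bahadur_error_combine:
  fixes b S T \<kappa> C2 C3 c0 :: real
  assumes b: "0 < b" "b \<le> 1" and S: "0 \<le> S" and T: "0 \<le> T" and \<rho>: "\<rho> = b^3 + S + T"
    and E1: "E1 \<le> k1 * \<rho>" and \<delta>: "0 \<le> \<delta>" "\<delta> \<le> S" and e0: "b * e0 \<le> k2 * \<rho>" and k: "0 \<le> \<kappa>" "0 \<le> C2" "0 \<le> C3" "0 < c0" "0 \<le> k1" "0 \<le> k2"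
    and E3: "E3 = E1 + \<kappa> * \<delta> + \<kappa> * \<delta> * (C3 * b) + \<kappa> * (C2^3 + C2\<^sup>2 * C3) * b^3"
    and k3: "k3 = k1 + \<kappa> + \<kappa> * C3 + \<kappa> * (C2^3 + C2\<^sup>2 * C3)"
  shows "(E3 + \<kappa> / 2 * ((C2 + C3) * b * ((E3 + \<kappa> * (C2\<^sup>2 + C2 * C3) * b\<^sup>2 + e0) / c0))) / c0
     \<le> (k3 + \<kappa> / 2 * ((C2 + C3) * ((k3 + \<kappa> * (C2\<^sup>2 + C2 * C3) + k2) / c0))) / c0 * \<rho>"
proof -
  have b3: "0 < b^3" using b by simp
  have \<rho>0: "\<rho> \<ge> 0" unfolding \<rho> using b3 S T by linarith
  have S\<rho>: "S \<le> \<rho>" and b3\<rho>: "b^3 \<le> \<rho>" unfolding \<rho> using b3 S T by linarith+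
  have "\<kappa> * \<delta> \<le> \<kappa> * \<rho>" using k \<delta> S\<rho> by (intro mult_left_mono) auto
  moreover have "\<kappa> * \<delta> * (C3 * b) \<le> \<kappa> * \<rho> * (C3 * 1)"
    using k b \<delta> S\<rho> \<rho>0 by (intro mult_mono mult_left_mono) auto
  moreover have "\<kappa> * (C2^3 + C2\<^sup>2 * C3) * b^3 \<le> \<kappa> * (C2^3 + C2\<^sup>2 * C3) * \<rho>"
    using k b3\<rho> by (intro mult_left_mono) auto
  ultimately have E3\<rho>: "E3 \<le> k3 * \<rho>" unfolding E3 k3 using E1 by (simp add: algebra_simps)
  have k30: "k3 \<ge> 0" unfolding k3 using k by (intro add_nonneg_nonneg mult_nonneg_nonneg) auto
  have "b * E3 \<le> b * (k3 * \<rho>)" using E3\<rho> b by (intro mult_left_mono) auto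
  also have "\<dots> \<le> 1 * (k3 * \<rho>)" using b k30 \<rho>0 by (intro mult_right_mono) auto
  finally have bE3: "b * E3 \<le> k3 * \<rho>" by simp
  have bb: "b * (\<kappa> * (C2\<^sup>2 + C2 * C3) * b\<^sup>2) \<le> \<kappa> * (C2\<^sup>2 + C2 * C3) * \<rho>"
  proof -
    have "b * (\<kappa> * (C2\<^sup>2 + C2 * C3) * b\<^sup>2) = \<kappa> * (C2\<^sup>2 + C2 * C3) * b^3" by (simp add: power3_eq_cube power2_eq_square mult_ac)
    also have "\<dots> \<le> \<kappa> * (C2\<^sup>2 + C2 * C3) * \<rho>" using k b3\<rho> by (intro mult_left_mono) auto
    finally show ?thesis .
  qed
  have "b * (E3 + \<kappa> * (C2\<^sup>2 + C2 * C3) * b\<^sup>2 + e0) \<le> (k3 + \<kappa> * (C2\<^sup>2 + C2 * C3) + k2) * \<rho>"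
    using bE3 bb e0 unfolding distrib_left distrib_right by linarith
  then have "b * (E3 + \<kappa> * (C2\<^sup>2 + C2 * C3) * b\<^sup>2 + e0) / c0 \<le> (k3 + \<kappa> * (C2\<^sup>2 + C2 * C3) + k2) * \<rho> / c0"
    using k by (intro divide_right_mono) auto
  then have "\<kappa> / 2 * ((C2 + C3) * (b * (E3 + \<kappa> * (C2\<^sup>2 + C2 * C3) * b\<^sup>2 + e0) / c0)) \<le> \<kappa> / 2 * ((C2 + C3) * ((k3 + \<kappa> * (C2\<^sup>2 + C2 * C3) + k2) * \<rho> / c0))"
    using k by (intro mult_left_mono) auto
  then have "E3 + \<kappa> / 2 * ((C2 + C3) * (b * (E3 + \<kappa> * (C2\<^sup>2 + C2 * C3) * b\<^sup>2 + e0) / c0)) \<le> k3 * \<rho> + \<kappa> / 2 * ((C2 + C3) * ((k3 + \<kappa> * (C2\<^sup>2 + C2 * C3) + k2) * \<rho> / c0))"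
    using E3\<rho> by linarith
  then have "(E3 + \<kappa> / 2 * ((C2 + C3) * (b * (E3 + \<kappa> * (C2\<^sup>2 + C2 * C3) * b\<^sup>2 + e0) / c0))) / c0 \<le> (k3 * \<rho> + \<kappa> / 2 * ((C2 + C3) * ((k3 + \<kappa> * (C2\<^sup>2 + C2 * C3) + k2) * \<rho> / c0))) / c0"
    using k by (intro divide_right_mono) auto
  moreover have "(k3 * \<rho> + \<kappa> / 2 * ((C2 + C3) * ((k3 + \<kappa> * (C2\<^sup>2 + C2 * C3) + k2) * \<rho> / c0))) / c0 = (k3 + \<kappa> / 2 * ((C2 + C3) * ((k3 + \<kappa> * (C2\<^sup>2 + C2 * C3) + k2) / c0))) / c0 * \<rho>"
    using k(4) by (simp add: field_simps)
  moreover have "(C2 + C3) * b * ((E3 + \<kappa> * (C2\<^sup>2 + C2 * C3) * b\<^sup>2 + e0) / c0) = (C2 + C3) * (b * (E3 + \<kappa> * (C2\<^sup>2 + C2 * C3) * b\<^sup>2 + e0) / c0)" by simp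
  ultimately show ?thesis by (simp only:)
qed

lemma mono_empirical_cdf: "mono (empirical_cdf X n \<omega>)"
  unfolding empirical_cdf_def
  by (intro monoI mult_left_mono sum_mono) (auto simp: indicator_def)

section \<open>Continuity of \<open>F\<close> and location of its quantiles\<close>

context lrd_linear
begin

lemma F_mono: "x \<le> y \<Longrightarrow> F x \<le> F y"
proof -
  interpret D: real_distribution "distr M borel (R 0 0)" by (rule real_distribution_distr) simp
  show "x \<le> y \<Longrightarrow> F x \<le> F y" unfolding F_cdf[of 0] by (rule D.cdf_nondecreasing)
qed

lemma F_limits: "(F \<longlongrightarrow> 1) at_top" "(F \<longlongrightarrow> 0) at_bot"
proof -
  interpret D: real_distribution "distr M borel (R 0 0)" by (rule real_distribution_distr) simp
  show "(F \<longlongrightarrow> 1) at_top" "(F \<longlongrightarrow> 0) at_bot" unfolding F_cdf[of 0]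
    by (rule D.cdf_lim_at_top_prob, rule D.cdf_lim_at_bot)
qed

lemma F_quantile:
  assumes p: "0 < p" "p < 1"
  shows "F (quantile F p) = p"
proof -
  have cont: "continuous_on A F" for A using F_deriv by (meson DERIV_isCont continuous_at_imp_continuous_on)
  obtain u where u: "F u < p" using order_tendstoD(2)[OF F_limits(2) p(1)] by (auto simp: eventually_at_bot_linorder)
  obtain v where v: "p < F v" using order_tendstoD(1)[OF F_limits(1) p(2)] by (auto simp: eventually_at_top_linorder)
  have uv: "u \<le> v" using u v F_mono[of v u] by linarith
  define S where "S = {x. p \<le> F x}"
  have ne: "S \<noteq> {}" using v by (auto simp: S_def intro: less_imp_le)
  have lb: "u \<le> x" if "x \<in> S" for x using that u F_mono[of x u] by (cases "x \<le> u") (auto simp: S_def)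
  have bdd: "bdd_below S" using lb by (meson bdd_belowI)
  have "closed S" unfolding S_def by (intro closed_Collect_le continuous_intros cont)
  then have 1: "p \<le> F (Inf S)" using closed_contains_Inf[OF ne bdd] by (simp add: S_def)
  obtain y where y: "F y = p" using IVT'[of F u p v] u v uv cont by (auto intro: less_imp_le)
  then have "Inf S \<le> y" by (intro cInf_lower bdd) (simp add: S_def)
  then have "F (Inf S) \<le> p" using F_mono y by metis
  then show ?thesis using 1 by (simp add: quantile_def S_def)
qed

lemma quantile_bounded: "\<exists>K::nat. \<forall>p\<in>{p0..p1}. \<bar>quantile F p\<bar> \<le> real K - 1"
proof -
  obtain u where u: "F u < p0" using order_tendstoD(2)[OF F_limits(2) p01(1)] by (auto simp: eventually_at_bot_linorder)
  obtain v where v: "p1 < F v" using order_tendstoD(1)[OF F_limits(1) p01(3)] by (auto simp: eventually_at_top_linorder)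
  obtain K :: nat where K: "\<bar>u\<bar> + \<bar>v\<bar> + 1 \<le> real K" using real_arch_simple by blast
  have "\<bar>quantile F p\<bar> \<le> real K - 1" if p: "p \<in> {p0..p1}" for p
  proof -
    have e: "F (quantile F p) = p" using p p01 by (intro F_quantile) auto
    have "u \<le> quantile F p" using F_mono[of "quantile F p" u] e u p by fastforce
    moreover have "quantile F p \<le> v" using F_mono[of v "quantile F p"] e v p by fastforce
    ultimately show ?thesis using K by linarith
  qed
  then show ?thesis by blast
qed

abbreviation X :: "int \<Rightarrow> 'a \<Rightarrow> real" where "X \<equiv> \<lambda>k. R k 0"

lemma sigma1_eq: "n \<ge> 1 \<Longrightarrow> sigma1 M X n = sqrt (expectation (\<lambda>\<omega>. (SX n \<omega>)\<^sup>2))"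
  by (simp add: sigma1_def rv_norm_def sample_mean_def SX_def)

end

text \<open>Everything reduces to \<open>1 <= n * b\<close> and \<open>b <= sqrt b\<close>. The
  martingale modulus, \<open>b\<close> times the martingale supremum and the discretization step
  \<open>1 / n\<close> all fall under the one error term
  \<open>sqrt (b * ln n) / sqrt n\<close>.\<close>

lemma bahadur_scales:
  fixes n b :: real
  assumes n: "n \<ge> 1" and b: "0 < b" "b \<le> 1" and l: "1 \<le> ln n" "ln n \<le> n * b"
  shows "sqrt (n * b * ln n) / n = sqrt (b * ln n) / sqrt n" "b * (sqrt (n * ln n) / n) \<le> sqrt (b * ln n) / sqrt n"
    "1 / n \<le> sqrt (b * ln n) / sqrt n" "1 / n \<le> b"
proof -
  have d: "sqrt n / n = 1 / sqrt n" using n by (simp add: frac_eq_eq)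
  have "sqrt (n * b * ln n) / n = sqrt (b * ln n) * (sqrt n / n)" by (simp add: real_sqrt_mult)
  then show 1: "sqrt (n * b * ln n) / n = sqrt (b * ln n) / sqrt n" unfolding d by simp
  have "b\<^sup>2 \<le> b" using b by (simp add: power2_eq_square mult_left_le)
  then have "b \<le> sqrt b" by (rule real_le_rsqrt)
  then have "b * (sqrt (ln n) / sqrt n) \<le> sqrt b * (sqrt (ln n) / sqrt n)" using n l by (intro mult_right_mono) auto
  moreover have "sqrt (n * ln n) / n = sqrt (ln n) * (sqrt n / n)" by (simp add: real_sqrt_mult)
  ultimately show "b * (sqrt (n * ln n) / n) \<le> sqrt (b * ln n) / sqrt n" unfolding d by (simp add: real_sqrt_mult)
  have nb: "1 \<le> n * b" using l by linarith
  have "1 * 1 \<le> (n * b) * ln n" using nb l by (intro mult_mono) auto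
  then have "1 \<le> sqrt (n * b * ln n)" by simp
  then have "1 / n \<le> sqrt (n * b * ln n) / n" using n by (intro divide_right_mono) auto
  then show "1 / n \<le> sqrt (b * ln n) / sqrt n" unfolding 1 .
  show "1 / n \<le> b" using nb n by (simp add: field_simps)
qed

context lrd_linear
begin

lemma bahadur_AE:
  assumes b_def: "b = b_seq M X"
  shows "AE \<omega> in M. \<exists>C. \<forall>\<^sub>F n in sequentially. \<forall>p\<in>{p0..p1}.
     \<bar>quantile (empirical_cdf X n \<omega>) p - quantile F p - (p - empirical_cdf X n \<omega> (quantile F p)) / f (quantile F p)
        - (sample_mean X n \<omega>)\<^sup>2 / 2 * (f1 (quantile F p) / f (quantile F p))\<bar>
     \<le> C * (b n ^ 3 + sqrt (b n * ln (real n)) / sqrt (real n) + b n * sqrt (A_seq \<beta> L n) / real n)"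
proof -
  define \<sigma> where "\<sigma> = sigma1 M X"
  define q where "q n = sqrt (rate (2 * \<beta> - 1/2) \<psi> n)" for n
  define c0 where "c0 = (INF p\<in>{p0..p1}. f (quantile F p))"
  have c0: "c0 > 0" using f_pos by (simp add: c0_def)
  have c0_le: "c0 \<le> f (quantile F p)" if "p \<in> {p0..p1}" for p
    unfolding c0_def by (rule cINF_lower[OF _ that]) (auto intro!: bdd_belowI[of _ 0] f_nonneg)
  obtain K :: nat where K: "\<And>p. p \<in> {p0..p1} \<Longrightarrow> \<bar>quantile F p\<bar> \<le> real K - 1" using quantile_bounded by blast
  have K1: "real K \<ge> 1" using K[of p0] p01 by simp
  obtain c C where c: "c > 0" "C > 0" and cC: "\<forall>n\<ge>n0. c * (sqrt (real n) * psum \<theta> n) \<le> sqrt (expectation (\<lambda>\<omega>. (SX n \<omega>)\<^sup>2))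
      \<and> sqrt (expectation (\<lambda>\<omega>. (SX n \<omega>)\<^sup>2)) \<le> C * (sqrt (real n) * psum \<theta> n)"
    using SX_norm_bounds[OF a_eq n0] by blast
  have \<sigma>: "c * (sqrt (real n) * psum \<theta> n) \<le> \<sigma> n" "\<sigma> n \<le> C * (sqrt (real n) * psum \<theta> n)" if "n \<ge> n0" for n
    using cC[rule_format, OF that] that n0 by (simp_all add: \<sigma>_def sigma1_eq)
  have b: "b n = \<sigma> n * sqrt (ln (real n)) * ln (ln (real n)) / real n" for n by (simp add: b_def b_seq_def \<sigma>_def)
  obtain k1 where k1: "k1 > 0" "\<forall>\<^sub>F n in sequentially. sqrt (real n * ln (real n)) \<le> k1 * (real n * b n)"
    using sqrt_n_ln_le_nb[OF c(1) \<sigma>(1) c(2) \<sigma>(2) b] by blast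
  obtain k2 where k2: "k2 > 0" "\<forall>\<^sub>F n in sequentially. sqrt (rate \<beta> \<theta> n) \<le> k2 * (real n * b n)"
    using sqrt_rate_\<theta>_le_nb[OF c(1) \<sigma>(1) c(2) \<sigma>(2) b] by blast
  obtain k3 where k3: "k3 > 0" "\<forall>\<^sub>F n in sequentially. q n \<le> k3 * (real n * b n)"
    unfolding q_def using sqrt_rate_\<psi>_le_nb[OF c(1) \<sigma>(1) c(2) \<sigma>(2) b] by blast
  obtain k4 where k4: "k4 > 0" "\<forall>\<^sub>F n in sequentially. rate (2 * \<beta> - 1/2) \<psi> n \<le> k4 * A_seq \<beta> L n"
    using rate_\<psi>_le_A_seq[OF n0 \<theta>_eq] by blast
  have lnb: "\<forall>\<^sub>F n in sequentially. ln (real n) \<le> real n * b n" by (rule ln_le_nb[OF c(1) \<sigma>(1) c(2) \<sigma>(2) b])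
  have b0: "b \<longlonglongrightarrow> 0" by (rule b_tendsto_0[OF c(1) \<sigma>(1) c(2) \<sigma>(2) b])
  have fLip: "\<bar>f1 u - f1 v\<bar> \<le> \<kappa> * \<bar>u - v\<bar>" for u v by (rule real_lipschitz_of_deriv_bound[OF f1_deriv f_bounds(3)])
  have K12: "real K \<ge> 1/2" using K1 by simp
  show ?thesis
    using X_rate Nn_bound[OF K12] Nd_bound[OF K12] martingale_sup[OF g_bounds(1), of K]
      martingale_modulus[OF g_bounds(1) lnb, of K] AE_R0
  proof eventually_elim
    case (elim \<omega>)
    obtain Cx where Cx: "Cx \<ge> 0" "\<And>n. n \<ge> 27 \<Longrightarrow> (\<Sum>i=1..n. R (int i) 0 \<omega>)\<^sup>2 \<le> Cx * rate \<beta> \<theta> n" using elim(1) by blast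
    obtain Cn where Cn: "Cn \<ge> 0" "\<And>n x. n \<ge> 27 \<Longrightarrow> x \<in> {-real K..real K} \<Longrightarrow> (Nn n x \<omega>)\<^sup>2 \<le> Cn * rate (2 * \<beta> - 1/2) \<psi> n" using elim(2) by blast
    obtain Cd where Cd: "Cd \<ge> 0" "\<And>n x. n \<ge> 27 \<Longrightarrow> x \<in> {-real K..real K} \<Longrightarrow> (Nd n x \<omega>)\<^sup>2 \<le> Cd * rate (2 * \<beta> - 1/2) \<psi> n" using elim(3) by blast
    obtain Cm where Cm: "Cm \<ge> 0" "\<forall>\<^sub>F n in sequentially. \<forall>x\<in>{- real K..real K}. \<bar>Mn n x \<omega>\<bar> \<le> Cm * sqrt (real n * ln (real n))" using elim(4) by blast
    define C3 where "C3 = sqrt Cx * k2"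
    define C1 where "C1 = Cm * k1 + sqrt Cn * k3"
    define C2 where "C2 = 2 * (\<kappa> * C3 + C1 + 1) / c0"
    have nn: "C3 \<ge> 0" "C1 \<ge> 0" using Cx(1) Cm(1) Cn(1) k1(1) k2(1) k3(1) by (auto simp: C3_def C1_def)
    then have C20: "C2 \<ge> 0" unfolding C2_def using \<kappa>1 c0 by (intro divide_nonneg_pos mult_nonneg_nonneg add_nonneg_nonneg) auto
    \<comment> \<open>\<open>C2\<close> depends on the path; the modulus is available because it
      holds almost surely for all naturals at once.\<close>
    obtain C0 :: nat where C0: "C2 + 1 \<le> real C0" using real_arch_simple by blast
    obtain C4 where C4: "C4 \<ge> 0" "\<forall>\<^sub>F n in sequentially. \<forall>x\<in>{- real K..real K}. \<forall>y\<in>{- real K..real K}.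
     \<bar>x - y\<bar> \<le> real C0 * b n \<longrightarrow> \<bar>Mn n y \<omega> - Mn n x \<omega>\<bar> \<le> C4 * sqrt (real n * b n * ln (real n))" using elim(5) by blast
    define k5 where "k5 = C4 + sqrt Cd * real C0 * sqrt k4"
    define k6 where "k6 = Cm + sqrt Cn * sqrt k4"
    define k7 where "k7 = k5 + \<kappa> + \<kappa> * C3 + \<kappa> * (C2^3 + C2\<^sup>2 * C3)"
    define \<Gamma> where "\<Gamma> = (k7 + \<kappa> / 2 * ((C2 + C3) * ((k7 + \<kappa> * (C2\<^sup>2 + C2 * C3) + k6) / c0))) / c0"
    have k56: "k5 \<ge> 0" "k6 \<ge> 0" using C4(1) Cm(1) Cn(1) Cd(1) k4(1) by (auto simp: k5_def k6_def)
    have "\<forall>\<^sub>F n in sequentially. b n < 1" using order_tendstoD(2)[OF b0, of 1] by simp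
    moreover have "\<forall>\<^sub>F n in sequentially. C2 * b n < 1/2" using order_tendstoD(2)[OF tendsto_mult_left[OF b0, of C2], of "1/2"] by simp
    moreover have "\<forall>\<^sub>F n in sequentially. \<kappa> * (C2 * b n) < c0 / 2"
      using order_tendstoD(2)[OF tendsto_mult_left[OF tendsto_mult_left[OF b0, of C2], of \<kappa>], of "c0/2"] c0 by simp
    ultimately have "\<forall>\<^sub>F n in sequentially. \<forall>p\<in>{p0..p1}.
     \<bar>quantile (empirical_cdf X n \<omega>) p - quantile F p - (p - empirical_cdf X n \<omega> (quantile F p)) / f (quantile F p)
        - (sample_mean X n \<omega>)\<^sup>2 / 2 * (f1 (quantile F p) / f (quantile F p))\<bar>
     \<le> \<Gamma> * (b n ^ 3 + sqrt (b n * ln (real n)) / sqrt (real n) + b n * sqrt (A_seq \<beta> L n) / real n)"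
      using Cm(2) C4(2) k1(2) k2(2) k3(2) k4(2) lnb eventually_ge_at_top[of 27]
    proof eventually_elim
      case (elim n)
      have n: "n \<ge> 27" "n \<ge> 1" "real n \<ge> 1" "real n > 0" using elim(11) by auto
      have l3: "3 \<le> ln (real n)" by (rule ln_ge_3[OF n(1)])
      have "0 < real n * b n" using elim(10) l3 by linarith
      then have bpos: "b n > 0" using n(4) by (simp add: zero_less_mult_iff)
      have b1: "b n \<le> 1" using elim(1) by simp
      have l1: "1 \<le> ln (real n)" using l3 by simp
      note sc = bahadur_scales[OF n(3) bpos b1 l1 elim(10)]
      define S where "S = sqrt (b n * ln (real n)) / sqrt (real n)"
      define T where "T = b n * sqrt (A_seq \<beta> L n) / real n"
      define Xb where "Xb = sample_mean X n \<omega>"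
      define D where "D x = (Mn n x \<omega> + Nn n x \<omega>) / real n" for x
      define E1 where "E1 = (C4 * sqrt (real n * b n * ln (real n)) + sqrt Cd * q n * (real C0 * b n)) / real n"
      define e0 where "e0 = (Cm * sqrt (real n * ln (real n)) + sqrt Cn * q n) / real n"
      have q0: "q n \<ge> 0" unfolding q_def using rate_nonneg[OF n(1)] by simp
      have qA: "q n \<le> sqrt k4 * sqrt (A_seq \<beta> L n)" unfolding q_def real_sqrt_mult[symmetric] using elim(9) by simp
      have A0: "0 \<le> A_seq \<beta> L n" using l3 by (simp add: A_seq_def)
      have S0: "0 \<le> S" and T0: "0 \<le> T" using bpos l3 A0 by (auto simp: S_def T_def)
      \<comment> \<open>The smooth part and its derivative enter \<open>D\<close> and its increments
        through \<open>q n / n\<close>; multiplied by \<open>b n\<close> this is the last error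
        term.\<close>
      have qT: "b n * q n / real n \<le> sqrt k4 * T"
      proof -
        have "b n * q n / real n \<le> b n * (sqrt k4 * sqrt (A_seq \<beta> L n)) / real n" using qA bpos n by (intro divide_right_mono mult_left_mono) auto
        then show ?thesis by (simp add: T_def mult_ac)
      qed
      have XbC3: "\<bar>Xb\<bar> \<le> C3 * b n"
      proof -
        have "\<bar>\<Sum>i=1..n. R (int i) 0 \<omega>\<bar> \<le> sqrt (Cx * rate \<beta> \<theta> n)" using Cx(2)[OF n(1)] by (rule real_le_rsqrt[of "\<bar>_\<bar>", unfolded power2_abs])
        also have "\<dots> = sqrt Cx * sqrt (rate \<beta> \<theta> n)" by (rule real_sqrt_mult)
        also have "\<dots> \<le> sqrt Cx * (k2 * (real n * b n))" using elim(7) Cx(1) by (intro mult_left_mono) auto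
        finally show ?thesis using n by (simp add: Xb_def sample_mean_def C3_def abs_mult field_simps)
      qed
      have Nnb: "\<bar>Nn n x \<omega>\<bar> \<le> sqrt Cn * q n" and Ndb: "\<bar>Nd n x \<omega>\<bar> \<le> sqrt Cd * q n" if "x \<in> {-real K..real K}" for x
        using Cn(2)[OF n(1) that] Cd(2)[OF n(1) that] unfolding q_def real_sqrt_mult[symmetric]
        by (auto intro: real_le_rsqrt[of "\<bar>_\<bar>", unfolded power2_abs])
      have De0: "\<bar>D x\<bar> \<le> e0" if "\<bar>x\<bar> \<le> real K" for x
      proof -
        have x: "x \<in> {-real K..real K}" using that by auto
        have "\<bar>Mn n x \<omega> + Nn n x \<omega>\<bar> \<le> Cm * sqrt (real n * ln (real n)) + sqrt Cn * q n"
          using bspec[OF elim(4) x] Nnb[OF x] by linarith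
        then show ?thesis unfolding D_def e0_def abs_divide using n by (simp add: divide_right_mono)
      qed
      have e0C1: "e0 \<le> C1 * b n"
      proof -
        have "Cm * sqrt (real n * ln (real n)) \<le> Cm * (k1 * (real n * b n))" using elim(6) Cm(1) by (intro mult_left_mono) auto
        moreover have "sqrt Cn * q n \<le> sqrt Cn * (k3 * (real n * b n))" using elim(8) Cn(1) by (intro mult_left_mono) auto
        ultimately have "Cm * sqrt (real n * ln (real n)) + sqrt Cn * q n \<le> C1 * b n * real n" unfolding C1_def by (simp add: algebra_simps)
        then show ?thesis unfolding e0_def using n by (simp add: pos_divide_le_eq)
      qed
      have modulus: "\<bar>D x - D y\<bar> \<le> E1" if "\<bar>x\<bar> \<le> real K" "\<bar>y\<bar> \<le> real K" "\<bar>x - y\<bar> \<le> real C0 * b n" for x y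
      proof -
        have x: "x \<in> {-real K..real K}" "y \<in> {-real K..real K}" using that by auto
        have "\<bar>Mn n y \<omega> - Mn n x \<omega>\<bar> \<le> C4 * sqrt (real n * b n * ln (real n))" using elim(5) x that(3) by blast
        moreover have "\<bar>Nn n x \<omega> - Nn n y \<omega>\<bar> \<le> sqrt Cd * q n * \<bar>x - y\<bar>" by (rule Nn_diff[OF Ndb x])
        moreover have "sqrt Cd * q n * \<bar>x - y\<bar> \<le> sqrt Cd * q n * (real C0 * b n)" using that(3) Cd(1) q0 by (intro mult_left_mono) auto
        ultimately have "\<bar>(Mn n x \<omega> + Nn n x \<omega>) - (Mn n y \<omega> + Nn n y \<omega>)\<bar> \<le> C4 * sqrt (real n * b n * ln (real n)) + sqrt Cd * q n * (real C0 * b n)"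
          by linarith
        then show ?thesis unfolding D_def E1_def diff_divide_distrib[symmetric] abs_divide using n by (simp add: divide_right_mono)
      qed
      define \<rho> where "\<rho> = b n ^ 3 + S + T"
      have b30: "0 \<le> b n ^ 3" using bpos by simp
      have ST: "x * S + y * T \<le> (x + y) * \<rho>" if "0 \<le> x" "0 \<le> y" for x y
      proof -
        have "x * S \<le> x * \<rho>" "y * T \<le> y * \<rho>" unfolding \<rho>_def using that b30 S0 T0 by (auto intro!: mult_left_mono)
        then show ?thesis by (simp add: distrib_right)
      qed
      have E1\<rho>: "E1 \<le> k5 * \<rho>"
      proof -
        have "E1 = C4 * S + sqrt Cd * real C0 * (b n * q n / real n)"
          unfolding E1_def add_divide_distrib S_def sc(1)[symmetric] by (simp add: mult_ac)
        also have "\<dots> \<le> C4 * S + sqrt Cd * real C0 * (sqrt k4 * T)" using qT Cd(1) by (intro add_left_mono mult_left_mono) auto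
        also have "\<dots> = C4 * S + (sqrt Cd * real C0 * sqrt k4) * T" by (simp add: mult.assoc)
        also have "\<dots> \<le> k5 * \<rho>" unfolding k5_def using C4(1) Cd(1) k4(1) by (intro ST) auto
        finally show ?thesis .
      qed
      have e0\<rho>: "b n * e0 \<le> k6 * \<rho>"
      proof -
        have "b n * e0 = Cm * (b n * (sqrt (real n * ln (real n)) / real n)) + sqrt Cn * (b n * q n / real n)"
          unfolding e0_def add_divide_distrib by (simp add: algebra_simps)
        also have "\<dots> \<le> Cm * S + sqrt Cn * (sqrt k4 * T)" using qT sc(2) Cn(1) Cm(1) unfolding S_def by (intro add_mono mult_left_mono) auto
        also have "\<dots> = Cm * S + (sqrt Cn * sqrt k4) * T" by (simp add: mult.assoc)
        also have "\<dots> \<le> k6 * \<rho>" unfolding k6_def using Cm(1) Cn(1) k4(1) by (intro ST) auto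
        finally show ?thesis .
      qed
      define E3 where "E3 = E1 + \<kappa> * (1 / real n) + \<kappa> * (1 / real n) * (C3 * b n) + \<kappa> * (C2^3 + C2\<^sup>2 * C3) * b n ^ 3"
      have comb: "(E3 + \<kappa> / 2 * ((C2 + C3) * b n * ((E3 + \<kappa> * (C2\<^sup>2 + C2 * C3) * (b n)\<^sup>2 + e0) / c0))) / c0 \<le> \<Gamma> * \<rho>"
        unfolding \<Gamma>_def
        by (rule bahadur_error_combine[OF bpos b1 S0 T0 \<rho>_def E1\<rho> _ sc(3)[folded S_def] e0\<rho> _ C20 nn(1) c0 k56 E3_def k7_def])
           (use \<kappa>1 in auto)
      show ?case
      proof
        fix p assume p: "p \<in> {p0..p1}"
        have Fq: "F (quantile F p) = p" using p p01 by (intro F_quantile) auto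
        have dec: "empirical_cdf X n \<omega> x = F x - f x * Xb + D x" for x
          unfolding Xb_def D_def by (rule empirical_cdf_decomposition[OF _ n(2)]) (rule \<open>\<forall>i. R i 0 \<omega> = \<epsilon> i \<omega> + R i 1 \<omega>\<close>)
        have D1: "\<bar>D x\<bar> \<le> C1 * b n" if "\<bar>x\<bar> \<le> real K" for x using De0[OF that] e0C1 by linarith
        have Dq: "\<bar>D (quantile F p)\<bar> \<le> e0" using K[OF p] by (intro De0) linarith
        have s1: "C2 * b n \<le> 1/2" "\<kappa> * (C2 * b n) \<le> c0 / 2" using elim(2,3) by auto
        have dn: "0 < 1 / real n" "1 / real n \<le> 1/2" using n(1) by (auto simp: field_simps)
        have "\<bar>quantile (empirical_cdf X n \<omega>) p - quantile F p - (p - empirical_cdf X n \<omega> (quantile F p)) / f (quantile F p)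
        - Xb\<^sup>2 / 2 * (f1 (quantile F p) / f (quantile F p))\<bar> \<le> (E3 + \<kappa> / 2 * ((C2 + C3) * b n * ((E3 + \<kappa> * (C2\<^sup>2 + C2 * C3) * (b n)\<^sup>2 + e0) / c0))) / c0"
          by (rule bahadur_deterministic[OF F_deriv f_deriv fLip f_bounds(1,2) mono_empirical_cdf dec Fq K[OF p] c0 c0_le[OF p] bpos XbC3 D1 Dq modulus C2_def C0 s1 dn(1) sc(4) dn(2) E3_def])
        then show "\<bar>quantile (empirical_cdf X n \<omega>) p - quantile F p - (p - empirical_cdf X n \<omega> (quantile F p)) / f (quantile F p)
        - (sample_mean X n \<omega>)\<^sup>2 / 2 * (f1 (quantile F p) / f (quantile F p))\<bar>
        \<le> \<Gamma> * (b n ^ 3 + sqrt (b n * ln (real n)) / sqrt (real n) + b n * sqrt (A_seq \<beta> L n) / real n)"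
          using comb unfolding Xb_def \<rho>_def S_def T_def by linarith
      qed
    qed
    then show ?case by blast
  qed
qed

lemma bahadur_rate:
  "bigo_as M
     (\<lambda>n \<omega>. SUP p\<in>{p0..p1}. ereal
        \<bar>quantile (empirical_cdf X n \<omega>) p - quantile F p
          - (p - empirical_cdf X n \<omega> (quantile F p)) / f (quantile F p)
          - (sample_mean X n \<omega>)\<^sup>2 / 2 * (deriv f (quantile F p) / f (quantile F p))\<bar>)
     (\<lambda>n. (b_seq M X n) ^ 3 + sqrt (b_seq M X n * ln (real n)) / sqrt (real n) + b_seq M X n * sqrt (A_seq \<beta> L n) / real n)"
  unfolding bigo_as_def
  using bahadur_AE[OF refl]
proof eventually_elim
  case (elim \<omega>)
  have df: "deriv f x = f1 x" for x by (rule DERIV_imp_deriv[OF f_deriv])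
  obtain C where C: "\<forall>\<^sub>F n in sequentially. \<forall>p\<in>{p0..p1}.
     \<bar>quantile (empirical_cdf X n \<omega>) p - quantile F p - (p - empirical_cdf X n \<omega> (quantile F p)) / f (quantile F p)
        - (sample_mean X n \<omega>)\<^sup>2 / 2 * (f1 (quantile F p) / f (quantile F p))\<bar>
     \<le> C * ((b_seq M X n) ^ 3 + sqrt (b_seq M X n * ln (real n)) / sqrt (real n) + b_seq M X n * sqrt (A_seq \<beta> L n) / real n)"
    using elim by blast
  show ?case
  proof (rule exI[of _ "\<bar>C\<bar>"], use C in eventually_elim)
    case (elim n)
    define r where "r = (b_seq M X n) ^ 3 + sqrt (b_seq M X n * ln (real n)) / sqrt (real n) + b_seq M X n * sqrt (A_seq \<beta> L n) / real n"
    define Z where "Z p = \<bar>quantile (empirical_cdf X n \<omega>) p - quantile F p - (p - empirical_cdf X n \<omega> (quantile F p)) / f (quantile F p)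
        - (sample_mean X n \<omega>)\<^sup>2 / 2 * (f1 (quantile F p) / f (quantile F p))\<bar>" for p
    have Zr: "Z p \<le> \<bar>C\<bar> * \<bar>r\<bar>" if "p \<in> {p0..p1}" for p
    proof -
      have "Z p \<le> C * r" using elim that unfolding Z_def r_def by blast
      also have "\<dots> \<le> \<bar>C * r\<bar>" by simp
      finally show ?thesis unfolding abs_mult .
    qed
    have "(SUP p\<in>{p0..p1}. ereal (Z p)) \<le> ereal (\<bar>C\<bar> * \<bar>r\<bar>)" by (rule SUP_least) (simp add: Zr)
    moreover have "ereal (Z p0) \<le> (SUP p\<in>{p0..p1}. ereal (Z p))" using p01 by (intro SUP_upper) auto
    then have "0 \<le> (SUP p\<in>{p0..p1}. ereal (Z p))" by (rule order_trans[rotated]) (simp add: Z_def)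
    ultimately have "\<bar>SUP p\<in>{p0..p1}. ereal (Z p)\<bar> \<le> ereal (\<bar>C\<bar> * \<bar>r\<bar>)" by simp
    then show ?case unfolding Z_def r_def df .
  qed
qed

end

text \<open>The hypothesis gives \<open>|g'| <= 2 * sqrt L * sqrt g\<close>, and by the
  arithmetic-geometric mean \<open>2 * sqrt g\<close> is at most
  \<open>g * (1 + u^2) + 1 / (1 + u^2)\<close>. The first term is integrable by the second moment,
  the second has the arctangent as primitive.\<close>

lemma nn_integral_deriv_of_second_moment:
  fixes g g' :: "real \<Rightarrow> real"
  assumes nn: "\<And>x. 0 \<le> g x" and [measurable]: "g \<in> borel_measurable borel" "g' \<in> borel_measurable borel"
    and bd: "\<And>x. (g' x)\<^sup>2 \<le> 4 * L * g x" and L: "0 \<le> L"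
    and mom: "(\<integral>\<^sup>+u. ennreal (g u) * ennreal (1 + u\<^sup>2) \<partial>lborel) < \<infinity>"
  shows "\<exists>G1\<ge>0. (\<integral>\<^sup>+u. ennreal \<bar>g' u\<bar> \<partial>lborel) \<le> ennreal G1"
proof -
  have ptw: "\<bar>g' u\<bar> \<le> sqrt L * (g u * (1 + u\<^sup>2) + inverse (1 + u\<^sup>2))" for u
  proof -
    have u: "0 < 1 + u\<^sup>2" by (simp add: add_pos_nonneg)
    have "(2 * sqrt L * sqrt (g u))\<^sup>2 = 4 * L * g u" using L nn[of u] by (simp add: power_mult_distrib)
    then have "\<bar>g' u\<bar> \<le> 2 * sqrt L * sqrt (g u)"
      using bd[of u] L nn[of u] abs_le_square_iff[of "g' u" "2 * sqrt L * sqrt (g u)"] by simp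
    also have "\<dots> = sqrt L * (2 * sqrt (g u))" by simp
    also have "\<dots> \<le> sqrt L * (g u * (1 + u\<^sup>2) + inverse (1 + u\<^sup>2))"
    proof (rule mult_left_mono)
      have e: "sqrt (g u * (1 + u\<^sup>2)) * sqrt (inverse (1 + u\<^sup>2)) = sqrt (g u)"
        unfolding real_sqrt_mult[symmetric] using u by (simp add: mult.assoc)
      have "0 \<le> (sqrt (g u * (1 + u\<^sup>2)) - sqrt (inverse (1 + u\<^sup>2)))\<^sup>2" by simp
      then have "2 * (sqrt (g u * (1 + u\<^sup>2)) * sqrt (inverse (1 + u\<^sup>2))) \<le> (sqrt (g u * (1 + u\<^sup>2)))\<^sup>2 + (sqrt (inverse (1 + u\<^sup>2)))\<^sup>2"
        unfolding power2_diff by simp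
      also have "(sqrt (g u * (1 + u\<^sup>2)))\<^sup>2 = g u * (1 + u\<^sup>2)" using u nn[of u] by (intro real_sqrt_pow2 mult_nonneg_nonneg) auto
      also have "(sqrt (inverse (1 + u\<^sup>2)))\<^sup>2 = inverse (1 + u\<^sup>2)" using u by (intro real_sqrt_pow2) auto
      finally show "2 * sqrt (g u) \<le> g u * (1 + u\<^sup>2) + inverse (1 + u\<^sup>2)" unfolding e .
    qed (use L in simp)
    finally show ?thesis .
  qed
  have i: "integrable lborel (\<lambda>u. inverse (1 + u\<^sup>2) :: real)"
    using integrable_inverse_1_plus_square by (simp add: set_integrable_def)
  have "(\<integral>\<^sup>+u. ennreal (inverse (1 + u\<^sup>2)) \<partial>lborel) = ennreal (\<integral>u. inverse (1 + u\<^sup>2) \<partial>lborel)"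
    by (rule nn_integral_eq_integral[OF i]) simp
  then have c: "(\<integral>\<^sup>+u. ennreal (inverse (1 + u\<^sup>2)) \<partial>lborel) < \<infinity>" by simp
  have "(\<integral>\<^sup>+u. ennreal \<bar>g' u\<bar> \<partial>lborel) \<le> (\<integral>\<^sup>+u. ennreal (sqrt L) * (ennreal (g u) * ennreal (1 + u\<^sup>2) + ennreal (inverse (1 + u\<^sup>2))) \<partial>lborel)"
  proof (rule nn_integral_mono)
    fix u :: real
    have "0 \<le> 1 + u\<^sup>2" by simp
    then have "ennreal (sqrt L) * (ennreal (g u) * ennreal (1 + u\<^sup>2) + ennreal (inverse (1 + u\<^sup>2))) = ennreal (sqrt L * (g u * (1 + u\<^sup>2) + inverse (1 + u\<^sup>2)))"
      using nn[of u] L by (subst ennreal_mult[symmetric], simp, simp) (subst ennreal_plus[symmetric], simp, simp, simp add: ennreal_mult)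
    then show "ennreal \<bar>g' u\<bar> \<le> ennreal (sqrt L) * (ennreal (g u) * ennreal (1 + u\<^sup>2) + ennreal (inverse (1 + u\<^sup>2)))"
      using ptw[of u] by (simp add: ennreal_leI)
  qed
  also have "\<dots> = ennreal (sqrt L) * ((\<integral>\<^sup>+u. ennreal (g u) * ennreal (1 + u\<^sup>2) \<partial>lborel) + (\<integral>\<^sup>+u. ennreal (inverse (1 + u\<^sup>2)) \<partial>lborel))"
    by (subst nn_integral_cmult, simp) (subst nn_integral_add, simp_all)
  also have "\<dots> < \<infinity>" using mom c by (simp add: ennreal_mult_less_top)
  finally have "(\<integral>\<^sup>+u. ennreal \<bar>g' u\<bar> \<partial>lborel) < \<infinity>" .
  then have "(\<integral>\<^sup>+u. ennreal \<bar>g' u\<bar> \<partial>lborel) = ennreal (enn2real (\<integral>\<^sup>+u. ennreal \<bar>g' u\<bar> \<partial>lborel))" by simp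
  then show ?thesis by (metis enn2real_nonneg order_refl)
qed

text \<open>The finitely many initial coefficients, among them \<open>a 0\<close>, are covered by
  the constant \<open>D\<close>; from \<open>n0\<close> on the shift by one is paid by
  \<open>potter_Suc\<close>.\<close>

lemma lrd_coeff_le_shifted:
  assumes P: "potter \<beta> \<theta>" and \<beta>: "\<beta> > 0" and a: "\<And>n. n \<ge> n0 \<Longrightarrow> a n = \<theta> n" and n0: "n0 \<ge> 1"
  shows "\<exists>Ca>0. \<forall>j. \<bar>a j\<bar> \<le> Ca * \<theta> (Suc j)"
proof -
  obtain C where C: "C > 0" "\<forall>n\<ge>1. \<theta> n \<le> C * \<theta> (Suc n)" using potter_Suc[OF P \<beta>] by blast
  have pos: "\<theta> (Suc j) > 0" for j by (rule potter_pos[OF P]) simp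
  define D where "D = (\<Sum>i<n0. \<bar>a i\<bar> / \<theta> (Suc i))"
  have t: "0 \<le> \<bar>a i\<bar> / \<theta> (Suc i)" for i using pos[of i] by simp
  have D: "D \<ge> 0" unfolding D_def using t by (intro sum_nonneg)
  have "\<bar>a j\<bar> \<le> (C + D) * \<theta> (Suc j)" for j
  proof (cases "j < n0")
    case True
    then have "\<bar>a j\<bar> / \<theta> (Suc j) \<le> D" unfolding D_def by (intro member_le_sum t) auto
    then have "\<bar>a j\<bar> \<le> D * \<theta> (Suc j)" using pos[of j] by (simp add: pos_divide_le_eq)
    also have "\<dots> \<le> (C + D) * \<theta> (Suc j)" using pos[of j] C(1) by (intro mult_right_mono) auto
    finally show ?thesis .
  next
    case False
    then have j: "j \<ge> n0" "j \<ge> 1" using n0 by auto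
    have "\<bar>a j\<bar> = \<theta> j" using a[OF j(1)] potter_pos[OF P j(2)] by simp
    also have "\<dots> \<le> C * \<theta> (Suc j)" using C(2) j(2) by blast
    also have "\<dots> \<le> (C + D) * \<theta> (Suc j)" using pos[of j] D by (intro mult_right_mono) auto
    finally show ?thesis .
  qed
  then show ?thesis using C(1) D by (intro exI[of _ "C + D"]) auto
qed

theorem theorem3:
  fixes M :: "'a measure"
    and \<epsilon> :: "int \<Rightarrow> 'a \<Rightarrow> real"
    and f\<^sub>\<epsilon> f F L :: "real \<Rightarrow> real"
    and X :: "int \<Rightarrow> 'a \<Rightarrow> real"
    and \<beta> p\<^sub>0 p\<^sub>1 :: real
  assumes "prob_space M"
    and "prob_space.indep_vars M (\<lambda>_. borel) \<epsilon> UNIV"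
    and "\<And>x. 0 \<le> f\<^sub>\<epsilon> x"
    and "\<And>k. distributed M lborel (\<epsilon> k) (\<lambda>x. ennreal (f\<^sub>\<epsilon> x))"
    and "\<And>k. integrable M (\<lambda>\<omega>. (\<epsilon> k \<omega>)\<^sup>2)"
    and "\<And>k. prob_space.expectation M (\<epsilon> k) = 0"
    and "1/2 < \<beta>" and "\<beta> < 1"
    and "slowly_varying L"
    and "X = linear_process (lrd_coeff \<beta> L) \<epsilon>"
    and "\<And>k. F = cdf (distr M borel (X k))"
    and "\<And>x. 0 \<le> f x"
    and "\<And>k. distributed M lborel (X k) (\<lambda>x. ennreal (f x))"
    and "continuous_on UNIV f"
    and "0 < p\<^sub>0" and "p\<^sub>0 < p\<^sub>1" and "p\<^sub>1 < 1"
    and "(INF p\<in>{p\<^sub>0..p\<^sub>1}. f (quantile F p)) > 0"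
    and "\<And>k. integrable M (\<lambda>\<omega>. (\<epsilon> k \<omega>) ^ 4)"
    and "\<And>x. f\<^sub>\<epsilon> differentiable (at x)"
    and "\<And>x. deriv f\<^sub>\<epsilon> differentiable (at x)"
    and "(\<Sum>i=0..2. SUP x. ennreal \<bar>(deriv ^^ i) f\<^sub>\<epsilon> x\<bar>)
           + (\<integral>\<^sup>+u. ennreal (\<bar>deriv f\<^sub>\<epsilon> u\<bar>\<^sup>2) \<partial>lborel) < \<infinity>"
  shows "bigo_as M
           (\<lambda>n \<omega>. SUP p\<in>{p\<^sub>0..p\<^sub>1}. ereal
              \<bar>quantile (empirical_cdf X n \<omega>) p - quantile F p
                - (p - empirical_cdf X n \<omega> (quantile F p)) / f (quantile F p)
                - (sample_mean X n \<omega>)\<^sup>2 / 2 * (deriv f (quantile F p) / f (quantile F p))\<bar>)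
           (\<lambda>n. (b_seq M X n) ^ 3
                + sqrt (b_seq M X n * ln (real n)) / sqrt (real n)
                + b_seq M X n * sqrt (A_seq \<beta> L n) / real n)"
proof -
  interpret prob_space M by (rule assms(1))
  have d1: "(f\<^sub>\<epsilon> has_real_derivative deriv f\<^sub>\<epsilon> y) (at y)" for y
    using assms(20)[of y] by (simp add: DERIV_deriv_iff_real_differentiable)
  have d2: "(deriv f\<^sub>\<epsilon> has_real_derivative deriv (deriv f\<^sub>\<epsilon>) y) (at y)" for y
    using assms(21)[of y] by (simp add: DERIV_deriv_iff_real_differentiable)
  define s where "s i = (SUP x. ennreal \<bar>(deriv ^^ i) f\<^sub>\<epsilon> x\<bar>)" for i :: nat
  have "(\<Sum>i=0..2. s i) < \<infinity>" using assms(22) unfolding s_def by (rule le_less_trans[rotated]) simp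
  then have sfin: "s i < \<infinity>" if "i \<in> {0..2}" for i
    using that sum_mono2[of "{0..2}" "{i}" s] by (simp add: le_less_trans)
  \<comment> \<open>One bound for the density and its first two derivatives; the summand 1 makes it
    also a bound for the distribution function of the innovations.\<close>
  define \<kappa> where "\<kappa> = 1 + (\<Sum>i\<in>{0..2}. enn2real (s i))"
  have \<kappa>1: "1 \<le> \<kappa>" by (simp add: \<kappa>_def sum_nonneg)
  have sb: "\<bar>(deriv ^^ i) f\<^sub>\<epsilon> x\<bar> \<le> \<kappa>" if i: "i \<in> {0..2}" for i x
  proof -
    have "ennreal \<bar>(deriv ^^ i) f\<^sub>\<epsilon> x\<bar> \<le> s i" unfolding s_def by (rule SUP_upper) simp
    also have "s i = ennreal (enn2real (s i))" using sfin[OF i] by simp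
    finally have "\<bar>(deriv ^^ i) f\<^sub>\<epsilon> x\<bar> \<le> enn2real (s i)" by (simp del: ennreal_enn2real_if)
    also have "\<dots> \<le> (\<Sum>i\<in>{0..2}. enn2real (s i))" by (rule member_le_sum[OF i]) auto
    finally show ?thesis by (simp add: \<kappa>_def)
  qed
  have b0: "f\<^sub>\<epsilon> y \<le> \<kappa>" and b1: "\<bar>deriv f\<^sub>\<epsilon> y\<bar> \<le> \<kappa>" and b2: "\<bar>deriv (deriv f\<^sub>\<epsilon>) y\<bar> \<le> \<kappa>" for y
    using sb[of 0 y] sb[of 1 y] sb[of 2 y] by (auto simp: numeral_2_eq_2)
  have c1: "continuous_on UNIV (deriv f\<^sub>\<epsilon>)" using d2 by (meson DERIV_isCont continuous_at_imp_continuous_on)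
  have fm[measurable]: "f\<^sub>\<epsilon> \<in> borel_measurable borel"
    using d1 by (intro borel_measurable_continuous_onI) (meson DERIV_isCont continuous_at_imp_continuous_on)
  have [measurable]: "deriv f\<^sub>\<epsilon> \<in> borel_measurable borel" by (rule borel_measurable_continuous_onI[OF c1])
  \<comment> \<open>Feeds the integrability of the first derivative, and hence the L1 modulus of the
    density on which the smoothing rests.\<close>
  have sq: "(deriv f\<^sub>\<epsilon> x)\<^sup>2 \<le> 4 * \<kappa> * f\<^sub>\<epsilon> x" for x
    using \<kappa>1 by (intro nonneg_deriv_square_le[OF assms(3) d1 real_lipschitz_of_deriv_bound[OF d2 b2]]) auto
  have "(\<integral>\<^sup>+u. ennreal (f\<^sub>\<epsilon> u) * ennreal (1 + u\<^sup>2) \<partial>lborel) = (\<integral>\<^sup>+\<omega>. ennreal (1 + (\<epsilon> 0 \<omega>)\<^sup>2) \<partial>M)"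
    by (rule distributed_nn_integral[OF assms(4)]) simp
  also have "\<dots> = ennreal (expectation (\<lambda>\<omega>. 1 + (\<epsilon> 0 \<omega>)\<^sup>2))"
    by (rule nn_integral_eq_integral) (use assms(5) in auto)
  finally have mom: "(\<integral>\<^sup>+u. ennreal (f\<^sub>\<epsilon> u) * ennreal (1 + u\<^sup>2) \<partial>lborel) < \<infinity>" by simp
  obtain G1 where G1: "G1 \<ge> 0" "(\<integral>\<^sup>+u. ennreal \<bar>deriv f\<^sub>\<epsilon> u\<bar> \<partial>lborel) \<le> ennreal G1"
    using nn_integral_deriv_of_second_moment[OF assms(3) _ _ sq _ mom] \<kappa>1 by auto
  obtain \<theta> n0 where n0: "n0 \<ge> 1" and P: "potter \<beta> \<theta>" and \<theta>: "\<And>n. n \<ge> n0 \<Longrightarrow> \<theta> n = real n powr (-\<beta>) * L (real n)"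
    by (rule potter_of_slowly_varying[OF assms(9), of \<beta>]) blast
  have a_eq: "lrd_coeff \<beta> L n = \<theta> n" if "n \<ge> n0" for n using that n0 \<theta>[OF that] by (simp add: lrd_coeff_def)
  obtain Ca where Ca: "Ca > 0" "\<forall>j. \<bar>lrd_coeff \<beta> L j\<bar> \<le> Ca * \<theta> (Suc j)"
    using lrd_coeff_le_shifted[OF P _ a_eq n0] assms(7) by auto
  \<comment> \<open>\<open>\<theta>\<close> is positive, so every coefficient from \<open>n0\<close>
    on is nonzero.\<close>
  have nz: "\<exists>j. lrd_coeff \<beta> L (Suc j) \<noteq> 0"
    using a_eq[of "Suc n0"] potter_pos[OF P, of "Suc n0"] by (intro exI[of _ n0]) simp
  interpret I: innovations M \<epsilon> f\<^sub>\<epsilon> by unfold_locales (rule assms)+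
  interpret I: linear_innovations M \<epsilon> f\<^sub>\<epsilon> "lrd_coeff \<beta> L" \<beta> Ca \<theta>
    by unfold_locales (use assms(7,8) P Ca in auto)
  have X: "X = (\<lambda>k. I.R k 0)" unfolding assms(10) by (intro ext) (simp add: I.R_def linear_process_def)
  interpret I: lrd_linear M \<epsilon> f\<^sub>\<epsilon> "lrd_coeff \<beta> L" \<beta> Ca \<theta> G1 "deriv f\<^sub>\<epsilon>" "deriv (deriv f\<^sub>\<epsilon>)" f F L \<kappa> p\<^sub>0 p\<^sub>1 n0
  proof unfold_locales
    show "(\<integral>\<^sup>+u. ennreal \<bar>f\<^sub>\<epsilon> (u + t) - f\<^sub>\<epsilon> u\<bar> \<partial>lborel) \<le> ennreal (G1 * \<bar>t\<bar>)" for t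
      by (rule L1_modulus_of_deriv[OF d1 c1 G1(2,1)])
    show "F = cdf (distr M borel (I.R k 0))" for k using assms(11)[of k] unfolding X .
    show "distributed M lborel (I.R k 0) (\<lambda>x. ennreal (f x))" for k using assms(13)[of k] unfolding X .
    show "lrd_coeff \<beta> L 0 = 1" by (simp add: lrd_coeff_def)
  qed (assumption | rule G1(1) nz d1 d2 b0 b1 b2 \<kappa>1 n0 a_eq \<theta> fm assms(12,14-18))+
  show ?thesis unfolding X by (rule I.bahadur_rate)
qed

end
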